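(* Let $F$ be an $h$-flipclass in a Coxeter group. (1) If $F$ is of finite type, then $F$ is isomorphic to a flipclass $\bar F$ of a finite Coxeter group $\overline W$, and $c(F)=c(\bar F)$. (2) If $F$ is of Weyl type, then $F$ is isomorphic to a flipclass $\bar F$ of a Weyl group $\overline W$, and $c(F)=c(\bar F)$. (3) If $F$ is of symmetric type, then $F$ is isomorphic to a flipclass $\bar F$ of a Coxeter group $\overline W$ isomorphic to a product of Weyl groups of type $A$, and $c(F)=c(\bar F)$. Moreover, in all these cases $\overline W$ may be taken of rank at most $h$, and if $F$ is irreducible then $\overline W$ may be taken irreducible.
   Context: Let $(W,S)$ be a Coxeter system with length $\ell$ and reflections $T=\{wsw^{-1}\}$. The Bruhat graph has vertex set $W$ and edges $u\xrightarrow{t}v$ ($t\in T$) when $\ell(u)<\ell(v)$ and $vu^{-1}=t$; $P_h(u,v)$ is the set of length-$h$ paths from $u$ to $v$. For $u,v$, let $X(u,v)$ be the set of $x\notin\{u,v\}$ on some path of $P_2(u,v)$; there is a unique fixed-point-free involution $f$ of $X(u,v)$ such that $\ell(x_1)<\ell(x_2)$, $x_2\ne f(x_1)$ imply $\ell(f(x_1))<\ell(f(x_2))$; the flip of $(u\to x\to v)$ is $(u\to f(x)\to v)$. The $i$-th flip $f_i$ of a path $(x_0\to\cdots\to x_h)$ replaces $(x_{i-1}\to x_i\to x_{i+1})$ by its flip; an $h$-flipclass from $u$ to $v$ is a minimal nonempty subset of $P_h(u,v)$ closed under all $f_i$. $E(F)$ and $T(F)$ are the sets of vertices and of edge labels of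 paths in $F$; $W(F)=\langle T(F)\rangle$, a reflection subgroup, which is a Coxeter group with generators $\chi(W(F))=\{t\in W(F)\cap T:\{r\in W(F)\cap T:\ell(rt)<\ell(t)\}=\{t\}\}$. $F$ is of finite type if $W(F)$ is finite, of Weyl type if $W(F)$ is a Weyl group, of symmetric type if $W(F)$ is a product of Weyl groups of type $A$. $F$ is reducible if there is a nontrivial partition $T(F)=T_1\sqcup T_2$ with $t_1t_2=t_2t_1$ for all $t_1\in T_1,t_2\in T_2$; otherwise irreducible. A reflection ordering is a total order $\preceq$ on $T$ such that for every reflection subgroup $W'$ with $\chi(W')=\{a,b\}$ the reflections of $W'$ appear as $a\preceq aba\preceq\cdots\preceq bab\preceq b$ or reversed; a path with labels $t_1,\dots,t_h$ is increasing if $t_1\preceq\cdots\preceq t_h$. For $F$ of finite type, the number of increasing paths in $F$ is independent of the reflection ordering and is denoted $c(F)$. Two $h$-flipclasses $F$ (of $W$) and $F'$ (of $W'$) are isomorphic if there are bijections $\varepsilon:E(F)\to E(F')$, $\tau:T(F)\to T(F')$ such that $(x_0\xrightarrow{t_1}\cdots\xrightarrow{t_h}x_h)\in F$ iff $(\varepsilon(x_0)\xrightarrow{\tau(t_1)}\cdots\xrightarrow{\tau(t_h)}\varepsilon(x_h))\in F'$, the induced bijection $\bar\varepsilon:F\to F'$ satisfies $\bar\varepsilon f_i=f_i\bar\varepsilon$ for all $i$, and there are reflection orderings of $W$ and $W'$ for which $\tau$ is order preserving. *)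

theory Defs
  imports
    "HOL-Algebra.Sym_Groups"
    "HOL-Algebra.Product_Groups"
    "HOL-Algebra.Multiplicative_Group"
    "HOL-Algebra.Bij"
begin

section \<open>Coxeter systems\<close>

definition word_prod :: "('a, 'b) monoid_scheme \<Rightarrow> 'a list \<Rightarrow> 'a" where
  "word_prod G ws = foldr (\<lambda>x y. x \<otimes>\<^bsub>G\<^esub> y) ws \<one>\<^bsub>G\<^esub>"

text \<open>The entry \<open>m s t = 0\<close> encodes \<open>m(s,t) = \<infinity>\<close>.\<close>

definition coxeter_matrix :: "'a set \<Rightarrow> ('a \<Rightarrow> 'a \<Rightarrow> nat) \<Rightarrow> bool" where
  "coxeter_matrix S m \<longleftrightarrow>
     (\<forall>s\<in>S. m s s = 1) \<and>
     (\<forall>s\<in>S. \<forall>t\<in>S. m s t = m t s) \<and>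
     (\<forall>s\<in>S. \<forall>t\<in>S. s \<noteq> t \<longrightarrow> m s t \<noteq> 1)"

text \<open>Deletion of one relator \<open>(s t)^{m(s,t)}\<close> from a word.\<close>

definition relator_step ::
  "'a set \<Rightarrow> ('a \<Rightarrow> 'a \<Rightarrow> nat) \<Rightarrow> 'a list \<Rightarrow> 'a list \<Rightarrow> bool" where
  "relator_step S m xs ys \<longleftrightarrow>
     (\<exists>us\<in>lists S. \<exists>vs\<in>lists S. \<exists>s\<in>S. \<exists>t\<in>S.
        m s t \<noteq> 0 \<and>
        xs = us @ concat (replicate (m s t) [s, t]) @ vs \<and> ys = us @ vs)"

text \<open>The assumption \<open>presentation\<close> says that \<open>G\<close> is the group presented by generators \<open>S\<close> and
  relations \<open>(s t)^{m(s,t)} = 1\<close>. Since \<open>m(s,s) = 1\<close> yields \<open>s\<^sup>2 = 1\<close>, words without inverse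
  letters suffice. The generating set is not required to be finite.\<close>

locale coxeter_system = group G for G :: "('a, 'b) monoid_scheme" (structure) +
  fixes S :: "'a set"
  assumes generators_in_carrier: "S \<subseteq> carrier G"
    and generators_generate: "generate G S = carrier G"
    and presentation: "\<exists>m. coxeter_matrix S m \<and>
          (\<forall>xs\<in>lists S. \<forall>ys\<in>lists S.
             word_prod G xs = word_prod G ys \<longleftrightarrow> equivclp (relator_step S m) xs ys)"

definition cox_length :: "('a, 'b) monoid_scheme \<Rightarrow> 'a set \<Rightarrow> 'a \<Rightarrow> nat" where
  "cox_length G S w = (LEAST n. \<exists>ws\<in>lists S. length ws = n \<and> word_prod G ws = w)"

definition reflections :: "('a, 'b) monoid_scheme \<Rightarrow> 'a set \<Rightarrow> 'a set" where
  "reflections G S = {w \<otimes>\<^bsub>G\<^esub> s \<otimes>\<^bsub>G\<^esub> inv\<^bsub>G\<^esub> w | w s. w \<in> carrier G \<and> s \<in> S}"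

text \<open>The same notion of reducibility is used for the generators of a Coxeter system and for
  the label set of a flipclass; the empty set is irreducible.\<close>

definition commuting_irreducible :: "('a, 'b) monoid_scheme \<Rightarrow> 'a set \<Rightarrow> bool" where
  "commuting_irreducible G A \<longleftrightarrow>
     \<not> (\<exists>A1 A2. A1 \<noteq> {} \<and> A2 \<noteq> {} \<and> A1 \<inter> A2 = {} \<and> A1 \<union> A2 = A \<and>
          (\<forall>a\<in>A1. \<forall>b\<in>A2. a \<otimes>\<^bsub>G\<^esub> b = b \<otimes>\<^bsub>G\<^esub> a))"

section \<open>Reflection subgroups and reflection orderings\<close>

definition reflection_subgroup :: "('a, 'b) monoid_scheme \<Rightarrow> 'a set \<Rightarrow> 'a set \<Rightarrow> bool" where
  "reflection_subgroup G S H \<longleftrightarrow> (\<exists>A \<subseteq> reflections G S. H = generate G A)"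

definition canonical_generators ::
  "('a, 'b) monoid_scheme \<Rightarrow> 'a set \<Rightarrow> 'a set \<Rightarrow> 'a set" where
  "canonical_generators G S H =
     {t \<in> H \<inter> reflections G S.
        {r \<in> H \<inter> reflections G S. cox_length G S (r \<otimes>\<^bsub>G\<^esub> t) < cox_length G S t} = {t}}"

text \<open>With \<open>u i = a(ba)^i\<close> and \<open>v i = b(ab)^i\<close>, the dihedral group generated by the involutions
  \<open>a\<close> and \<open>b\<close> has reflections \<open>u 0 = a, u 1 = aba, \<dots>, v 1 = bab, v 0 = b\<close>. If \<open>ab\<close> has finite
  order \<open>m\<close>, these are \<open>u 0, \<dots>, u (m - 1)\<close> and \<open>v j = u (m - 1 - j)\<close>; if \<open>ab\<close> has infinite order
  (encoded as \<open>ord (a b) = 0\<close>) all \<open>u i\<close>, \<open>v j\<close> are distinct. The definition says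
  that they appear as \<open>a \<preceq> aba \<preceq> \<dots> \<preceq> bab \<preceq> b\<close>.\<close>

definition dihedral_increasing ::
  "('a, 'b) monoid_scheme \<Rightarrow> 'a rel \<Rightarrow> 'a \<Rightarrow> 'a \<Rightarrow> bool" where
  "dihedral_increasing G R a b \<longleftrightarrow>
     (let m = group.ord G (a \<otimes>\<^bsub>G\<^esub> b);
          u = (\<lambda>i::nat. a \<otimes>\<^bsub>G\<^esub> ((b \<otimes>\<^bsub>G\<^esub> a) [^]\<^bsub>G\<^esub> i));
          v = (\<lambda>i::nat. b \<otimes>\<^bsub>G\<^esub> ((a \<otimes>\<^bsub>G\<^esub> b) [^]\<^bsub>G\<^esub> i))
      in \<forall>i j. (i \<le> j \<and> (m = 0 \<or> j < m) \<longrightarrow> (u i, u j) \<in> R \<and> (v j, v i) \<in> R) \<and>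
               (m = 0 \<or> i + j < m \<longrightarrow> (u i, v j) \<in> R))"

definition reflection_ordering ::
  "('a, 'b) monoid_scheme \<Rightarrow> 'a set \<Rightarrow> 'a rel \<Rightarrow> bool" where
  "reflection_ordering G S R \<longleftrightarrow>
     linear_order_on (reflections G S) R \<and>
     (\<forall>H a b. reflection_subgroup G S H \<and> canonical_generators G S H = {a, b} \<longrightarrow>
        dihedral_increasing G R a b \<or> dihedral_increasing G R b a)"

section \<open>Paths in the Bruhat graph and flips\<close>

definition bruhat_edge :: "('a, 'b) monoid_scheme \<Rightarrow> 'a set \<Rightarrow> 'a \<Rightarrow> 'a \<Rightarrow> bool" where
  "bruhat_edge G S u v \<longleftrightarrow>
     u \<in> carrier G \<and> v \<in> carrier G \<and> cox_length G S u < cox_length G S v \<and>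
     v \<otimes>\<^bsub>G\<^esub> inv\<^bsub>G\<^esub> u \<in> reflections G S"

text \<open>A path is represented by its list of vertices, which determines its list of labels.\<close>

definition paths :: "('a, 'b) monoid_scheme \<Rightarrow> 'a set \<Rightarrow> nat \<Rightarrow> 'a \<Rightarrow> 'a \<Rightarrow> 'a list set" where
  "paths G S h u v =
     {xs \<in> lists (carrier G). length xs = Suc h \<and> xs ! 0 = u \<and> xs ! h = v \<and>
        (\<forall>i<h. bruhat_edge G S (xs ! i) (xs ! Suc i))}"

definition labels :: "('a, 'b) monoid_scheme \<Rightarrow> 'a list \<Rightarrow> 'a list" where
  "labels G xs = map (\<lambda>i. xs ! Suc i \<otimes>\<^bsub>G\<^esub> inv\<^bsub>G\<^esub> (xs ! i)) [0..<length xs - 1]"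

definition middle_vertices :: "('a, 'b) monoid_scheme \<Rightarrow> 'a set \<Rightarrow> 'a \<Rightarrow> 'a \<Rightarrow> 'a set" where
  "middle_vertices G S u v = {x. x \<notin> {u, v} \<and> (\<exists>xs\<in>paths G S 2 u v. x \<in> set xs)}"

text \<open>The involution is taken in the extensional function space so that it is unique as a total
  function.\<close>

definition flip :: "('a, 'b) monoid_scheme \<Rightarrow> 'a set \<Rightarrow> 'a \<Rightarrow> 'a \<Rightarrow> 'a \<Rightarrow> 'a" where
  "flip G S u v =
     (THE f. f \<in> middle_vertices G S u v \<rightarrow>\<^sub>E middle_vertices G S u v \<and>
        (\<forall>x\<in>middle_vertices G S u v. f (f x) = x \<and> f x \<noteq> x) \<and>
        (\<forall>x1\<in>middle_vertices G S u v. \<forall>x2\<in>middle_vertices G S u v.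
           cox_length G S x1 < cox_length G S x2 \<and> x2 \<noteq> f x1 \<longrightarrow>
           cox_length G S (f x1) < cox_length G S (f x2)))"

definition flip_path :: "('a, 'b) monoid_scheme \<Rightarrow> 'a set \<Rightarrow> nat \<Rightarrow> 'a list \<Rightarrow> 'a list" where
  "flip_path G S i xs = xs[i := flip G S (xs ! (i - 1)) (xs ! (i + 1)) (xs ! i)]"

section \<open>Flipclasses\<close>

definition flip_closed :: "('a, 'b) monoid_scheme \<Rightarrow> 'a set \<Rightarrow> nat \<Rightarrow> 'a list set \<Rightarrow> bool" where
  "flip_closed G S h A \<longleftrightarrow> (\<forall>xs\<in>A. \<forall>i\<in>{1..<h}. flip_path G S i xs \<in> A)"

definition flipclass_from_to ::
  "('a, 'b) monoid_scheme \<Rightarrow> 'a set \<Rightarrow> nat \<Rightarrow> 'a \<Rightarrow> 'a \<Rightarrow> 'a list set \<Rightarrow> bool" where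
  "flipclass_from_to G S h u v F \<longleftrightarrow>
     F \<subseteq> paths G S h u v \<and> F \<noteq> {} \<and> flip_closed G S h F \<and>
     (\<forall>A. A \<subseteq> F \<and> A \<noteq> {} \<and> flip_closed G S h A \<longrightarrow> A = F)"

definition flipclass :: "('a, 'b) monoid_scheme \<Rightarrow> 'a set \<Rightarrow> nat \<Rightarrow> 'a list set \<Rightarrow> bool" where
  "flipclass G S h F \<longleftrightarrow> (\<exists>u\<in>carrier G. \<exists>v\<in>carrier G. flipclass_from_to G S h u v F)"

definition vertex_set :: "'a list set \<Rightarrow> 'a set" where
  "vertex_set F = (\<Union>xs\<in>F. set xs)"

definition label_set :: "('a, 'b) monoid_scheme \<Rightarrow> 'a list set \<Rightarrow> 'a set" where
  "label_set G F = (\<Union>xs\<in>F. set (labels G xs))"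

definition label_subgroup :: "('a, 'b) monoid_scheme \<Rightarrow> 'a list set \<Rightarrow> 'a set" where
  "label_subgroup G F = generate G (label_set G F)"

definition flipclass_irreducible :: "('a, 'b) monoid_scheme \<Rightarrow> 'a list set \<Rightarrow> bool" where
  "flipclass_irreducible G F \<longleftrightarrow> commuting_irreducible G (label_set G F)"

definition increasing_paths ::
  "('a, 'b) monoid_scheme \<Rightarrow> 'a rel \<Rightarrow> 'a list set \<Rightarrow> 'a list set" where
  "increasing_paths G R F = {xs \<in> F. sorted_wrt (\<lambda>s t. (s, t) \<in> R) (labels G xs)}"

text \<open>The common number of increasing paths in \<open>F\<close> for all reflection orderings; it is only
  meaningful when this number does not depend on the ordering, as is the case for flipclasses of
  finite type.\<close>

definition increasing_number :: "('a, 'b) monoid_scheme \<Rightarrow> 'a set \<Rightarrow> 'a list set \<Rightarrow> nat" where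
  "increasing_number G S F =
     (THE n. \<forall>R. reflection_ordering G S R \<longrightarrow> card (increasing_paths G R F) = n)"

definition flipclass_isomorphic ::
  "nat \<Rightarrow> ('a, 'c) monoid_scheme \<Rightarrow> 'a set \<Rightarrow> 'a list set \<Rightarrow>
     ('b, 'd) monoid_scheme \<Rightarrow> 'b set \<Rightarrow> 'b list set \<Rightarrow> bool" where
  "flipclass_isomorphic h G S F G' S' F' \<longleftrightarrow>
     (\<exists>\<epsilon> \<tau>.
        bij_betw \<epsilon> (vertex_set F) (vertex_set F') \<and>
        bij_betw \<tau> (label_set G F) (label_set G' F') \<and>
        (\<forall>xs\<in>lists (vertex_set F). \<forall>ts\<in>lists (label_set G F).
           (xs \<in> F \<and> labels G xs = ts) \<longleftrightarrow>
           (map \<epsilon> xs \<in> F' \<and> labels G' (map \<epsilon> xs) = map \<tau> ts)) \<and>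
        (\<forall>xs\<in>F. \<forall>i\<in>{1..<h}.
           map \<epsilon> (flip_path G S i xs) = flip_path G' S' i (map \<epsilon> xs)) \<and>
        (\<exists>R R'. reflection_ordering G S R \<and> reflection_ordering G' S' R' \<and>
           (\<forall>s\<in>label_set G F. \<forall>t\<in>label_set G F. (s, t) \<in> R \<longleftrightarrow> (\<tau> s, \<tau> t) \<in> R')))"

section \<open>Weyl groups\<close>

text \<open>Euclidean space \<open>\<real>\<^sup>n\<close>, with \<open>n\<close> quantifiable, as real sequences supported on \<open>{..<n}\<close>.\<close>

definition euclid :: "nat \<Rightarrow> (nat \<Rightarrow> real) set" where
  "euclid n = {x. \<forall>i\<ge>n. x i = 0}"

definition euclid_inner :: "nat \<Rightarrow> (nat \<Rightarrow> real) \<Rightarrow> (nat \<Rightarrow> real) \<Rightarrow> real" where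
  "euclid_inner n x y = (\<Sum>i<n. x i * y i)"

definition root_reflection :: "nat \<Rightarrow> (nat \<Rightarrow> real) \<Rightarrow> (nat \<Rightarrow> real) \<Rightarrow> (nat \<Rightarrow> real)" where
  "root_reflection n a =
     (\<lambda>x\<in>euclid n. \<lambda>i. x i - 2 * euclid_inner n x a / euclid_inner n a a * a i)"

definition crystallographic_root_system :: "nat \<Rightarrow> (nat \<Rightarrow> real) set \<Rightarrow> bool" where
  "crystallographic_root_system n \<Phi> \<longleftrightarrow>
     finite \<Phi> \<and> \<Phi> \<subseteq> euclid n - {\<lambda>i. 0} \<and>
     (\<forall>a\<in>\<Phi>. \<Phi> \<inter> {(\<lambda>i. c * a i) | c. True} = {a, \<lambda>i. - a i}) \<and>
     (\<forall>a\<in>\<Phi>. root_reflection n a ` \<Phi> = \<Phi>) \<and>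
     (\<forall>a\<in>\<Phi>. \<forall>b\<in>\<Phi>. 2 * euclid_inner n b a / euclid_inner n a a \<in> \<int>)"

definition simple_system :: "(nat \<Rightarrow> real) set \<Rightarrow> (nat \<Rightarrow> real) set \<Rightarrow> bool" where
  "simple_system \<Phi> \<Delta> \<longleftrightarrow>
     \<Delta> \<subseteq> \<Phi> \<and>
     (\<forall>c. (\<forall>i. (\<Sum>a\<in>\<Delta>. c a * a i) = 0) \<longrightarrow> (\<forall>a\<in>\<Delta>. c a = 0)) \<and>
     (\<forall>b\<in>\<Phi>. \<exists>c. b = (\<lambda>i. \<Sum>a\<in>\<Delta>. c a * a i) \<and>
        ((\<forall>a\<in>\<Delta>. c a \<ge> 0) \<or> (\<forall>a\<in>\<Delta>. c a \<le> 0)))"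

definition root_system_group ::
  "nat \<Rightarrow> (nat \<Rightarrow> real) set \<Rightarrow> ((nat \<Rightarrow> real) \<Rightarrow> (nat \<Rightarrow> real)) monoid" where
  "root_system_group n \<Phi> =
     (BijGroup (euclid n)) \<lparr>carrier := generate (BijGroup (euclid n)) (root_reflection n ` \<Phi>)\<rparr>"

text \<open>The group \<open>G\<close> with Coxeter generators \<open>S\<close> is the Weyl group of a (possibly reducible)
  crystallographic root system, the generators being the simple reflections. The root system
  need not span \<open>\<real>\<^sup>n\<close>, which does not affect its Weyl group up to isomorphism.\<close>

definition is_weyl_group :: "('a, 'b) monoid_scheme \<Rightarrow> 'a set \<Rightarrow> bool" where
  "is_weyl_group G S \<longleftrightarrow>
     (\<exists>n \<Phi> \<Delta> \<phi>. crystallographic_root_system n \<Phi> \<and> simple_system \<Phi> \<Delta> \<and>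
        \<phi> \<in> iso G (root_system_group n \<Phi>) \<and> \<phi> ` S = root_reflection n ` \<Delta>)"

text \<open>The Weyl group of type \<open>A\<^sub>n\<close> is the symmetric group on \<open>{1..n+1}\<close> with the adjacent
  transpositions as Coxeter generators. The generators of a product are the generators of the
  factors, and the empty product is the trivial group.\<close>

definition is_product_of_type_A :: "('a, 'b) monoid_scheme \<Rightarrow> 'a set \<Rightarrow> bool" where
  "is_product_of_type_A G S \<longleftrightarrow>
     (\<exists>(k::nat) (n :: nat \<Rightarrow> nat) \<phi>.
        (\<forall>i<k. n i \<ge> 1) \<and>
        \<phi> \<in> iso G (product_group {..<k} (\<lambda>i. sym_group (n i + 1))) \<and>
        \<phi> ` S = {(\<lambda>j\<in>{..<k}. if j = i then transpose p (p + 1) else id)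
                  | i p. i < k \<and> 1 \<le> p \<and> p \<le> n i})"

section \<open>Types of flipclasses\<close>

text \<open>The reflection subgroup generated by the labels is regarded as a Coxeter group with
  respect to its canonical generators.\<close>

definition finite_type :: "('a, 'b) monoid_scheme \<Rightarrow> 'a list set \<Rightarrow> bool" where
  "finite_type G F \<longleftrightarrow> finite (label_subgroup G F)"

definition weyl_type :: "('a, 'b) monoid_scheme \<Rightarrow> 'a set \<Rightarrow> 'a list set \<Rightarrow> bool" where
  "weyl_type G S F \<longleftrightarrow>
     is_weyl_group (G\<lparr>carrier := label_subgroup G F\<rparr>)
       (canonical_generators G S (label_subgroup G F))"

definition symmetric_type :: "('a, 'b) monoid_scheme \<Rightarrow> 'a set \<Rightarrow> 'a list set \<Rightarrow> bool" where
  "symmetric_type G S F \<longleftrightarrow>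
     is_product_of_type_A (G\<lparr>carrier := label_subgroup G F\<rparr>)
       (canonical_generators G S (label_subgroup G F))"

end

(* A coset H u of a reflection subgroup H contains a representative with no inversions in H, and
   then multiplication by it embeds the Bruhat graph of H, with respect to its canonical generators,
   into that of W (Dyer). So a flipclass F, all of whose vertices lie in W(F) u, is the image of a set
   of paths of the Coxeter group W(F). Lengths are not preserved, but the flip of x is the only
   middle vertex that is not comparable to x: the middle vertices lie in a coset of one maximal
   dihedral reflection subgroup. Hence flips are preserved too, and any reflection ordering of W
   restricts to one of W(F).

   The geometric representation, enlarged so that simple coroots become linearly independent, gives
   the needed facts on dihedral subgroups; a lexicographic comparison of normalised roots is a
   reflection ordering. The points fixed by all labels of one path are fixed by all of W(F), which
   bounds the rank by h. The reflection orderings of a finite Coxeter group come from reduced words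
   of the longest element; two of these are connected by braid moves, each of which changes the set
   of increasing paths by a bijection composed of flips, so c(F) is well defined. *)
theory Submission
  imports Defs
begin

section \<open>Groups generated by involutions with a reflection cocycle\<close>

text \<open>That W(F) with its canonical generators is a Coxeter system is proved without geometry.
  For a group generated by involutions, a set-valued cocycle N with N(s) = {s} for each generator
  already forces the exchange condition, hence the word property, hence the presentation by the
  relations (st)^ord(st) = 1. The inversion sets of W are such a cocycle, and intersecting them with
  a reflection subgroup gives one for the canonical generators. The roots enter only afterwards, for
  what a cocycle does not see: which reflections share a plane, and which positive combinations
  occur.

  As W may be infinite, independence of c(F) from the ordering is proved in the finite model alone.
  It reaches F because every reflection ordering of W pulls back to the model with corresponding
  increasing paths; that W has such an ordering at all makes c(F) a genuine value.

  All three types use the same model, a copy of W(F) on the natural numbers. They differ only in why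
  W(F) is finite and in which property is carried along the isomorphism.\<close>

lemma word_prod_Nil [simp]: "word_prod G [] = \<one>\<^bsub>G\<^esub>"
  and word_prod_Cons [simp]: "word_prod G (x # xs) = x \<otimes>\<^bsub>G\<^esub> word_prod G xs"
  by (simp_all add: word_prod_def)

context group
begin

lemma inv_mult_cancel [simp]:
  "x \<in> carrier G \<Longrightarrow> y \<in> carrier G \<Longrightarrow> inv x \<otimes> (x \<otimes> y) = y"
  by (simp flip: m_assoc)

lemma mult_inv_cancel [simp]:
  "x \<in> carrier G \<Longrightarrow> y \<in> carrier G \<Longrightarrow> x \<otimes> (inv x \<otimes> y) = y"
  by (simp flip: m_assoc)

lemma involution_cancel:
  "t \<in> carrier G \<Longrightarrow> t \<otimes> t = \<one> \<Longrightarrow> y \<in> carrier G \<Longrightarrow> t \<otimes> (t \<otimes> y) = y"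
  by (simp flip: m_assoc)

lemma conj_eq_iff:
  "\<lbrakk>x \<in> carrier G; s \<in> carrier G; t \<in> carrier G\<rbrakk> \<Longrightarrow> inv x \<otimes> t \<otimes> x = s \<longleftrightarrow> t = x \<otimes> s \<otimes> inv x"
  by (metis inv_closed m_assoc m_closed mult_inv_cancel inv_mult_cancel r_inv l_inv r_one)

lemma word_prod_closed [simp]: "set xs \<subseteq> carrier G \<Longrightarrow> word_prod G xs \<in> carrier G"
  by (induction xs) auto

lemma word_prod_append:
  "set xs \<subseteq> carrier G \<Longrightarrow> set ys \<subseteq> carrier G \<Longrightarrow>
     word_prod G (xs @ ys) = word_prod G xs \<otimes> word_prod G ys"
  by (induction xs) (auto simp: m_assoc)

end

section \<open>Alternating words\<close>

primrec alt :: "'a \<Rightarrow> 'a \<Rightarrow> nat \<Rightarrow> 'a list" where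
  "alt s t 0 = []"
| "alt s t (Suc n) = s # alt t s n"

lemma length_alt [simp]: "length (alt s t n) = n"
  by (induction n arbitrary: s t) auto

lemma set_alt: "set (alt s t n) \<subseteq> {s, t}"
  by (induction n arbitrary: s t) fastforce+

lemma alt_double: "alt s t (2 * n) = concat (replicate n [s, t])"
  by (induction n) auto

lemma alt_Suc_snoc: "alt s t (Suc n) = alt s t n @ [if even n then s else t]"
  by (induction n arbitrary: s t) auto

lemma alt_add: "alt s t (m + n) = alt s t m @ (if even m then alt s t n else alt t s n)"
  by (induction m arbitrary: s t) auto

text \<open>For involutions, reversal is inversion; so this identity turns the relation (st)^n = 1
  into the equality of the two alternating words of length n, and back.\<close>

lemma alt_rev_alt: "alt s t n @ rev (alt t s n) = concat (replicate n [s, t])"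
proof (induction n arbitrary: s t)
  case (Suc n)
  have *: "concat (replicate n [t, s]) @ [t] = t # concat (replicate n [s, t])" for n
    by (induction n) auto
  have "alt s t (Suc n) @ rev (alt t s (Suc n)) = s # (alt t s n @ rev (alt s t n)) @ [t]"
    by simp
  then show ?case unfolding Suc * by simp
qed simp

lemma nth_alt: "i < n \<Longrightarrow> alt s t n ! i = (if even i then s else t)"
proof (induction n arbitrary: s t i)
  case (Suc n) then show ?case by (cases i) auto
qed simp

lemma take_alt: "i \<le> n \<Longrightarrow> take i (alt s t n) = alt s t i"
proof (induction n arbitrary: s t i)
  case (Suc n) then show ?case by (cases i) auto
qed simp

text \<open>An alternating word of odd length is a palindrome, so its product is a conjugate of its
  middle letter and hence a reflection.\<close>

lemma alt_odd_palindrome: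
  "alt s t (Suc (2 * i)) = alt s t i @ (if even i then s else t) # rev (alt s t i)"
proof (induction i arbitrary: s t)
  case (Suc i)
  have "alt s t (Suc (2 * Suc i)) = s # alt t s (Suc (2 * i)) @ [s]"
    using alt_Suc_snoc[of t s "Suc (2 * i)"] by simp
  then show ?case unfolding Suc by simp
qed simp

text \<open>Collects what follows from involutive generators alone, so that it is available for a
  reflection subgroup before this is known to be a Coxeter group.\<close>

locale involutive_generators = group G for G (structure) +
  fixes S
  assumes S_carrier: "S \<subseteq> carrier G"
    and S_gen: "generate G S = carrier G"
    and S_square: "s \<in> S \<Longrightarrow> s \<otimes> s = \<one>"
begin

abbreviation len ("\<ell>") where "\<ell> \<equiv> cox_length G S"
abbreviation refls ("T") where "T \<equiv> reflections G S"
abbreviation wprod ("\<pi>") where "\<pi> \<equiv> word_prod G"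

lemma S_in [simp]: "s \<in> S \<Longrightarrow> s \<in> carrier G"
  using S_carrier by auto

lemma S_inv [simp]: "s \<in> S \<Longrightarrow> inv s = s"
  by (simp add: S_square inv_equality)

lemma S_cancel [simp]: "s \<in> S \<Longrightarrow> y \<in> carrier G \<Longrightarrow> s \<otimes> (s \<otimes> y) = y"
  by (simp add: involution_cancel S_square)

lemma words_carrier [simp]: "set xs \<subseteq> S \<Longrightarrow> set xs \<subseteq> carrier G"
  using S_carrier by auto

lemma words_closed [simp]: "set xs \<subseteq> S \<Longrightarrow> \<pi> xs \<in> carrier G"
  by simp

lemma words_append: "set xs \<subseteq> S \<Longrightarrow> set ys \<subseteq> S \<Longrightarrow> \<pi> (xs @ ys) = \<pi> xs \<otimes> \<pi> ys"
  by (simp add: word_prod_append)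

lemma words_rev: "set xs \<subseteq> S \<Longrightarrow> \<pi> (rev xs) = inv (\<pi> xs)"
  by (induction xs) (auto simp: words_append inv_mult_group)

lemma ex_word_generate:
  assumes "A \<subseteq> S" "w \<in> generate G A" shows "\<exists>xs. set xs \<subseteq> A \<and> \<pi> xs = w"
  using assms(2)
proof induction
  case one show ?case by (rule exI[of _ "[]"]) simp
next
  case (incl h) then show ?case using assms(1) by (intro exI[of _ "[h]"]) auto
next
  case (inv h) then show ?case using assms(1) by (intro exI[of _ "[h]"]) auto
next
  case (eng h1 h2)
  then obtain xs ys where "set xs \<subseteq> A" "\<pi> xs = h1" "set ys \<subseteq> A" "\<pi> ys = h2" by auto
  then show ?case using words_append[of xs ys] assms(1)
    by (intro exI[of _ "xs @ ys"]) auto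
qed

lemma ex_word: "w \<in> carrier G \<Longrightarrow> \<exists>xs. set xs \<subseteq> S \<and> \<pi> xs = w"
  using ex_word_generate[of S w] S_gen by auto

lemma len_le: assumes "set xs \<subseteq> S" shows "\<ell> (\<pi> xs) \<le> length xs"
  unfolding cox_length_def using assms by (intro Least_le bexI[of _ xs]) auto

lemma ex_reduced: assumes "w \<in> carrier G"
  shows "\<exists>xs. set xs \<subseteq> S \<and> \<pi> xs = w \<and> length xs = \<ell> w"
proof -
  obtain xs where "set xs \<subseteq> S" "\<pi> xs = w" using ex_word assms by auto
  then have "\<exists>ws\<in>lists S. length ws = length xs \<and> \<pi> ws = w" by (intro bexI[of _ xs]) auto
  from LeastI[of "\<lambda>n. \<exists>ws\<in>lists S. length ws = n \<and> \<pi> ws = w", OF this]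
  show ?thesis unfolding cox_length_def by auto
qed

lemma len_one [simp]: "\<ell> \<one> = 0"
  using len_le[of "[]"] by simp

lemma len_zero_iff: "w \<in> carrier G \<Longrightarrow> \<ell> w = 0 \<longleftrightarrow> w = \<one>"
  using ex_reduced[of w] by auto

lemma len_mult_le: assumes "x \<in> carrier G" "y \<in> carrier G" shows "\<ell> (x \<otimes> y) \<le> \<ell> x + \<ell> y"
proof -
  obtain xs where xs: "set xs \<subseteq> S" "\<pi> xs = x" "length xs = \<ell> x"
    using ex_reduced assms(1) by blast
  obtain ys where ys: "set ys \<subseteq> S" "\<pi> ys = y" "length ys = \<ell> y"
    using ex_reduced assms(2) by blast
  have "\<ell> (\<pi> (xs @ ys)) \<le> length (xs @ ys)" using xs ys by (intro len_le) simp
  then show ?thesis unfolding words_append[OF xs(1) ys(1)] unfolding xs ys length_append .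
qed

lemma len_inv [simp]: assumes "x \<in> carrier G" shows "\<ell> (inv x) = \<ell> x"
proof -
  have "\<ell> (inv x) \<le> \<ell> x" if x: "x \<in> carrier G" for x
  proof -
    obtain xs where xs: "set xs \<subseteq> S" "\<pi> xs = x" "length xs = \<ell> x"
      using ex_reduced[OF x] by blast
    have "\<ell> (\<pi> (rev xs)) \<le> length (rev xs)" using xs by (intro len_le) simp
    then show ?thesis unfolding words_rev[OF xs(1)] unfolding xs length_rev .
  qed
  from this[of x] this[of "inv x"] assms show ?thesis by simp
qed

lemma len_gen_le: "s \<in> S \<Longrightarrow> \<ell> s \<le> 1"
  using len_le[of "[s]"] by simp

lemma T_iff: "t \<in> T \<longleftrightarrow> (\<exists>x\<in>carrier G. \<exists>s\<in>S. t = x \<otimes> s \<otimes> inv x)"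
  unfolding reflections_def by auto

lemma T_E:
  assumes "t \<in> T"
  obtains x s where "x \<in> carrier G" "s \<in> S" "t = x \<otimes> s \<otimes> inv x"
  using assms unfolding T_iff by blast

lemma T_carrier [simp]: "t \<in> T \<Longrightarrow> t \<in> carrier G"
  unfolding T_iff by auto

lemma T_square [simp]: "t \<in> T \<Longrightarrow> t \<otimes> t = \<one>"
  unfolding T_iff by (auto simp: m_assoc)

lemma T_inv [simp]: "t \<in> T \<Longrightarrow> inv t = t"
  by (simp add: inv_equality)

lemma T_cancel [simp]: "t \<in> T \<Longrightarrow> y \<in> carrier G \<Longrightarrow> t \<otimes> (t \<otimes> y) = y"
  by (simp add: involution_cancel)

lemma S_subset_T: "S \<subseteq> T"
proof
  fix s assume "s \<in> S"
  then have "s = \<one> \<otimes> s \<otimes> inv \<one>" by simp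
  then show "s \<in> T" using \<open>s \<in> S\<close> T_iff by blast
qed

lemma T_conj: assumes "t \<in> T" "x \<in> carrier G" shows "x \<otimes> t \<otimes> inv x \<in> T"
proof -
  obtain y s where "y \<in> carrier G" "s \<in> S" "t = y \<otimes> s \<otimes> inv y" using assms T_E by blast
  then show ?thesis using assms
    unfolding T_iff by (intro bexI[of _ "x \<otimes> y"] bexI[of _ s]) (auto simp: m_assoc inv_mult_group)
qed

lemma T_conj': "t \<in> T \<Longrightarrow> x \<in> carrier G \<Longrightarrow> inv x \<otimes> t \<otimes> x \<in> T"
  using T_conj[of t "inv x"] by simp

section \<open>Reduced words and the reflections of a word\<close>

definition reduced :: "'a list \<Rightarrow> bool" where
  "reduced xs \<longleftrightarrow> set xs \<subseteq> S \<and> length xs = \<ell> (\<pi> xs)"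

lemma reduced_appendD:
  assumes "reduced (xs @ ys)" shows "reduced xs" "reduced ys"
proof -
  have S: "set xs \<subseteq> S" "set ys \<subseteq> S" using assms by (auto simp: reduced_def)
  then show "reduced xs" "reduced ys"
    using assms len_le[of xs] len_le[of ys] len_mult_le[of "\<pi> xs" "\<pi> ys"]
    by (auto simp: reduced_def words_append)
qed

lemma ex_reduced': "w \<in> carrier G \<Longrightarrow> \<exists>xs. reduced xs \<and> \<pi> xs = w"
  using ex_reduced[of w] by (auto simp: reduced_def)

text \<open>The reflection belonging to letter \<open>i\<close>, counted from 0. Multiplication by
  it from the left deletes this letter, see \<open>rfl_mult\<close>.\<close>

definition rfl :: "'a list \<Rightarrow> nat \<Rightarrow> 'a" where
  "rfl xs i = \<pi> (take i xs) \<otimes> xs ! i \<otimes> inv (\<pi> (take i xs))"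

lemma take_drop_S: "set xs \<subseteq> S \<Longrightarrow> set (take i xs) \<subseteq> S" "set xs \<subseteq> S \<Longrightarrow> set (drop i xs) \<subseteq> S"
  by (auto dest: in_set_takeD in_set_dropD)

lemma nth_S: "set xs \<subseteq> S \<Longrightarrow> i < length xs \<Longrightarrow> xs ! i \<in> S"
  by auto

lemma rfl_T: "set xs \<subseteq> S \<Longrightarrow> i < length xs \<Longrightarrow> rfl xs i \<in> T"
  unfolding rfl_def using nth_S[of xs i] S_subset_T
  by (intro T_conj) (auto simp: take_drop_S)

lemma rfl_mult:
  assumes "set xs \<subseteq> S" "i < length xs"
  shows "rfl xs i \<otimes> \<pi> xs = \<pi> (take i xs @ drop (Suc i) xs)"
proof -
  have 1: "\<pi> xs = \<pi> (take i xs) \<otimes> (xs ! i \<otimes> \<pi> (drop (Suc i) xs))"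
    using words_append[of "take i xs" "drop i xs"] assms nth_S[OF assms]
    by (simp add: take_drop_S Cons_nth_drop_Suc[symmetric])
       (metis Cons_nth_drop_Suc append_take_drop_id)
  show ?thesis unfolding 1 rfl_def
    using assms nth_S[OF assms] take_drop_S[OF assms(1)] by (simp add: words_append m_assoc)
qed

lemma rfl_Cons_Suc:
  "s \<in> S \<Longrightarrow> set xs \<subseteq> S \<Longrightarrow> i < length xs \<Longrightarrow> rfl (s # xs) (Suc i) = s \<otimes> rfl xs i \<otimes> s"
  using nth_S[of xs i] take_drop_S[of xs i]
  by (simp add: rfl_def m_assoc inv_mult_group)

lemma rfl_Cons_0 [simp]: "s \<in> S \<Longrightarrow> rfl (s # xs) 0 = s"
  by (simp add: rfl_def)

lemma rfl_append: "i < length xs \<Longrightarrow> rfl (xs @ ys) i = rfl xs i"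
  by (simp add: rfl_def nth_append)

lemma rfl_append2:
  assumes "set xs \<subseteq> S" "set ys \<subseteq> S" "i < length ys"
  shows "rfl (xs @ ys) (length xs + i) = \<pi> xs \<otimes> rfl ys i \<otimes> inv (\<pi> xs)"
  using assms take_drop_S(1)[OF assms(2)] nth_S[OF assms(2,3)]
  by (simp add: rfl_def nth_append words_append m_assoc inv_mult_group)

lemma alt_S [simp]: "s \<in> S \<Longrightarrow> t \<in> S \<Longrightarrow> set (alt s t n) \<subseteq> S"
  using set_alt[of s t n] by auto

lemma gen_power_alt:
  assumes "s \<in> S" "t \<in> S"
  shows "\<pi> (alt s t (2 * n)) = (s \<otimes> t) [^] n"
proof (induction n)
  case (Suc n)
  have "\<pi> (alt s t (2 * Suc n)) = s \<otimes> t \<otimes> \<pi> (alt s t (2 * n))"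
    using assms by (simp add: m_assoc)
  then show ?case using assms Suc nat_pow_Suc2[of "s \<otimes> t" n] by (simp del: nat_pow_Suc)
qed simp

end

text \<open>The first axiom says that N(xy) is the symmetric difference of N(x) and x N(y) x^-1.
  \<open>N\<close> stays abstract because it is instantiated by parity sets and by restricted
  inversion sets, and only later identified with the inversion set of the group.\<close>

locale reflection_cocycle = involutive_generators +
  fixes N :: "'a \<Rightarrow> 'a set"
  assumes N_mult: "\<lbrakk>x \<in> carrier G; y \<in> carrier G; t \<in> carrier G\<rbrakk> \<Longrightarrow>
      t \<in> N (x \<otimes> y) \<longleftrightarrow> (t \<in> N x) \<noteq> (inv x \<otimes> t \<otimes> x \<in> N y)"
    and N_carrier: "x \<in> carrier G \<Longrightarrow> N x \<subseteq> carrier G"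
    and N_gen: "s \<in> S \<Longrightarrow> N s = {s}"
begin

lemma N_one: "N \<one> = {}"
  using N_mult[of \<one> \<one>] N_carrier[of \<one>] by auto

lemma N_inv: "\<lbrakk>x \<in> carrier G; t \<in> carrier G\<rbrakk> \<Longrightarrow> inv x \<otimes> t \<otimes> x \<in> N (inv x) \<longleftrightarrow> t \<in> N x"
  using N_mult[of x "inv x" t] N_one by simp

text \<open>The strong exchange condition in the language of cocycles: splitting off the first
  letter shows that each member of N(w) is met among the reflections of any word for w.\<close>

lemma in_N_rfl: "set xs \<subseteq> S \<Longrightarrow> t \<in> N (\<pi> xs) \<Longrightarrow> \<exists>i<length xs. t = rfl xs i"
proof (induction xs arbitrary: t)
  case (Cons s xs)
  then have s: "s \<in> S" "set xs \<subseteq> S" by auto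
  have t: "t \<in> carrier G" using Cons.prems N_carrier words_closed by blast
  show ?case
  proof (cases "t = s")
    case True then show ?thesis using s by auto
  next
    case False
    then have "s \<otimes> t \<otimes> s \<in> N (\<pi> xs)"
      using Cons.prems N_mult[of s "\<pi> xs" t] N_gen s t by auto
    then obtain i where i: "i < length xs" "s \<otimes> t \<otimes> s = rfl xs i" using Cons.IH s by blast
    then have "t = s \<otimes> rfl xs i \<otimes> s" using s t by (simp add: m_assoc S_square flip: i(2))
    then show ?thesis using i s by (intro exI[of _ "Suc i"]) (simp add: rfl_Cons_Suc)
  qed
qed (simp add: N_one)

lemma N_subset_T: "w \<in> carrier G \<Longrightarrow> N w \<subseteq> T"
  using ex_word[of w] in_N_rfl rfl_T by blast

lemma N_less: assumes "w \<in> carrier G" "t \<in> N w" shows "\<ell> (t \<otimes> w) < \<ell> w"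
proof -
  obtain xs where xs: "set xs \<subseteq> S" "\<pi> xs = w" "length xs = \<ell> w"
    using ex_reduced[OF assms(1)] by blast
  obtain i where i: "i < length xs" "t = rfl xs i" using in_N_rfl xs assms by blast
  have "t \<otimes> w = \<pi> (take i xs @ drop (Suc i) xs)" using rfl_mult[OF xs(1) i(1)] i(2) xs(2) by simp
  also have "\<ell> \<dots> \<le> length (take i xs @ drop (Suc i) xs)" using take_drop_S[OF xs(1)] by (intro len_le) simp
  also have "\<dots> < \<ell> w" using i(1) unfolding xs(3)[symmetric] by simp
  finally show ?thesis .
qed

text \<open>For t = x s x^-1 the contributions of x and of x^-1 test the same element and cancel;
  the contribution of s remains.\<close>

lemma refl_in_N: assumes "t \<in> T" shows "t \<in> N t"
proof -
  obtain x s where x: "x \<in> carrier G" "s \<in> S" "t = x \<otimes> s \<otimes> inv x" using assms T_E by blast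
  have "inv x \<otimes> t \<otimes> x = s" using x by (simp add: m_assoc)
  then have "t \<in> N x \<longleftrightarrow> s \<in> N (inv x)" using N_inv[of x t] x by simp
  moreover have "s \<in> N (s \<otimes> inv x) \<longleftrightarrow> s \<notin> N (inv x)"
    using N_mult[of s "inv x" s] N_gen x by (simp add: S_square)
  moreover have "t \<in> N t \<longleftrightarrow> (t \<in> N x) \<noteq> (s \<in> N (s \<otimes> inv x))"
    using N_mult[of x "s \<otimes> inv x" t] x \<open>inv x \<otimes> t \<otimes> x = s\<close> by (simp add: m_assoc)
  ultimately show ?thesis by auto
qed

text \<open>So a cocycle is determined by the generators. If \<open>t\<close> is not in N(w), the
  cocycle rule and \<open>refl_in_N\<close> put it into N(tw), and then w is shorter than tw by
  \<open>N_less\<close>.\<close>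

lemma N_eq: assumes "w \<in> carrier G" shows "N w = {t \<in> T. \<ell> (t \<otimes> w) < \<ell> w}"
proof -
  have "t \<in> N w" if "t \<in> T" "\<ell> (t \<otimes> w) < \<ell> w" for t
  proof (rule ccontr)
    assume "t \<notin> N w"
    then have "t \<in> N (t \<otimes> w)" using N_mult[of t w t] refl_in_N assms that by simp
    then show False using N_less[of "t \<otimes> w" t] that assms by simp
  qed
  then show ?thesis using assms N_less N_subset_T by blast
qed

lemma reduced_rfl_N: assumes "reduced xs" "i < length xs" shows "rfl xs i \<in> N (\<pi> xs)"
proof -
  have S: "set xs \<subseteq> S" using assms by (simp add: reduced_def)
  then have "\<ell> (rfl xs i \<otimes> \<pi> xs) < length xs"
    using rfl_mult[of xs i] len_le[of "take i xs @ drop (Suc i) xs"] assms take_drop_S[OF S] by simp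
  then show ?thesis using N_eq rfl_T S assms by (simp add: reduced_def)
qed

lemma reduced_N: "reduced xs \<Longrightarrow> N (\<pi> xs) = rfl xs ` {..<length xs}"
  using in_N_rfl[of xs] reduced_rfl_N[of xs] by (auto simp: reduced_def)

text \<open>If two letters had the same reflection, deleting both would multiply by it twice, giving
  a word for the same element that is shorter by two.\<close>

lemma reduced_rfl_inj: assumes "reduced xs" shows "inj_on (rfl xs) {..<length xs}"
proof -
  have "rfl xs i \<noteq> rfl xs j" if ij: "i < j" "j < length xs" for i j
  proof
    assume eq: "rfl xs i = rfl xs j"
    have S: "set xs \<subseteq> S" using assms by (simp add: reduced_def)
    define ys where "ys = take j xs @ drop (Suc j) xs"
    have ys: "set ys \<subseteq> S" "i < length ys" using ij take_drop_S[OF S] by (auto simp: ys_def)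
    have "rfl ys i = rfl xs i" using ij by (simp add: ys_def rfl_def nth_append min_def)
    then have "\<pi> (take i ys @ drop (Suc i) ys) = rfl xs i \<otimes> (rfl xs j \<otimes> \<pi> xs)"
      using rfl_mult[of ys i] rfl_mult[of xs j] ys S ij by (simp add: ys_def)
    also have "\<dots> = \<pi> xs" using eq rfl_T[OF S] ij S by simp
    finally have "\<ell> (\<pi> xs) \<le> length (take i ys @ drop (Suc i) ys)"
      using len_le[of "take i ys @ drop (Suc i) ys"] take_drop_S[OF ys(1)] by simp
    then show False using assms ys ij by (simp add: ys_def reduced_def)
  qed
  then show ?thesis by (metis (no_types) inj_onI lessThan_iff nat_neq_iff)
qed

lemma card_N: assumes "w \<in> carrier G" shows "finite (N w)" "card (N w) = \<ell> w"
proof -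
  obtain xs where "reduced xs" "\<pi> xs = w" using ex_reduced' assms by auto
  then show "finite (N w)" "card (N w) = \<ell> w"
    using reduced_N[of xs] reduced_rfl_inj[of xs] by (auto simp: card_image reduced_def)
qed

lemma gen_left_descent:
  assumes "s \<in> S" "w \<in> carrier G"
  shows "s \<in> N w \<Longrightarrow> \<ell> w = Suc (\<ell> (s \<otimes> w))" "s \<notin> N w \<Longrightarrow> \<ell> (s \<otimes> w) = Suc (\<ell> w)"
proof -
  have *: "\<ell> w \<le> Suc (\<ell> (s \<otimes> w))" "\<ell> (s \<otimes> w) \<le> Suc (\<ell> w)"
    using len_mult_le[of s "s \<otimes> w"] len_mult_le[of s w] len_gen_le[of s] assms by auto
  show "s \<in> N w \<Longrightarrow> \<ell> w = Suc (\<ell> (s \<otimes> w))" using * N_less[of w s] assms by simp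
  assume "s \<notin> N w"
  then have "s \<in> N (s \<otimes> w)" using N_mult[of s w s] N_gen assms by (simp add: S_square)
  then show "\<ell> (s \<otimes> w) = Suc (\<ell> w)" using * N_less[of "s \<otimes> w" s] assms by simp
qed

lemma reduced_Cons_iff:
  "s \<in> S \<Longrightarrow> reduced xs \<Longrightarrow> reduced (s # xs) \<longleftrightarrow> s \<notin> N (\<pi> xs)"
  using gen_left_descent[of s "\<pi> xs"] by (auto simp: reduced_def)


lemma rfl_alt:
  assumes "s \<in> S" "t \<in> S" "i < n"
  shows "rfl (alt s t n) i = \<pi> (alt s t (Suc (2 * i)))"
proof -
  let ?c = "if even i then s else t"
  have "\<pi> (alt s t (Suc (2 * i))) = \<pi> (alt s t i @ [?c] @ rev (alt s t i))"
    by (simp only: alt_odd_palindrome append_Cons append_Nil)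
  also have "\<dots> = \<pi> (alt s t i) \<otimes> (?c \<otimes> inv \<pi> (alt s t i))"
    using assms by (subst words_append) (auto simp: words_rev)
  finally show ?thesis using assms by (simp add: rfl_def take_alt nth_alt m_assoc)
qed

lemma ord_swap: "s \<in> S \<Longrightarrow> t \<in> S \<Longrightarrow> ord (t \<otimes> s) = ord (s \<otimes> t)"
  using ord_inv[of "s \<otimes> t"] by (simp add: inv_mult_group)

lemma alt_power_one:
  assumes "s \<in> S" "t \<in> S" "(s \<otimes> t) [^] n = \<one>"
  shows "\<pi> (alt s t n) = \<pi> (alt t s n)"
proof -
  have "\<pi> (alt s t n) \<otimes> inv \<pi> (alt t s n) = \<pi> (alt s t n @ rev (alt t s n))"
    using assms by (simp add: words_append words_rev)
  also have "\<dots> = \<one>"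
    unfolding alt_rev_alt using assms gen_power_alt[of s t n] by (simp add: alt_double)
  finally show ?thesis using assms
    by (metis alt_S inv_equality inv_inv words_closed inv_closed)
qed

section \<open>Braid moves and the word property\<close>

definition braid_step :: "'a list \<Rightarrow> 'a list \<Rightarrow> bool" where
  "braid_step xs ys \<longleftrightarrow> (\<exists>us vs s t. s \<in> S \<and> t \<in> S \<and> s \<noteq> t \<and> ord (s \<otimes> t) \<noteq> 0 \<and>
     xs = us @ alt s t (ord (s \<otimes> t)) @ vs \<and> ys = us @ alt t s (ord (s \<otimes> t)) @ vs)"

lemma braid_step_Cons: "braid_step xs ys \<Longrightarrow> braid_step (x # xs) (x # ys)"
  unfolding braid_step_def by (metis append_Cons)

lemma braid_steps_Cons: "braid_step\<^sup>*\<^sup>* xs ys \<Longrightarrow> braid_step\<^sup>*\<^sup>* (x # xs) (x # ys)"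
  by (induction rule: rtranclp_induct) (auto intro: rtranclp.rtrancl_into_rtrancl braid_step_Cons)

text \<open>Exchange puts \<open>t\<close> in front and deletes one letter. If that letter, of index
  i < k, lay in the alternating prefix, then \<open>t\<close> would equal an odd alternating word
  and (st)^(i+1) would be trivial, although i + 1 is less than the order. So the letter lies in
  \<open>zs\<close>, and the prefix has grown.\<close>

lemma reduced_alt_exchange:
  assumes "reduced (alt s t k @ zs)" and st: "s \<in> S" "t \<in> S"
    and "t \<in> N (\<pi> (alt s t k @ zs))" and k: "ord (s \<otimes> t) = 0 \<or> k < ord (s \<otimes> t)"
  shows "\<exists>zs'. reduced (alt t s (Suc k) @ zs') \<and>
     \<pi> (alt t s (Suc k) @ zs') = \<pi> (alt s t k @ zs)"
proof -
  let ?xs = "alt s t k @ zs"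
  have S: "set ?xs \<subseteq> S" using assms by (simp add: reduced_def)
  obtain i where i: "i < length ?xs" "t = rfl ?xs i" using in_N_rfl[OF S] assms by blast
  have "k \<le> i"
  proof (rule ccontr)
    assume "\<not> k \<le> i"
    then have ik: "i < k" by simp
    then have t: "t = \<pi> (alt s t (Suc (2 * i)))" using i st by (simp add: rfl_append rfl_alt)
    have "\<pi> (alt s t (2 * Suc i)) = \<pi> (alt s t (Suc (2 * i)) @ [t])"
      using alt_Suc_snoc[of s t "Suc (2 * i)"] by simp
    also have "\<dots> = t \<otimes> t" using st t words_append[of "alt s t (Suc (2 * i))" "[t]"]
      alt_S[of s t "Suc (2 * i)"] by (simp del: alt.simps)
    finally have "(s \<otimes> t) [^] Suc i = \<one>" using gen_power_alt[OF st, of "Suc i"] st S_square by simp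
    then have "ord (s \<otimes> t) dvd Suc i" using pow_eq_id[of "s \<otimes> t" "Suc i"] st by (simp del: nat_pow_Suc)
    then show False using k ik by (auto dest: dvd_imp_le)
  qed
  define zs' where "zs' = take (i - k) zs @ drop (Suc (i - k)) zs"
  have zs': "set zs' \<subseteq> S" using S by (auto simp: zs'_def dest: in_set_takeD in_set_dropD)
  have "t \<otimes> \<pi> ?xs = \<pi> (alt s t k @ zs')"
    using rfl_mult[OF S i(1)] \<open>k \<le> i\<close> by (simp add: zs'_def Suc_diff_le flip: i(2))
  then have eq: "\<pi> (alt t s (Suc k) @ zs') = \<pi> ?xs"
    using st S zs' by (metis S_cancel alt.simps(2) append_Cons word_prod_Cons words_closed)
  moreover have "length (alt t s (Suc k) @ zs') = length ?xs"
    using i \<open>k \<le> i\<close> by (auto simp: zs'_def)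
  ultimately show ?thesis using assms(1) zs' st
    by (intro exI[of _ zs']) (auto simp: reduced_def)
qed

text \<open>Both prefixes grow together: an exchange makes from the prefix that begins with one
  letter a longer prefix that begins with the other.\<close>

lemma two_descents_alt:
  assumes st: "s \<in> S" "t \<in> S" and w: "w \<in> carrier G" "s \<in> N w" "t \<in> N w"
    and "ord (s \<otimes> t) = 0 \<or> k \<le> ord (s \<otimes> t)"
  shows "(\<exists>zs. reduced (alt s t k @ zs) \<and> \<pi> (alt s t k @ zs) = w) \<and>
    (\<exists>zs. reduced (alt t s k @ zs) \<and> \<pi> (alt t s k @ zs) = w)"
  using assms(6)
proof (induction k)
  case 0
  then show ?case using ex_reduced'[OF w(1)] by simp
next
  case (Suc k)
  then have k: "ord (s \<otimes> t) = 0 \<or> k < ord (s \<otimes> t)" and "ord (s \<otimes> t) = 0 \<or> k \<le> ord (s \<otimes> t)"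
    by auto
  then obtain zs zs' where *: "reduced (alt s t k @ zs)" "\<pi> (alt s t k @ zs) = w"
    "reduced (alt t s k @ zs')" "\<pi> (alt t s k @ zs') = w" using Suc.IH by blast
  have "\<exists>zs. reduced (alt t s (Suc k) @ zs) \<and> \<pi> (alt t s (Suc k) @ zs) = w"
    using reduced_alt_exchange[OF *(1) st _ k] *(2) w by metis
  moreover have "\<exists>zs. reduced (alt s t (Suc k) @ zs) \<and> \<pi> (alt s t (Suc k) @ zs) = w"
    using reduced_alt_exchange[OF *(3) st(2,1)] k *(4) w ord_swap[OF st] by metis
  ultimately show ?case by blast
qed

text \<open>Matsumoto's theorem, by induction on the length. If the first letters \<open>s\<close>
  and \<open>t\<close> differ, both are descents, so the element has a reduced word that begins with
  the alternating word of length ord(st). One braid move turns this word into the one starting with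
  \<open>t\<close>; the two words share a first letter with \<open>xs\<close> and with
  \<open>ys\<close> respectively.\<close>

lemma word_property:
  "reduced xs \<Longrightarrow> reduced ys \<Longrightarrow> \<pi> xs = \<pi> ys \<Longrightarrow> braid_step\<^sup>*\<^sup>* xs ys"
proof (induction "length xs" arbitrary: xs ys)
  case 0
  then have "xs = []" by simp
  moreover have "ys = []" using 0 by (metis len_one length_0_conv reduced_def word_prod_Nil)
  ultimately show ?case by simp
next
  case (Suc n)
  have "length ys = Suc n" using Suc by (simp add: reduced_def)
  then obtain s xs' t ys' where xs: "xs = s # xs'" and ys: "ys = t # ys'" and n: "n = length xs'"
    using Suc.hyps(2) by (metis length_Suc_conv)
  have st: "s \<in> S" "t \<in> S" "set xs' \<subseteq> S" "set ys' \<subseteq> S"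
    using Suc.prems xs ys by (auto simp: reduced_def)
  have red: "reduced xs'" "reduced ys'"
    using Suc.prems reduced_appendD(2)[of "[s]" xs'] reduced_appendD(2)[of "[t]" ys'] xs ys by auto
  have canc: "\<pi> us = \<pi> vs" if "\<pi> (c # us) = \<pi> (c # vs)" "c \<in> S" "set us \<subseteq> S" "set vs \<subseteq> S" for c us vs
    using that by (metis S_cancel word_prod_Cons words_closed)
  show ?case
  proof (cases "s = t")
    case True
    then show ?thesis using Suc xs ys red st n canc braid_steps_Cons by metis
  next
    case False
    let ?w = "\<pi> xs" and ?m = "ord (s \<otimes> t)"
    have w: "?w \<in> carrier G" using Suc.prems by (simp add: reduced_def)
    have N: "s \<in> N ?w" "t \<in> N ?w"
      using reduced_rfl_N[OF Suc.prems(1), of 0] reduced_rfl_N[OF Suc.prems(2), of 0] xs ys st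
        Suc.prems(3) by auto
    \<comment> \<open>For infinite order the alternating prefix could be made longer than the
      element itself.\<close>
    have m: "?m \<noteq> 0"
    proof
      assume "?m = 0"
      then obtain zs where "reduced (alt s t (Suc (\<ell> ?w)) @ zs)"
        "\<pi> (alt s t (Suc (\<ell> ?w)) @ zs) = ?w"
        using two_descents_alt[OF st(1,2) w N, of "Suc (\<ell> ?w)"] by blast
      then show False unfolding reduced_def by (metis Suc_n_not_le_n le_add1 length_alt length_append)
    qed
    then obtain m' where m': "?m = Suc m'" using not0_implies_Suc by blast
    obtain zs where zs: "reduced (alt s t ?m @ zs)" "\<pi> (alt s t ?m @ zs) = ?w"
      using two_descents_alt[OF st(1,2) w N, of ?m] by auto
    have zsS: "set zs \<subseteq> S" using zs by (simp add: reduced_def)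
    have "\<pi> (alt s t ?m) = \<pi> (alt t s ?m)" using st by (intro alt_power_one) simp_all
    then have eq: "\<pi> (alt t s ?m @ zs) = ?w" using zs zsS st by (simp add: words_append)
    then have zs2: "reduced (alt t s ?m @ zs)" using zs st by (simp add: reduced_def)
    have "reduced (alt t s m' @ zs)" "reduced (alt s t m' @ zs)"
      using zs zs2 reduced_appendD(2)[of "[s]" "alt t s m' @ zs"]
        reduced_appendD(2)[of "[t]" "alt s t m' @ zs"] m' by auto
    moreover have "\<pi> xs' = \<pi> (alt t s m' @ zs)" "\<pi> (alt s t m' @ zs) = \<pi> ys'"
      using canc[of s xs' "alt t s m' @ zs"] canc[of t "alt s t m' @ zs" ys'] zs eq st zsS m' xs ys
        Suc.prems(3) by auto
    ultimately have IH: "braid_step\<^sup>*\<^sup>* xs' (alt t s m' @ zs)" "braid_step\<^sup>*\<^sup>* (alt s t m' @ zs) ys'"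
      using Suc.hyps(1)[OF n red(1), of "alt t s m' @ zs"]
        Suc.hyps(1)[of "alt s t m' @ zs" ys'] red n \<open>length ys = Suc n\<close> ys
      by (auto simp: reduced_def)
    have "braid_step (alt s t ?m @ zs) (alt t s ?m @ zs)"
      unfolding braid_step_def using st False m by (intro exI[of _ "[]"] exI) auto
    then show ?thesis
      using braid_steps_Cons[OF IH(1), of s] braid_steps_Cons[OF IH(2), of t] xs ys m' by simp
  qed
qed

section \<open>The Coxeter presentation from the word property\<close>

definition mord :: "'a \<Rightarrow> 'a \<Rightarrow> nat" where "mord s t = ord (s \<otimes> t)"

text \<open>\<open>ord\<close> is 0 on elements of infinite order, which is the value that encodes
  infinity in a Coxeter matrix.\<close>

lemma coxeter_matrix_mord: "coxeter_matrix S mord"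
  unfolding coxeter_matrix_def mord_def
proof (intro conjI ballI impI)
  fix s t assume "s \<in> S" "t \<in> S" "s \<noteq> t"
  then show "ord (s \<otimes> t) \<noteq> 1" by (metis S_in S_inv inv_equality m_closed ord_eq_1)
qed (simp_all add: S_square ord_swap)

lemma relator_step_prod: assumes "relator_step S mord xs ys" shows "\<pi> xs = \<pi> ys"
proof -
  obtain us vs s t where st: "s \<in> S" "t \<in> S" and "us \<in> lists S" "vs \<in> lists S"
    and xy: "xs = us @ alt s t (2 * mord s t) @ vs" "ys = us @ vs"
    using assms unfolding relator_step_def alt_double by blast
  then have uv: "set us \<subseteq> S" "set vs \<subseteq> S" by auto
  then show ?thesis unfolding xy using gen_power_alt[OF st, of "mord s t"] st
    by (simp add: words_append mord_def)
qed

abbreviation weq (infix "\<sim>\<^sub>w" 50) where "xs \<sim>\<^sub>w ys \<equiv> equivclp (relator_step S mord) xs ys"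

lemma relator_step_append:
  assumes "relator_step S mord xs ys" "set us \<subseteq> S" "set vs \<subseteq> S"
  shows "relator_step S mord (us @ xs @ vs) (us @ ys @ vs)"
proof -
  obtain us' vs' s t where "us' \<in> lists S" "vs' \<in> lists S" "s \<in> S" "t \<in> S" "mord s t \<noteq> 0"
    "xs = us' @ concat (replicate (mord s t) [s, t]) @ vs'" "ys = us' @ vs'"
    using assms unfolding relator_step_def by auto
  then show ?thesis unfolding relator_step_def using assms(2,3)
    by (intro bexI[of _ "us @ us'"] bexI[of _ "vs' @ vs"] bexI[of _ s] bexI[of _ t]) auto
qed

lemma weq_append: "xs \<sim>\<^sub>w ys \<Longrightarrow> set us \<subseteq> S \<Longrightarrow> set vs \<subseteq> S \<Longrightarrow> us @ xs @ vs \<sim>\<^sub>w us @ ys @ vs"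
proof (induction rule: equivclp_induct)
  case (step y z)
  then have "us @ y @ vs \<sim>\<^sub>w us @ z @ vs"
    using relator_step_append[of y z us vs] relator_step_append[of z y us vs]
    by (metis converse_r_into_equivclp r_into_equivclp)
  then show ?case using step by (meson equivclp_trans)
qed simp

lemma weq_relator: assumes "s \<in> S" "t \<in> S" "mord s t \<noteq> 0"
  shows "concat (replicate (mord s t) [s, t]) \<sim>\<^sub>w []"
  using assms unfolding relator_step_def
  by (intro r_into_equivclp) (metis append.left_neutral append.right_neutral lists.Nil relator_step_def)

lemma weq_square: "s \<in> S \<Longrightarrow> [s, s] \<sim>\<^sub>w []"
  using weq_relator[of s s] coxeter_matrix_mord by (simp add: coxeter_matrix_def)

lemma weq_rev: "set xs \<subseteq> S \<Longrightarrow> rev xs @ xs \<sim>\<^sub>w []"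
proof (induction xs)
  case (Cons x xs)
  then have "rev xs @ [x, x] @ xs \<sim>\<^sub>w rev xs @ [] @ xs"
    by (intro weq_append weq_square) auto
  then show ?case using Cons by (auto intro: equivclp_trans)
qed simp

lemma weq_braid:
  assumes "braid_step xs ys" "set xs \<subseteq> S" shows "xs \<sim>\<^sub>w ys"
proof -
  obtain us vs s t where st: "s \<in> S" "t \<in> S" "mord s t \<noteq> 0"
    and xy: "xs = us @ alt s t (mord s t) @ vs" "ys = us @ alt t s (mord s t) @ vs"
    using assms unfolding braid_step_def mord_def by auto
  have uv: "set us \<subseteq> S" "set vs \<subseteq> S" using assms xy by auto
  let ?a = "alt s t (mord s t)" and ?b = "alt t s (mord s t)"
  \<comment> \<open>Behind \<open>?a\<close> the trivial word \<open>rev ?b @ ?b\<close> is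
    inserted; then \<open>?a @ rev ?b\<close> is a relator by \<open>alt_rev_alt\<close> and
    disappears.\<close>
  have "?a @ (rev ?b @ ?b) @ [] \<sim>\<^sub>w ?a @ [] @ []"
    using st by (intro weq_append weq_rev) auto
  moreover have "[] @ (?a @ rev ?b) @ ?b \<sim>\<^sub>w [] @ [] @ ?b"
    unfolding alt_rev_alt using st by (intro weq_append weq_relator) auto
  ultimately have "?a \<sim>\<^sub>w ?b" by simp (meson equivclp_sym equivclp_trans)
  then show ?thesis unfolding xy using uv by (intro weq_append)
qed

lemma braid_step_S: assumes "braid_step xs ys" "set xs \<subseteq> S" shows "set ys \<subseteq> S"
proof -
  obtain us vs s t where st: "s \<in> S" "t \<in> S"
    and xy: "xs = us @ alt s t (ord (s \<otimes> t)) @ vs" "ys = us @ alt t s (ord (s \<otimes> t)) @ vs"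
    using assms(1) unfolding braid_step_def by blast
  show ?thesis using assms(2) alt_S[OF st(2,1)] unfolding xy set_append by blast
qed

lemma weq_braids: "braid_step\<^sup>*\<^sup>* xs ys \<Longrightarrow> set xs \<subseteq> S \<Longrightarrow> xs \<sim>\<^sub>w ys \<and> set ys \<subseteq> S"
proof (induction rule: rtranclp_induct)
  case (step y z)
  then show ?case by (meson braid_step_S equivclp_trans weq_braid)
qed simp

text \<open>When \<open>s\<close> is a descent of the reduced word behind it, the word property lets
  that word start with \<open>s\<close>, and the two copies of \<open>s\<close> cancel.\<close>

lemma weq_reduced: "set xs \<subseteq> S \<Longrightarrow> \<exists>ys. reduced ys \<and> xs \<sim>\<^sub>w ys \<and> \<pi> ys = \<pi> xs"
proof (induction xs)
  case Nil
  show ?case by (intro exI[of _ "[]"]) (simp add: reduced_def)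
next
  case (Cons s xs)
  then obtain ys where ys: "reduced ys" "xs \<sim>\<^sub>w ys" "\<pi> ys = \<pi> xs" and s: "s \<in> S" by auto
  have ysS: "set ys \<subseteq> S" using ys by (simp add: reduced_def)
  have eq: "s # xs \<sim>\<^sub>w s # ys" using weq_append[OF ys(2), of "[s]" "[]"] s by simp
  show ?case
  proof (cases "s \<in> N (\<pi> ys)")
    case False
    then show ?thesis using ys eq s reduced_Cons_iff by (intro exI[of _ "s # ys"]) auto
  next
    case True
    obtain zs where zs: "reduced zs" "\<pi> zs = s \<otimes> \<pi> ys" using ex_reduced' s ysS by (metis S_in m_closed words_closed)
    have zsS: "set zs \<subseteq> S" using zs by (simp add: reduced_def)
    have "\<ell> (\<pi> ys) = Suc (\<ell> (\<pi> zs))" using gen_left_descent(1)[OF s _ True] zs ysS by simp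
    then have "reduced (s # zs)" "\<pi> (s # zs) = \<pi> ys" using zs zsS s ysS by (simp_all add: reduced_def)
    then have "ys \<sim>\<^sub>w s # zs" using weq_braids[OF word_property[OF ys(1), of "s # zs"]] ysS by simp
    then have "s # ys \<sim>\<^sub>w s # s # zs" using weq_append[of ys "s # zs" "[s]" "[]"] s by simp
    moreover have "[s, s] @ zs \<sim>\<^sub>w zs" using weq_append[OF weq_square[OF s], of "[]" zs] zsS by simp
    ultimately have "s # xs \<sim>\<^sub>w zs" using eq by (metis append_Cons append_Nil equivclp_trans)
    then show ?thesis using zs ys by auto
  qed
qed

lemma weq_iff: assumes "set xs \<subseteq> S" "set ys \<subseteq> S" shows "\<pi> xs = \<pi> ys \<longleftrightarrow> xs \<sim>\<^sub>w ys"
proof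
  show "\<pi> xs = \<pi> ys" if "xs \<sim>\<^sub>w ys"
    using that by (induction rule: equivclp_induct) (auto dest: relator_step_prod)
next
  assume eq: "\<pi> xs = \<pi> ys"
  obtain xs' ys' where xy: "reduced xs'" "xs \<sim>\<^sub>w xs'" "\<pi> xs' = \<pi> xs"
    "reduced ys'" "ys \<sim>\<^sub>w ys'" "\<pi> ys' = \<pi> ys" using weq_reduced assms by metis
  then have "xs' \<sim>\<^sub>w ys'" using weq_braids[OF word_property] eq by (metis reduced_def)
  then show "xs \<sim>\<^sub>w ys" using xy by (meson equivclp_sym equivclp_trans)
qed

text \<open>The criterion by which reflection subgroups are recognised as Coxeter systems.\<close>

lemma cocycle_coxeter_system: "coxeter_system G S"
proof
  show "\<exists>m. coxeter_matrix S m \<and> (\<forall>xs\<in>lists S. \<forall>ys\<in>lists S.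
      (\<pi> xs = \<pi> ys) = equivclp (relator_step S m) xs ys)"
    using coxeter_matrix_mord weq_iff by (intro exI[of _ mord]) auto
qed (use S_carrier S_gen in auto)

end

definition inversions :: "('a, 'b) monoid_scheme \<Rightarrow> 'a set \<Rightarrow> 'a \<Rightarrow> 'a set" where
  "inversions G S w = {t \<in> reflections G S. cox_length G S (t \<otimes>\<^bsub>G\<^esub> w) < cox_length G S w}"

section \<open>The inversion cocycle of a Coxeter system\<close>

text \<open>Parity of the number of \<open>i\<close> with \<open>t = s\<^sub>1 \<cdots> s\<^sub>i \<cdots> s\<^sub>1\<close>. Every reflection occurs an even
  number of times in a relator \<open>(s t)\<^sup>m\<close>, so the parity only depends on the product of the word.\<close>

primrec inv_parity :: "('a, 'b) monoid_scheme \<Rightarrow> 'a list \<Rightarrow> 'a \<Rightarrow> bool" where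
  "inv_parity G [] t = False"
| "inv_parity G (s # xs) t = ((t = s) \<noteq> inv_parity G xs (s \<otimes>\<^bsub>G\<^esub> t \<otimes>\<^bsub>G\<^esub> s))"

context involutive_generators
begin

lemma inv_parity_append:
  "set xs \<subseteq> S \<Longrightarrow> set ys \<subseteq> S \<Longrightarrow> t \<in> carrier G \<Longrightarrow>
    inv_parity G (xs @ ys) t \<longleftrightarrow> inv_parity G xs t \<noteq> inv_parity G ys (inv \<pi> xs \<otimes> t \<otimes> \<pi> xs)"
  by (induction xs arbitrary: t) (auto simp: inv_mult_group m_assoc)

lemma inv_parity_alt:
  "s \<in> S \<Longrightarrow> t \<in> S \<Longrightarrow> r \<in> carrier G \<Longrightarrow>
    inv_parity G (alt s t n) r \<longleftrightarrow> odd (card {i. i < n \<and> r = \<pi> (alt s t (Suc (2 * i)))})"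
proof (induction n arbitrary: s t r)
  case (Suc n)
  have eq: "s \<otimes> r \<otimes> s = \<pi> (alt t s (Suc (2 * i))) \<longleftrightarrow> r = \<pi> (alt s t (Suc (2 * Suc i)))" for i
  proof -
    have "alt s t (Suc (2 * Suc i)) = s # alt t s (Suc (2 * i)) @ [s]"
      using alt_Suc_snoc[of t s "Suc (2 * i)"] by simp
    then have "\<pi> (alt s t (Suc (2 * Suc i))) = s \<otimes> \<pi> (alt t s (Suc (2 * i))) \<otimes> inv s"
      using Suc.prems words_append[of "alt t s (Suc (2 * i))" "[s]"] alt_S[of t s "Suc (2 * i)"]
      by (simp add: m_assoc del: alt.simps)
    then show ?thesis using conj_eq_iff[of s "\<pi> (alt t s (Suc (2 * i)))" r] Suc.prems
      alt_S[of t s "Suc (2 * i)"] by (simp del: alt.simps)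
  qed
  let ?A = "{i. i < n \<and> r = \<pi> (alt s t (Suc (2 * Suc i)))}"
  have "{i. i < Suc n \<and> r = \<pi> (alt s t (Suc (2 * i)))} = (if r = s then {0} else {}) \<union> Suc ` ?A"
  proof (rule Set.set_eqI)
    fix i show "i \<in> {i. i < Suc n \<and> r = \<pi> (alt s t (Suc (2 * i)))} \<longleftrightarrow>
      i \<in> (if r = s then {0} else {}) \<union> Suc ` ?A"
      using Suc.prems by (cases i) (auto simp: image_iff)
  qed
  then have "card {i. i < Suc n \<and> r = \<pi> (alt s t (Suc (2 * i)))} = (if r = s then 1 else 0) + card ?A"
    by (simp add: card_insert_if card_image)
  moreover have "inv_parity G (alt t s n) (s \<otimes> r \<otimes> s) = odd (card ?A)"
    using Suc.IH[of t s "s \<otimes> r \<otimes> s"] Suc.prems unfolding eq by simp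
  ultimately show ?case by simp
qed simp

text \<open>The word has 2n letters, and its reflections number i and n + i coincide because (st)^n
  = 1; so every reflection is counted an even number of times.\<close>

lemma inv_parity_relator:
  assumes st: "s \<in> S" "t \<in> S" "r \<in> carrier G" "(s \<otimes> t) [^] n = \<one>"
  shows "\<not> inv_parity G (concat (replicate n [s, t])) r"
proof -
  define u where "u i = \<pi> (alt s t (Suc (2 * i)))" for i
  let ?A = "{i. i < n \<and> r = u i}"
  have per: "u (n + i) = u i" for i
  proof -
    have "alt s t (Suc (2 * (n + i))) = alt s t (2 * n) @ alt s t (Suc (2 * i))"
      using alt_add[of s t "2 * n" "Suc (2 * i)"] by (simp add: algebra_simps)
    then show ?thesis using st gen_power_alt[of s t n] alt_S[of s t "Suc (2*i)"]
      by (simp add: u_def words_append del: alt.simps)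
  qed
  have "{i. i < 2 * n \<and> r = u i} = ?A \<union> (\<lambda>i. n + i) ` ?A"
  proof (rule Set.set_eqI)
    fix i
    show "i \<in> {i. i < 2 * n \<and> r = u i} \<longleftrightarrow> i \<in> ?A \<union> (\<lambda>i. n + i) ` ?A"
    proof (cases "i < n")
      case False
      then obtain j where "i = n + j" using le_Suc_ex not_less by blast
      then show ?thesis using per[of j] by auto
    qed auto
  qed
  moreover have "card (?A \<union> (\<lambda>i. n + i) ` ?A) = card ?A + card ((\<lambda>i. n + i) ` ?A)"
    by (intro card_Un_disjoint) auto
  ultimately have "card {i. i < 2 * n \<and> r = u i} = 2 * card ?A"
    by (simp add: card_image)
  then show ?thesis using inv_parity_alt[of s t r "2 * n"] st by (simp add: u_def alt_double)
qed

end

context coxeter_system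
begin

lemma coxeter_generator_square: assumes "s \<in> S" shows "s \<otimes> s = \<one>"
proof -
  obtain m where m: "coxeter_matrix S m" and p: "\<And>xs ys. \<lbrakk>xs \<in> lists S; ys \<in> lists S\<rbrakk> \<Longrightarrow>
    word_prod G xs = word_prod G ys \<longleftrightarrow> equivclp (relator_step S m) xs ys" using presentation by blast
  have "m s s = 1" using m assms by (simp add: coxeter_matrix_def)
  then have "relator_step S m [s, s] []" unfolding relator_step_def
    using assms by (intro bexI[of _ "[]"] bexI[of _ s]) auto
  then have "word_prod G [s, s] = word_prod G []" using p[of "[s, s]" "[]"] assms by auto
  then show ?thesis using assms generators_in_carrier by auto
qed

sublocale involutive_generators G S
  using generators_in_carrier generators_generate coxeter_generator_square by unfold_locales auto

lemma inv_parity_prod: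
  assumes "set xs \<subseteq> S" "set ys \<subseteq> S" "\<pi> xs = \<pi> ys" "r \<in> carrier G"
  shows "inv_parity G xs r = inv_parity G ys r"
proof -
  obtain m where m: "coxeter_matrix S m" and p: "\<And>xs ys. \<lbrakk>xs \<in> lists S; ys \<in> lists S\<rbrakk> \<Longrightarrow>
    \<pi> xs = \<pi> ys \<longleftrightarrow> equivclp (relator_step S m) xs ys" using presentation by blast
  have step: "inv_parity G xs r = inv_parity G ys r" if rs: "relator_step S m xs ys" for xs ys
  proof -
    obtain us vs s t where st: "us \<in> lists S" "vs \<in> lists S" "s \<in> S" "t \<in> S" "m s t \<noteq> 0"
      and xy: "xs = us @ concat (replicate (m s t) [s, t]) @ vs" "ys = us @ vs"
      using rs unfolding relator_step_def by blast
    let ?r = "concat (replicate (m s t) [s, t])"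
    have S: "set us \<subseteq> S" "set vs \<subseteq> S" "set ?r \<subseteq> S" using st by auto
    have "relator_step S m ?r []" unfolding relator_step_def
      using st by (intro bexI[of _ "[]"] bexI[of _ s] bexI[of _ t]) auto
    then have one: "\<pi> ?r = \<one>" using p[of ?r "[]"] S by (auto simp del: set_concat)
    then have "(s \<otimes> t) [^] m s t = \<one>" using gen_power_alt[OF st(3,4), of "m s t"] by (simp add: alt_double)
    then have np: "\<not> inv_parity G ?r q" if "q \<in> carrier G" for q
      using inv_parity_relator st that by blast
    have "inv \<pi> us \<otimes> r \<otimes> \<pi> us \<in> carrier G" using S assms by simp
    then show ?thesis unfolding xy using S one np assms
      by (simp add: inv_parity_append del: set_concat)
  qed
  have "equivclp (relator_step S m) xs ys" using p assms by auto
  then show ?thesis by (induction rule: equivclp_induct) (auto dest: step)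
qed

text \<open>The parity sets \<open>M\<close> satisfy the cocycle axioms by construction, and the
  uniqueness in \<open>N_eq\<close> identifies them with the inversion sets.\<close>

lemma coxeter_reflection_cocycle: "reflection_cocycle G S (inversions G S)"
proof -
  define wd where "wd w = (SOME xs. set xs \<subseteq> S \<and> \<pi> xs = w)" for w
  have wd: "set (wd w) \<subseteq> S" "\<pi> (wd w) = w" if "w \<in> carrier G" for w
    using someI_ex[OF ex_word[OF that]] by (auto simp: wd_def)
  define M where "M w = {t \<in> carrier G. inv_parity G (wd w) t}" for w
  interpret M: reflection_cocycle G S M
  proof
    fix x y t assume xyt: "x \<in> carrier G" "y \<in> carrier G" "t \<in> carrier G"
    have "inv_parity G (wd (x \<otimes> y)) t = inv_parity G (wd x @ wd y) t"
      using xyt wd[of x] wd[of y] wd[of "x \<otimes> y"] by (intro inv_parity_prod) (auto simp: words_append)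
    then show "t \<in> M (x \<otimes> y) \<longleftrightarrow> (t \<in> M x) \<noteq> (inv x \<otimes> t \<otimes> x \<in> M y)"
      using xyt wd[of x] wd[of y] by (simp add: M_def inv_parity_append)
  next
    fix s assume s: "s \<in> S"
    have "inv_parity G (wd s) t = inv_parity G [s] t" if "t \<in> carrier G" for t
      using s wd[of s] that by (intro inv_parity_prod) auto
    then show "M s = {s}" using s by (auto simp: M_def)
  qed (auto simp: M_def)
  have M: "inversions G S w = M w" if "w \<in> carrier G" for w
    using M.N_eq[OF that] by (simp add: inversions_def)
  show ?thesis
  proof
    fix x y t assume "x \<in> carrier G" "y \<in> carrier G" "t \<in> carrier G"
    then show "t \<in> inversions G S (x \<otimes> y) \<longleftrightarrow> (t \<in> inversions G S x) \<noteq>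
        (inv x \<otimes> t \<otimes> x \<in> inversions G S y)"
      using M.N_mult by (simp add: M)
  qed (simp_all add: M M.N_carrier M.N_gen)
qed

sublocale reflection_cocycle G S "inversions G S"
  by (rule coxeter_reflection_cocycle)

end

section \<open>Canonical generators of reflection subgroups\<close>

context coxeter_system
begin

abbreviation invs ("N") where "N \<equiv> inversions G S"
abbreviation cgens ("\<chi>") where "\<chi> \<equiv> canonical_generators G S"

lemma cgens_iff:
  "t \<in> \<chi> H \<longleftrightarrow> t \<in> H \<and> t \<in> T \<and> N t \<inter> H = {t}"
  unfolding canonical_generators_def inversions_def by auto

lemma cgens_T: "\<chi> H \<subseteq> T"
  and cgens_sub: "\<chi> H \<subseteq> H"
  using cgens_iff by auto

lemma refl_subgroup_subgroup:
  assumes "reflection_subgroup G S H" shows "subgroup H G"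
proof -
  obtain A where "A \<subseteq> T" "H = generate G A" using assms unfolding reflection_subgroup_def by blast
  then show ?thesis using generate_is_subgroup[of A] T_carrier by blast
qed

lemma N_T: "w \<in> carrier G \<Longrightarrow> t \<in> N w \<Longrightarrow> t \<in> T"
  using N_subset_T by blast

lemma N_reflection_iff:
  assumes "x \<in> carrier G" "s \<in> S" "q \<in> carrier G" and t: "t = x \<otimes> s \<otimes> inv x"
  shows "q \<in> N t \<longleftrightarrow> ((q \<in> N x) \<noteq> ((q = t) \<noteq> (t \<otimes> q \<otimes> t \<in> N x)))"
proof -
  define q' where "q' = inv x \<otimes> q \<otimes> x"
  have q': "q' \<in> carrier G" using assms by (simp add: q'_def)
  have 1: "q \<in> N t \<longleftrightarrow> (q \<in> N x) \<noteq> (q' \<in> N (s \<otimes> inv x))"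
    unfolding t q'_def using N_mult[of x "s \<otimes> inv x" q] assms by (simp add: m_assoc)
  have 2: "q' \<in> N (s \<otimes> inv x) \<longleftrightarrow> (q' = s) \<noteq> (s \<otimes> q' \<otimes> s \<in> N (inv x))"
    using N_mult[of s "inv x" q'] assms q' by (simp add: N_gen)
  have 3: "q' = s \<longleftrightarrow> q = t"
    unfolding q'_def t using conj_eq_iff assms by simp
  have "s \<otimes> q' \<otimes> s = inv x \<otimes> (t \<otimes> q \<otimes> t) \<otimes> x"
    unfolding q'_def t using assms by (simp add: m_assoc)
  then have "s \<otimes> q' \<otimes> s \<in> N (inv x) \<longleftrightarrow> t \<otimes> q \<otimes> t \<in> N x"
    using N_inv[of x "t \<otimes> q \<otimes> t"] assms by simp
  then show ?thesis using 1 2 3 by blast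
qed

text \<open>For \<open>r\<close> commuting with \<open>t\<close> the two occurrences of N(x) in
  \<open>N_reflection_iff\<close> test the same element, so they cancel.\<close>

lemma commuting_not_in_N:
  assumes "t \<in> T" "r \<in> carrier G" "r \<noteq> t" "t \<otimes> r \<otimes> t = r" shows "r \<notin> N t"
proof -
  obtain x s where "x \<in> carrier G" "s \<in> S" "t = x \<otimes> s \<otimes> inv x" using assms T_E by blast
  then show ?thesis using N_reflection_iff[of x s r t] assms by auto
qed

end

locale reflection_subgroup_of = coxeter_system +
  fixes H
  assumes refl_subgroup: "reflection_subgroup G S H"
begin

lemma H_subgroup: "subgroup H G"
  using refl_subgroup by (rule refl_subgroup_subgroup)

lemma H_carrier [simp]: "x \<in> H \<Longrightarrow> x \<in> carrier G"
  using subgroup.mem_carrier[OF H_subgroup] .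

lemma H_mult [simp]: "x \<in> H \<Longrightarrow> y \<in> H \<Longrightarrow> x \<otimes> y \<in> H"
  using subgroup.m_closed[OF H_subgroup] .

lemma H_inv [simp]: "x \<in> H \<Longrightarrow> inv x \<in> H"
  using subgroup.m_inv_closed[OF H_subgroup] .

lemma H_one [simp]: "\<one> \<in> H"
  using subgroup.one_closed[OF H_subgroup] .

text \<open>Inside \<open>H\<close> both terms with N(x) in \<open>N_reflection_iff\<close> vanish,
  which leaves the conjugate as its own only inversion in \<open>H\<close>.\<close>

lemma coset_minimal_conj:
  assumes "x \<in> carrier G" "N x \<inter> H = {}" "s \<in> S" "x \<otimes> s \<otimes> inv x \<in> H"
  shows "x \<otimes> s \<otimes> inv x \<in> \<chi> H"
proof -
  let ?t = "x \<otimes> s \<otimes> inv x"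
  have t: "?t \<in> T" using assms T_iff by blast
  have "q \<in> N ?t \<longleftrightarrow> q = ?t" if q: "q \<in> H" for q
  proof -
    have "?t \<otimes> q \<otimes> ?t \<in> H" using H_mult[OF H_mult[OF assms(4) q] assms(4)] .
    then have "q \<notin> N x" "?t \<otimes> q \<otimes> ?t \<notin> N x" using assms(2) q by blast+
    then show ?thesis using N_reflection_iff[OF assms(1,3) H_carrier[OF q] refl] by metis
  qed
  then show ?thesis unfolding cgens_iff using t assms by blast
qed

text \<open>Among the reflections of a reduced word take the first that lies in \<open>H\<close>.
  The prefix before it has no inversion in \<open>H\<close>, so \<open>coset_minimal_conj\<close>
  makes this reflection canonical.\<close>

lemma descent_cgen:
  assumes w: "w \<in> carrier G" "N w \<inter> H \<noteq> {}" shows "\<exists>r\<in>\<chi> H. r \<in> N w"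
proof -
  obtain xs where xs: "reduced xs" "\<pi> xs = w" using ex_reduced'[OF w(1)] by blast
  have S: "set xs \<subseteq> S" using xs by (simp add: reduced_def)
  have "\<exists>i. i < length xs \<and> rfl xs i \<in> H" using w(2) xs reduced_N[OF xs(1)] by auto
  then obtain i where i: "i < length xs" "rfl xs i \<in> H"
    and least: "\<And>j. j < i \<Longrightarrow> \<not> (j < length xs \<and> rfl xs j \<in> H)"
    using exists_least_iff[of "\<lambda>i. i < length xs \<and> rfl xs i \<in> H"] by blast
  define x where "x = \<pi> (take i xs)"
  have red: "reduced (take i xs)" using reduced_appendD(1)[of "take i xs" "drop i xs"] xs by simp
  have x: "x \<in> carrier G" using take_drop_S(1)[OF S] by (simp add: x_def)
  have "rfl (take i xs) j = rfl xs j" if "j < i" for j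
    using that by (simp add: rfl_def min_def)
  then have "N x \<inter> H = {}" using reduced_N[OF red] i least unfolding x_def by auto
  moreover have "x \<otimes> xs ! i \<otimes> inv x \<in> H" using i by (simp add: rfl_def x_def)
  ultimately have "rfl xs i \<in> \<chi> H"
    using coset_minimal_conj[OF x, of "xs ! i"] nth_S[OF S i(1)] by (simp add: rfl_def x_def)
  then show ?thesis using reduced_rfl_N[OF xs(1) i(1)] xs by blast
qed

lemma N_cgen_mult:
  assumes "r \<in> \<chi> H" "x \<in> carrier G" "q \<in> H"
  shows "q \<in> N (r \<otimes> x) \<longleftrightarrow> (q = r) \<noteq> (r \<otimes> q \<otimes> r \<in> N x)"
proof -
  have r: "r \<in> T" "r \<in> H" "q \<in> N r \<longleftrightarrow> q = r" using assms cgens_iff by auto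
  then show ?thesis using N_mult[of r x q] assms by simp
qed

text \<open>A canonical generator behaves like a simple reflection with respect to inversions in
  \<open>H\<close>: apart from \<open>r\<close> itself, conjugation by \<open>r\<close> carries
  those of x bijectively to those of rx.\<close>

lemma card_N_cgen_mult:
  assumes r: "r \<in> \<chi> H" and x: "x \<in> carrier G"
  shows "r \<in> N x \<Longrightarrow> card (N x \<inter> H) = Suc (card (N (r \<otimes> x) \<inter> H))"
    and "r \<notin> N x \<Longrightarrow> card (N (r \<otimes> x) \<inter> H) = Suc (card (N x \<inter> H))"
proof -
  have rH: "r \<in> H" "r \<in> T" using r cgens_iff by auto
  have main: "card (N x \<inter> H) = Suc (card (N (r \<otimes> x) \<inter> H))" if x: "x \<in> carrier G" "r \<in> N x" for x
  proof -
    have fin: "finite (N x \<inter> H)" using card_N(1)[OF x(1)] by simp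
    have "inj_on (\<lambda>q. r \<otimes> q \<otimes> r) (N x \<inter> H - {r})"
    proof (rule inj_onI)
      fix p q assume "p \<in> N x \<inter> H - {r}" "q \<in> N x \<inter> H - {r}" "r \<otimes> p \<otimes> r = r \<otimes> q \<otimes> r"
      moreover then have "r \<otimes> (r \<otimes> p \<otimes> r) \<otimes> r = r \<otimes> (r \<otimes> q \<otimes> r) \<otimes> r" by simp
      ultimately show "p = q" using rH by (simp add: m_assoc)
    qed
    moreover have "(\<lambda>q. r \<otimes> q \<otimes> r) ` (N x \<inter> H - {r}) = N (r \<otimes> x) \<inter> H"
    proof (intro equalityI subsetI)
      fix p assume "p \<in> (\<lambda>q. r \<otimes> q \<otimes> r) ` (N x \<inter> H - {r})"
      then obtain q where q: "q \<in> N x" "q \<in> H" "q \<noteq> r" "p = r \<otimes> q \<otimes> r" by auto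
      have qq: "r \<otimes> p \<otimes> r = q" using q rH by (simp add: m_assoc)
      have "p \<noteq> r" using qq q(3) rH by auto
      then show "p \<in> N (r \<otimes> x) \<inter> H" using N_cgen_mult[OF r x(1), of p] q rH qq by simp
    next
      fix p assume "p \<in> N (r \<otimes> x) \<inter> H"
      then have p: "p \<in> N (r \<otimes> x)" "p \<in> H" by auto
      have "p \<noteq> r" using N_cgen_mult[OF r x(1), of p] p rH x by (auto simp: m_assoc)
      then have "r \<otimes> p \<otimes> r \<in> N x" using N_cgen_mult[OF r x(1), of p] p by simp
      moreover have "r \<otimes> p \<otimes> r \<noteq> r"
      proof
        assume "r \<otimes> p \<otimes> r = r"
        then have "r \<otimes> (r \<otimes> p \<otimes> r) \<otimes> r = r \<otimes> r \<otimes> r" by simp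
        then show False using rH p \<open>p \<noteq> r\<close> by (simp add: m_assoc)
      qed
      ultimately have "r \<otimes> p \<otimes> r \<in> N x \<inter> H - {r}" using rH p by simp
      moreover have "p = r \<otimes> (r \<otimes> p \<otimes> r) \<otimes> r" using rH p by (simp add: m_assoc)
      ultimately show "p \<in> (\<lambda>q. r \<otimes> q \<otimes> r) ` (N x \<inter> H - {r})" by (rule image_eqI[rotated])
    qed
    ultimately have "card (N (r \<otimes> x) \<inter> H) = card (N x \<inter> H - {r})" by (metis card_image)
    moreover have "card (N x \<inter> H) = Suc (card (N x \<inter> H - {r}))"
      using fin x rH by (intro card.remove) auto
    ultimately show ?thesis by simp
  qed
  show "r \<in> N x \<Longrightarrow> card (N x \<inter> H) = Suc (card (N (r \<otimes> x) \<inter> H))" using main[OF x] .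
  assume "r \<notin> N x"
  then have "r \<in> N (r \<otimes> x)" using N_cgen_mult[OF r x rH(1)] rH by (simp add: m_assoc)
  then show "card (N (r \<otimes> x) \<inter> H) = Suc (card (N x \<inter> H))"
    using main[of "r \<otimes> x"] x rH by simp
qed

lemma card_N_inv: assumes "x \<in> H" shows "card (N (inv x) \<inter> H) = card (N x \<inter> H)"
proof -
  have "bij_betw (\<lambda>q. inv x \<otimes> q \<otimes> x) (N x \<inter> H) (N (inv x) \<inter> H)"
  proof (rule bij_betw_byWitness[where f' = "\<lambda>q. x \<otimes> q \<otimes> inv x"])
    show "(\<lambda>q. inv x \<otimes> q \<otimes> x) ` (N x \<inter> H) \<subseteq> N (inv x) \<inter> H" using assms N_inv[of x] by auto
    show "(\<lambda>q. x \<otimes> q \<otimes> inv x) ` (N (inv x) \<inter> H) \<subseteq> N x \<inter> H"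
      using assms N_inv[of "inv x"] by auto
  qed (use assms in \<open>auto simp: m_assoc\<close>)
  then show ?thesis by (metis bij_betw_same_card)
qed

text \<open>Conjugation by a canonical descent \<open>r\<close> of \<open>t\<close> removes two
  inversions in \<open>H\<close>. The first is lost from t to rt. For the second, \<open>r\<close>
  is still a descent of tr: otherwise t r t would be an inversion of \<open>r\<close> in
  \<open>H\<close>, hence equal to \<open>r\<close>, and a reflection commuting with
  \<open>t\<close> is no inversion of it.\<close>

lemma reflection_conj_cgen:
  assumes "t \<in> T" "t \<in> H"
  shows "\<exists>y\<in>generate G (\<chi> H). \<exists>s\<in>\<chi> H. t = y \<otimes> s \<otimes> inv y"
  using assms
proof (induction "card (N t \<inter> H)" arbitrary: t rule: less_induct)
  case less
  show ?case
  proof (cases "t \<in> \<chi> H")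
    case True
    then show ?thesis using less.prems
      by (intro bexI[of _ \<one>] bexI[of _ t]) (auto intro: generate.one)
  next
    case False
    have "t \<in> N t" using refl_in_N less.prems by simp
    then obtain r where r: "r \<in> \<chi> H" "r \<in> N t" using descent_cgen[of t] less.prems by auto
    have rH: "r \<in> H" "r \<in> T" "r \<noteq> t" using r cgens_iff False by auto
    let ?u = "r \<otimes> t \<otimes> r"
    have "t \<otimes> r \<otimes> t \<noteq> r" using commuting_not_in_N[of t r] less.prems rH r by auto
    then have "t \<otimes> r \<otimes> t \<notin> N r" using cgens_iff r rH less.prems by auto
    then have "r \<in> N (t \<otimes> r)" using N_mult[of t r r] r less.prems rH by simp
    then have "card (N (t \<otimes> r) \<inter> H) = Suc (card (N ?u \<inter> H))"
      using card_N_cgen_mult(1)[OF r(1), of "t \<otimes> r"] less.prems rH by (simp add: m_assoc)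
    moreover have "card (N (t \<otimes> r) \<inter> H) = card (N (r \<otimes> t) \<inter> H)"
      using card_N_inv[of "r \<otimes> t"] less.prems rH by (simp add: inv_mult_group)
    moreover have "card (N t \<inter> H) = Suc (card (N (r \<otimes> t) \<inter> H))"
      using card_N_cgen_mult(1)[OF r(1), of t] r less.prems by simp
    ultimately have "card (N ?u \<inter> H) < card (N t \<inter> H)" by simp
    moreover have u: "?u \<in> T" "?u \<in> H" using T_conj[of t r] less.prems rH by auto
    ultimately obtain y s where y: "y \<in> generate G (\<chi> H)" "s \<in> \<chi> H" "?u = y \<otimes> s \<otimes> inv y"
      using less.hyps by blast
    have yc: "y \<in> carrier G" "s \<in> carrier G"
      using y generate_in_carrier[of "\<chi> H" y] cgens_sub H_carrier by blast+
    have "t = r \<otimes> ?u \<otimes> r" using less.prems rH by (simp add: m_assoc)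
    also have "\<dots> = (r \<otimes> y) \<otimes> s \<otimes> inv (r \<otimes> y)"
      unfolding y(3) using yc rH by (simp add: m_assoc inv_mult_group)
    finally have "t = (r \<otimes> y) \<otimes> s \<otimes> inv (r \<otimes> y)" .
    moreover have "r \<otimes> y \<in> generate G (\<chi> H)" by (rule generate.eng[OF generate.incl[OF r(1)] y(1)])
    ultimately show ?thesis using y(2) by blast
  qed
qed

lemma generate_cgens: "generate G (\<chi> H) = H"
proof
  show "generate G (\<chi> H) \<subseteq> H" using generate_subgroup_incl[OF cgens_sub H_subgroup] .
  obtain A where A: "A \<subseteq> T" "H = generate G A" using refl_subgroup unfolding reflection_subgroup_def by blast
  have c: "\<chi> H \<subseteq> carrier G" using cgens_sub H_carrier by blast
  have sub: "subgroup (generate G (\<chi> H)) G" using generate_is_subgroup[OF c] .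
  have "A \<subseteq> generate G (\<chi> H)"
  proof
    fix t assume "t \<in> A"
    then have "t \<in> T" "t \<in> H" using A generate.incl by auto
    then obtain y s where "y \<in> generate G (\<chi> H)" "s \<in> \<chi> H" "t = y \<otimes> s \<otimes> inv y"
      using reflection_conj_cgen by blast
    then show "t \<in> generate G (\<chi> H)"
      using subgroup.m_closed[OF sub] subgroup.m_inv_closed[OF sub] generate.incl[of s "\<chi> H" G] by simp
  qed
  then show "H \<subseteq> generate G (\<chi> H)" using A(2) generate_subgroup_incl[OF _ sub] by blast
qed

text \<open>Conjugation by \<open>h\<close> keeps a reflection inside \<open>H\<close>, where
  \<open>x\<close> has no inversions; so the factor \<open>x\<close> contributes nothing.\<close>

lemma N_coset:
  assumes "x \<in> carrier G" "N x \<inter> H = {}" "h \<in> H"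
  shows "N (h \<otimes> x) \<inter> H = N h \<inter> H"
proof -
  have "q \<in> N (h \<otimes> x) \<longleftrightarrow> q \<in> N h" if "q \<in> H" for q
  proof -
    have "inv h \<otimes> q \<otimes> h \<in> H" using assms that by simp
    then have "inv h \<otimes> q \<otimes> h \<notin> N x" using assms(2) by blast
    then show ?thesis using N_mult[of h x q] assms that by simp
  qed
  then show ?thesis by blast
qed

lemma coset_minimal_rep:
  assumes "u \<in> carrier G"
  shows "\<exists>h\<in>H. \<exists>x\<in>carrier G. u = h \<otimes> x \<and> N x \<inter> H = {}"
  using assms
proof (induction "card (N u \<inter> H)" arbitrary: u rule: less_induct)
  case less
  show ?case
  proof (cases "N u \<inter> H = {}")
    case True
    then show ?thesis using less.prems by (intro bexI[of _ \<one>] bexI[of _ u]) auto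
  next
    case False
    then obtain r where r: "r \<in> \<chi> H" "r \<in> N u" using descent_cgen less.prems by blast
    have rH: "r \<in> H" "r \<in> T" using r cgens_iff by auto
    have "card (N (r \<otimes> u) \<inter> H) < card (N u \<inter> H)"
      using card_N_cgen_mult(1)[OF r(1) less.prems r(2)] by simp
    then obtain h x where h: "h \<in> H" "x \<in> carrier G" "r \<otimes> u = h \<otimes> x" "N x \<inter> H = {}"
      using less.hyps[of "r \<otimes> u"] less.prems rH by auto
    have "u = r \<otimes> (r \<otimes> u)" using rH less.prems by simp
    also have "\<dots> = (r \<otimes> h) \<otimes> x" unfolding h(3) using h rH by (simp add: m_assoc)
    finally have "u = (r \<otimes> h) \<otimes> x" .
    then show ?thesis using h(2,4) H_mult[OF rH(1) h(1)] by blast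
  qed
qed

end

text \<open>The subgroup is given as the image of an injective homomorphism, so that the results
  serve both the inclusion of a subgroup and a copy of it on the natural numbers.\<close>

locale reflection_embedding = G: coxeter_system G S + W: group W
  for G :: "('a, 'c) monoid_scheme" and S and W :: "('b, 'd) monoid_scheme" +
  fixes \<psi> :: "'b \<Rightarrow> 'a"
  assumes \<psi>_hom: "\<psi> \<in> hom W G"
    and \<psi>_inj: "inj_on \<psi> (carrier W)"
    and \<psi>_image: "reflection_subgroup G S (\<psi> ` carrier W)"
begin

abbreviation "H \<equiv> \<psi> ` carrier W"

sublocale H: reflection_subgroup_of G S H
  using \<psi>_image by unfold_locales

sublocale \<psi>: group_hom W G \<psi>
  using \<psi>_hom by unfold_locales

definition "gens = {s \<in> carrier W. \<psi> s \<in> canonical_generators G S H}"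
definition "cocycle w = {t \<in> carrier W. \<psi> t \<in> inversions G S (\<psi> w)}"

lemma \<psi>_eq_iff: "x \<in> carrier W \<Longrightarrow> y \<in> carrier W \<Longrightarrow> \<psi> x = \<psi> y \<longleftrightarrow> x = y"
  using \<psi>_inj by (auto dest: inj_onD)

lemma image_gens: "\<psi> ` gens = canonical_generators G S H"
  using G.cgens_sub[of H] by (auto simp: gens_def)

lemma generate_gens: "generate W gens = carrier W"
proof -
  have sub: "gens \<subseteq> carrier W" by (auto simp: gens_def)
  then have "\<psi> ` generate W gens = \<psi> ` carrier W"
    using \<psi>.generate_img[OF sub] H.generate_cgens image_gens by simp
  then show ?thesis using \<psi>_inj W.generate_incl[OF sub] by (simp add: inj_on_image_eq_iff)
qed

lemma reflection_cocycle_W: "reflection_cocycle W gens cocycle"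
proof
  show "gens \<subseteq> carrier W" "generate W gens = carrier W" using generate_gens by (auto simp: gens_def)
next
  fix s assume "s \<in> gens"
  then have s: "s \<in> carrier W" "\<psi> s \<in> reflections G S" using G.cgens_T[of H] unfolding gens_def by blast+
  then have "\<psi> (s \<otimes>\<^bsub>W\<^esub> s) = \<psi> \<one>\<^bsub>W\<^esub>" by simp
  then show "s \<otimes>\<^bsub>W\<^esub> s = \<one>\<^bsub>W\<^esub>" using \<psi>_eq_iff s by (metis W.m_closed W.one_closed)
next
  fix x y t assume "x \<in> carrier W" "y \<in> carrier W" "t \<in> carrier W"
  then show "(t \<in> cocycle (x \<otimes>\<^bsub>W\<^esub> y)) = ((t \<in> cocycle x) \<noteq> (inv\<^bsub>W\<^esub> x \<otimes>\<^bsub>W\<^esub> t \<otimes>\<^bsub>W\<^esub> x \<in> cocycle y))"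
    using G.N_mult[of "\<psi> x" "\<psi> y" "\<psi> t"] by (simp add: cocycle_def)
next
  fix s assume "s \<in> gens"
  then have s: "s \<in> carrier W" "inversions G S (\<psi> s) \<inter> H = {\<psi> s}"
    using G.cgens_iff by (auto simp: gens_def)
  show "cocycle s = {s}"
  proof (intro equalityI subsetI)
    fix t assume "t \<in> cocycle s"
    then have "t \<in> carrier W" "\<psi> t \<in> inversions G S (\<psi> s) \<inter> H" by (auto simp: cocycle_def)
    then show "t \<in> {s}" using s \<psi>_eq_iff by auto
  qed (use s in \<open>auto simp: cocycle_def\<close>)
qed (auto simp: cocycle_def)

sublocale W: coxeter_system W gens
  using reflection_cocycle.cocycle_coxeter_system[OF reflection_cocycle_W] .

lemma inversions_W: "w \<in> carrier W \<Longrightarrow>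
    inversions W gens w = {t \<in> carrier W. \<psi> t \<in> inversions G S (\<psi> w)}"
  using reflection_cocycle.N_eq[OF reflection_cocycle_W, of w]
  by (simp add: inversions_def cocycle_def)

lemma reflections_W: "reflections W gens = {t \<in> carrier W. \<psi> t \<in> reflections G S}"
proof (intro equalityI subsetI CollectI conjI)
  fix t assume t: "t \<in> reflections W gens"
  then show "t \<in> carrier W" by simp
  obtain x s where x: "x \<in> carrier W" "s \<in> gens" "t = x \<otimes>\<^bsub>W\<^esub> s \<otimes>\<^bsub>W\<^esub> inv\<^bsub>W\<^esub> x" using W.T_E[OF t] .
  have "\<psi> s \<in> reflections G S" using x(2) G.cgens_T[of H] unfolding gens_def by blast
  then show "\<psi> t \<in> reflections G S" using G.T_conj[of "\<psi> s" "\<psi> x"] x by simp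
next
  fix t assume "t \<in> {t \<in> carrier W. \<psi> t \<in> reflections G S}"
  then have t: "t \<in> carrier W" "\<psi> t \<in> reflections G S" by auto
  then obtain y s where y: "y \<in> H" "s \<in> canonical_generators G S H" "\<psi> t = y \<otimes>\<^bsub>G\<^esub> s \<otimes>\<^bsub>G\<^esub> inv\<^bsub>G\<^esub> y"
    using H.reflection_conj_cgen[of "\<psi> t"] H.generate_cgens by blast
  obtain x where x: "x \<in> carrier W" "y = \<psi> x" using y by blast
  obtain r where r: "r \<in> gens" "s = \<psi> r" using y image_gens by blast
  have "\<psi> t = \<psi> (x \<otimes>\<^bsub>W\<^esub> r \<otimes>\<^bsub>W\<^esub> inv\<^bsub>W\<^esub> x)" using x r y by simp
  moreover have "x \<otimes>\<^bsub>W\<^esub> r \<otimes>\<^bsub>W\<^esub> inv\<^bsub>W\<^esub> x \<in> carrier W" using x(1) r(1) by simp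
  ultimately have "t = x \<otimes>\<^bsub>W\<^esub> r \<otimes>\<^bsub>W\<^esub> inv\<^bsub>W\<^esub> x" using \<psi>_eq_iff[OF t(1)] by blast
  then show "t \<in> reflections W gens" using x r W.T_iff by blast
qed

lemma length_W: assumes "w \<in> carrier W"
  shows "cox_length W gens w = card (inversions G S (\<psi> w) \<inter> H)"
proof -
  have "\<psi> ` inversions W gens w = inversions G S (\<psi> w) \<inter> H" using inversions_W assms by auto
  moreover have "inj_on \<psi> (inversions W gens w)"
    using \<psi>_inj inversions_W[OF assms] by (auto intro: inj_on_subset)
  ultimately show ?thesis using W.card_N(2)[OF assms] by (metis card_image)
qed

lemma reflection_subgroup_image:
  assumes "reflection_subgroup W gens K" shows "reflection_subgroup G S (\<psi> ` K)"
proof -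
  obtain A where A: "A \<subseteq> reflections W gens" "K = generate W A"
    using assms unfolding reflection_subgroup_def by blast
  have "A \<subseteq> carrier W" "\<psi> ` A \<subseteq> reflections G S" using A(1) reflections_W by blast+
  then show ?thesis unfolding reflection_subgroup_def A(2) using \<psi>.generate_img[of A] by metis
qed

lemma canonical_generators_image:
  assumes "K \<subseteq> carrier W"
  shows "canonical_generators G S (\<psi> ` K) = \<psi> ` canonical_generators W gens K"
proof -
  have "\<psi> t \<in> canonical_generators G S (\<psi> ` K) \<longleftrightarrow> t \<in> canonical_generators W gens K" if t: "t \<in> K" for t
  proof -
    have "inversions G S (\<psi> t) \<inter> \<psi> ` K = \<psi> ` (inversions W gens t \<inter> K)"
      using inversions_W[of t] assms t by auto
    moreover have "\<psi> ` (inversions W gens t \<inter> K) = {\<psi> t} \<longleftrightarrow> inversions W gens t \<inter> K = {t}"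
      using inj_on_image_eq_iff[OF \<psi>_inj, of "inversions W gens t \<inter> K" "{t}"] assms t by auto
    ultimately show ?thesis unfolding G.cgens_iff W.cgens_iff reflections_W using t assms by auto
  qed
  moreover have "canonical_generators G S (\<psi> ` K) \<subseteq> \<psi> ` K" "canonical_generators W gens K \<subseteq> K"
    using G.cgens_sub W.cgens_sub by auto
  ultimately show ?thesis by blast
qed

end

context reflection_subgroup_of
begin

lemma reflection_embedding_subgroup: "reflection_embedding G S (G\<lparr>carrier := H\<rparr>) (\<lambda>x. x)"
proof -
  interpret K: group "G\<lparr>carrier := H\<rparr>" using subgroup.subgroup_is_group[OF H_subgroup is_group] .
  show ?thesis
    by unfold_locales (auto simp: hom_def refl_subgroup)
qed

end

section \<open>Dihedral systems\<close>

context coxeter_system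
begin

lemma even_length_word: "set xs \<subseteq> S \<Longrightarrow> even (\<ell> (\<pi> xs)) \<longleftrightarrow> even (length xs)"
proof (induction xs)
  case (Cons s xs)
  then have s: "s \<in> S" "\<pi> xs \<in> carrier G" by auto
  then have "\<ell> (\<pi> xs) = Suc (\<ell> (s \<otimes> \<pi> xs)) \<or> \<ell> (s \<otimes> \<pi> xs) = Suc (\<ell> (\<pi> xs))"
    using gen_left_descent by blast
  then show ?case using Cons by auto
qed simp

lemma even_length_mult:
  assumes "x \<in> carrier G" "y \<in> carrier G"
  shows "even (\<ell> (x \<otimes> y)) \<longleftrightarrow> (even (\<ell> x) \<longleftrightarrow> even (\<ell> y))"
proof -
  obtain xs where xs: "set xs \<subseteq> S" "\<pi> xs = x" using ex_word[OF assms(1)] by blast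
  obtain ys where ys: "set ys \<subseteq> S" "\<pi> ys = y" using ex_word[OF assms(2)] by blast
  have "even (\<ell> (\<pi> (xs @ ys))) \<longleftrightarrow> (even (\<ell> (\<pi> xs)) \<longleftrightarrow> even (\<ell> (\<pi> ys)))"
    using even_length_word[of "xs @ ys"] even_length_word[OF xs(1)] even_length_word[OF ys(1)] xs(1) ys(1)
    by auto
  then show ?thesis unfolding words_append[OF xs(1) ys(1)] unfolding xs ys .
qed

lemma reduced_single: "s \<in> S \<Longrightarrow> reduced [s]"
  using gen_left_descent(2)[of s \<one>] by (simp add: reduced_def N_one)

lemma length_gen: "s \<in> S \<Longrightarrow> \<ell> s = 1"
  using reduced_single[of s] by (simp add: reduced_def)

lemma odd_length_T: assumes "t \<in> T" shows "odd (\<ell> t)"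
proof -
  obtain x s where x: "x \<in> carrier G" "s \<in> S" "t = x \<otimes> s \<otimes> inv x" using assms by (rule T_E)
  show ?thesis unfolding x(3) using x(1,2) by (simp add: even_length_mult length_gen)
qed

lemma not_reduced_square: "s \<in> S \<Longrightarrow> \<not> reduced (s # s # xs)"
  using reduced_appendD(1)[of "[s, s]" xs] by (auto simp: reduced_def S_square)

lemma reduced_alt:
  "reduced xs \<Longrightarrow> set xs \<subseteq> {a, b} \<Longrightarrow> xs = alt a b (length xs) \<or> xs = alt b a (length xs)"
proof (induction xs)
  case (Cons x xs)
  then have x: "x = a \<or> x = b" "x \<in> S" and xs: "set xs \<subseteq> {a, b}" by (auto simp: reduced_def)
  have red: "reduced xs" using Cons.prems(1) reduced_appendD(2)[of "[x]" xs] by simp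
  show ?case
  proof (cases xs)
    case Nil then show ?thesis using x by auto
  next
    case (Cons y ys)
    then have "x \<noteq> y" using Cons.prems not_reduced_square[of x ys] x by auto
    then show ?thesis using Cons.IH[OF red xs] Cons x by auto
  qed
qed simp

text \<open>After the prefix of length \<open>Suc k\<close> has been replaced by the other
  alternating word, the last two letters are equal and cancel.\<close>

lemma alt_collision:
  assumes "s \<in> S" "t \<in> S" "\<pi> (alt s t (Suc k)) = \<pi> (alt t s (Suc k))"
  shows "\<not> reduced (alt s t (Suc (Suc k)))"
proof
  assume red: "reduced (alt s t (Suc (Suc k)))"
  define c where "c = (if even (Suc k) then s else t)"
  have c: "c \<in> S" using assms by (simp add: c_def)
  have "\<pi> (alt s t (Suc (Suc k))) = \<pi> (alt s t (Suc k)) \<otimes> c"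
    unfolding alt_Suc_snoc[of s t "Suc k"] c_def[symmetric] using assms(1,2) c
    by (subst words_append) (auto simp del: alt.simps)
  also have "\<dots> = \<pi> (alt t s (Suc k)) \<otimes> c" using assms(3) by simp
  also have "alt t s (Suc k) = alt t s k @ [c]" using alt_Suc_snoc[of t s k] by (simp add: c_def)
  also have "\<pi> (alt t s k @ [c]) \<otimes> c = \<pi> (alt t s k)"
    using assms(1,2) c by (simp add: words_append m_assoc S_square)
  finally have "\<ell> (\<pi> (alt s t (Suc (Suc k)))) \<le> k" using len_le[of "alt t s k"] assms(1,2) by simp
  then show False using red by (simp add: reduced_def)
qed

end

locale dihedral_system = coxeter_system +
  fixes a b
  assumes gens_ne: "a \<noteq> b" and S_eq: "S = {a, b}"
begin

lemma ab: "a \<in> S" "b \<in> S"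
  by (simp_all add: S_eq)

lemma element_alt:
  assumes "w \<in> carrier G"
  obtains "reduced (alt a b (\<ell> w))" "w = \<pi> (alt a b (\<ell> w))"
  | "reduced (alt b a (\<ell> w))" "w = \<pi> (alt b a (\<ell> w))"
proof -
  obtain xs where xs: "reduced xs" "\<pi> xs = w" using ex_reduced'[OF assms] by blast
  then have "length xs = \<ell> w" by (simp add: reduced_def)
  then show ?thesis using reduced_alt[OF xs(1), of a b] xs(2) that S_eq xs(1) by (metis reduced_def)
qed

text \<open>The elements of a dihedral group are alternating words, and those of odd length are
  palindromes.\<close>

lemma T_iff_odd: assumes "w \<in> carrier G" shows "w \<in> T \<longleftrightarrow> odd (\<ell> w)"
proof
  assume "odd (\<ell> w)"
  then obtain i where i: "\<ell> w = Suc (2 * i)" by (metis oddE Suc_eq_plus1)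
  have *: "\<pi> (alt c d (Suc (2 * i))) \<in> T" if "c \<in> S" "d \<in> S" for c d
    using rfl_alt[OF that, of i "Suc i"] rfl_T[of "alt c d (Suc i)" i] alt_S[OF that, of "Suc i"] by simp
  show "w \<in> T" by (rule element_alt[OF assms]) (use i *[of a b] *[of b a] ab in auto)
qed (use odd_length_T in auto)

lemma longer_reduced:
  assumes "v \<in> carrier G" "k < \<ell> v" shows "reduced (alt a b k)" "reduced (alt b a k)"
proof -
  have *: "reduced (alt c d k) \<and> reduced (alt d c k)" if r: "reduced (alt c d (\<ell> v))" for c d
  proof -
    obtain n where n: "\<ell> v = Suc n" "k \<le> n" using assms(2) by (metis less_imp_Suc_add le_add1)
    have "alt c d (Suc n) = alt c d k @ drop k (alt c d (Suc n))"
      using take_alt[of k "Suc n" c d] n(2) by (metis append_take_drop_id le_Suc_eq)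
    then have 1: "reduced (alt c d k)" using r reduced_appendD(1) n(1) by metis
    have 2: "reduced (alt d c n)" using r reduced_appendD(2)[of "[c]" "alt d c n"] n(1) by simp
    have "alt d c n = alt d c k @ drop k (alt d c n)"
      using take_alt[of k n d c] n(2) by (metis append_take_drop_id)
    then show ?thesis using 1 2 reduced_appendD(1) by metis
  qed
  show "reduced (alt a b k)" "reduced (alt b a k)"
    using element_alt[OF assms(1)] *[of a b] *[of b a] by blast+
qed

lemma alt_distinct:
  assumes "v \<in> carrier G" "0 < k" "k < \<ell> v" shows "\<pi> (alt a b k) \<noteq> \<pi> (alt b a k)"
proof
  assume eq: "\<pi> (alt a b k) = \<pi> (alt b a k)"
  obtain j where j: "k = Suc j" using assms(2) gr0_implies_Suc by blast
  have nr: "\<not> reduced (alt a b (Suc k))" "\<not> reduced (alt b a (Suc k))"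
    using alt_collision[OF ab] alt_collision[OF ab(2,1)] eq j by auto
  show False
  proof (cases "Suc k < \<ell> v")
    case True then show False using longer_reduced(1)[OF assms(1)] nr by blast
  next
    case False then have "\<ell> v = Suc k" using assms by simp
    then show False using element_alt[OF assms(1)] nr by metis
  qed
qed

lemma reduced_alt_N:
  assumes "c \<in> S" "d \<in> S" "reduced (alt c d k)"
  shows "N (\<pi> (alt c d k)) = (\<lambda>i. \<pi> (alt c d (Suc (2 * i)))) ` {..<k}"
  using reduced_N[OF assms(3)] rfl_alt[OF assms(1,2)] by (auto simp del: alt.simps)

text \<open>A reflection is an odd alternating word. \<open>flip\<close> makes it begin with
  \<open>a\<close>, and \<open>per\<close> brings its index below the order of ab.\<close>

lemma T_enum:
  assumes "ord (a \<otimes> b) \<noteq> 0"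
  shows "T \<subseteq> (\<lambda>i. \<pi> (alt a b (Suc (2 * i)))) ` {..<ord (a \<otimes> b)}"
proof
  fix t assume t: "t \<in> T"
  let ?m = "ord (a \<otimes> b)"
  have ab_m: "(a \<otimes> b) [^] ?m = \<one>" using ab by (intro pow_ord_eq_1) simp
  obtain i where i: "\<ell> t = Suc (2 * i)" using odd_length_T[OF t] by (metis oddE Suc_eq_plus1)
  \<comment> \<open>The multiple n of the order leaves room for an index \<open>j\<close> of any
    size; it is applied with n = i + 1.\<close>
  have flip: "\<pi> (alt b a (Suc (2 * j))) = \<pi> (alt a b (Suc (2 * (?m * n - Suc j))))" if "j < ?m * n" for j n
  proof -
    let ?x = "\<pi> (alt a b (Suc (2 * (?m * n - Suc j))))" and ?y = "\<pi> (alt b a (Suc (2 * j)))"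
    have "2 * M = Suc (2 * (M - Suc j)) + Suc (2 * j)" if "j < M" for M
      using that by arith
    then have "alt a b (2 * (?m * n)) = alt a b (Suc (2 * (?m * n - Suc j)) + Suc (2 * j))"
      using that by metis
    also have "\<dots> = alt a b (Suc (2 * (?m * n - Suc j))) @ alt b a (Suc (2 * j))"
      by (subst alt_add) (simp del: alt.simps)
    finally have "?x \<otimes> ?y = (a \<otimes> b) [^] (?m * n)"
      using gen_power_alt[OF ab, of "?m * n"] words_append[OF alt_S[OF ab] alt_S[OF ab(2,1)]] by metis
    also have "\<dots> = \<one>" using ab_m nat_pow_pow[of "a \<otimes> b" ?m n] ab by simp
    finally have *: "?x \<otimes> ?y = \<one>" .
    have y: "?y \<in> T" using rfl_alt[OF ab(2,1), of j "Suc j"] rfl_T[of "alt b a (Suc j)" j]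
      alt_S[OF ab(2,1), of "Suc j"] by (simp del: alt.simps)
    have x: "?x \<in> carrier G" using words_closed[OF alt_S[OF ab]] .
    have "?x = inv ?y" using inv_equality[OF * T_carrier[OF y] x] by simp
    then show ?thesis using y by simp
  qed
  have per: "\<pi> (alt a b (Suc (2 * j))) = \<pi> (alt a b (Suc (2 * (j mod ?m))))" for j
  proof -
    have "Suc (2 * j) = 2 * (?m * (j div ?m)) + Suc (2 * (j mod ?m))"
      by (metis add_Suc_right distrib_left mult_div_mod_eq)
    then have "alt a b (Suc (2 * j)) = alt a b (2 * (?m * (j div ?m)) + Suc (2 * (j mod ?m)))"
      by (rule arg_cong)
    also have "\<dots> = alt a b (2 * (?m * (j div ?m))) @ alt a b (Suc (2 * (j mod ?m)))"
      by (subst alt_add) (simp del: alt.simps)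
    finally have "alt a b (Suc (2 * j)) = alt a b (2 * (?m * (j div ?m))) @ alt a b (Suc (2 * (j mod ?m)))" .
    then have "\<pi> (alt a b (Suc (2 * j))) = (a \<otimes> b) [^] (?m * (j div ?m)) \<otimes> \<pi> (alt a b (Suc (2 * (j mod ?m))))"
      using gen_power_alt[OF ab] words_append[OF alt_S[OF ab] alt_S[OF ab]] by metis
    also have "(a \<otimes> b) [^] (?m * (j div ?m)) = \<one>"
      using ab_m nat_pow_pow[of "a \<otimes> b" ?m "j div ?m"] ab by simp
    finally show ?thesis using words_closed[OF alt_S[OF ab]] by (metis l_one)
  qed
  have "\<exists>j. t = \<pi> (alt a b (Suc (2 * j)))"
  proof (rule element_alt[OF T_carrier[OF t]])
    assume "t = \<pi> (alt b a (\<ell> t))"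
    moreover have "i < ?m * Suc i" using mult_le_mono1[of 1 ?m "Suc i"] assms by simp
    ultimately show ?thesis using flip[of i "Suc i"] i by metis
  qed (use i in metis)
  then obtain j where "t = \<pi> (alt a b (Suc (2 * (j mod ?m))))" using per by metis
  then show "t \<in> (\<lambda>i. \<pi> (alt a b (Suc (2 * i)))) ` {..<?m}" using assms by (intro image_eqI[of _ _ "j mod ?m"]) auto
qed

end

section \<open>Levels in the cosets of a reflection subgroup\<close>

context reflection_subgroup_of
begin

text \<open>Plays the part of the length in the coset of \<open>y\<close>: for y = hx with x minimal
  it is the length of h in the subgroup, see \<open>lev_coset\<close>.\<close>

definition lev :: "'a \<Rightarrow> nat" where "lev y = card (N y \<inter> H)"

lemma word_prod_sub: "word_prod (G\<lparr>carrier := H\<rparr>) xs = word_prod G xs"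
  by (simp add: word_prod_def)

lemma lev_coset:
  assumes "x \<in> carrier G" "N x \<inter> H = {}" "h \<in> H"
  shows "lev (h \<otimes> x) = cox_length (G\<lparr>carrier := H\<rparr>) (\<chi> H) h"
proof -
  interpret E: reflection_embedding G S "G\<lparr>carrier := H\<rparr>" "\<lambda>x. x" by (rule reflection_embedding_subgroup)
  have "E.gens = \<chi> H" using E.image_gens by simp
  then show ?thesis using E.length_W[of h] N_coset[OF assms] assms(3) by (simp add: lev_def)
qed

lemma in_N_iff_lev:
  assumes "t \<in> T" "t \<in> H" "y \<in> carrier G"
  shows "t \<in> N y \<longleftrightarrow> lev (t \<otimes> y) < lev y" and "t \<notin> N y \<longleftrightarrow> lev y < lev (t \<otimes> y)"
proof -
  interpret E: reflection_embedding G S "G\<lparr>carrier := H\<rparr>" "\<lambda>x. x" by (rule reflection_embedding_subgroup)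
  have gens: "E.gens = \<chi> H" using E.image_gens by simp
  have main: "lev (t \<otimes> y) < lev y" if y: "y \<in> carrier G" "t \<in> N y" for y
  proof -
    obtain h x where hx: "h \<in> H" "x \<in> carrier G" "y = h \<otimes> x" "N x \<inter> H = {}"
      using coset_minimal_rep[OF y(1)] by blast
    have "t \<in> N h" using N_coset[OF hx(2,4,1)] y assms(2) hx(3) by blast
    then have "t \<in> inversions (G\<lparr>carrier := H\<rparr>) (\<chi> H) h" using E.inversions_W[of h] gens hx assms by simp
    then have "cox_length (G\<lparr>carrier := H\<rparr>) (\<chi> H) (t \<otimes> h) < cox_length (G\<lparr>carrier := H\<rparr>) (\<chi> H) h"
      by (simp add: inversions_def)
    moreover have "t \<otimes> y = (t \<otimes> h) \<otimes> x" using hx assms by (simp add: m_assoc)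
    ultimately show ?thesis using lev_coset[OF hx(2,4)] hx assms by simp
  qed
  have t: "t \<notin> N y \<longleftrightarrow> t \<in> N (t \<otimes> y)" using N_mult[of t y t] refl_in_N assms by simp
  show "t \<in> N y \<longleftrightarrow> lev (t \<otimes> y) < lev y" "t \<notin> N y \<longleftrightarrow> lev y < lev (t \<otimes> y)"
    using main[of y] main[of "t \<otimes> y"] t assms by auto
qed

text \<open>Lengths and levels differ in general, but across a reflection in \<open>H\<close> both
  inequalities say that this reflection is not an inversion of \<open>y\<close>.\<close>

lemma length_less_iff_lev:
  assumes "y \<in> carrier G" "z \<in> carrier G" "z \<otimes> inv y \<in> T" "z \<otimes> inv y \<in> H"
  shows "\<ell> y < \<ell> z \<longleftrightarrow> lev y < lev z"
proof -
  let ?t = "z \<otimes> inv y"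
  have z: "?t \<otimes> y = z" using assms by (simp add: m_assoc)
  have "?t \<in> N y \<longleftrightarrow> \<ell> z < \<ell> y" using N_eq[OF assms(1)] assms(3) z by simp
  moreover have "?t \<notin> N y \<longleftrightarrow> ?t \<in> N z" using N_mult[of ?t y ?t] refl_in_N[OF assms(3)] assms z by simp
  moreover have "?t \<otimes> z = y" using T_cancel[OF assms(3,1)] z by simp
  then have "?t \<in> N z \<longleftrightarrow> \<ell> y < \<ell> z" using N_eq[OF assms(2)] assms(3) by simp
  ultimately show ?thesis using in_N_iff_lev(2)[OF assms(3,4,1)] z by simp
qed

end

locale rank_two_subgroup = reflection_subgroup_of +
  fixes a b
  assumes cgens: "\<chi> H = {a, b}" and ab_ne: "a \<noteq> b"
begin

lemma dihedral: "dihedral_system (G\<lparr>carrier := H\<rparr>) {a, b} a b"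
proof -
  interpret E: reflection_embedding G S "G\<lparr>carrier := H\<rparr>" "\<lambda>x. x" by (rule reflection_embedding_subgroup)
  have "E.gens = {a, b}" using E.image_gens cgens by simp
  then show ?thesis using E.W.coxeter_system_axioms ab_ne
    by (simp add: dihedral_system_def dihedral_system_axioms_def)
qed

lemma refl_H: "reflections (G\<lparr>carrier := H\<rparr>) {a, b} = T \<inter> H"
  and invs_H: "h \<in> H \<Longrightarrow> inversions (G\<lparr>carrier := H\<rparr>) {a, b} h = N h \<inter> H"
proof -
  interpret E: reflection_embedding G S "G\<lparr>carrier := H\<rparr>" "\<lambda>x. x" by (rule reflection_embedding_subgroup)
  have "E.gens = {a, b}" using E.image_gens cgens by simp
  then show "reflections (G\<lparr>carrier := H\<rparr>) {a, b} = T \<inter> H"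
    "h \<in> H \<Longrightarrow> inversions (G\<lparr>carrier := H\<rparr>) {a, b} h = N h \<inter> H"
    using E.reflections_W E.inversions_W[of h] by auto
qed

lemma coset_rep_same:
  assumes "y \<in> carrier G" "z \<in> carrier G" "z \<otimes> inv y \<in> H"
  obtains g h x where "g \<in> H" "h \<in> H" "x \<in> carrier G" "N x \<inter> H = {}" "y = g \<otimes> x" "z = h \<otimes> x"
    "z \<otimes> inv y = h \<otimes> inv g"
proof -
  obtain g x where gx: "g \<in> H" "x \<in> carrier G" "y = g \<otimes> x" "N x \<inter> H = {}"
    using coset_minimal_rep[OF assms(1)] by blast
  have "(z \<otimes> inv y) \<otimes> g \<otimes> x = z" using assms(1,2) gx by (simp add: m_assoc inv_mult_group)
  moreover have "(z \<otimes> inv y) \<otimes> g \<in> H" using assms(3) gx by simp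
  moreover have "z \<otimes> inv y = (z \<otimes> inv y) \<otimes> g \<otimes> inv g" using assms(1,2) gx(1) by (simp add: m_assoc)
  ultimately show ?thesis using that gx by metis
qed

lemma T_iff_lev:
  assumes "y \<in> carrier G" "z \<in> carrier G" "z \<otimes> inv y \<in> H"
  shows "z \<otimes> inv y \<in> T \<longleftrightarrow> odd (lev y + lev z)"
proof -
  interpret D: dihedral_system "G\<lparr>carrier := H\<rparr>" "{a, b}" a b by (rule dihedral)
  obtain g h x where *: "g \<in> H" "h \<in> H" "x \<in> carrier G" "N x \<inter> H = {}" "y = g \<otimes> x" "z = h \<otimes> x"
    and zy: "z \<otimes> inv y = h \<otimes> inv g" using coset_rep_same[OF assms] by blast
  have inv: "inv\<^bsub>G\<lparr>carrier := H\<rparr>\<^esub> g = inv g" using m_inv_consistent[OF H_subgroup *(1)] by simp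
  have "h \<otimes> inv g \<in> T \<longleftrightarrow> h \<otimes> inv g \<in> reflections (G\<lparr>carrier := H\<rparr>) {a, b}"
    using refl_H * by simp
  also have "\<dots> \<longleftrightarrow> odd (cox_length (G\<lparr>carrier := H\<rparr>) {a, b} h + cox_length (G\<lparr>carrier := H\<rparr>) {a, b} g)"
    using D.T_iff_odd[of "h \<otimes> inv g"] D.even_length_mult[of h "inv g"] D.len_inv[of g] * inv by auto
  finally show ?thesis using lev_coset[OF *(3,4)] * zy cgens by (simp add: add.commute)
qed

abbreviation "ua i \<equiv> word_prod G (alt a b (Suc (2 * i)))"
abbreviation "ub i \<equiv> word_prod G (alt b a (Suc (2 * i)))"

text \<open>In a dihedral group a length strictly between 0 and that of some other element belongs
  to exactly two elements, the two alternating words. Their inversions are the initial segments of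
  the reflections counted from either end.\<close>

lemma level_partner:
  assumes "y \<in> carrier G" "v \<in> carrier G" "v \<otimes> inv y \<in> H" "0 < lev y" "lev y < lev v"
  shows "\<exists>z\<in>carrier G. z \<otimes> inv y \<in> H \<and> z \<noteq> y \<and> lev z = lev y \<and>
    (\<forall>z'\<in>carrier G. z' \<otimes> inv y \<in> H \<and> lev z' = lev y \<longrightarrow> z' = y \<or> z' = z) \<and>
    (N y \<inter> H = ua ` {..<lev y} \<and> N z \<inter> H = ub ` {..<lev y} \<or>
     N y \<inter> H = ub ` {..<lev y} \<and> N z \<inter> H = ua ` {..<lev y})"
proof -
  interpret D: dihedral_system "G\<lparr>carrier := H\<rparr>" "{a, b}" a b by (rule dihedral)
  obtain g h x where *: "g \<in> H" "h \<in> H" "x \<in> carrier G" "N x \<inter> H = {}" "y = g \<otimes> x" "v = h \<otimes> x"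
    and zy: "v \<otimes> inv y = h \<otimes> inv g" using coset_rep_same[OF assms(1-3)] by blast
  let ?l = "cox_length (G\<lparr>carrier := H\<rparr>) {a, b}"
  let ?k = "lev y"
  have lev: "lev (q \<otimes> x) = ?l q" if "q \<in> H" for q using lev_coset[OF *(3,4) that] cgens by simp
  have k: "?k = ?l g" "?k < ?l h" using lev * assms by auto
  let ?A = "word_prod G (alt a b ?k)" and ?B = "word_prod G (alt b a ?k)"
  have red: "D.reduced (alt a b ?k)" "D.reduced (alt b a ?k)"
    using D.longer_reduced[of h ?k] k * by auto
  have ne: "?A \<noteq> ?B" using D.alt_distinct[of h ?k] k * assms(4) by (simp add: word_prod_sub)
  have AB: "?A \<in> H" "?B \<in> H"
    using D.words_closed[OF D.alt_S, of a b ?k] D.words_closed[OF D.alt_S, of b a ?k]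
    by (simp_all add: word_prod_sub)
  have lAB: "?l ?A = ?k" "?l ?B = ?k" using red by (simp_all add: D.reduced_def word_prod_sub)
  have only: "q = ?A \<or> q = ?B" if "q \<in> H" "?l q = ?k" for q
  proof (rule D.element_alt[of q])
    show "q \<in> carrier (G\<lparr>carrier := H\<rparr>)" using that by simp
  qed (use that in \<open>simp_all add: word_prod_sub\<close>)
  have NA: "N (?A \<otimes> x) \<inter> H = ua ` {..<?k}"
    using D.reduced_alt_N[OF _ _ red(1)] N_coset[OF *(3,4) AB(1)] invs_H[OF AB(1)]
    by (simp add: word_prod_sub del: alt.simps)
  have NB: "N (?B \<otimes> x) \<inter> H = ub ` {..<?k}"
    using D.reduced_alt_N[OF _ _ red(2)] N_coset[OF *(3,4) AB(2)] invs_H[OF AB(2)]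
    by (simp add: word_prod_sub del: alt.simps)
  define z where "z = (if g = ?A then ?B else ?A)"
  have g: "g = ?A \<or> g = ?B" using only * k by simp
  have zH: "z \<in> H" using AB by (simp add: z_def)
  have z: "z \<noteq> g" "?l z = ?k" "z = ?A \<or> z = ?B" using g ne lAB by (auto simp: z_def)
  have inH: "(q \<otimes> x) \<otimes> inv y \<in> H" if "q \<in> H" for q
    unfolding *(5) using that * by (simp add: m_assoc inv_mult_group)
  have canc: "q \<otimes> x = r \<otimes> x \<longleftrightarrow> q = r" if "q \<in> H" "r \<in> H" for q r using that * by simp
  have others: "z' = y \<or> z' = z \<otimes> x" if z': "z' \<in> carrier G" "z' \<otimes> inv y \<in> H" "lev z' = ?k" for z'
  proof -
    let ?q = "z' \<otimes> inv y \<otimes> g"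
    have q: "?q \<in> H" using z' * by simp
    have "?q \<otimes> x = z'" using z' assms(1) * by (simp add: m_assoc)
    moreover have "?q = ?A \<or> ?q = ?B" using only[OF q] lev[OF q] \<open>?q \<otimes> x = z'\<close> z'(3) by simp
    ultimately show ?thesis using g z *(5) by metis
  qed
  have "N y \<inter> H = ua ` {..<?k} \<and> N (z \<otimes> x) \<inter> H = ub ` {..<?k} \<or>
     N y \<inter> H = ub ` {..<?k} \<and> N (z \<otimes> x) \<inter> H = ua ` {..<?k}"
  proof (cases "g = ?A")
    case True
    then have "z = ?B" by (simp add: z_def)
    then show ?thesis using NA NB True *(5) by metis
  next
    case False
    then have "z = ?A" "g = ?B" using g by (simp_all add: z_def)
    then show ?thesis using NA NB *(5) by metis
  qed
  then show ?thesis
    using inH[OF zH] canc[OF zH *(1)] z lev[OF zH] others *(3,5) zH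
    by (intro bexI[of _ "z \<otimes> x"]) auto
qed

lemma level_below:
  assumes "v \<in> carrier G" "j \<le> lev v"
  shows "\<exists>z\<in>carrier G. z \<otimes> inv v \<in> H \<and> lev z = j"
proof -
  interpret D: dihedral_system "G\<lparr>carrier := H\<rparr>" "{a, b}" a b by (rule dihedral)
  obtain h x where *: "h \<in> H" "x \<in> carrier G" "v = h \<otimes> x" "N x \<inter> H = {}"
    using coset_minimal_rep[OF assms(1)] by blast
  have lev: "lev (q \<otimes> x) = cox_length (G\<lparr>carrier := H\<rparr>) {a, b} q" if "q \<in> H" for q
    using lev_coset[OF *(2,4) that] cgens by simp
  show ?thesis
  proof (cases "j = lev v")
    case True
    then show ?thesis using assms(1) by (intro bexI[of _ v]) auto
  next
    case False
    then have "j < cox_length (G\<lparr>carrier := H\<rparr>) {a, b} h" using assms(2) lev * by simp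
    then have "D.reduced (alt a b j)" using D.longer_reduced[of h j] * by simp
    moreover have A: "word_prod G (alt a b j) \<in> H"
      using D.words_closed[OF D.alt_S, of a b j] by (simp add: word_prod_sub)
    ultimately have "lev (word_prod G (alt a b j) \<otimes> x) = j" using lev by (simp add: D.reduced_def word_prod_sub)
    moreover have "(word_prod G (alt a b j) \<otimes> x) \<otimes> inv v \<in> H"
      unfolding *(3) using A * by (simp add: m_assoc inv_mult_group)
    ultimately show ?thesis using A * by (intro bexI[of _ "word_prod G (alt a b j) \<otimes> x"]) auto
  qed
qed

end

section \<open>The geometric representation\<close>

text \<open>A Chebyshev recursion of second kind, kept as a pair of consecutive terms.
  \<open>cp (2 * cos x) n\<close> is sin(nx)/sin x where sin x is nonzero; for c = 2 it degenerates
  to n.\<close>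

primrec cheb :: "real \<Rightarrow> nat \<Rightarrow> real \<times> real" where
  "cheb c 0 = (0, 1)"
| "cheb c (Suc n) = (snd (cheb c n), c * snd (cheb c n) - fst (cheb c n))"

definition cp :: "real \<Rightarrow> nat \<Rightarrow> real" where "cp c n = fst (cheb c n)"

lemma cp_simps [simp]: "cp c 0 = 0" "cp c (Suc 0) = 1" "cp c (Suc (Suc n)) = c * cp c (Suc n) - cp c n"
  by (simp_all add: cp_def)

lemma cp_sin: "cp (2 * cos x) n * sin x = sin (n * x)"
proof (induction n rule: induct_nat_012)
  case (ge2 n)
  have e: "real (Suc (Suc n)) * x = real (Suc n) * x + x" "real n * x = real (Suc n) * x - x"
    by (simp_all add: algebra_simps)
  have "sin (real (Suc (Suc n)) * x) = 2 * cos x * sin (real (Suc n) * x) - sin (real n * x)"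
    unfolding e sin_add sin_diff by simp
  then show ?case using ge2 by (simp add: algebra_simps)
qed auto

lemma cp_two: "cp 2 n = real n"
  by (induction n rule: induct_nat_012) (auto simp: algebra_simps)

lemma cp_pos:
  assumes "0 < n" "n < m" shows "cp (2 * cos (pi / real m)) n > 0"
proof -
  have m: "real m > 0" "1 < m" using assms by auto
  have "0 < pi / real m" "pi / real m < pi" using m by (auto simp: field_simps)
  then have s: "sin (pi / real m) > 0" by (intro sin_gt_zero) auto
  have "real n * (pi / real m) < pi" using assms m by (simp add: field_simps)
  moreover have "0 < real n * (pi / real m)" using assms by simp
  ultimately have "sin (real n * (pi / real m)) > 0" by (intro sin_gt_zero) auto
  then have "cp (2 * cos (pi / real m)) n * sin (pi / real m) > 0" by (simp only: cp_sin)
  then show ?thesis using s by (simp add: zero_less_mult_iff)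
qed

lemma cp_zero: assumes "m \<noteq> 0" "m \<noteq> 1" shows "cp (2 * cos (pi / real m)) m = 0"
proof -
  have m: "real m > 0" "1 < m" using assms by auto
  have "0 < pi / real m" "pi / real m < pi" using m by (auto simp: field_simps)
  then have s: "sin (pi / real m) > 0" by (intro sin_gt_zero) auto
  have "cp (2 * cos (pi / real m)) m * sin (pi / real m) = 0" unfolding cp_sin using m by simp
  then show ?thesis using s by simp
qed

section \<open>The action of the group on points\<close>

context coxeter_system
begin

text \<open>The coordinates \<open>(t, False)\<close> of a point are its values on the simple roots. The
  additional coordinates \<open>(t, True)\<close> make the coroots linearly independent, also when the
  bilinear form of the Coxeter system is degenerate.\<close>

definition cartan :: "'a \<Rightarrow> 'a \<Rightarrow> real" where
  "cartan s t = (if t \<notin> S then 0 else if mord s t = 0 then -2 else - 2 * cos (pi / real (mord s t)))"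

definition simple_coroot :: "'a \<Rightarrow> 'a \<times> bool \<Rightarrow> real" where
  "simple_coroot s = (\<lambda>(t, b). if b then of_bool (t = s) else cartan s t)"

definition refl :: "'a \<Rightarrow> ('a \<times> bool \<Rightarrow> real) \<Rightarrow> 'a \<times> bool \<Rightarrow> real" where
  "refl s F = (\<lambda>p. F p - F (s, False) * simple_coroot s p)"

definition word_act :: "'a list \<Rightarrow> ('a \<times> bool \<Rightarrow> real) \<Rightarrow> 'a \<times> bool \<Rightarrow> real" where
  "word_act xs F = foldr refl xs F"

lemma word_act_simps [simp]: "word_act [] F = F" "word_act (s # xs) F = refl s (word_act xs F)"
  by (simp_all add: word_act_def)

lemma word_act_append: "word_act (xs @ ys) F = word_act xs (word_act ys F)"
  by (simp add: word_act_def)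

lemma mord_self: "s \<in> S \<Longrightarrow> mord s s = 1"
  and mord_sym: "s \<in> S \<Longrightarrow> t \<in> S \<Longrightarrow> mord s t = mord t s"
  and mord_ne_1: "s \<in> S \<Longrightarrow> t \<in> S \<Longrightarrow> s \<noteq> t \<Longrightarrow> mord s t \<noteq> 1"
  using coxeter_matrix_mord unfolding coxeter_matrix_def by blast+

lemma cartan_self: "s \<in> S \<Longrightarrow> cartan s s = 2"
  by (simp add: cartan_def mord_self)

lemma cartan_sym: "s \<in> S \<Longrightarrow> t \<in> S \<Longrightarrow> cartan s t = cartan t s"
  by (simp add: cartan_def mord_sym)

lemma simple_coroot_False [simp]: "simple_coroot s (t, False) = cartan s t"
  and simple_coroot_True [simp]: "simple_coroot s (t, True) = of_bool (t = s)"
  by (simp_all add: simple_coroot_def)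

lemma refl_lin: "refl s (\<lambda>p. x * F p + y * F' p) = (\<lambda>p. x * refl s F p + y * refl s F' p)"
  by (simp add: refl_def fun_eq_iff algebra_simps)

lemma refl_refl: "s \<in> S \<Longrightarrow> refl s (refl s F) = F"
  by (simp add: refl_def fun_eq_iff cartan_self)

text \<open>The two coroots span a plane on which the Cartan form is nondegenerate. Subtracting a
  suitable point of the plane from \<open>F\<close> leaves a point \<open>F0\<close> fixed by both
  reflections; inside the plane, each letter advances a sequence of sines by the angle
  \<open>x\<close>, and 2m letters complete a full turn.\<close>

lemma refl_braid:
  assumes st: "s \<in> S" "t \<in> S" "s \<noteq> t" and m: "mord s t \<noteq> 0"
  shows "word_act (concat (replicate (mord s t) [s, t])) F = F"
proof -
  define x where "x = pi / real (mord s t)"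
  define c where "c = 2 * cos x"
  have m2: "1 < mord s t" using m mord_ne_1[OF st] by linarith
  have "0 < x" "x < pi" using m2 by (auto simp: x_def field_simps)
  then have sx: "sin x > 0" by (intro sin_gt_zero) auto
  have k: "cartan s t = - c" "cartan t s = - c" "cartan s s = 2" "cartan t t = 2"
    using st m mord_sym[OF st(1,2)] by (simp_all add: cartan_def c_def x_def mord_self)
  \<comment> \<open>The determinant of the 2 by 2 Cartan matrix of \<open>s\<close> and
    \<open>t\<close>; \<open>u\<close> and \<open>v\<close> solve the linear system with this matrix
    and right-hand side the values of \<open>F\<close> at \<open>s\<close> and
    \<open>t\<close>.\<close>
  define d where "d = 4 - c * c"
  have "d = 4 * (sin x)\<^sup>2" unfolding d_def c_def sin_squared_eq by (simp add: power2_eq_square)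
  then have d: "d \<noteq> 0" using sx by simp
  define u where "u = (2 * F (s, False) + c * F (t, False)) / d"
  define v where "v = (c * F (s, False) + 2 * F (t, False)) / d"
  have uv: "2 * u - c * v = F (s, False)" "2 * v - c * u = F (t, False)"
    using d by (simp_all add: u_def v_def field_simps) (simp_all add: d_def algebra_simps)
  define F0 where "F0 p = F p - u * simple_coroot s p - v * simple_coroot t p" for p
  have F0: "F0 (s, False) = 0" "F0 (t, False) = 0" using uv k by (simp_all add: F0_def algebra_simps)
  define G where "G a b = (\<lambda>p. F0 p + a * simple_coroot s p + b * simple_coroot t p)" for a b
  have GF: "F = G u v" by (simp add: G_def F0_def fun_eq_iff)
  have rs: "refl s (G a b) = G (c * b - a) b" and rt: "refl t (G a b) = G a (c * a - b)" for a b
    using F0 k by (simp_all add: refl_def G_def fun_eq_iff algebra_simps)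
  \<comment> \<open>The solution of the recursion z(y + 1) = c z(y) - z(y - 1) with z(0) = u and
    z(-1) = v. The coefficients after 2n letters are z(2n) and z(2n - 1).\<close>
  define z where "z y = (u * sin ((y + 1) * x) - v * sin (y * x)) / sin x" for y
  have z_rec: "c * z y - z (y - 1) = z (y + 1)" for y
  proof -
    have "sin ((y + 1) * x) = 2 * cos x * sin (y * x) - sin ((y - 1) * x)" for y
      by (simp add: ring_distribs sin_add sin_diff)
    then have A: "sin ((y + 1) * x) = c * sin (y * x) - sin ((y - 1) * x)" for y
      by (simp only: c_def)
    have "u * sin ((y + 1 + 1) * x) = u * (c * sin ((y + 1) * x) - sin (y * x))"
      "v * sin ((y + 1) * x) = v * (c * sin (y * x) - sin ((y - 1) * x))"
      using A[of y] A[of "y + 1"] by simp_all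
    moreover have "c * (u * b - v * a) - (u * a - v * e) = p - q"
      if "p = u * (c * b - a)" "q = v * (c * a - e)" for a b e p q
      using that by (simp add: algebra_simps)
    ultimately have "c * (u * sin ((y + 1) * x) - v * sin (y * x)) - (u * sin (y * x) - v * sin ((y - 1) * x)) =
        u * sin ((y + 1 + 1) * x) - v * sin ((y + 1) * x)" by blast
    moreover have "y - 1 + 1 = y" by simp
    ultimately show ?thesis unfolding z_def by (simp only: times_divide_eq_right flip: diff_divide_distrib)
  qed
  have "word_act (concat (replicate n [s, t])) F = G (z (2 * real n)) (z (2 * real n - 1))" for n
  proof (induction n)
    case 0
    have "z 0 = u" "z (- 1) = v" using sx by (simp_all add: z_def)
    then show ?case by (simp flip: GF)
  next
    case (Suc n)
    have "c * z (2 * real n) - z (2 * real n - 1) = z (2 * real n + 1)"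
      "c * z (2 * real n + 1) - z (2 * real n) = z (2 * real n + 2)"
      using z_rec[of "2 * real n"] z_rec[of "2 * real n + 1"] by (simp_all add: add.commute)
    moreover have "2 * real (Suc n) = 2 * real n + 2" "2 * real (Suc n) - 1 = 2 * real n + 1" by simp_all
    ultimately show ?case unfolding replicate_Suc concat.simps append_Cons append_Nil word_act_simps Suc rs rt
      by (simp add: add.commute)
  qed
  moreover have "z (2 * real (mord s t)) = u" "z (2 * real (mord s t) - 1) = v"
  proof -
    have e: "2 * real (mord s t) * x = 2 * pi" using m by (simp add: x_def)
    have e1: "(2 * real (mord s t) + 1) * x = x + 2 * pi" "(2 * real (mord s t) - 1 + 1) * x = 2 * pi"
      "(2 * real (mord s t) - 1) * x = - x + 2 * pi"
      using e by (simp_all add: distrib_right left_diff_distrib)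
    show "z (2 * real (mord s t)) = u" "z (2 * real (mord s t) - 1) = v"
      unfolding z_def e e1 sin_periodic using sx by simp_all
  qed
  ultimately show ?thesis using GF by metis
qed

lemma word_act_relator: assumes "relator_step S mord xs ys" shows "word_act xs F = word_act ys F"
proof -
  obtain us vs s t where st: "s \<in> S" "t \<in> S" "mord s t \<noteq> 0"
    and xy: "xs = us @ concat (replicate (mord s t) [s, t]) @ vs" "ys = us @ vs"
    using assms unfolding relator_step_def by blast
  have "word_act (concat (replicate (mord s t) [s, t])) F = F" for F
  proof (cases "s = t")
    case True then show ?thesis using st mord_self refl_refl by simp
  qed (use refl_braid st in simp)
  then show ?thesis unfolding xy word_act_append by simp
qed

lemma word_act_cong: assumes "set xs \<subseteq> S" "set ys \<subseteq> S" "\<pi> xs = \<pi> ys" shows "word_act xs F = word_act ys F"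
proof -
  have "equivclp (relator_step S mord) xs ys" using weq_iff assms by blast
  then show ?thesis by (induction rule: equivclp_induct) (auto dest: word_act_relator[of _ _ F])
qed

definition act :: "'a \<Rightarrow> ('a \<times> bool \<Rightarrow> real) \<Rightarrow> 'a \<times> bool \<Rightarrow> real" where
  "act w = word_act (SOME xs. set xs \<subseteq> S \<and> \<pi> xs = w)"

lemma act_word: assumes "set xs \<subseteq> S" shows "act (\<pi> xs) F = word_act xs F"
proof -
  have "\<exists>ys. set ys \<subseteq> S \<and> \<pi> ys = \<pi> xs" using assms by blast
  then show ?thesis unfolding act_def using someI_ex[of "\<lambda>ys. set ys \<subseteq> S \<and> \<pi> ys = \<pi> xs"] assms word_act_cong by blast
qed

lemma act_mult: assumes "x \<in> carrier G" "y \<in> carrier G" shows "act (x \<otimes> y) F = act x (act y F)"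
proof -
  obtain xs where xs: "set xs \<subseteq> S" "\<pi> xs = x" using ex_word[OF assms(1)] by blast
  obtain ys where ys: "set ys \<subseteq> S" "\<pi> ys = y" using ex_word[OF assms(2)] by blast
  have "act (\<pi> (xs @ ys)) F = act (\<pi> xs) (act (\<pi> ys) F)"
    using xs(1) ys(1) by (simp add: act_word word_act_append)
  then show ?thesis unfolding words_append[OF xs(1) ys(1)] unfolding xs ys .
qed

lemma act_one [simp]: "act \<one> F = F"
  using act_word[of "[]"] by simp

lemma act_gen: "s \<in> S \<Longrightarrow> act s F = refl s F"
  using act_word[of "[s]"] by simp

lemma act_inv_cancel [simp]:
  "x \<in> carrier G \<Longrightarrow> act (inv x) (act x F) = F"
  "x \<in> carrier G \<Longrightarrow> act x (act (inv x) F) = F"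
  by (simp_all flip: act_mult)

lemma act_lin:
  assumes "w \<in> carrier G"
  shows "act w (\<lambda>p. x * F p + y * F' p) = (\<lambda>p. x * act w F p + y * act w F' p)"
proof -
  obtain xs where xs: "set xs \<subseteq> S" "\<pi> xs = w" using ex_word[OF assms] by blast
  have "word_act xs (\<lambda>p. x * F p + y * F' p) = (\<lambda>p. x * word_act xs F p + y * word_act xs F' p)"
    by (induction xs) (simp_all add: refl_lin)
  then show ?thesis using act_word[OF xs(1)] xs(2) by simp
qed

definition cham :: "('a \<times> bool \<Rightarrow> real) set" where "cham = {F. \<forall>s\<in>S. F (s, False) > 0}"

lemma alt_act_value:
  assumes rs: "r \<in> S" "s \<in> S" and c: "c = - cartan r s"
  shows "word_act (alt r s n) F (s, False) =
    cp c (Suc n) * F (if even n then s else r, False) + cp c n * F (if even n then r else s, False)"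
  using rs c
proof (induction n arbitrary: r s rule: induct_nat_012)
  case 0 then show ?case by simp
next
  case 1 then show ?case by (simp add: refl_def algebra_simps)
next
  case (ge2 n)
  let ?A = "word_act (alt s r (Suc n)) F"
  have c': "c = - cartan s r" using ge2.prems cartan_sym by simp
  have A1: "?A (r, False) = cp c (Suc (Suc n)) * F (if even (Suc n) then r else s, False) +
      cp c (Suc n) * F (if even (Suc n) then s else r, False)"
    using ge2.IH(2)[of s r] ge2.prems c' by blast
  have "?A = refl s (word_act (alt r s n) F)" by simp
  then have A2: "?A (s, False) = - word_act (alt r s n) F (s, False)"
    using ge2.prems by (simp add: refl_def cartan_self)
  have "word_act (alt r s (Suc (Suc n))) F (s, False) = ?A (s, False) + c * ?A (r, False)"
    using ge2.prems by (simp add: refl_def algebra_simps)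
  then show ?case using A1 A2 ge2.IH(1)[OF ge2.prems]
    by (cases "even n") (simp_all add: algebra_simps del: alt.simps word_act_simps)
qed

lemma right_descent:
  assumes "w \<in> carrier G" "s \<in> S"
  shows "\<ell> (w \<otimes> s) = Suc (\<ell> w) \<or> \<ell> w = Suc (\<ell> (w \<otimes> s))"
    and "\<ell> w < \<ell> (w \<otimes> s) \<longleftrightarrow> s \<notin> N (inv w)"
proof -
  have "\<ell> (s \<otimes> inv w) = \<ell> (w \<otimes> s)" using len_inv[of "w \<otimes> s"] assms by (simp add: inv_mult_group)
  then show "\<ell> (w \<otimes> s) = Suc (\<ell> w) \<or> \<ell> w = Suc (\<ell> (w \<otimes> s))" "\<ell> w < \<ell> (w \<otimes> s) \<longleftrightarrow> s \<notin> N (inv w)"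
    using gen_left_descent[of s "inv w"] assms by auto
qed

lemma reduced_rev: "reduced xs \<Longrightarrow> reduced (rev xs)"
  by (simp add: reduced_def words_rev)

lemma reduced_alt_le_mord:
  assumes "s \<in> S" "t \<in> S" "reduced (alt s t n)" "mord s t \<noteq> 0" shows "n \<le> mord s t"
proof (rule ccontr)
  assume "\<not> n \<le> mord s t"
  then have n: "Suc (mord s t) \<le> n" by simp
  have "alt s t n = alt s t (Suc (mord s t)) @ drop (Suc (mord s t)) (alt s t n)"
    using take_alt[OF n, of s t] append_take_drop_id by metis
  then have red: "reduced (alt s t (Suc (mord s t)))" using assms(3) reduced_appendD(1) by metis
  obtain k where k: "mord s t = Suc k" using assms(4) not0_implies_Suc by blast
  have "(s \<otimes> t) [^] mord s t = \<one>" unfolding mord_def using assms by (intro pow_ord_eq_1) simp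
  then have "\<pi> (alt s t (Suc k)) = \<pi> (alt t s (Suc k))"
    using alt_power_one[OF assms(1,2)] k by metis
  then show False using alt_collision[OF assms(1,2)] red k by metis
qed

text \<open>Split off from the right end of \<open>w\<close> as long a word in \<open>s\<close> and
  \<open>r\<close> as possible, where \<open>r\<close> is a last letter of \<open>w\<close>. The
  rest \<open>v\<close> becomes longer under both \<open>s\<close> and \<open>r\<close>, so both
  simple roots are positive at v^-1 F by induction. The split word alternates, and by
  \<open>alt_act_value\<close> the wanted value combines these two numbers with Chebyshev
  coefficients.\<close>

theorem root_positive:
  assumes "w \<in> carrier G" "s \<in> S" "\<ell> w < \<ell> (w \<otimes> s)" "F \<in> cham"
  shows "act (inv w) F (s, False) > 0"
  using assms(1-3)
proof (induction "\<ell> w" arbitrary: w s rule: less_induct)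
  case less
  show ?case
  proof (cases "w = \<one>")
    case True then show ?thesis using assms(4) less.prems by (simp add: cham_def)
  next
    case False
    obtain ws where ws: "reduced ws" "\<pi> ws = w" using ex_reduced'[OF less.prems(1)] by blast
    have "ws \<noteq> []" using False ws by auto
    then obtain us r where us: "ws = us @ [r]" by (metis rev_exhaust)
    have usS: "set us \<subseteq> S" and r: "r \<in> S" using ws us by (auto simp: reduced_def)
    have wr: "w \<otimes> r = \<pi> us" using ws(2) usS r unfolding us
      by (auto simp: words_append m_assoc S_square)
    then have lwr: "\<ell> (w \<otimes> r) < \<ell> w"
      using len_le[OF usS] ws us by (simp add: reduced_def)
    have rs: "r \<noteq> s" using lwr less.prems by auto
    \<comment> \<open>The candidates for the rest \<open>v\<close>; one of minimal length is
      chosen.\<close>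
    define P where "P v \<longleftrightarrow> v \<in> carrier G \<and> \<ell> v < \<ell> w \<and>
      (\<exists>xs. set xs \<subseteq> {s, r} \<and> w = v \<otimes> \<pi> xs \<and> \<ell> w = \<ell> v + length xs)" for v
    have "P (w \<otimes> r)" unfolding P_def
      using lwr right_descent(1)[OF less.prems(1) r] less.prems r
      by (intro conjI exI[of _ "[r]"]) (auto simp: m_assoc S_square)
    then obtain v where v: "P v" "\<And>y. P y \<Longrightarrow> \<ell> v \<le> \<ell> y"
      using ex_has_least_nat[of P "w \<otimes> r" \<ell>] by blast
    then obtain xs where xs: "set xs \<subseteq> {s, r}" "w = v \<otimes> \<pi> xs" "\<ell> w = \<ell> v + length xs"
      and vc: "v \<in> carrier G" "\<ell> v < \<ell> w" unfolding P_def by blast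
    have xsS: "set xs \<subseteq> S" using xs(1) r less.prems by auto
    have up: "\<ell> v < \<ell> (v \<otimes> q)" if q: "q \<in> {s, r}" for q
    proof (rule ccontr)
      assume not: "\<not> \<ell> v < \<ell> (v \<otimes> q)"
      have qS: "q \<in> S" using q r less.prems by auto
      then have l: "\<ell> v = Suc (\<ell> (v \<otimes> q))" using not right_descent(1)[OF vc(1), of q] by simp
      have "(v \<otimes> q) \<otimes> \<pi> (q # xs) = w" using vc xsS qS xs(2) by (simp add: m_assoc)
      then have "P (v \<otimes> q)" unfolding P_def using vc l qS q xs
        by (intro conjI exI[of _ "q # xs"]) auto
      then show False using v(2) l by force
    qed
    let ?F = "act (inv v) F"
    have pos: "?F (s, False) > 0" "?F (r, False) > 0"
      using less.hyps[OF vc(2,1)] up r less.prems(2) by auto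
    have "w \<otimes> s = v \<otimes> \<pi> (xs @ [s])"
      using vc xsS less.prems(2) by (simp add: words_append m_assoc xs(2))
    then have "\<ell> (w \<otimes> s) \<le> \<ell> v + \<ell> (\<pi> (xs @ [s]))"
      using len_mult_le[of v "\<pi> (xs @ [s])"] vc xsS less.prems(2) by simp
    then have "reduced (xs @ [s])"
      using len_le[of "xs @ [s]"] xsS less.prems xs(3) by (simp add: reduced_def)
    then have "reduced (rev (xs @ [s]))" by (rule reduced_rev)
    then have red: "reduced (s # rev xs)" by simp
    have "s # rev xs = alt s r (Suc (length xs))"
      using reduced_alt[OF red, of s r] xs(1) rs by auto
    then have rev: "rev xs = alt r s (length xs)" and red': "reduced (alt s r (Suc (length xs)))"
      using red by auto
    define n where "n = length xs"
    define c where "c = - cartan r s"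
    have m: "mord r s \<noteq> 1" "mord s r = mord r s" using mord_ne_1 mord_sym r less.prems(2) rs by auto
    \<comment> \<open>The second coefficient vanishes when the alternating word with
      \<open>s\<close> added has the full length \<open>mord r s\<close>; then n > 0 and the first
      coefficient is positive.\<close>
    have p1: "0 < n \<Longrightarrow> cp c n > 0" and p2: "cp c (Suc n) \<ge> 0" and p3: "n = 0 \<Longrightarrow> cp c (Suc n) > 0"
    proof -
      show "n = 0 \<Longrightarrow> cp c (Suc n) > 0" by simp
      have "(0 < n \<longrightarrow> cp c n > 0) \<and> cp c (Suc n) \<ge> 0"
      proof (cases "mord r s = 0")
        case True
        then have "c = 2" using less.prems(2) by (simp add: c_def cartan_def)
        then show ?thesis by (simp add: cp_two del: cp_simps)
      next
        case False
        then have c: "c = 2 * cos (pi / real (mord r s))" using less.prems(2) by (simp add: c_def cartan_def)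
        have le: "Suc n \<le> mord r s"
          using reduced_alt_le_mord[OF less.prems(2) r red'] False m by (simp add: n_def)
        show ?thesis
        proof (cases "Suc n = mord r s")
          case True
          then show ?thesis using cp_pos[of n "mord r s"] cp_zero[of "mord r s"] False m c by auto
        next
          case False
          then show ?thesis using cp_pos[of n "mord r s"] cp_pos[of "Suc n" "mord r s"] le c
            by (auto simp del: cp_simps)
        qed
      qed
      then show "0 < n \<Longrightarrow> cp c n > 0" "cp c (Suc n) \<ge> 0" by blast+
    qed
    have "act (inv w) F = act (inv \<pi> xs) ?F"
      unfolding xs(2) using vc xsS by (simp add: inv_mult_group act_mult)
    also have "\<dots> = act (\<pi> (rev xs)) ?F" unfolding words_rev[OF xsS] ..
    also have "\<dots> = word_act (rev xs) ?F" using xsS by (intro act_word) simp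
    also have "\<dots> = word_act (alt r s n) ?F" unfolding rev n_def ..
    finally have eq: "act (inv w) F (s, False) =
        cp c (Suc n) * ?F (if even n then s else r, False) + cp c n * ?F (if even n then r else s, False)"
      using alt_act_value[OF r less.prems(2) c_def] by simp
    show ?thesis
    proof (cases "n = 0")
      case True then show ?thesis using eq pos by simp
    next
      case False
      then have "cp c n * ?F (if even n then r else s, False) > 0" using p1 pos by simp
      moreover have "cp c (Suc n) * ?F (if even n then s else r, False) \<ge> 0" using p2 pos by simp
      ultimately show ?thesis using eq by linarith
    qed
  qed
qed

text \<open>The functional obtained by moving the simple root of \<open>s\<close> by
  \<open>x\<close>. With \<open>coroot\<close> below, the reflection x s x^-1 subtracts from a point
  its root value times the coroot, see \<open>act_conj_gen\<close>.\<close>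

definition root :: "'a \<Rightarrow> 'a \<Rightarrow> ('a \<times> bool \<Rightarrow> real) \<Rightarrow> real" where
  "root x s F = act (inv x) F (s, False)"

definition coroot :: "'a \<Rightarrow> 'a \<Rightarrow> 'a \<times> bool \<Rightarrow> real" where
  "coroot x s = act x (simple_coroot s)"

lemma act_conj_gen:
  assumes "x \<in> carrier G" "s \<in> S"
  shows "act (x \<otimes> s \<otimes> inv x) F = (\<lambda>p. F p - root x s F * coroot x s p)"
proof -
  have "act (x \<otimes> s \<otimes> inv x) F = act x (refl s (act (inv x) F))"
    using assms by (simp add: act_mult act_gen)
  also have "refl s (act (inv x) F) = (\<lambda>p. 1 * act (inv x) F p + (- root x s F) * simple_coroot s p)"
    by (simp add: refl_def root_def)
  finally show ?thesis using act_lin[OF assms(1), of 1 "act (inv x) F" "- root x s F"] assms(1)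
    by (simp add: coroot_def)
qed

lemma refl_coroot_sym:
  "set xs \<subseteq> S \<Longrightarrow> r \<in> S \<Longrightarrow> q \<in> S \<Longrightarrow>
    word_act xs (simple_coroot r) (q, False) = word_act (rev xs) (simple_coroot q) (r, False)"
proof (induction xs arbitrary: q)
  case Nil then show ?case by (simp add: cartan_sym)
next
  case (Cons s xs)
  have s: "s \<in> S" "set xs \<subseteq> S" using Cons.prems by auto
  have lin: "word_act ys (\<lambda>p. F p + y * F' p) = (\<lambda>p. word_act ys F p + y * word_act ys F' p)" for ys y F F'
    by (induction ys) (simp_all add: refl_lin[of _ 1, simplified])
  have "word_act (rev (s # xs)) (simple_coroot q) = word_act (rev xs) (refl s (simple_coroot q))"
    by (simp add: word_act_append)
  also have "refl s (simple_coroot q) = (\<lambda>p. simple_coroot q p + (- cartan q s) * simple_coroot s p)"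
    by (simp add: refl_def)
  finally have "word_act (rev (s # xs)) (simple_coroot q) (r, False) =
    word_act xs (simple_coroot r) (q, False) - cartan q s * word_act xs (simple_coroot r) (s, False)"
    unfolding lin using Cons s by simp
  then show ?case using Cons.prems s by (simp add: refl_def cartan_sym)
qed

definition delta :: "'a \<Rightarrow> 'a \<times> bool \<Rightarrow> real" where
  "delta q = (\<lambda>p. of_bool (p = (q, False)))"

text \<open>The coordinate (q, True) of a coroot is its coefficient at the simple coroot of
  \<open>q\<close>; evaluation at \<open>delta q\<close> gives the coefficient of the root at the
  simple root of \<open>q\<close>. The two agree because the Cartan matrix is symmetric.\<close>

lemma coroot_star:
  "set xs \<subseteq> S \<Longrightarrow> r \<in> S \<Longrightarrow> q \<in> S \<Longrightarrow>
    word_act xs (simple_coroot r) (q, True) = word_act (rev xs) (delta q) (r, False)"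
proof (induction xs arbitrary: q)
  case Nil then show ?case by (auto simp: delta_def)
next
  case (Cons s xs)
  have s: "s \<in> S" "set xs \<subseteq> S" using Cons.prems by auto
  have lin: "word_act ys (\<lambda>p. F p + y * F' p) = (\<lambda>p. word_act ys F p + y * word_act ys F' p)" for ys y F F'
    by (induction ys) (simp_all add: refl_lin[of _ 1, simplified])
  have "word_act (rev (s # xs)) (delta q) = word_act (rev xs) (refl s (delta q))"
    by (simp add: word_act_append)
  also have "refl s (delta q) = (\<lambda>p. delta q p + (- of_bool (s = q)) * simple_coroot s p)"
    by (auto simp: refl_def delta_def)
  finally have "word_act (rev (s # xs)) (delta q) (r, False) =
    word_act xs (simple_coroot r) (q, True) - of_bool (s = q) * word_act (rev xs) (simple_coroot s) (r, False)"
    unfolding lin using Cons s by simp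
  then show ?case using Cons.prems s refl_coroot_sym[OF s(2) Cons.prems(2) s(1)] by (auto simp: refl_def)
qed

lemma root_coroot_sym:
  assumes "x \<in> carrier G" "y \<in> carrier G" "s \<in> S" "r \<in> S"
  shows "root x s (coroot y r) = root y r (coroot x s)"
proof -
  obtain xs where xs: "set xs \<subseteq> S" "\<pi> xs = inv x \<otimes> y" using ex_word[of "inv x \<otimes> y"] assms by blast
  have "inv (inv x \<otimes> y) = inv y \<otimes> x" using assms by (simp add: inv_mult_group)
  then have rev: "\<pi> (rev xs) = inv y \<otimes> x" using words_rev[OF xs(1)] unfolding xs(2) by simp
  have xsr: "set (rev xs) \<subseteq> S" using xs(1) by simp
  have 1: "word_act xs F = act (inv x) (act y F)" for F
    using act_word[OF xs(1), of F] act_mult[of "inv x" y F] assms(1,2) unfolding xs(2) by simp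
  have 2: "word_act (rev xs) F = act (inv y) (act x F)" for F
    using act_word[OF xsr, of F] act_mult[of "inv y" x F] assms(1,2) unfolding rev by simp
  show ?thesis using refl_coroot_sym[OF xs(1) assms(4,3)] unfolding 1 2 root_def coroot_def .
qed

lemma coroot_star_root:
  assumes "x \<in> carrier G" "s \<in> S" "q \<in> S" shows "coroot x s (q, True) = root x s (delta q)"
proof -
  obtain xs where xs: "set xs \<subseteq> S" "\<pi> xs = x" using ex_word assms by blast
  then show ?thesis using coroot_star[OF xs(1) assms(2,3)] act_word[OF xs(1)] act_word[of "rev xs"] xs
    by (simp add: root_def coroot_def words_rev)
qed

lemma coroot_outside:
  assumes "x \<in> carrier G" "s \<in> S" "q \<notin> S" shows "coroot x s (q, b) = 0"
proof -
  obtain xs where xs: "set xs \<subseteq> S" "\<pi> xs = x" using ex_word assms by blast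
  have sc: "simple_coroot r (q, b) = 0" if "r \<in> S" for r
    using assms(3) that by (cases b) (auto simp: cartan_def)
  have "word_act xs (simple_coroot s) (q, b) = 0" using xs(1)
    by (induction xs) (use sc assms in \<open>auto simp: refl_def\<close>)
  then show ?thesis using act_word[OF xs(1)] xs(2) by (simp add: coroot_def)
qed

text \<open>\<open>S\<close> may be infinite, but a root involves only finitely many simple roots;
  this gives finite expansions.\<close>

lemma word_act_finite_support:
  "set xs \<subseteq> S \<Longrightarrow> s \<in> S \<Longrightarrow> \<exists>A. finite A \<and> A \<subseteq> S \<and>
    (\<forall>F F'. (\<forall>q\<in>A. F (q, False) = F' (q, False)) \<longrightarrow> word_act xs F (s, False) = word_act xs F' (s, False))"
proof (induction xs arbitrary: s)
  case Nil
  then show ?case by (intro exI[of _ "{s}"]) auto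
next
  case (Cons r xs)
  have "set xs \<subseteq> S" "r \<in> S" using Cons.prems by auto
  from Cons.IH[OF this(1) Cons.prems(2)] obtain A where A: "finite A" "A \<subseteq> S" "\<And>F F'. (\<forall>q\<in>A. F (q, False) = F' (q, False)) \<Longrightarrow>
      word_act xs F (s, False) = word_act xs F' (s, False)" by blast
  from Cons.IH[OF \<open>set xs \<subseteq> S\<close> \<open>r \<in> S\<close>] obtain B where B: "finite B" "B \<subseteq> S" "\<And>F F'. (\<forall>q\<in>B. F (q, False) = F' (q, False)) \<Longrightarrow>
      word_act xs F (r, False) = word_act xs F' (r, False)" by blast
  have "word_act (r # xs) F (s, False) = word_act (r # xs) F' (s, False)"
    if "\<forall>q\<in>A \<union> B. F (q, False) = F' (q, False)" for F F'
    using A(3)[of F F'] B(3)[of F F'] that by (simp add: refl_def)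
  then show ?case using A B by (intro exI[of _ "A \<union> B"]) auto
qed

lemma root_lin:
  "x \<in> carrier G \<Longrightarrow> root x s (\<lambda>p. a * F p + b * F' p) = a * root x s F + b * root x s F'"
  by (simp add: root_def act_lin)

lemma root_finite_expansion:
  assumes "x \<in> carrier G" "s \<in> S"
  shows "\<exists>A. finite A \<and> A \<subseteq> S \<and> (\<forall>B. finite B \<and> A \<subseteq> B \<longrightarrow>
    (\<forall>F. root x s F = (\<Sum>q\<in>B. F (q, False) * root x s (delta q))))"
proof -
  obtain xs where xs: "set xs \<subseteq> S" "\<pi> xs = inv x" using ex_word[OF inv_closed[OF assms(1)]] by blast
  obtain A where A: "finite A" "A \<subseteq> S" "\<And>F F'. (\<forall>q\<in>A. F (q, False) = F' (q, False)) \<Longrightarrow>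
      word_act xs F (s, False) = word_act xs F' (s, False)"
    using word_act_finite_support[OF xs(1) assms(2)] by blast
  have root: "root x s F = word_act xs F (s, False)" for F
    using act_word[OF xs(1), of F] unfolding xs(2) root_def by simp
  have sum: "root x s (\<lambda>p. \<Sum>q\<in>B. F (q, False) * delta q p) = (\<Sum>q\<in>B. F (q, False) * root x s (delta q))"
    if "finite B" for B F using that
  proof (induction B)
    case empty
    show ?case using root_lin[OF assms(1), of s 0 "\<lambda>_. 0" 0 "\<lambda>_. 0"] by simp
  next
    case (insert q B)
    then show ?case using root_lin[OF assms(1), of s "F (q, False)" "delta q" 1] by simp
  qed
  have "root x s F = (\<Sum>q\<in>B. F (q, False) * root x s (delta q))" if B: "finite B" "A \<subseteq> B" for B F
  proof -
    have "(\<Sum>q\<in>B. F (q, False) * delta q (q', False)) = F (q', False)" if "q' \<in> A" for q'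
    proof -
      have "(\<Sum>q\<in>B. F (q, False) * delta q (q', False)) = (\<Sum>q\<in>B. if q = q' then F (q, False) else 0)"
        by (intro sum.cong) (auto simp: delta_def)
      then show ?thesis using B that by auto
    qed
    then have "\<forall>q'\<in>A. F (q', False) = (\<Sum>q\<in>B. F (q, False) * delta q (q', False))" by simp
    from A(3)[OF this] have "root x s F = root x s (\<lambda>p. \<Sum>q\<in>B. F (q, False) * delta q p)"
      unfolding root .
    then show ?thesis using sum[OF B(1)] by simp
  qed
  then show ?thesis using A(1,2) by blast
qed

lemma positive_presentation:
  assumes "t \<in> T" shows "\<exists>x\<in>carrier G. \<exists>s\<in>S. t = x \<otimes> s \<otimes> inv x \<and> \<ell> x < \<ell> (x \<otimes> s)"
proof -
  obtain x s where x: "x \<in> carrier G" "s \<in> S" "t = x \<otimes> s \<otimes> inv x" using assms by (rule T_E)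
  show ?thesis
  proof (cases "\<ell> x < \<ell> (x \<otimes> s)")
    case True then show ?thesis using x by blast
  next
    case False
    then have "\<ell> (x \<otimes> s) < \<ell> ((x \<otimes> s) \<otimes> s)" using right_descent(1)[OF x(1,2)] x by (simp add: m_assoc S_square)
    moreover have "t = (x \<otimes> s) \<otimes> s \<otimes> inv (x \<otimes> s)" unfolding x(3) using x(1,2) by (simp add: m_assoc inv_mult_group)
    ultimately show ?thesis using m_closed[OF x(1) S_in[OF x(2)]] x(2) by blast
  qed
qed

text \<open>The length condition selects, by \<open>root_positive\<close>, the positive one of the
  two opposite roots of the reflection.\<close>

definition conj_rep :: "'a \<Rightarrow> 'a \<times> 'a" where
  "conj_rep t = (SOME (x, s). x \<in> carrier G \<and> s \<in> S \<and> t = x \<otimes> s \<otimes> inv x \<and> \<ell> x < \<ell> (x \<otimes> s))"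

lemma conj_rep:
  assumes "t \<in> T" shows "fst (conj_rep t) \<in> carrier G" "snd (conj_rep t) \<in> S"
    "t = fst (conj_rep t) \<otimes> snd (conj_rep t) \<otimes> inv (fst (conj_rep t))"
    "\<ell> (fst (conj_rep t)) < \<ell> (fst (conj_rep t) \<otimes> snd (conj_rep t))"
proof -
  have "\<exists>p. case p of (x, s) \<Rightarrow> x \<in> carrier G \<and> s \<in> S \<and> t = x \<otimes> s \<otimes> inv x \<and> \<ell> x < \<ell> (x \<otimes> s)"
    using positive_presentation[OF assms] by auto
  from someI_ex[OF this] have *: "case conj_rep t of (x, s) \<Rightarrow>
      x \<in> carrier G \<and> s \<in> S \<and> t = x \<otimes> s \<otimes> inv x \<and> \<ell> x < \<ell> (x \<otimes> s)"
    unfolding conj_rep_def .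
  show "fst (conj_rep t) \<in> carrier G" "snd (conj_rep t) \<in> S"
    "t = fst (conj_rep t) \<otimes> snd (conj_rep t) \<otimes> inv (fst (conj_rep t))"
    "\<ell> (fst (conj_rep t)) < \<ell> (fst (conj_rep t) \<otimes> snd (conj_rep t))"
    using * unfolding split_beta by blast+
qed

section \<open>The positive root and the coroot of a reflection\<close>

definition rt :: "'a \<Rightarrow> ('a \<times> bool \<Rightarrow> real) \<Rightarrow> real" where
  "rt t = root (fst (conj_rep t)) (snd (conj_rep t))"

definition crt :: "'a \<Rightarrow> 'a \<times> bool \<Rightarrow> real" where
  "crt t = coroot (fst (conj_rep t)) (snd (conj_rep t))"

lemma act_refl: assumes "t \<in> T" shows "act t F = (\<lambda>p. F p - rt t F * crt t p)"
  using act_conj_gen[OF conj_rep(1,2)[OF assms], of F] conj_rep(3)[OF assms]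
  by (simp add: rt_def crt_def)

lemma rt_pos: assumes "t \<in> T" "F \<in> cham" shows "rt t F > 0"
  using root_positive[OF conj_rep(1,2,4)[OF assms(1)] assms(2)] by (simp add: rt_def root_def)

lemma rt_lin: "t \<in> T \<Longrightarrow> rt t (\<lambda>p. a * F p + b * F' p) = a * rt t F + b * rt t F'"
  unfolding rt_def by (intro root_lin conj_rep)

lemma rt_sym: "t \<in> T \<Longrightarrow> r \<in> T \<Longrightarrow> rt t (crt r) = rt r (crt t)"
  unfolding rt_def crt_def by (intro root_coroot_sym conj_rep)

lemma rt_self: assumes "t \<in> T" shows "rt t (crt t) = 2"
  using conj_rep[OF assms] by (simp add: rt_def crt_def root_def coroot_def cartan_self)

text \<open>With t = x s x^-1 and y = w^-1 x, the value is that of the root of \<open>s\<close>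
  moved by y. Its sign depends on whether \<open>s\<close> lengthens y, and by the cocycle rule this
  holds exactly if \<open>t\<close> is not an inversion of \<open>w\<close>.\<close>

lemma rt_act_sign:
  assumes t: "t \<in> T" and w: "w \<in> carrier G" and F: "F \<in> cham"
  shows "t \<in> N w \<Longrightarrow> rt t (act w F) < 0" "t \<notin> N w \<Longrightarrow> rt t (act w F) > 0"
proof -
  define x s where "x = fst (conj_rep t)" and "s = snd (conj_rep t)"
  have x: "x \<in> carrier G" "s \<in> S" "t = x \<otimes> s \<otimes> inv x" "\<ell> x < \<ell> (x \<otimes> s)"
    using conj_rep[OF t] by (simp_all add: x_def s_def)
  define y where "y = inv w \<otimes> x"
  have y: "y \<in> carrier G" "inv y = inv x \<otimes> w" using x w by (simp_all add: y_def inv_mult_group)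
  have rt: "rt t (act w F) = act (inv y) F (s, False)"
    unfolding rt_def root_def x_def[symmetric] s_def[symmetric] y(2) using x(1) w by (simp add: act_mult)
  have "s \<notin> N (inv x)" using right_descent(2)[OF x(1,2)] x(4) by simp
  then have *: "s \<in> N (inv y) \<longleftrightarrow> t \<in> N w"
    using N_mult[of "inv x" w s] x w y by simp
  show "t \<notin> N w \<Longrightarrow> rt t (act w F) > 0"
    using root_positive[OF y(1) x(2) _ F] right_descent(2)[OF y(1) x(2)] * rt by simp
  assume "t \<in> N w"
  then have "\<ell> (y \<otimes> s) < \<ell> ((y \<otimes> s) \<otimes> s)"
    using right_descent[OF y(1) x(2)] * y x by (auto simp: m_assoc S_square)
  then have "act (inv (y \<otimes> s)) F (s, False) > 0" using root_positive[of "y \<otimes> s" s F] y x F by simp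
  moreover have "act (inv (y \<otimes> s)) F (s, False) = - act (inv y) F (s, False)"
    using y(1) x(2) by (simp add: inv_mult_group act_mult act_gen refl_def cartan_self)
  ultimately show "rt t (act w F) < 0" using rt by simp
qed

definition unitF :: "'a \<times> bool \<Rightarrow> real" where "unitF = (\<lambda>_. 1)"

lemma unitF_cham: "unitF \<in> cham" by (simp add: unitF_def cham_def)

lemma N_inj: assumes "x \<in> carrier G" "y \<in> carrier G" "N x = N y" shows "x = y"
proof -
  have "t \<notin> N (inv x \<otimes> y)" if t: "t \<in> carrier G" for t
  proof -
    have "x \<otimes> t \<otimes> inv x \<in> N y \<longleftrightarrow> t \<in> N (inv x)"
      using N_inv[of "inv x" t] assms t by simp
    then show ?thesis using N_mult[of "inv x" y t] assms t by simp
  qed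
  then have "N (inv x \<otimes> y) = {}" using N_carrier[of "inv x \<otimes> y"] assms by blast
  then have "\<ell> (inv x \<otimes> y) = 0" using card_N(2)[of "inv x \<otimes> y"] assms by simp
  then have "inv x \<otimes> y = \<one>" using len_zero_iff assms by simp
  then show ?thesis using assms by (metis inv_equality inv_inv inv_closed)
qed

lemma act_inj: assumes "x \<in> carrier G" "y \<in> carrier G" "act x unitF = act y unitF" shows "x = y"
proof -
  have "t \<in> N x \<longleftrightarrow> t \<in> N y" if t: "t \<in> T" for t
    using rt_act_sign[OF t assms(1) unitF_cham] rt_act_sign[OF t assms(2) unitF_cham] assms(3) by fastforce
  then have "N x = N y" using N_T assms(1,2) by blast
  then show ?thesis using N_inj assms by blast
qed

lemma crt_coords:
  assumes "t \<in> T"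
  shows "q \<in> S \<Longrightarrow> crt t (q, False) = rt t (simple_coroot q)"
    "q \<in> S \<Longrightarrow> crt t (q, True) = rt t (delta q)" "q \<notin> S \<Longrightarrow> crt t (q, b) = 0"
proof -
  note c = conj_rep[OF assms]
  show "q \<in> S \<Longrightarrow> crt t (q, True) = rt t (delta q)" unfolding crt_def rt_def using coroot_star_root c by simp
  show "q \<notin> S \<Longrightarrow> crt t (q, b) = 0" unfolding crt_def using coroot_outside c by simp
  assume q: "q \<in> S"
  have "root \<one> q F = F (q, False)" for F by (simp add: root_def)
  moreover have "coroot \<one> q = simple_coroot q" by (simp add: coroot_def)
  ultimately show "crt t (q, False) = rt t (simple_coroot q)"
    using root_coroot_sym[of \<one> "fst (conj_rep t)" q "snd (conj_rep t)"] c q by (simp add: rt_def crt_def)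
qed

text \<open>The coroots are proportional with the same factor \<open>c\<close>, by their
  coordinates. Pairing each root with the other coroot gives c^2 = 1, so both reflections act alike,
  and the action is faithful.\<close>

lemma rt_proportional:
  assumes "t \<in> T" "r \<in> T" "\<And>F. rt t F = c * rt r F" shows "t = r"
proof -
  have crt: "crt t p = c * crt r p" for p
  proof (cases p)
    case (Pair q b)
    then show ?thesis using crt_coords[OF assms(1), of q] crt_coords[OF assms(2), of q] assms(3)
      by (cases "q \<in> S"; cases b) auto
  qed
  have "2 = c * rt r (crt t)" using rt_self[OF assms(1)] assms(3) by simp
  also have "rt r (crt t) = c * 2" using rt_sym[OF assms(1,2)] rt_self[OF assms(2)] assms(3) by simp
  finally have c: "c * c = 1" by simp
  have "rt t F * crt t p = rt r F * crt r p" for F p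
  proof -
    have "rt t F * crt t p = (c * c) * (rt r F * crt r p)" unfolding crt assms(3) by (simp only: mult_ac)
    then show ?thesis using c by simp
  qed
  then have "act t F = act r F" for F unfolding act_refl[OF assms(1)] act_refl[OF assms(2)] by simp
  then show ?thesis using act_inj assms by simp
qed

lemma rt_finite_expansion:
  assumes "t \<in> T"
  shows "\<exists>A. finite A \<and> A \<subseteq> S \<and> (\<forall>B. finite B \<and> A \<subseteq> B \<longrightarrow>
    (\<forall>F. rt t F = (\<Sum>q\<in>B. F (q, False) * rt t (delta q))))"
  unfolding rt_def by (rule root_finite_expansion[OF conj_rep(1,2)[OF assms]])

text \<open>Here the coordinates (q, True) are essential: they recover the coefficients of a root
  from its coroot even if the Cartan form is degenerate.\<close>

lemma crt_proportional:
  assumes "t \<in> T" "r \<in> T" "\<And>p. crt t p = c * crt r p" shows "t = r"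
proof (rule rt_proportional[OF assms(1,2)])
  fix F
  obtain A where A: "finite A" "A \<subseteq> S"
    "\<forall>B. finite B \<and> A \<subseteq> B \<longrightarrow> (\<forall>F. rt t F = (\<Sum>q\<in>B. F (q, False) * rt t (delta q)))"
    using rt_finite_expansion[OF assms(1)] by blast
  obtain B where B: "finite B" "B \<subseteq> S"
    "\<forall>C. finite C \<and> B \<subseteq> C \<longrightarrow> (\<forall>F. rt r F = (\<Sum>q\<in>C. F (q, False) * rt r (delta q)))"
    using rt_finite_expansion[OF assms(2)] by blast
  have "rt t (delta q) = c * rt r (delta q)" if "q \<in> A \<union> B" for q
  proof -
    have "q \<in> S" using that A B by blast
    then show ?thesis using crt_coords(2)[OF assms(1) \<open>q \<in> S\<close>] crt_coords(2)[OF assms(2) \<open>q \<in> S\<close>]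
      assms(3)[of "(q, True)"] by simp
  qed
  then have "(\<Sum>q\<in>A \<union> B. F (q, False) * rt t (delta q)) = c * (\<Sum>q\<in>A \<union> B. F (q, False) * rt r (delta q))"
    by (simp add: sum_distrib_left algebra_simps)
  then show "rt t F = c * rt r F" using A(3)[rule_format, of "A \<union> B" F] B(3)[rule_format, of "A \<union> B" F] A(1) B(1) by simp
qed

end

section \<open>Maximal dihedral subgroups and flips\<close>

text \<open>If \<open>g\<close> also satisfies the condition and differs from \<open>p\<close> at
  some \<open>x\<close> of least level, then \<open>g\<close> moves both \<open>x\<close> and
  \<open>p x\<close> to higher levels. Then L(p x) < L(g x), while the condition for
  \<open>x\<close> and \<open>g (p x)\<close> gives L(g x) < L(p x).\<close>

lemma level_flip_unique:
  fixes lv L :: "'a \<Rightarrow> nat"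
  assumes p: "\<And>x. x \<in> X \<Longrightarrow> p x \<in> X \<and> p x \<noteq> x \<and> lv (p x) = lv x \<and> p (p x) = x"
    and two: "\<And>x y. x \<in> X \<Longrightarrow> y \<in> X \<Longrightarrow> lv x = lv y \<Longrightarrow> y = x \<or> y = p x"
    and mono: "\<And>x y. x \<in> X \<Longrightarrow> y \<in> X \<Longrightarrow> lv x < lv y \<Longrightarrow> L x < L y"
  shows "(THE f. f \<in> X \<rightarrow>\<^sub>E X \<and> (\<forall>x\<in>X. f (f x) = x \<and> f x \<noteq> x) \<and>
    (\<forall>x1\<in>X. \<forall>x2\<in>X. L x1 < L x2 \<and> x2 \<noteq> f x1 \<longrightarrow> L (f x1) < L (f x2))) = restrict p X"
proof (rule the_equality)
  have "L (p x1) < L (p x2)" if "x1 \<in> X" "x2 \<in> X" "L x1 < L x2" "x2 \<noteq> p x1" for x1 x2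
  proof -
    have "lv x1 \<noteq> lv x2" using two that by blast
    moreover have "\<not> lv x2 < lv x1" using mono[of x2 x1] that by auto
    ultimately show ?thesis using mono[of "p x1" "p x2"] p that by auto
  qed
  then show "restrict p X \<in> X \<rightarrow>\<^sub>E X \<and> (\<forall>x\<in>X. restrict p X (restrict p X x) = x \<and> restrict p X x \<noteq> x) \<and>
    (\<forall>x1\<in>X. \<forall>x2\<in>X. L x1 < L x2 \<and> x2 \<noteq> restrict p X x1 \<longrightarrow> L (restrict p X x1) < L (restrict p X x2))"
    using p by auto
next
  fix g assume g: "g \<in> X \<rightarrow>\<^sub>E X \<and> (\<forall>x\<in>X. g (g x) = x \<and> g x \<noteq> x) \<and>
    (\<forall>x1\<in>X. \<forall>x2\<in>X. L x1 < L x2 \<and> x2 \<noteq> g x1 \<longrightarrow> L (g x1) < L (g x2))"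
  then have gX: "g x \<in> X" "g (g x) = x" "g x \<noteq> x" if "x \<in> X" for x using that by auto
  have "x \<in> X \<Longrightarrow> g x = p x" for x
  proof (induction "lv x" arbitrary: x rule: less_induct)
    case less
    have up: "lv y < lv (g y)" if y: "y \<in> X" "lv y = lv x" "g y \<noteq> p y" for y
    proof -
      have "lv (g y) \<noteq> lv y" using two[of y "g y"] gX[OF y(1)] y by auto
      moreover have "\<not> lv (g y) < lv y"
      proof
        assume l: "lv (g y) < lv y"
        then have "g (g y) = p (g y)" using less.hyps[of "g y"] gX[OF y(1)] y by simp
        then have "lv y = lv (g y)" using gX[OF y(1)] p[of "g y"] by metis
        then show False using l by simp
      qed
      ultimately show ?thesis by linarith
    qed
    show ?case
    proof (rule ccontr)
      assume ne: "g x \<noteq> p x"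
      have px: "p x \<in> X" "p x \<noteq> x" "lv (p x) = lv x" "p (p x) = x" using p[OF less.prems] by auto
      have "g (p x) \<noteq> x" using ne gX(2)[OF px(1)] gX(2)[OF less.prems] by metis
      then have l: "lv (p x) < lv (g (p x))" using up[OF px(1,3)] px(4) by simp
      have "lv x < lv (g x)" using up[OF less.prems _ ne] by simp
      then have 1: "L (p x) < L (g x)" using mono[OF px(1) gX(1)[OF less.prems]] px by simp
      have "L x < L (g (p x))" using mono[OF less.prems gX(1)[OF px(1)]] l px by simp
      moreover have "g (p x) \<noteq> g x" using gX(2)[OF px(1)] gX(2)[OF less.prems] px(2) by metis
      ultimately have "L (g x) < L (g (g (p x)))" using g less.prems gX(1)[OF px(1)] by blast
      then show False using 1 gX(2)[OF px(1)] by simp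
    qed
  qed
  moreover have "g x = undefined" if "x \<notin> X" for x using g that by (auto simp: PiE_def extensional_def)
  ultimately show "g = restrict p X" unfolding restrict_def by (intro ext) simp
qed

context coxeter_system
begin

abbreviation edge (infix "\<rightarrow>\<^sub>B" 50) where "u \<rightarrow>\<^sub>B v \<equiv> bruhat_edge G S u v"

lemma edgeD:
  assumes "u \<rightarrow>\<^sub>B v" shows "u \<in> carrier G" "v \<in> carrier G" "\<ell> u < \<ell> v" "v \<otimes> inv u \<in> T"
  using assms by (auto simp: bruhat_edge_def)

lemma middle_vertices_iff: "x \<in> middle_vertices G S u v \<longleftrightarrow> u \<rightarrow>\<^sub>B x \<and> x \<rightarrow>\<^sub>B v"
proof
  assume "x \<in> middle_vertices G S u v"
  then obtain xs where x: "x \<noteq> u" "x \<noteq> v" "xs \<in> paths G S 2 u v" "x \<in> set xs"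
    unfolding middle_vertices_def by blast
  then have xs: "length xs = 3" "xs ! 0 = u" "xs ! 2 = v" "\<forall>i<2. xs ! i \<rightarrow>\<^sub>B xs ! Suc i"
    by (auto simp: paths_def)
  obtain i where "i < 3" "xs ! i = x" using x(4) xs(1) by (auto simp: in_set_conv_nth)
  then have "i = 1" using x xs by (cases i; cases "i - 1"; cases "i - 2") (auto simp: numeral_2_eq_2)
  then have "xs ! 1 = x" using \<open>xs ! i = x\<close> by simp
  then show "u \<rightarrow>\<^sub>B x \<and> x \<rightarrow>\<^sub>B v" using xs(2-4) by (auto simp: numeral_2_eq_2)
next
  assume e: "u \<rightarrow>\<^sub>B x \<and> x \<rightarrow>\<^sub>B v"
  then have "[u, x, v] \<in> paths G S 2 u v"
    by (auto simp: paths_def numeral_2_eq_2 less_Suc_eq dest: edgeD)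
  moreover have "x \<noteq> u" "x \<noteq> v" using e by (auto dest: edgeD(3))
  ultimately show "x \<in> middle_vertices G S u v" unfolding middle_vertices_def
    by (auto intro!: bexI[of _ "[u, x, v]"])
qed

lemma crt_nz: assumes "t \<in> T" shows "\<exists>p. crt t p \<noteq> 0"
proof (rule ccontr)
  assume "\<nexists>p. crt t p \<noteq> 0"
  then have "crt t = (\<lambda>p. 0)" by auto
  then have "rt t (\<lambda>p. 0) = 2" using rt_self[OF assms] by simp
  then show False using rt_lin[OF assms, of 0 unitF 0 unitF] by simp
qed

lemma act_fix_iff: assumes "t \<in> T" shows "act t F = F \<longleftrightarrow> rt t F = 0"
  using crt_nz[OF assms] unfolding act_refl[OF assms] by (auto simp: fun_eq_iff)

text \<open>For distinct \<open>t\<close> and \<open>r\<close> these are the reflections whose root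
  lies in the plane spanned by the roots of \<open>t\<close> and \<open>r\<close>, see
  \<open>fixplane_span\<close>. The formulation by common zeros passes directly to fixed
  points.\<close>

definition fixplane :: "'a \<Rightarrow> 'a \<Rightarrow> 'a set" where
  "fixplane t r = {q \<in> T. \<forall>F. rt t F = 0 \<and> rt r F = 0 \<longrightarrow> rt q F = 0}"

definition dmax :: "'a \<Rightarrow> 'a \<Rightarrow> 'a set" where "dmax t r = generate G (fixplane t r)"

lemma rt_separate:
  assumes "t \<in> T" "r \<in> T" "t \<noteq> r" shows "\<exists>F. rt t F = 1 \<and> rt r F = 0"
proof -
  have "\<exists>F. rt r F = 0 \<and> rt t F \<noteq> 0"
  proof (rule ccontr)
    assume no: "\<nexists>F. rt r F = 0 \<and> rt t F \<noteq> 0"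
    have "rt t F = (rt t (crt r) / 2) * rt r F" for F
    proof -
      let ?F = "\<lambda>p. 1 * F p + (- rt r F / 2) * crt r p"
      have "rt r ?F = 0" unfolding rt_lin[OF assms(2)] rt_self[OF assms(2)] by simp
      then have "rt t ?F = 0" using no by blast
      then show ?thesis unfolding rt_lin[OF assms(1)] by simp
    qed
    then show False using rt_proportional[OF assms(1,2)] assms(3) by blast
  qed
  then obtain F where F: "rt r F = 0" "rt t F \<noteq> 0" by blast
  let ?F = "\<lambda>p. (1 / rt t F) * F p + 0 * F p"
  have "rt t ?F = 1" "rt r ?F = 0" unfolding rt_lin[OF assms(1)] rt_lin[OF assms(2)] using F by simp_all
  then show ?thesis by blast
qed

lemma fixplane_span:
  assumes "t \<in> T" "r \<in> T" "t \<noteq> r" "q \<in> fixplane t r"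
  shows "\<exists>x y. \<forall>F. rt q F = x * rt t F + y * rt r F"
proof -
  have q: "q \<in> T" "\<And>F. rt t F = 0 \<Longrightarrow> rt r F = 0 \<Longrightarrow> rt q F = 0" using assms(4) by (auto simp: fixplane_def)
  obtain A where A: "rt t A = 1" "rt r A = 0" using rt_separate[OF assms(1-3)] by blast
  obtain B where B: "rt r B = 1" "rt t B = 0" using rt_separate[OF assms(2,1)] assms(3) by metis
  have "rt q F = rt q A * rt t F + rt q B * rt r F" for F
  proof -
    let ?C = "\<lambda>p. rt t F * A p + rt r F * B p"
    let ?F = "\<lambda>p. 1 * F p + (- 1) * ?C p"
    have "rt t ?F = 0" "rt r ?F = 0"
      unfolding rt_lin[OF assms(1)] rt_lin[OF assms(2)] using A B by simp_all
    then have "rt q ?F = 0" by (rule q(2))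
    then show ?thesis unfolding rt_lin[OF q(1)] by (simp add: algebra_simps)
  qed
  then show ?thesis by blast
qed

text \<open>The matrix that expresses the roots of \<open>a\<close> and \<open>b\<close> by those of
  \<open>t\<close> and \<open>r\<close> is invertible, since some points separate \<open>a\<close>
  from \<open>b\<close>; so both pairs of roots have the same common zeros.\<close>

lemma fixplane_change:
  assumes tr: "t \<in> T" "r \<in> T" "t \<noteq> r" and ab: "a \<in> fixplane t r" "b \<in> fixplane t r" "a \<noteq> b"
  shows "fixplane a b = fixplane t r"
proof -
  have T: "a \<in> T" "b \<in> T" using ab by (auto simp: fixplane_def)
  obtain x y where a: "\<And>F. rt a F = x * rt t F + y * rt r F" using fixplane_span[OF tr ab(1)] by blast
  obtain z w where b: "\<And>F. rt b F = z * rt t F + w * rt r F" using fixplane_span[OF tr ab(2)] by blast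
  have det: "x * w - y * z \<noteq> 0"
  proof
    assume d: "x * w - y * z = 0"
    obtain A where A: "rt a A = 1" "rt b A = 0" using rt_separate[OF T ab(3)] by blast
    obtain B where B: "rt b B = 1" "rt a B = 0" using rt_separate[OF T(2,1)] ab(3) by metis
    have "(x * w - y * z) * (rt t A * rt r B - rt t B * rt r A) = rt a A * rt b B - rt a B * rt b A"
      unfolding a b by (simp add: algebra_simps)
    then show False using d A B by simp
  qed
  have "rt a F = 0 \<and> rt b F = 0 \<longleftrightarrow> rt t F = 0 \<and> rt r F = 0" for F
  proof
    assume ab0: "rt a F = 0 \<and> rt b F = 0"
    have "(x * w - y * z) * rt t F = w * rt a F - y * rt b F"
      "(x * w - y * z) * rt r F = x * rt b F - z * rt a F" unfolding a b by (simp_all add: algebra_simps)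
    then show "rt t F = 0 \<and> rt r F = 0" using ab0 det by simp
  qed (simp add: a b)
  then show ?thesis unfolding fixplane_def by simp
qed

lemma dmax_reflection_subgroup: "reflection_subgroup G S (dmax t r)"
  unfolding reflection_subgroup_def dmax_def by (intro exI[of _ "fixplane t r"]) (auto simp: fixplane_def)

text \<open>Generating the group adds no reflections: each of its elements fixes the common fixed
  points of \<open>t\<close> and \<open>r\<close>.\<close>

lemma dmax_T: assumes "t \<in> T" "r \<in> T" shows "T \<inter> dmax t r = fixplane t r"
proof (intro equalityI subsetI)
  fix q assume "q \<in> T \<inter> dmax t r"
  then have q: "q \<in> T" "q \<in> generate G (fixplane t r)" by (auto simp: dmax_def)
  have sub: "fixplane t r \<subseteq> T" by (auto simp: fixplane_def)
  have "act q F = F" if F: "rt t F = 0" "rt r F = 0" for F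
    using q(2)
  proof induction
    case (inv h)
    then have "h \<in> T" using sub by blast
    then show ?case using inv F act_fix_iff by (simp add: fixplane_def)
  next
    case (eng h1 h2)
    then show ?case using generate_in_carrier[of "fixplane t r"] sub by (simp add: act_mult subset_iff)
  qed (use F act_fix_iff in \<open>auto simp: fixplane_def\<close>)
  then show "q \<in> fixplane t r" using q(1) act_fix_iff by (simp add: fixplane_def)
next
  fix q assume "q \<in> fixplane t r"
  then show "q \<in> T \<inter> dmax t r" by (auto simp: dmax_def fixplane_def intro: generate.incl)
qed

lemma in_fixplane: "t \<in> T \<Longrightarrow> t \<in> fixplane t r" "r \<in> T \<Longrightarrow> r \<in> fixplane t r"
  by (auto simp: fixplane_def)

text \<open>The coroots of \<open>q\<close> and \<open>p\<close> are linearly independent, so a point fixed by \<open>q p\<close> is fixed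
  by both.\<close>

lemma same_product_fixplane:
  assumes T: "t \<in> T" "r \<in> T" "q \<in> T" "p \<in> T" and ne: "t \<noteq> r" and eq: "t \<otimes> r = q \<otimes> p"
  shows "q \<in> fixplane t r" "p \<in> fixplane t r"
proof -
  have qp: "p \<noteq> q"
  proof
    assume "p = q"
    then have "t \<otimes> r = \<one>" using eq T by simp
    then show False using inv_equality[of t r] T ne by simp
  qed
  have "rt p F = 0 \<and> rt q F = 0" if F: "rt t F = 0" "rt r F = 0" for F
  proof -
    have "act t F = F" "act r F = F" using F act_fix_iff T by blast+
    then have "act (t \<otimes> r) F = F" using T by (simp add: act_mult)
    then have "act q (act p F) = F" using eq T by (simp add: act_mult)
    then have "act q (act q (act p F)) = act q F" by simp
    moreover have "act q (act q (act p F)) = act p F"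
      using act_mult[OF T_carrier[OF T(3)] T_carrier[OF T(3)]] T(3) by simp
    ultimately have e: "act p F = act q F" by simp
    have *: "rt p F * crt p x = rt q F * crt q x" for x
      using fun_cong[OF e, of x] unfolding act_refl[OF T(3)] act_refl[OF T(4)] by simp
    have "rt p F = 0"
    proof (rule ccontr)
      assume "rt p F \<noteq> 0"
      then have "crt p x = (rt q F / rt p F) * crt q x" for x using *[of x] by (simp add: field_simps)
      then show False using crt_proportional[OF T(4,3)] qp by blast
    qed
    then show ?thesis using * crt_nz[OF T(3)] by auto
  qed
  then show "q \<in> fixplane t r" "p \<in> fixplane t r" using T by (simp_all add: fixplane_def)
qed

end

context reflection_subgroup_of
begin

text \<open>Suppose y < 0. Evaluation at a point of the chamber gives x > 0. After moving this point
  by \<open>a\<close>, only the root of \<open>a\<close> has become negative, as \<open>a\<close> is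
  its only inversion in \<open>H\<close>; then the right-hand side is negative and the left-hand
  side positive.\<close>

lemma cgen_cone:
  assumes ab: "a \<in> \<chi> H" "b \<in> \<chi> H" "a \<noteq> b" and r: "r \<in> T" "r \<in> H"
    and rt: "\<And>F. rt r F = x * rt a F + y * rt b F"
  shows "y \<ge> 0"
proof (rule ccontr)
  assume "\<not> y \<ge> 0"
  then have y: "y < 0" by simp
  have aT: "a \<in> T" "a \<in> H" "N a \<inter> H = {a}" and bT: "b \<in> T" "b \<in> H" using ab cgens_iff by auto
  have "rt r unitF > 0" "rt b unitF > 0" "rt a unitF > 0" using rt_pos unitF_cham r aT bT by auto
  moreover then have "y * rt b unitF < 0" using y by (simp add: mult_less_0_iff)
  ultimately have "x * rt a unitF > 0" using rt[of unitF] by linarith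
  then have x: "x > 0" using \<open>rt a unitF > 0\<close> by (simp add: zero_less_mult_iff)
  have ra: "r \<noteq> a"
  proof
    assume "r = a"
    then have "rt b F = ((1 - x) / y) * rt a F" for F using rt[of F] y by (simp add: field_simps)
    then show False using rt_proportional[OF bT(1) aT(1)] ab(3) by blast
  qed
  let ?F = "act a unitF"
  have "rt a ?F < 0" using rt_act_sign(1)[OF aT(1) _ unitF_cham, of a] refl_in_N aT by simp
  moreover have "rt r ?F > 0" using rt_act_sign(2)[OF r(1) _ unitF_cham, of a] aT r ra by auto
  moreover have "b \<notin> N a" using aT bT ab(3) by auto
  then have "rt b ?F > 0" using rt_act_sign(2)[OF bT(1) _ unitF_cham, of a] aT by simp
  ultimately have "x * rt a ?F < 0" "y * rt b ?F < 0" "rt r ?F > 0"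
    using x y by (simp_all add: mult_less_0_iff)
  then show False using rt[of ?F] by linarith
qed

end

locale maximal_dihedral = rank_two_subgroup +
  assumes maximal: "p \<in> T \<Longrightarrow> p \<in> H \<Longrightarrow> q \<in> T \<Longrightarrow> q \<in> H \<Longrightarrow> p \<noteq> q \<Longrightarrow> fixplane p q = T \<inter> H"

context coxeter_system
begin

text \<open>A single canonical generator would leave only one reflection. The root of a third one
  would be a combination of those of \<open>a\<close> and \<open>b\<close> with nonnegative
  coefficients; solving for \<open>a\<close> and using \<open>cgen_cone\<close> again, one
  coefficient vanishes, and proportional roots belong to equal reflections.\<close>

lemma dmax_maximal_dihedral:
  assumes tr: "t \<in> T" "r \<in> T" "t \<noteq> r"
  shows "\<exists>a b. maximal_dihedral G S (dmax t r) a b"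
proof -
  let ?D = "dmax t r"
  interpret D: reflection_subgroup_of G S ?D using dmax_reflection_subgroup by unfold_locales
  have TD: "T \<inter> ?D = fixplane t r" using dmax_T tr by blast
  have trD: "t \<in> ?D" "r \<in> ?D" using TD in_fixplane tr by blast+
  have "N t \<inter> ?D \<noteq> {}" using refl_in_N tr trD by blast
  then obtain a where a: "a \<in> \<chi> ?D" using D.descent_cgen[of t] tr by auto
  have aT: "a \<in> T" "a \<in> ?D" using a cgens_iff by auto
  have "\<exists>b\<in>\<chi> ?D. b \<noteq> a"
  proof (rule ccontr)
    assume "\<not> (\<exists>b\<in>\<chi> ?D. b \<noteq> a)"
    then have chi: "\<chi> ?D = {a}" using a by blast
    have gen: "y = \<one> \<or> y = a" if "y \<in> generate G {a}" for y
      using that by induction (use aT in auto)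
    have "q = a" if q: "q \<in> T" "q \<in> ?D" for q
    proof -
      obtain y where y: "y \<in> generate G {a}" "q = y \<otimes> a \<otimes> inv y"
        using D.reflection_conj_cgen[OF q] unfolding chi by blast
      show ?thesis using gen[OF y(1)] unfolding y(2) using aT by auto
    qed
    then show False using tr trD by blast
  qed
  then obtain b where b: "b \<in> \<chi> ?D" "b \<noteq> a" by blast
  have bT: "b \<in> T" "b \<in> ?D" using b cgens_iff by auto
  have max: "fixplane p q = T \<inter> ?D" if "p \<in> T" "p \<in> ?D" "q \<in> T" "q \<in> ?D" "p \<noteq> q" for p q
    using fixplane_change[OF tr, of p q] that TD by auto
  have "c = a \<or> c = b" if c: "c \<in> \<chi> ?D" for c
  proof (rule ccontr)
    assume "\<not> (c = a \<or> c = b)"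
    then have ne: "c \<noteq> a" "c \<noteq> b" by auto
    have cT: "c \<in> T" "c \<in> ?D" using c cgens_iff by auto
    have "c \<in> fixplane a b" using max[OF aT bT] b cT by auto
    then obtain x y where xy: "\<And>F. rt c F = x * rt a F + y * rt b F"
      using fixplane_span[OF aT(1) bT(1)] b by metis
    have y: "y \<ge> 0" using D.cgen_cone[OF a b(1) _ cT xy] b by blast
    have "rt c F = y * rt b F + x * rt a F" for F using xy[of F] by simp
    then have x: "x \<ge> 0" using D.cgen_cone[OF b(1) a b(2) cT] by blast
    show False
    proof (cases "x = 0")
      case True
      then show False using rt_proportional[OF cT(1) bT(1), of y] xy ne by simp
    next
      case False
      then have "rt a F = (1 / x) * rt c F + (- y / x) * rt b F" for F using xy[of F] by (simp add: field_simps)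
      then have "- y / x \<ge> 0" using D.cgen_cone[OF c b(1) ne(2) aT] by blast
      then have "(- y / x) * x \<ge> 0" using x by (rule mult_nonneg_nonneg)
      then have "y = 0" using y False by simp
      then show False using rt_proportional[OF cT(1) aT(1), of x] xy ne by simp
    qed
  qed
  then have "\<chi> ?D = {a, b}" using a b by blast
  then have "maximal_dihedral G S ?D a b"
    using b(2) max by unfold_locales auto
  then show ?thesis by blast
qed

text \<open>The flip of \<open>x\<close> will be the other middle vertex not comparable to \<open>x\<close>; this description
  passes to cosets of reflection subgroups, although the lengths of the vertices change there.\<close>

definition comparable :: "'a \<Rightarrow> 'a \<Rightarrow> bool" where
  "comparable x y \<longleftrightarrow> (\<exists>z. x \<rightarrow>\<^sub>B z \<and> z \<rightarrow>\<^sub>B y \<or> y \<rightarrow>\<^sub>B z \<and> z \<rightarrow>\<^sub>B x)"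

end

context rank_two_subgroup
begin

lemma edge_iff_lev:
  assumes "y \<in> carrier G" "z \<in> carrier G" "z \<otimes> inv y \<in> H"
  shows "y \<rightarrow>\<^sub>B z \<longleftrightarrow> odd (lev y + lev z) \<and> lev y < lev z"
  unfolding bruhat_edge_def using assms T_iff_lev[OF assms] length_less_iff_lev[OF assms(1,2) _ assms(3)]
  by blast

lemma coset_trans: "\<lbrakk>x \<in> carrier G; y \<in> carrier G; z \<in> carrier G; y \<otimes> inv x \<in> H; z \<otimes> inv y \<in> H\<rbrakk> \<Longrightarrow> z \<otimes> inv x \<in> H"
  using H_mult[of "z \<otimes> inv y" "y \<otimes> inv x"] by (simp add: m_assoc)

lemma coset_sym: "\<lbrakk>x \<in> carrier G; y \<in> carrier G; y \<otimes> inv x \<in> H\<rbrakk> \<Longrightarrow> x \<otimes> inv y \<in> H"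
  using H_inv[of "y \<otimes> inv x"] by (simp add: inv_mult_group)

end

context maximal_dihedral
begin

text \<open>The labels of both paths are factorisations of v u^-1 into two reflections, and these
  lie in one plane by \<open>same_product_fixplane\<close>.\<close>

lemma middle_in_coset:
  assumes u: "u \<rightarrow>\<^sub>B x" "x \<rightarrow>\<^sub>B v" "x \<otimes> inv u \<in> H" "v \<otimes> inv x \<in> H"
    and y: "u \<rightarrow>\<^sub>B y" "y \<rightarrow>\<^sub>B v"
  shows "y \<otimes> inv u \<in> H"
proof -
  note c = edgeD[OF u(1)] edgeD[OF u(2)] edgeD[OF y(1)] edgeD[OF y(2)]
  have "v \<otimes> inv x \<noteq> x \<otimes> inv u"
  proof
    assume "v \<otimes> inv x = x \<otimes> inv u"
    then have "(v \<otimes> inv x) \<otimes> (x \<otimes> inv u) = \<one>" using c by simp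
    then have "v \<otimes> inv u = \<one>" using c by (simp add: m_assoc)
    then have "v = u" using c by (metis inv_equality inv_inv inv_closed)
    then show False using c by simp
  qed
  moreover have "(v \<otimes> inv x) \<otimes> (x \<otimes> inv u) = (v \<otimes> inv y) \<otimes> (y \<otimes> inv u)" using c by (simp add: m_assoc)
  ultimately have "y \<otimes> inv u \<in> fixplane (v \<otimes> inv x) (x \<otimes> inv u)"
    using same_product_fixplane c by blast
  then show ?thesis using maximal[OF c(8) u(4) c(4) u(3)] \<open>v \<otimes> inv x \<noteq> x \<otimes> inv u\<close> by blast
qed

text \<open>The middle vertices are the elements of the coset with a level strictly between the
  outer ones and of the opposite parity. Each such level has two elements, exchanged by the flip.
  Middle vertices on different levels are comparable: the levels differ by at least two, which
  leaves room for an element between them.\<close>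

lemma flip_level:
  assumes u: "u \<rightarrow>\<^sub>B x" "x \<rightarrow>\<^sub>B v" "x \<otimes> inv u \<in> H" "v \<otimes> inv x \<in> H"
  shows "flip G S u v x \<in> carrier G" "flip G S u v x \<otimes> inv x \<in> H"
    "flip G S u v x \<noteq> x" "lev (flip G S u v x) = lev x"
    "flip G S u v x \<in> middle_vertices G S u v" "\<not> comparable x (flip G S u v x)"
    "\<And>y. y \<in> middle_vertices G S u v \<Longrightarrow> y \<noteq> x \<Longrightarrow> \<not> comparable x y \<Longrightarrow> y = flip G S u v x"
    "\<And>z. z \<in> carrier G \<Longrightarrow> z \<otimes> inv x \<in> H \<Longrightarrow> z \<noteq> x \<Longrightarrow> lev z = lev x \<Longrightarrow> z = flip G S u v x"
proof -
  let ?X = "middle_vertices G S u v"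
  note c = edgeD[OF u(1)] edgeD[OF u(2)]
  have uv: "v \<otimes> inv u \<in> H" using coset_trans[of u x v] u c by blast
  have X: "y \<in> ?X \<longleftrightarrow> y \<in> carrier G \<and> y \<otimes> inv u \<in> H \<and> odd (lev u + lev y) \<and> odd (lev y + lev v) \<and> lev u < lev y \<and> lev y < lev v" for y
  proof
    assume y: "y \<in> ?X"
    then have yc: "u \<rightarrow>\<^sub>B y" "y \<rightarrow>\<^sub>B v" "y \<in> carrier G" using middle_vertices_iff edgeD by blast+
    then have yu: "y \<otimes> inv u \<in> H" using middle_in_coset[OF u] by blast
    have "v \<otimes> inv y \<in> H" using coset_trans[of y u v] coset_sym[of u y] yu uv c yc by blast
    then show "y \<in> carrier G \<and> y \<otimes> inv u \<in> H \<and> odd (lev u + lev y) \<and> odd (lev y + lev v) \<and> lev u < lev y \<and> lev y < lev v"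
      using edge_iff_lev[of u y] edge_iff_lev[of y v] yc yu c by blast
  next
    assume y: "y \<in> carrier G \<and> y \<otimes> inv u \<in> H \<and> odd (lev u + lev y) \<and> odd (lev y + lev v) \<and> lev u < lev y \<and> lev y < lev v"
    then have "v \<otimes> inv y \<in> H" using coset_trans[of y u v] coset_sym[of u y] uv c by blast
    then show "y \<in> ?X" using middle_vertices_iff edge_iff_lev[of u y] edge_iff_lev[of y v] y c by blast
  qed
  have co: "z \<otimes> inv y \<in> H" if "y \<in> ?X" "z \<in> ?X" for y z
    using coset_trans[of y u z] coset_sym[of u y] that X c by blast
  have pex: "\<exists>z. z \<in> carrier G \<and> z \<otimes> inv y \<in> H \<and> z \<noteq> y \<and> lev z = lev y \<and>
    (\<forall>z'\<in>carrier G. z' \<otimes> inv y \<in> H \<and> lev z' = lev y \<longrightarrow> z' = y \<or> z' = z)" if y: "y \<in> ?X" for y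
  proof -
    have "v \<otimes> inv y \<in> H" using coset_trans[of y u v] coset_sym[of u y] uv c X y by blast
    moreover have "y \<in> carrier G" "0 < lev y" "lev y < lev v" using X y by auto
    ultimately show ?thesis using level_partner[OF _ c(6)] by blast
  qed
  define p where "p y = (SOME z. z \<in> carrier G \<and> z \<otimes> inv y \<in> H \<and> z \<noteq> y \<and> lev z = lev y \<and>
    (\<forall>z'\<in>carrier G. z' \<otimes> inv y \<in> H \<and> lev z' = lev y \<longrightarrow> z' = y \<or> z' = z))" for y
  have p: "p y \<in> carrier G" "p y \<otimes> inv y \<in> H" "p y \<noteq> y" "lev (p y) = lev y"
    "\<And>z'. z' \<in> carrier G \<Longrightarrow> z' \<otimes> inv y \<in> H \<Longrightarrow> lev z' = lev y \<Longrightarrow> z' = y \<or> z' = p y" if y: "y \<in> ?X" for y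
    using someI_ex[OF pex[OF y]] unfolding p_def by blast+
  have pX: "p y \<in> ?X" if y: "y \<in> ?X" for y
    using X p[OF y] coset_trans[of u y "p y"] c y by auto
  have pp: "p (p y) = y" if y: "y \<in> ?X" for y
    using p(5)[OF pX[OF y], of y] p[OF y] coset_sym[of y "p y"] X y by auto
  have mono: "y \<rightarrow>\<^sub>B z \<or> (\<exists>q. y \<rightarrow>\<^sub>B q \<and> q \<rightarrow>\<^sub>B z)" if y: "y \<in> ?X" "z \<in> ?X" "lev y < lev z" for y z
  proof -
    have "odd (lev y + lev u)" "odd (lev u + lev z)" using X y by (auto simp: add.commute)
    then have l: "Suc (lev y) < lev z" using y(3) by presburger
    have yz: "y \<in> carrier G" "z \<in> carrier G" using X y by blast+
    obtain q where q: "q \<in> carrier G" "q \<otimes> inv z \<in> H" "lev q = Suc (lev y)"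
      using level_below[OF yz(2) less_imp_le[OF l]] by blast
    have "q \<otimes> inv y \<in> H" using coset_trans[OF yz(1,2) q(1)] co[OF y(1,2)] q by blast
    then have "y \<rightarrow>\<^sub>B q" using edge_iff_lev[of y q] yz q by simp
    moreover have "odd (lev q + lev z)" using \<open>odd (lev y + lev u)\<close> \<open>odd (lev u + lev z)\<close> q by presburger
    then have "q \<rightarrow>\<^sub>B z" using edge_iff_lev[of q z] yz q l coset_sym[OF yz(2) q(1)] by simp
    ultimately show ?thesis by blast
  qed
  have monoL: "\<ell> y < \<ell> z" if y: "y \<in> ?X" "z \<in> ?X" "lev y < lev z" for y z
    using mono[OF that] by (meson edgeD(3) less_trans)
  have "flip G S u v = restrict p ?X"
    unfolding flip_def
  proof (rule level_flip_unique[where lv = lev])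
    show "p x \<in> ?X \<and> p x \<noteq> x \<and> lev (p x) = lev x \<and> p (p x) = x" if "x \<in> ?X" for x
      using p[OF that] pX[OF that] pp[OF that] by blast
    show "y = x \<or> y = p x" if "x \<in> ?X" "y \<in> ?X" "lev x = lev y" for x y
      using p(5)[OF that(1), of y] co[OF that(1,2)] X that by auto
    show "\<ell> y < \<ell> z" if "y \<in> ?X" "z \<in> ?X" "lev y < lev z" for y z
      using monoL[OF that] .
  qed
  moreover have x: "x \<in> ?X" using middle_vertices_iff u by blast
  ultimately have f: "flip G S u v x = p x" by simp
  show "flip G S u v x \<in> carrier G" unfolding f by (rule p(1)[OF x])
  show "flip G S u v x \<otimes> inv x \<in> H" unfolding f by (rule p(2)[OF x])
  show "flip G S u v x \<noteq> x" unfolding f by (rule p(3)[OF x])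
  show "lev (flip G S u v x) = lev x" unfolding f by (rule p(4)[OF x])
  show "flip G S u v x \<in> ?X" unfolding f by (rule pX[OF x])
  have cmp: "lev y < lev z" if yz: "y \<rightarrow>\<^sub>B q" "q \<rightarrow>\<^sub>B z" "y \<in> ?X" "z \<in> ?X" for y z q
  proof -
    note qc = edgeD[OF yz(1)] edgeD[OF yz(2)]
    have zne: "lev y \<noteq> lev z"
    proof
      assume eq: "lev y = lev z"
      have *: "y \<noteq> z" using qc(3,7) by auto
      have zy: "z \<otimes> inv y \<in> H" using co yz(3,4) by blast
      have "lev u < lev y" using X yz(3) by blast
      then obtain j where j: "lev y = Suc j" by (cases "lev y") auto
      \<comment> \<open>A common lower neighbour of \<open>y\<close> and \<open>z\<close> inside the
        coset. It writes z y^-1 as a product of two reflections of \<open>H\<close>, so a path from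
        \<open>y\<close> over \<open>q\<close> to \<open>z\<close> cannot leave the coset, where
        levels strictly increase.\<close>
      obtain w where w: "w \<in> carrier G" "w \<otimes> inv y \<in> H" "lev w = j"
        using level_below[of y j] j qc by auto
      have wy: "w \<rightarrow>\<^sub>B y" using edge_iff_lev[OF w(1) qc(1)] coset_sym[OF qc(1) w(1,2)] w j by simp
      have wzH: "z \<otimes> inv w \<in> H" using coset_trans[OF w(1) qc(1) qc(6)] coset_sym[OF qc(1) w(1,2)] zy by blast
      have wz: "w \<rightarrow>\<^sub>B z" using edge_iff_lev[OF w(1) qc(6) wzH] w j eq by simp
      have T1: "y \<otimes> inv w \<in> T" "z \<otimes> inv w \<in> T" using edgeD wy wz by auto
      have H1: "y \<otimes> inv w \<in> H" "z \<otimes> inv w \<in> H" using coset_sym[OF qc(1) w(1,2)] wzH by blast+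
      have ne: "z \<otimes> inv w \<noteq> y \<otimes> inv w" using * qc(1,6) w(1) by simp
      have "(z \<otimes> inv w) \<otimes> (y \<otimes> inv w) = (z \<otimes> inv w) \<otimes> inv (y \<otimes> inv w)" using T1 by simp
      also have "\<dots> = z \<otimes> inv y" using qc w by (simp add: m_assoc inv_mult_group)
      also have "\<dots> = (z \<otimes> inv q) \<otimes> (q \<otimes> inv y)" using qc by (simp add: m_assoc)
      finally have "q \<otimes> inv y \<in> fixplane (z \<otimes> inv w) (y \<otimes> inv w)"
        "z \<otimes> inv q \<in> fixplane (z \<otimes> inv w) (y \<otimes> inv w)"
        using same_product_fixplane[OF T1(2,1) _ _ ne] qc by blast+
      then have qH: "q \<otimes> inv y \<in> H" "z \<otimes> inv q \<in> H" using maximal[OF T1(2) H1(2) T1(1) H1(1) ne] by blast+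
      have "lev y < lev q" "lev q < lev z"
        using edge_iff_lev[OF qc(1,2) qH(1)] edge_iff_lev[OF qc(5,6) qH(2)] yz by auto
      then show False using eq by simp
    qed
    moreover have "\<not> lev z < lev y"
    proof
      assume "lev z < lev y"
      then have "\<ell> z < \<ell> y" using monoL[OF yz(4,3)] by blast
      then show False using qc by simp
    qed
    ultimately show ?thesis by linarith
  qed
  show "\<not> comparable x (flip G S u v x)"
    unfolding f comparable_def using cmp[OF _ _ x pX[OF x]] cmp[OF _ _ pX[OF x] x] p(4)[OF x] by (metis less_irrefl)
  show "y = flip G S u v x" if y: "y \<in> ?X" "y \<noteq> x" "\<not> comparable x y" for y
  proof -
    have edge: "\<not> a \<rightarrow>\<^sub>B b" if "a \<in> ?X" "b \<in> ?X" for a b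
    proof
      assume "a \<rightarrow>\<^sub>B b"
      moreover have "odd (lev u + lev a)" "odd (lev u + lev b)" "a \<in> carrier G" "b \<in> carrier G"
        using X that by blast+
      ultimately show False using edge_iff_lev[of a b] co[OF that] by auto
    qed
    have "lev x = lev y"
      using mono[OF x y(1)] mono[OF y(1) x] edge[OF x y(1)] edge[OF y(1) x] y(3)
      unfolding comparable_def by (metis linorder_neqE_nat)
    moreover have "y \<in> carrier G" using X y(1) by blast
    ultimately show ?thesis unfolding f using p(5)[OF x, of y] co[OF x y(1)] y(2) by metis
  qed
  show "z = flip G S u v x" if "z \<in> carrier G" "z \<otimes> inv x \<in> H" "z \<noteq> x" "lev z = lev x" for z
    unfolding f using p(5)[OF x that(1,2)] that by blast
qed

end

context coxeter_system
begin

lemma flip_maximal_dihedral: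
  assumes "u \<rightarrow>\<^sub>B x" "x \<rightarrow>\<^sub>B v"
  shows "\<exists>D a b. maximal_dihedral G S D a b \<and> x \<otimes> inv u \<in> D \<and> v \<otimes> inv x \<in> D \<and>
    D = dmax (v \<otimes> inv x) (x \<otimes> inv u) \<and> v \<otimes> inv x \<noteq> x \<otimes> inv u"
proof -
  note c = edgeD[OF assms(1)] edgeD[OF assms(2)]
  have ne: "v \<otimes> inv x \<noteq> x \<otimes> inv u"
  proof
    assume "v \<otimes> inv x = x \<otimes> inv u"
    then have "(v \<otimes> inv x) \<otimes> (x \<otimes> inv u) = \<one>" using c by simp
    then have "v \<otimes> inv u = \<one>" using c by (simp add: m_assoc)
    then have "v = u" using c by (metis inv_equality inv_inv inv_closed)
    then show False using c by simp
  qed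
  obtain a b where m: "maximal_dihedral G S (dmax (v \<otimes> inv x) (x \<otimes> inv u)) a b"
    using dmax_maximal_dihedral[OF c(8,4) ne] by blast
  have "T \<inter> dmax (v \<otimes> inv x) (x \<otimes> inv u) = fixplane (v \<otimes> inv x) (x \<otimes> inv u)" using dmax_T c by blast
  then have "x \<otimes> inv u \<in> dmax (v \<otimes> inv x) (x \<otimes> inv u)" "v \<otimes> inv x \<in> dmax (v \<otimes> inv x) (x \<otimes> inv u)"
    using in_fixplane c by blast+
  then show ?thesis using m ne by blast
qed

text \<open>The flip described without any dihedral subgroup, so that it can be compared between a
  group and its subgroups.\<close>

lemma flip_char:
  assumes "x \<in> middle_vertices G S u v"
  shows "flip G S u v x \<in> middle_vertices G S u v" "flip G S u v x \<noteq> x" "\<not> comparable x (flip G S u v x)"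
    "\<And>y. y \<in> middle_vertices G S u v \<Longrightarrow> y \<noteq> x \<Longrightarrow> \<not> comparable x y \<Longrightarrow> y = flip G S u v x"
    "flip G S u v (flip G S u v x) = x"
proof -
  have e: "u \<rightarrow>\<^sub>B x" "x \<rightarrow>\<^sub>B v" using assms middle_vertices_iff by blast+
  obtain D a b where D: "maximal_dihedral G S D a b" "x \<otimes> inv u \<in> D" "v \<otimes> inv x \<in> D"
    using flip_maximal_dihedral[OF e] by blast
  interpret D: maximal_dihedral G S D a b by (rule D(1))
  note f = D.flip_level[OF e D(2,3)]
  show "flip G S u v x \<in> middle_vertices G S u v" "flip G S u v x \<noteq> x" "\<not> comparable x (flip G S u v x)"
    "\<And>y. y \<in> middle_vertices G S u v \<Longrightarrow> y \<noteq> x \<Longrightarrow> \<not> comparable x y \<Longrightarrow> y = flip G S u v x"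
    by (fact f)+
  define y where "y = flip G S u v x"
  have y: "u \<rightarrow>\<^sub>B y" "y \<rightarrow>\<^sub>B v" using f(5) middle_vertices_iff y_def by blast+
  obtain D' a' b' where D': "maximal_dihedral G S D' a' b'" "y \<otimes> inv u \<in> D'" "v \<otimes> inv y \<in> D'"
    using flip_maximal_dihedral[OF y] by blast
  interpret D': maximal_dihedral G S D' a' b' by (rule D'(1))
  have "\<not> comparable y x" using f(6) unfolding comparable_def y_def by blast
  then show "flip G S u v (flip G S u v x) = x"
    using D'.flip_level(7)[OF y D'(2,3) assms] f(3) unfolding y_def by metis
qed

end

section \<open>Existence of reflection orderings\<close>

text \<open>Well-order the arguments; \<open>P\<close> holds if the function is positive at the
  first argument where it does not vanish.\<close>

lemma lex_positive_functions:
  "\<exists>P :: ('b \<Rightarrow> real) \<Rightarrow> bool. (\<forall>f. P f \<longrightarrow> \<not> P (\<lambda>x. - f x)) \<and>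
     (\<forall>f. (\<exists>x. f x \<noteq> 0) \<longrightarrow> P f \<or> P (\<lambda>x. - f x)) \<and>
     (\<forall>f g. P f \<and> P g \<longrightarrow> P (\<lambda>x. f x + g x)) \<and> (\<forall>f c. P f \<and> c > 0 \<longrightarrow> P (\<lambda>x. c * f x))"
proof -
  obtain r :: "'b rel" where r: "well_order_on UNIV r" using well_order_on by blast
  define L where "L = r - Id"
  have wf: "wf L" using r by (simp add: well_order_on_def L_def)
  have tot: "(x, y) \<in> L \<or> x = y \<or> (y, x) \<in> L" for x y
    using r unfolding well_order_on_def linear_order_on_def total_on_def L_def by auto
  have tr: "(x, z) \<in> L" if "(x, y) \<in> L" "(y, z) \<in> L" for x y z
    using r that unfolding well_order_on_def linear_order_on_def partial_order_on_def preorder_on_def L_def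
    by (auto dest: transD antisymD)
  define P where "P f \<longleftrightarrow> (\<exists>x. f x > 0 \<and> (\<forall>y. (y, x) \<in> L \<longrightarrow> f y = 0))" for f :: "'b \<Rightarrow> real"
  have "\<not> P (\<lambda>x. - f x)" if Pf: "P f" for f
  proof
    assume "P (\<lambda>x. - f x)"
    then obtain y where y: "- f y > 0" "\<forall>z. (z, y) \<in> L \<longrightarrow> - f z = 0" unfolding P_def by blast
    obtain x where "f x > 0" "\<forall>z. (z, x) \<in> L \<longrightarrow> f z = 0" using Pf unfolding P_def by blast
    then show False using y tot[of x y] by force
  qed
  moreover have "P f \<or> P (\<lambda>x. - f x)" if fx: "f x \<noteq> 0" for f x
  proof -
    obtain z where z: "z \<in> {z. f z \<noteq> 0}" "\<And>y. (y, z) \<in> L \<Longrightarrow> y \<notin> {z. f z \<noteq> 0}"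
      using wfE_min[OF wf, of x "{z. f z \<noteq> 0}"] fx by blast
    then show ?thesis unfolding P_def by (cases "f z > 0") (auto intro!: exI[of _ z])
  qed
  moreover have "P (\<lambda>x. f x + g x)" if fg: "P f" "P g" for f g
  proof -
    obtain x y where x: "f x > 0" "\<And>z. (z, x) \<in> L \<Longrightarrow> f z = 0" and y: "g y > 0" "\<And>z. (z, y) \<in> L \<Longrightarrow> g z = 0"
      using fg unfolding P_def by blast
    consider "(x, y) \<in> L" | "x = y" | "(y, x) \<in> L" using tot by blast
    then show ?thesis
    proof cases
      case 1 then show ?thesis unfolding P_def using x y tr by (intro exI[of _ x]) auto
    next
      case 2 then show ?thesis unfolding P_def using x y by (intro exI[of _ x]) auto
    next
      case 3 then show ?thesis unfolding P_def using x y tr by (intro exI[of _ y]) auto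
    qed
  qed
  moreover have "P (\<lambda>x. c * f x)" if "P f" "c > 0" for f c
    using that unfolding P_def by (metis mult_pos_pos mult_zero_right)
  ultimately show ?thesis by (intro exI[of _ P]) blast
qed

lemma cp_add: "cp c (Suc (i + j)) = cp c (Suc i) * cp c (Suc j) - cp c i * cp c j"
proof (induction i rule: induct_nat_012)
  case (ge2 n)
  have "cp c (Suc (Suc (Suc n) + j)) = c * cp c (Suc (Suc n + j)) - cp c (Suc (n + j))" by simp
  also have "\<dots> = c * (cp c (Suc (Suc n)) * cp c (Suc j) - cp c (Suc n) * cp c j) -
      (cp c (Suc n) * cp c (Suc j) - cp c n * cp c j)" by (simp only: ge2)
  finally show ?case by (simp add: algebra_simps)
qed auto

text \<open>With \<open>cp_add\<close>, the determinants formed from the coefficients of two roots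
  of a dihedral subgroup. Their signs decide which root comes first.\<close>

lemma cp_diff: "cp c (Suc i) * cp c (i + k) - cp c i * cp c (Suc (i + k)) = cp c k"
  by (induction i) (auto simp: algebra_simps)

lemma (in group) pow_shift:
  assumes "x \<in> carrier G" "y \<in> carrier G"
  shows "x \<otimes> (y \<otimes> x) [^] (i::nat) \<otimes> y = (x \<otimes> y) [^] Suc i"
proof (induction i)
  case (Suc i)
  have "x \<otimes> (y \<otimes> x) [^] Suc i \<otimes> y = (x \<otimes> (y \<otimes> x) [^] i \<otimes> y) \<otimes> (x \<otimes> y)"
    using assms by (simp add: m_assoc)
  then show ?case unfolding Suc using assms by simp
qed (use assms in simp)

context coxeter_system
begin

lemma rt_conj:
  assumes t: "t \<in> T" and w: "w \<in> carrier G"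
  shows "\<exists>k. k \<noteq> 0 \<and> (\<forall>F. rt t (act w F) = k * rt (inv w \<otimes> t \<otimes> w) F)"
proof -
  define r where "r = inv w \<otimes> t \<otimes> w"
  have r: "r \<in> T" using T_conj'[OF t w] by (simp add: r_def)
  define v where "v = act (inv w) (crt t)"
  obtain p where p: "crt r p \<noteq> 0" using crt_nz[OF r] by blast
  have eq: "rt r F * crt r p = rt t (act w F) * v p" for F
  proof -
    have "act r F = act (inv w) (act t (act w F))" using t w by (simp add: r_def act_mult)
    also have "act t (act w F) = (\<lambda>p. 1 * act w F p + (- rt t (act w F)) * crt t p)"
      unfolding act_refl[OF t] by simp
    also have "act (inv w) \<dots> = (\<lambda>p. 1 * F p + (- rt t (act w F)) * v p)"
      unfolding act_lin[OF inv_closed[OF w]] using w by (simp add: v_def)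
    finally show ?thesis unfolding act_refl[OF r] by (auto dest: fun_cong[of _ _ p])
  qed
  have "v p \<noteq> 0" using eq[of unitF] p rt_pos[OF r unitF_cham] by auto
  then show ?thesis using eq p
    by (intro exI[of _ "crt r p / v p"]) (auto simp: field_simps simp flip: r_def)
qed

definition ht :: "'a \<Rightarrow> real" where "ht t = rt t unitF"

text \<open>The positive root scaled to the value 1 at \<open>unitF\<close>. So scaled, the roots of
  a dihedral subgroup lie on the segment between those of its two generators, and any linear
  comparison orders them monotonically.\<close>

definition nrt :: "'a \<Rightarrow> ('a \<times> bool \<Rightarrow> real) \<Rightarrow> real" where "nrt t F = rt t F / ht t"

lemma ht_pos: "t \<in> T \<Longrightarrow> ht t > 0"
  unfolding ht_def using rt_pos unitF_cham by blast

end

context rank_two_subgroup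
begin

lemma swap: "rank_two_subgroup G S H b a"
  using reflection_subgroup_of_axioms cgens ab_ne
  by (auto simp: rank_two_subgroup_def rank_two_subgroup_axioms_def)

lemma ab_T: "a \<in> T" "b \<in> T" "a \<in> H" "b \<in> H"
  using cgens cgens_iff by blast+

definition "cc = - rt a (crt b)"
definition "uu i = a \<otimes> (b \<otimes> a) [^] (i::nat)"
definition "vv i = b \<otimes> (a \<otimes> b) [^] (i::nat)"

lemma uu_vv_Suc: "uu (Suc i) = a \<otimes> vv i \<otimes> a" "vv (Suc i) = b \<otimes> uu i \<otimes> b"
  using pow_shift[of b a i] pow_shift[of a b i] ab_T by (simp_all add: uu_def vv_def m_assoc)

lemma uu_vv_T: "uu i \<in> T \<inter> H \<and> vv i \<in> T \<inter> H"
proof (induction i)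
  case 0 then show ?case using ab_T by (simp add: uu_def vv_def)
next
  case (Suc i)
  then show ?case unfolding uu_vv_Suc using T_conj[of "vv i" a] T_conj[of "uu i" b] ab_T by auto
qed

text \<open>Each step conjugates by a generator, which acts on the two coefficients by the Chebyshev
  recursion. The factor \<open>k\<close> absorbs the sign and scale that conjugation leaves
  open.\<close>

lemma dihedral_root:
  "(\<exists>k. k \<noteq> 0 \<and> (\<forall>F. k * rt (uu i) F = cp cc (Suc i) * rt a F + cp cc i * rt b F)) \<and>
   (\<exists>k. k \<noteq> 0 \<and> (\<forall>F. k * rt (vv i) F = cp cc i * rt a F + cp cc (Suc i) * rt b F))"
proof (induction i)
  case 0
  show ?case using ab_T by (intro conjI exI[of _ 1]) (simp_all add: uu_def vv_def)
next
  case (Suc i)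
  have step: "\<exists>k. k \<noteq> 0 \<and> (\<forall>F. k * rt (x \<otimes> r \<otimes> x) F = cp cc (Suc (Suc i)) * rt x F + cp cc (Suc i) * rt y F)"
    if x: "x \<in> T" "y \<in> T" "rt y (crt x) = - cc" and r: "r \<in> T"
      and ex: "\<exists>k. k \<noteq> 0 \<and> (\<forall>F. k * rt r F = cp cc i * rt x F + cp cc (Suc i) * rt y F)" for x y r
  proof -
    obtain k where k: "k \<noteq> 0" "\<And>F. k * rt r F = cp cc i * rt x F + cp cc (Suc i) * rt y F" using ex by blast
    obtain l where l: "l \<noteq> 0" "\<And>F. rt r (act x F) = l * rt (inv x \<otimes> r \<otimes> x) F"
      using rt_conj[OF r T_carrier[OF x(1)]] by blast
    have "k * l * rt (x \<otimes> r \<otimes> x) F = cp cc (Suc (Suc i)) * rt x F + cp cc (Suc i) * rt y F" for F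
    proof -
      have e: "act x F = (\<lambda>p. 1 * F p + (- rt x F) * crt x p)" unfolding act_refl[OF x(1)] by simp
      have "rt x (act x F) = - rt x F" unfolding e rt_lin[OF x(1)] rt_self[OF x(1)] by simp
      moreover have "rt y (act x F) = rt y F + cc * rt x F" unfolding e rt_lin[OF x(2)] x(3) by simp
      ultimately have "k * rt r (act x F) = cp cc i * (- rt x F) + cp cc (Suc i) * (rt y F + cc * rt x F)"
        unfolding k(2) by simp
      then show ?thesis using l(2)[of F] x(1) by (simp add: algebra_simps)
    qed
    then show ?thesis using k(1) l(1) by (intro exI[of _ "k * l"]) auto
  qed
  have sym: "rt b (crt a) = - cc" "rt a (crt b) = - cc" using rt_sym[of a b] ab_T by (simp_all add: cc_def)
  have 1: "\<exists>k. k \<noteq> 0 \<and> (\<forall>F. k * rt (uu (Suc i)) F = cp cc (Suc (Suc i)) * rt a F + cp cc (Suc i) * rt b F)"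
    unfolding uu_vv_Suc using step[of a b "vv i"] Suc sym ab_T uu_vv_T by blast
  have "\<exists>k. k \<noteq> 0 \<and> (\<forall>F. k * rt (uu i) F = cp cc i * rt b F + cp cc (Suc i) * rt a F)"
    using Suc by (simp add: add.commute)
  then have "\<exists>k. k \<noteq> 0 \<and> (\<forall>F. k * rt (vv (Suc i)) F = cp cc (Suc (Suc i)) * rt b F + cp cc (Suc i) * rt a F)"
    unfolding uu_vv_Suc using step[of b a "uu i"] sym ab_T uu_vv_T by blast
  then show ?case using 1 by (simp add: add.commute)
qed

lemma cp_same_sign: "cp cc (Suc i) > 0 \<Longrightarrow> cp cc i \<ge> 0" "cp cc i > 0 \<Longrightarrow> cp cc (Suc i) \<ge> 0"
proof -
  obtain k where k: "k \<noteq> 0" "\<And>F. k * rt (uu i) F = cp cc (Suc i) * rt a F + cp cc i * rt b F"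
    using dihedral_root[of i] by blast
  have ab: "a \<in> \<chi> H" "b \<in> \<chi> H" using cgens by auto
  have u: "uu i \<in> T" "uu i \<in> H" using uu_vv_T by auto
  have e1: "rt (uu i) F = (cp cc (Suc i) / k) * rt a F + (cp cc i / k) * rt b F" for F
    using k(1) k(2)[of F] by (simp add: field_simps)
  have e2: "rt (uu i) F = (cp cc i / k) * rt b F + (cp cc (Suc i) / k) * rt a F" for F
    using e1[of F] by simp
  have 1: "cp cc i / k \<ge> 0" using cgen_cone[OF ab ab_ne u e1] .
  have 2: "cp cc (Suc i) / k \<ge> 0" using cgen_cone[OF ab(2,1) ab_ne[symmetric] u e2] .
  show "cp cc (Suc i) > 0 \<Longrightarrow> cp cc i \<ge> 0" "cp cc i > 0 \<Longrightarrow> cp cc (Suc i) \<ge> 0"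
    using 1 2 k(1) by (auto simp: zero_le_divide_iff)
qed

text \<open>\<open>cc\<close> is not known to be twice a cosine, so the sign comes from the cone
  property through \<open>cp_same_sign\<close>. A vanishing value at n + 1 would give
  \<open>uu n = b\<close>, that is (ab)^(n+1) = 1, against the bound on the order.\<close>

lemma cp_dihedral_pos:
  "0 < n \<Longrightarrow> ord (a \<otimes> b) = 0 \<or> n < ord (a \<otimes> b) \<Longrightarrow> cp cc n > 0"
proof (induction n)
  case (Suc n)
  show ?case
  proof (cases "n = 0")
    case False
    then have n: "cp cc n > 0" using Suc by auto
    have "cp cc (Suc n) \<noteq> 0"
    proof
      assume z: "cp cc (Suc n) = 0"
      obtain k where k: "k \<noteq> 0" "\<And>F. k * rt (uu n) F = cp cc (Suc n) * rt a F + cp cc n * rt b F"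
        using dihedral_root[of n] by blast
      have "rt (uu n) F = (cp cc n / k) * rt b F" for F using k(1) k(2)[of F] z by (simp add: field_simps)
      then have "uu n = b" using rt_proportional[of "uu n" b] uu_vv_T ab_T by blast
      then have "a \<otimes> (b \<otimes> a) [^] n \<otimes> b = \<one>" using ab_T by (simp add: uu_def)
      then have "(a \<otimes> b) [^] Suc n = \<one>" using pow_shift[of a b n] ab_T by (simp del: nat_pow_Suc)
      then have "ord (a \<otimes> b) dvd Suc n" using pow_eq_id[of "a \<otimes> b" "Suc n"] ab_T by (simp del: nat_pow_Suc)
      then show False using Suc.prems(2) by (auto dest: dvd_imp_le)
    qed
    then show ?thesis using cp_same_sign(2)[OF n] by simp
  qed simp
qed simp

lemma cp_dihedral_nonneg: "ord (a \<otimes> b) = 0 \<or> n \<le> ord (a \<otimes> b) \<Longrightarrow> cp cc n \<ge> 0"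
proof (cases n)
  case (Suc k)
  assume m: "ord (a \<otimes> b) = 0 \<or> n \<le> ord (a \<otimes> b)"
  show ?thesis
  proof (cases "k = 0")
    case False
    then have "cp cc k > 0" using cp_dihedral_pos[of k] m Suc by auto
    then show ?thesis using cp_same_sign(2) Suc by blast
  qed (simp add: Suc)
qed simp

text \<open>The difference of two normalised roots of the subgroup is a multiple of that for
  \<open>b\<close> and \<open>a\<close>. The factor has the sign of the determinant of the
  coefficients, and these determinants are Chebyshev values with index at most the order.\<close>

lemma dihedral_increasing_lex:
  assumes P: "\<And>f c. P f \<Longrightarrow> c > (0::real) \<Longrightarrow> P (\<lambda>x. c * f x)"
    and ab: "P (\<lambda>F. nrt b F - nrt a F)"
    and R: "\<And>t r. (t, r) \<in> R \<longleftrightarrow> t \<in> T \<and> r \<in> T \<and> (t = r \<or> P (\<lambda>F. nrt r F - nrt t F))"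
  shows "dihedral_increasing G R a b"
proof -
  have cmp: "(t, r) \<in> R" if tr: "t \<in> T" "r \<in> T" and k: "k \<noteq> 0" "\<And>F. k * rt t F = x * rt a F + y * rt b F"
    and l: "l \<noteq> 0" "\<And>F. l * rt r F = x' * rt a F + y' * rt b F"
    and nn: "x \<ge> 0" "y \<ge> 0" "x' \<ge> 0" "y' \<ge> 0" "x * y' - y * x' \<ge> 0" for t r k x y l x' y'
  proof -
    have pos: "ht t > 0" "ht r > 0" "ht a > 0" "ht b > 0" using ht_pos tr ab_T by blast+
    have "k * ht t \<ge> 0" "l * ht r \<ge> 0" using k(2)[of unitF] l(2)[of unitF] pos nn by (simp_all add: ht_def)
    then have kl: "k > 0" "l > 0" using k(1) l(1) pos by (auto simp: zero_le_mult_iff)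
    \<comment> \<open>The factor found by bringing both normalised roots to a common
      denominator.\<close>
    define q where "q = (x * y' - y * x') * ht a * ht b / (k * ht t * (l * ht r))"
    have q: "q \<ge> 0" unfolding q_def using nn pos kl by simp
    have eq: "nrt r F - nrt t F = q * (nrt b F - nrt a F)" for F
    proof -
      define A B hA hB where "A = rt a F" and "B = rt b F" and "hA = ht a" and "hB = ht b"
      have kt: "k * rt t F = x * A + y * B" "l * rt r F = x' * A + y' * B"
        "k * ht t = x * hA + y * hB" "l * ht r = x' * hA + y' * hB"
        using k(2)[of F] l(2)[of F] k(2)[of unitF] l(2)[of unitF] by (simp_all add: ht_def A_def B_def hA_def hB_def)
      have n: "nrt t F = (x * A + y * B) / (x * hA + y * hB)" "nrt r F = (x' * A + y' * B) / (x' * hA + y' * hB)"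
        using kl by (simp_all add: nrt_def flip: kt)
      have "k * ht t \<noteq> 0" "l * ht r \<noteq> 0" using kl pos by simp_all
      then have nz: "x * hA + y * hB \<noteq> 0" "x' * hA + y' * hB \<noteq> 0" "hA \<noteq> 0" "hB \<noteq> 0"
        using kt(3,4) pos by (simp_all add: hA_def hB_def)
      have "nrt b F - nrt a F = B / hB - A / hA" by (simp add: nrt_def A_def B_def hA_def hB_def)
      also have "q * \<dots> = (x * y' - y * x') * (hA * B - hB * A) / ((x * hA + y * hB) * (x' * hA + y' * hB))"
        unfolding q_def kt hA_def[symmetric] hB_def[symmetric] using nz(3,4) by (simp add: divide_simps)
      also have "(x * y' - y * x') * (hA * B - hB * A) =
          (x' * A + y' * B) * (x * hA + y * hB) - (x * A + y * B) * (x' * hA + y' * hB)" by (simp add: algebra_simps)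
      finally show ?thesis unfolding n using nz(1,2) by (simp add: diff_frac_eq mult.commute)
    qed
    show ?thesis
    proof (cases "q = 0")
      case True
      then have "nrt r F = nrt t F" for F using eq[of F] by simp
      then have "rt t F = (ht t / ht r) * rt r F" for F using pos by (simp add: nrt_def field_simps)
      then have "t = r" using rt_proportional[OF tr] by blast
      then show ?thesis using R tr by blast
    next
      case False
      then have "P (\<lambda>F. q * (nrt b F - nrt a F))" using P[OF ab] q by simp
      then show ?thesis using R tr eq by simp
    qed
  qed
  let ?m = "ord (a \<otimes> b)"
  have U: "\<exists>k. k \<noteq> 0 \<and> (\<forall>F. k * rt (uu i) F = cp cc (Suc i) * rt a F + cp cc i * rt b F)"
    and V: "\<exists>k. k \<noteq> 0 \<and> (\<forall>F. k * rt (vv i) F = cp cc i * rt a F + cp cc (Suc i) * rt b F)" for i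
    using dihedral_root by blast+
  have T: "uu i \<in> T" "vv i \<in> T" for i using uu_vv_T by auto
  have main: "(uu i, uu j) \<in> R \<and> (vv j, vv i) \<in> R" if ij: "i \<le> j" "?m = 0 \<or> j < ?m" for i j
  proof -
    have nn: "cp cc i \<ge> 0" "cp cc (Suc i) \<ge> 0" "cp cc j \<ge> 0" "cp cc (Suc j) \<ge> 0" "cp cc (j - i) \<ge> 0"
      using ij by (auto intro!: cp_dihedral_nonneg simp del: cp_simps)
    have d: "cp cc (Suc i) * cp cc j - cp cc i * cp cc (Suc j) \<ge> 0"
      using cp_diff[of cc i "j - i"] nn(5) ij(1) by simp
    then have d': "cp cc j * cp cc (Suc i) - cp cc (Suc j) * cp cc i \<ge> 0" by (simp add: mult.commute)
    obtain k l k' l' where "k \<noteq> 0" "\<And>F. k * rt (uu i) F = cp cc (Suc i) * rt a F + cp cc i * rt b F"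
      "l \<noteq> 0" "\<And>F. l * rt (uu j) F = cp cc (Suc j) * rt a F + cp cc j * rt b F"
      "k' \<noteq> 0" "\<And>F. k' * rt (vv i) F = cp cc i * rt a F + cp cc (Suc i) * rt b F"
      "l' \<noteq> 0" "\<And>F. l' * rt (vv j) F = cp cc j * rt a F + cp cc (Suc j) * rt b F"
      using U[of i] U[of j] V[of i] V[of j] by blast
    note * = this
    show ?thesis using cmp[OF T(1) T(1) *(1-4) nn(2,1,4,3) d] cmp[OF T(2) T(2) *(7,8,5,6) nn(3,4,1,2) d'] by blast
  qed
  have mix: "(uu i, vv j) \<in> R" if ij: "?m = 0 \<or> i + j < ?m" for i j
  proof -
    have nn: "cp cc i \<ge> 0" "cp cc (Suc i) \<ge> 0" "cp cc j \<ge> 0" "cp cc (Suc j) \<ge> 0" "cp cc (Suc (i + j)) \<ge> 0"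
      using ij by (auto intro!: cp_dihedral_nonneg simp del: cp_simps)
    have d: "cp cc (Suc i) * cp cc (Suc j) - cp cc i * cp cc j \<ge> 0"
      using cp_add[of cc i j] nn(5) by simp
    obtain k l where "k \<noteq> 0" "\<And>F. k * rt (uu i) F = cp cc (Suc i) * rt a F + cp cc i * rt b F"
      "l \<noteq> 0" "\<And>F. l * rt (vv j) F = cp cc j * rt a F + cp cc (Suc j) * rt b F"
      using U[of i] V[of j] by blast
    then show ?thesis using cmp[OF T(1) T(2) _ _ _ _ nn(2,1,3,4) d] by blast
  qed
  show ?thesis unfolding dihedral_increasing_def Let_def uu_def[symmetric] vv_def[symmetric]
    using main mix by blast
qed

end

context coxeter_system
begin

theorem reflection_ordering_exists: "\<exists>R. reflection_ordering G S R"
proof -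
  obtain P :: "(('a \<times> bool \<Rightarrow> real) \<Rightarrow> real) \<Rightarrow> bool" where
    P: "(\<forall>f. P f \<longrightarrow> \<not> P (\<lambda>x. - f x)) \<and>
     (\<forall>f. (\<exists>x. f x \<noteq> 0) \<longrightarrow> P f \<or> P (\<lambda>x. - f x)) \<and>
     (\<forall>f g. P f \<and> P g \<longrightarrow> P (\<lambda>x. f x + g x)) \<and> (\<forall>f c. P f \<and> c > 0 \<longrightarrow> P (\<lambda>x. c * f x))"
    using lex_positive_functions[where 'b = "'a \<times> bool \<Rightarrow> real"] by (rule exE)
  have P1: "\<not> P (\<lambda>x. - f x)" if "P f" for f using P that by simp
  have P2: "P f \<or> P (\<lambda>x. - f x)" if "f x \<noteq> 0" for f x using P that by metis
  have P3: "P (\<lambda>x. f x + g x)" if "P f" "P g" for f g using P that by simp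
  have P4: "P (\<lambda>x. c * f x)" if "P f" "c > 0" for f c using P that by simp
  define R where "R = {(t, r). t \<in> T \<and> r \<in> T \<and> (t = r \<or> P (\<lambda>F. nrt r F - nrt t F))}"
  have R: "(t, r) \<in> R \<longleftrightarrow> t \<in> T \<and> r \<in> T \<and> (t = r \<or> P (\<lambda>F. nrt r F - nrt t F))" for t r
    by (simp add: R_def)
  have neg: "(\<lambda>F. - (nrt r F - nrt t F)) = (\<lambda>F. nrt t F - nrt r F)" for t r by (simp add: fun_eq_iff)
  have tot: "P (\<lambda>F. nrt r F - nrt t F) \<or> P (\<lambda>F. nrt t F - nrt r F)" if tr: "t \<in> T" "r \<in> T" "t \<noteq> r" for t r
  proof -
    have "\<exists>F. nrt r F - nrt t F \<noteq> 0"
    proof (rule ccontr)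
      assume "\<nexists>F. nrt r F - nrt t F \<noteq> 0"
      then have "rt t F = (ht t / ht r) * rt r F" for F
        using ht_pos[OF tr(1)] ht_pos[OF tr(2)] by (simp add: nrt_def field_simps)
      then show False using rt_proportional[OF tr(1,2)] tr(3) by blast
    qed
    then show ?thesis using P2[of "\<lambda>F. nrt r F - nrt t F"] unfolding neg by blast
  qed
  have antisym: "\<not> (P (\<lambda>F. nrt r F - nrt t F) \<and> P (\<lambda>F. nrt t F - nrt r F))" for t r
    using P1[of "\<lambda>F. nrt r F - nrt t F"] unfolding neg by blast
  have trans: "P (\<lambda>F. nrt q F - nrt t F)" if "P (\<lambda>F. nrt r F - nrt t F)" "P (\<lambda>F. nrt q F - nrt r F)" for t r q
    using P3[OF that] by simp
  have lin: "linear_order_on T R"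
    unfolding order_on_defs
  proof (intro conjI)
    show "R \<subseteq> T \<times> T" using R by auto
    show "refl_on T R" using R by (auto simp: refl_on_def)
    show "trans R" unfolding trans_def R using trans by blast
    show "antisym R" unfolding antisym_def R using antisym by blast
    show "total_on T R" unfolding total_on_def R using tot by blast
  qed
  have "dihedral_increasing G R a b \<or> dihedral_increasing G R b a"
    if H: "reflection_subgroup G S H" "\<chi> H = {a, b}" for H a b
  proof (cases "a = b")
    \<comment> \<open>A subgroup with one reflection also has canonical generators of the form {a,
      b}. Then ab has order 1, and only the index 0 is to be compared with itself.\<close>
    case True
    then have aT: "a \<in> T" using H(2) cgens_iff by blast
    have "ord (a \<otimes> a) = 1" using aT by simp
    then show ?thesis using aT R unfolding dihedral_increasing_def Let_def True[symmetric] by auto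
  next
    case False
    interpret D: rank_two_subgroup G S H a b using H False by unfold_locales
    interpret D': rank_two_subgroup G S H b a by (rule D.swap)
    show ?thesis using tot[OF D.ab_T(1,2) False] D.dihedral_increasing_lex[of P R, OF P4 _ R]
      D'.dihedral_increasing_lex[of P R, OF P4 _ R] by blast
  qed
  then show ?thesis unfolding reflection_ordering_def using lin by blast
qed

end

context reflection_embedding
begin

definition pullback :: "'a rel \<Rightarrow> 'b rel" where
  "pullback R = {(s, t). s \<in> carrier W \<and> t \<in> carrier W \<and> (\<psi> s, \<psi> t) \<in> R}"

lemma ord_\<psi>: assumes "x \<in> carrier W" shows "group.ord G (\<psi> x) = group.ord W x"
proof (rule sym, subst W.ord_unique[OF assms], intro allI)
  fix n :: nat
  have "x [^]\<^bsub>W\<^esub> n = \<one>\<^bsub>W\<^esub> \<longleftrightarrow> \<psi> (x [^]\<^bsub>W\<^esub> n) = \<psi> \<one>\<^bsub>W\<^esub>"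
    by (rule \<psi>_eq_iff[OF W.nat_pow_closed[OF assms] W.one_closed, symmetric])
  also have "\<dots> \<longleftrightarrow> \<psi> x [^]\<^bsub>G\<^esub> n = \<one>\<^bsub>G\<^esub>" using assms by (simp add: \<psi>.hom_nat_pow)
  also have "\<dots> \<longleftrightarrow> G.ord (\<psi> x) dvd n" using G.pow_eq_id assms by simp
  finally show "x [^]\<^bsub>W\<^esub> n = \<one>\<^bsub>W\<^esub> \<longleftrightarrow> G.ord (\<psi> x) dvd n" .
qed

lemma dihedral_increasing_pullback:
  assumes "dihedral_increasing G R (\<psi> a) (\<psi> b)" "a \<in> carrier W" "b \<in> carrier W"
  shows "dihedral_increasing W (pullback R) a b"
proof -
  have u: "\<psi> (a \<otimes>\<^bsub>W\<^esub> (b \<otimes>\<^bsub>W\<^esub> a) [^]\<^bsub>W\<^esub> (i::nat)) = \<psi> a \<otimes>\<^bsub>G\<^esub> (\<psi> b \<otimes>\<^bsub>G\<^esub> \<psi> a) [^]\<^bsub>G\<^esub> i"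
    "\<psi> (b \<otimes>\<^bsub>W\<^esub> (a \<otimes>\<^bsub>W\<^esub> b) [^]\<^bsub>W\<^esub> (i::nat)) = \<psi> b \<otimes>\<^bsub>G\<^esub> (\<psi> a \<otimes>\<^bsub>G\<^esub> \<psi> b) [^]\<^bsub>G\<^esub> i" for i
    using assms by (simp_all add: \<psi>.hom_nat_pow)
  have m: "G.ord (\<psi> a \<otimes>\<^bsub>G\<^esub> \<psi> b) = W.ord (a \<otimes>\<^bsub>W\<^esub> b)" using ord_\<psi>[of "a \<otimes>\<^bsub>W\<^esub> b"] assms by simp
  show ?thesis using assms unfolding dihedral_increasing_def Let_def m u[symmetric] pullback_def by simp
qed

lemma reflection_ordering_pullback:
  assumes "reflection_ordering G S R"
  shows "reflection_ordering W gens (pullback R)"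
proof -
  have lin: "linear_order_on (reflections G S) R" using assms by (simp add: reflection_ordering_def)
  then have RT: "R \<subseteq> reflections G S \<times> reflections G S" "refl_on (reflections G S) R" "trans R" "antisym R"
    "total_on (reflections G S) R" by (auto simp: order_on_defs)
  have "linear_order_on (reflections W gens) (pullback R)"
    unfolding order_on_defs
  proof (intro conjI)
    show "pullback R \<subseteq> reflections W gens \<times> reflections W gens"
      using RT(1) unfolding pullback_def reflections_W by auto
    show "refl_on (reflections W gens) (pullback R)"
      using RT(1,2) unfolding pullback_def reflections_W refl_on_def by auto
    show "trans (pullback R)" using RT(3) unfolding pullback_def trans_def by blast
    show "antisym (pullback R)" using RT(4) \<psi>_eq_iff unfolding pullback_def antisym_def by blast
    show "total_on (reflections W gens) (pullback R)"
      using RT(5) \<psi>_eq_iff unfolding pullback_def total_on_def reflections_W by auto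
  qed
  moreover have "dihedral_increasing W (pullback R) a b \<or> dihedral_increasing W (pullback R) b a"
    if K: "reflection_subgroup W gens K" "canonical_generators W gens K = {a, b}" for K a b
  proof -
    have KW: "K \<subseteq> carrier W" using W.refl_subgroup_subgroup[OF K(1)] subgroup.subset by blast
    have ab: "a \<in> carrier W" "b \<in> carrier W" using K(2) W.cgens_sub[of K] KW by blast+
    have "canonical_generators G S (\<psi> ` K) = {\<psi> a, \<psi> b}"
      using canonical_generators_image[OF KW] K(2) by simp
    then have "dihedral_increasing G R (\<psi> a) (\<psi> b) \<or> dihedral_increasing G R (\<psi> b) (\<psi> a)"
      using assms reflection_subgroup_image[OF K(1)] unfolding reflection_ordering_def by blast
    then show ?thesis using dihedral_increasing_pullback ab by blast
  qed
  ultimately show ?thesis unfolding reflection_ordering_def by blast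
qed

end

section \<open>The number of increasing paths\<close>

lemma (in group) word_prod_alt_even:
  assumes "x \<in> carrier G" "y \<in> carrier G"
  shows "word_prod G (alt x y (2 * i)) = (x \<otimes> y) [^] i"
proof (induction i)
  case (Suc i)
  have "word_prod G (alt x y (2 * Suc i)) = (x \<otimes> y) \<otimes> (x \<otimes> y) [^] i"
    using assms Suc by (simp add: m_assoc)
  then show ?case using assms nat_pow_Suc2[of "x \<otimes> y" i] by simp
qed simp

context coxeter_system
begin

lemma fixplane_conj:
  assumes "s \<in> T" "t \<in> T" "y \<in> carrier G" "q \<in> T"
  shows "q \<in> fixplane (y \<otimes> s \<otimes> inv y) (y \<otimes> t \<otimes> inv y) \<longleftrightarrow> inv y \<otimes> q \<otimes> y \<in> fixplane s t"
proof -
  have z: "rt (inv y \<otimes> p \<otimes> y) (act (inv y) F) = 0 \<longleftrightarrow> rt p F = 0" if p: "p \<in> T" for p F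
  proof -
    obtain k where "k \<noteq> 0" "\<And>F. rt p (act y F) = k * rt (inv y \<otimes> p \<otimes> y) F"
      using rt_conj[OF p assms(3)] by blast
    note k = this(1) this(2)[of "act (inv y) F"]
    then show ?thesis using assms(3) by simp
  qed
  have r: "inv y \<otimes> q \<otimes> y \<in> T" using T_conj' assms by blast
  have c: "inv y \<otimes> (y \<otimes> p \<otimes> inv y) \<otimes> y = p" if "p \<in> T" for p using that assms(3) by (simp add: m_assoc)
  have zz: "rt p (act (inv y) F) = 0 \<longleftrightarrow> rt (y \<otimes> p \<otimes> inv y) F = 0" if p: "p \<in> T" for p F
    using z[OF T_conj[OF p assms(3)]] c[OF p] by simp
  show ?thesis
  proof
    assume L: "q \<in> fixplane (y \<otimes> s \<otimes> inv y) (y \<otimes> t \<otimes> inv y)"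
    have "rt (inv y \<otimes> q \<otimes> y) F = 0" if "rt s F = 0" "rt t F = 0" for F
    proof -
      have "act (inv y) (act y F) = F" using assms(3) by simp
      then have "rt q (act y F) = 0"
        using L zz[OF assms(1), of "act y F"] zz[OF assms(2), of "act y F"] that by (simp add: fixplane_def)
      then show ?thesis using z[OF assms(4), of "act y F"] assms(3) by simp
    qed
    then show "inv y \<otimes> q \<otimes> y \<in> fixplane s t" using r by (simp add: fixplane_def)
  next
    assume "inv y \<otimes> q \<otimes> y \<in> fixplane s t"
    then have "rt q F = 0" if "rt (y \<otimes> s \<otimes> inv y) F = 0" "rt (y \<otimes> t \<otimes> inv y) F = 0" for F
      using z[OF assms(4), of F] zz[OF assms(1), of F] zz[OF assms(2), of F] that by (simp add: fixplane_def)
    then show "q \<in> fixplane (y \<otimes> s \<otimes> inv y) (y \<otimes> t \<otimes> inv y)" using assms(4) by (simp add: fixplane_def)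
  qed
qed

lemma gen_cgen: "s \<in> S \<Longrightarrow> s \<in> H \<Longrightarrow> s \<in> \<chi> H"
  using cgens_iff N_gen S_subset_T by auto

lemma alt_flip:
  assumes "s \<in> S" "t \<in> S" "(s \<otimes> t) [^] m = \<one>" "j < m"
  shows "\<pi> (alt t s (Suc (2 * j))) = \<pi> (alt s t (Suc (2 * (m - Suc j))))"
proof -
  let ?x = "\<pi> (alt s t (Suc (2 * (m - Suc j))))" and ?y = "\<pi> (alt t s (Suc (2 * j)))"
  have "2 * m = Suc (2 * (m - Suc j)) + Suc (2 * j)" using assms(4) by arith
  then have "alt s t (2 * m) = alt s t (Suc (2 * (m - Suc j)) + Suc (2 * j))" by metis
  also have "\<dots> = alt s t (Suc (2 * (m - Suc j))) @ alt t s (Suc (2 * j))"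
    by (subst alt_add) (simp del: alt.simps)
  finally have *: "?x \<otimes> ?y = \<one>"
    using gen_power_alt[OF assms(1,2), of m] words_append[OF alt_S[OF assms(1,2)] alt_S[OF assms(2,1)]] assms(3) by metis
  have y: "?y \<in> T" using rfl_alt[OF assms(2,1), of j "Suc j"] rfl_T[of "alt t s (Suc j)" j]
    alt_S[OF assms(2,1), of "Suc j"] by (simp del: alt.simps)
  have x: "?x \<in> carrier G" using words_closed[OF alt_S[OF assms(1,2)]] .
  have "?x = inv ?y" using inv_equality[OF * T_carrier[OF y] x] by simp
  then show ?thesis using y by simp
qed

end

section \<open>Reduced words from reflection orderings\<close>

context rank_two_subgroup
begin

lemma ord_sub: "x \<in> H \<Longrightarrow> group.ord (G\<lparr>carrier := H\<rparr>) x = ord x"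
proof -
  interpret E: reflection_embedding G S "G\<lparr>carrier := H\<rparr>" "\<lambda>x. x" by (rule reflection_embedding_subgroup)
  show "x \<in> H \<Longrightarrow> group.ord (G\<lparr>carrier := H\<rparr>) x = ord x" using E.ord_\<psi>[of x] by simp
qed

lemma ua_uu: "ua i = uu i" and ub_vv: "ub i = vv i"
  using word_prod_alt_even[of a b i] word_prod_alt_even[of b a i] ab_T by (simp_all add: uu_def vv_def)

lemma TH_enum: "ord (a \<otimes> b) \<noteq> 0 \<Longrightarrow> T \<inter> H \<subseteq> uu ` {..<ord (a \<otimes> b)}"
proof -
  interpret D: dihedral_system "G\<lparr>carrier := H\<rparr>" "{a, b}" a b by (rule dihedral)
  show "ord (a \<otimes> b) \<noteq> 0 \<Longrightarrow> T \<inter> H \<subseteq> uu ` {..<ord (a \<otimes> b)}"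
    using D.T_enum ord_sub[of "a \<otimes> b"] ab_T refl_H by (simp add: word_prod_sub ua_uu del: alt.simps)
qed

text \<open>The inversions of \<open>d\<close> cannot be counted from the side of \<open>b\<close>,
  the maximum of \<open>R\<close>: then \<open>b\<close> would come before \<open>t\<close>, so t =
  b, yet \<open>t\<close> is not inverted. So \<open>d\<close> is the alternating word from
  \<open>a\<close> of some length k, \<open>t\<close> is \<open>uu k\<close>, and the palindrome for
  \<open>uu k\<close> has the shape d c d^-1 with c a generator.\<close>

lemma next_reflection:
  assumes R: "dihedral_increasing G R a b" "antisym R" and fin: "ord (a \<otimes> b) \<noteq> 0"
    and d: "d \<in> H" "\<And>p q. p \<in> N d \<inter> H \<Longrightarrow> q \<in> T \<inter> H \<Longrightarrow> q \<notin> N d \<Longrightarrow> (p, q) \<in> R"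
    and t: "t \<in> T" "t \<in> H" "t \<notin> N d" "\<And>q. q \<in> T \<inter> H \<Longrightarrow> q \<notin> N d \<Longrightarrow> (t, q) \<in> R"
  shows "inv d \<otimes> t \<otimes> d \<in> \<chi> H"
proof -
  interpret D: dihedral_system "G\<lparr>carrier := H\<rparr>" "{a, b}" a b by (rule dihedral)
  let ?m = "ord (a \<otimes> b)"
  define k where "k = cox_length (G\<lparr>carrier := H\<rparr>) {a, b} d"
  have inc: "(uu i, uu j) \<in> R" if "i \<le> j" "j < ?m" for i j
    using R(1) that unfolding dihedral_increasing_def Let_def uu_def by blast
  have max: "(uu i, b) \<in> R" if "i < ?m" for i
  proof -
    have "\<forall>i j. i + j < ?m \<longrightarrow> (uu i, vv j) \<in> R"
      using R(1) unfolding dihedral_increasing_def Let_def uu_def vv_def by blast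
    then have "(uu i, vv 0) \<in> R" using that by simp
    then show ?thesis using ab_T by (simp add: vv_def)
  qed
  obtain j where j: "j < ?m" "t = uu j" using TH_enum[OF fin] t by blast
  have "d = word_prod G (alt a b k) \<and> D.reduced (alt a b k)"
  proof (rule D.element_alt[of d])
    show "d \<in> carrier (G\<lparr>carrier := H\<rparr>)" using d by simp
  next
    assume r: "D.reduced (alt b a (cox_length (G\<lparr>carrier := H\<rparr>) {a, b} d))"
      "d = word_prod (G\<lparr>carrier := H\<rparr>) (alt b a (cox_length (G\<lparr>carrier := H\<rparr>) {a, b} d))"
    then have r: "D.reduced (alt b a k)" "d = word_prod G (alt b a k)" by (simp_all add: k_def word_prod_sub)
    show ?thesis
    proof (cases k)
      case 0 then show ?thesis using r by simp
    next
      case (Suc k')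
      have "N d \<inter> H = (\<lambda>i. ub i) ` {..<k}"
        using D.reduced_alt_N[of b a k] r invs_H[OF d(1)] by (simp add: word_prod_sub del: alt.simps)
      then have "ub 0 \<in> N d \<inter> H" using Suc by blast
      then have "b \<in> N d \<inter> H" using ab_T by simp
      then have "(b, t) \<in> R" using d(2) t by blast
      then have "t = b" using max[OF j(1)] j(2) R(2) by (auto dest: antisymD)
      then show ?thesis using \<open>b \<in> N d \<inter> H\<close> t by blast
    qed
  qed (simp add: k_def word_prod_sub)
  then have dA: "d = word_prod G (alt a b k)" and red: "D.reduced (alt a b k)" by auto
  have Nd: "N d \<inter> H = uu ` {..<k}"
    using D.reduced_alt_N[of a b k] red dA invs_H[OF d(1)] by (simp add: word_prod_sub ua_uu del: alt.simps)
  have kj: "k \<le> j"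
  proof (rule ccontr)
    assume "\<not> k \<le> j"
    then have "uu j \<in> N d" using Nd by auto
    then show False using t(3) j(2) by simp
  qed
  have "uu k \<notin> N d"
  proof
    assume "uu k \<in> N d"
    then obtain i where i: "i < k" "uu k = uu i" using Nd uu_vv_T by blast
    then have "(b \<otimes> a) [^] k = (b \<otimes> a) [^] i" using ab_T by (simp add: uu_def)
    moreover have "ord (b \<otimes> a) = ?m" using ord_inv[of "a \<otimes> b"] ab_T by (simp add: inv_mult_group)
    ultimately have "k = i" using ord_inj[of "b \<otimes> a"] i kj j(1) ab_T
      by (auto simp: inj_on_def)
    then show False using i by simp
  qed
  then have "(t, uu k) \<in> R" using t(4) uu_vv_T by blast
  moreover have "(uu k, t) \<in> R" using inc[OF kj j(1)] j(2) by simp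
  ultimately have tk: "t = uu k" using R(2) by (auto dest: antisymD)
  let ?c = "if even k then a else b"
  have c: "?c \<in> \<chi> H" "?c \<in> H" using cgens ab_T by auto
  have rev: "word_prod G (rev xs) = inv (word_prod G xs)" if "set xs \<subseteq> {a, b}" for xs
    using that
  proof (induction xs)
    case (Cons c xs)
    then have c: "c \<in> T" "c \<in> carrier G" "set xs \<subseteq> carrier G" using ab_T by auto
    then show ?case using Cons by (simp add: word_prod_append inv_mult_group)
  qed simp
  have sub: "set (alt a b k) \<subseteq> {a, b}" by (rule set_alt)
  have "{a, b} \<subseteq> carrier G" using ab_T by auto
  then have cc: "set (alt a b k) \<subseteq> carrier G" using sub by blast
  have "uu k = word_prod G (alt a b k @ [?c] @ rev (alt a b k))"
    unfolding ua_uu[symmetric] alt_odd_palindrome by simp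
  also have "\<dots> = d \<otimes> (?c \<otimes> inv d)"
    using cc c rev[OF sub] by (simp add: word_prod_append dA del: alt.simps)
  finally have "t = d \<otimes> (?c \<otimes> inv d)" using tk by simp
  then have "inv d \<otimes> t \<otimes> d = ?c" using d c by (simp add: m_assoc)
  then show ?thesis using c by simp
qed

end

context coxeter_system
begin

text \<open>Let r = w^-1 t w, and let \<open>s\<close> be the first letter of a reduced word for r.
  If r is not simple, \<open>s\<close> is an inversion different from r. In the maximal dihedral
  subgroup of w s w^-1 and \<open>t\<close>, \<open>next_reflection\<close> makes the conjugate of
  \<open>t\<close> canonical; having no other inversion there, it agrees with that of w s w^-1, so s
  = r.\<close>

lemma next_reflection_simple:
  assumes fin: "finite (carrier G)" and R: "reflection_ordering G S R"
    and w: "w \<in> carrier G" "\<And>p q. p \<in> N w \<Longrightarrow> q \<in> T \<Longrightarrow> q \<notin> N w \<Longrightarrow> (p, q) \<in> R"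
    and t: "t \<in> T" "t \<notin> N w" "\<And>q. q \<in> T \<Longrightarrow> q \<notin> N w \<Longrightarrow> (t, q) \<in> R"
  shows "inv w \<otimes> t \<otimes> w \<in> S"
proof (rule ccontr)
  assume no: "inv w \<otimes> t \<otimes> w \<notin> S"
  define r where "r = inv w \<otimes> t \<otimes> w"
  have r: "r \<in> T" using T_conj' t w by (simp add: r_def)
  obtain xs where xs: "reduced xs" "\<pi> xs = r" using ex_reduced'[OF T_carrier[OF r]] by blast
  have "xs \<noteq> []" using xs odd_length_T[OF r] by (auto simp: reduced_def)
  then obtain s ys where sx: "xs = s # ys" by (cases xs) auto
  have sS: "s \<in> S" "set xs \<subseteq> S" using xs sx by (auto simp: reduced_def)
  have sN: "s \<in> N r" using reduced_rfl_N[OF xs(1), of 0] sx sS xs(2) by simp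
  have sr: "s \<noteq> r" using no sS by (auto simp: r_def)
  have sT: "s \<in> T" using sS S_subset_T by blast
  define q where "q = w \<otimes> s \<otimes> inv w"
  have q: "q \<in> T" using T_conj[OF sT w(1)] by (simp add: q_def)
  have t_eq: "t = w \<otimes> r \<otimes> inv w" using t w by (simp add: r_def m_assoc)
  have qt: "q \<noteq> t"
  proof
    assume "q = t"
    then have "inv w \<otimes> q \<otimes> w = r" by (simp add: r_def)
    then show False using sr sT w by (simp add: q_def m_assoc)
  qed
  obtain a b where "maximal_dihedral G S (dmax q t) a b" using dmax_maximal_dihedral[OF q t(1) qt] by blast
  then interpret D: maximal_dihedral G S "dmax q t" a b .
  let ?D = "dmax q t"
  have qtD: "q \<in> ?D" "t \<in> ?D" using dmax_T[OF q t(1)] in_fixplane q t by blast+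
  obtain d x where dx: "d \<in> ?D" "x \<in> carrier G" "w = d \<otimes> x" "N x \<inter> ?D = {}"
    using D.coset_minimal_rep[OF w(1)] by blast
  have Nw: "N w \<inter> ?D = N d \<inter> ?D" using D.N_coset[OF dx(2,4,1)] dx(3) by simp
  have anti: "antisym R" using R by (simp add: reflection_ordering_def order_on_defs)
  have "(D.uu n) \<in> carrier G" for n using D.uu_vv_T by auto
  have finord: "ord g \<noteq> 0" if g: "g \<in> carrier G" for g
    using ord_ge_1[OF fin g] by simp
  have conds: "\<And>p q'. p \<in> N d \<inter> ?D \<Longrightarrow> q' \<in> T \<inter> ?D \<Longrightarrow> q' \<notin> N d \<Longrightarrow> (p, q') \<in> R"
    "t \<notin> N d" "\<And>q'. q' \<in> T \<inter> ?D \<Longrightarrow> q' \<notin> N d \<Longrightarrow> (t, q') \<in> R"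
    using w(2) t Nw qtD by blast+
  have "dihedral_increasing G R a b \<or> dihedral_increasing G R b a"
    using R D.refl_subgroup D.cgens unfolding reflection_ordering_def by blast
  then have "inv d \<otimes> t \<otimes> d \<in> \<chi> ?D"
  proof
    assume i: "dihedral_increasing G R a b"
    show ?thesis using D.next_reflection[OF i anti _ dx(1) conds(1) t(1) qtD(2) conds(2,3)] finord D.ab_T by simp
  next
    assume i: "dihedral_increasing G R b a"
    interpret D': rank_two_subgroup G S ?D b a by (rule D.swap)
    show ?thesis using D'.next_reflection[OF i anti _ dx(1) conds(1) t(1) qtD(2) conds(2,3)] finord D.ab_T by simp
  qed
  define t' where "t' = inv d \<otimes> t \<otimes> d"
  have t': "t' \<in> \<chi> ?D" "N t' \<inter> ?D = {t'}" "t' \<in> ?D" "t' \<in> T"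
    using \<open>inv d \<otimes> t \<otimes> d \<in> \<chi> ?D\<close> cgens_iff by (simp_all add: t'_def)
  define q' where "q' = inv d \<otimes> q \<otimes> d"
  have q': "q' \<in> ?D" using dx qtD by (simp add: q'_def)
  have dc: "d \<in> carrier G" using dx by simp
  have rx: "r = inv x \<otimes> (t' \<otimes> x)" unfolding r_def t'_def dx(3) using dc dx(2) t by (simp add: inv_mult_group m_assoc)
  have sx: "x \<otimes> s \<otimes> inv x = q'" unfolding q'_def q_def dx(3) using dc dx(2) sT by (simp add: inv_mult_group m_assoc)
  have "s \<in> N (inv x) \<longleftrightarrow> q' \<in> N x" using N_inv[of "inv x" s] dx(2) sT sx by simp
  then have s1: "s \<notin> N (inv x)" using dx(4) q' by blast
  have "t' \<otimes> q' \<otimes> t' \<in> ?D" using t' q' by simp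
  then have "t' \<otimes> q' \<otimes> t' \<notin> N x" using dx(4) by blast
  then have "q' \<in> N (t' \<otimes> x) \<longleftrightarrow> q' \<in> N t'" using N_mult[of t' x q'] t' q' dx(2) by simp
  also have "\<dots> \<longleftrightarrow> q' = t'" using t'(2) q' by blast
  finally have "s \<in> N r \<longleftrightarrow> q' = t'"
    using N_mult[of "inv x" "t' \<otimes> x" s] s1 sx dx(2) sT t' unfolding rx by simp
  then have "q' = t'" using sN by simp
  then have "s = r" using sx rx dx(2) sT t' by (metis T_carrier conj_eq_iff m_assoc inv_closed)
  then show False using sr by simp
qed

definition word_order :: "'a list \<Rightarrow> 'a rel" where
  "word_order ws = {(rfl ws i, rfl ws j) | i j. i \<le> j \<and> j < length ws}"

lemma finite_T: "finite (carrier G) \<Longrightarrow> finite T"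
  by (rule finite_subset[of _ "carrier G"]) auto

lemma linear_order_min:
  assumes "finite A" "A \<noteq> {}" "total_on B R" "trans R" "refl_on B R" "A \<subseteq> B"
  shows "\<exists>m\<in>A. \<forall>x\<in>A. (m, x) \<in> R"
  using assms(1,2,6)
proof (induction rule: finite_ne_induct)
  case (singleton x)
  then show ?case using assms(5) by (auto simp: refl_on_def)
next
  case (insert x A)
  then obtain m where m: "m \<in> A" "\<forall>y\<in>A. (m, y) \<in> R" by auto
  show ?case
  proof (cases "(m, x) \<in> R")
    case True then show ?thesis using m by auto
  next
    case False
    moreover have "m \<noteq> x" using m insert by auto
    ultimately have "(x, m) \<in> R" using assms(3) m insert by (auto simp: total_on_def)
    moreover have "(x, x) \<in> R" using assms(5) insert by (auto simp: refl_on_def)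
    ultimately show ?thesis using m assms(4) by (auto dest: transD)
  qed
qed

text \<open>Take a longest reduced word whose reflections are increasing and form an initial segment
  of the ordering. If some reflection were missing, the least missing one would extend the word by a
  letter, simple by \<open>next_reflection_simple\<close>.\<close>

lemma reflection_ordering_word:
  assumes fin: "finite (carrier G)" and R: "reflection_ordering G S R"
  shows "\<exists>ws. reduced ws \<and> N (\<pi> ws) = T \<and> R = word_order ws"
proof -
  have o: "R \<subseteq> T \<times> T" "refl_on T R" "trans R" "antisym R" "total_on T R"
    using R by (simp_all add: reflection_ordering_def order_on_defs)
  define P where "P ws \<longleftrightarrow> reduced ws \<and> (\<forall>i j. i < j \<and> j < length ws \<longrightarrow> (rfl ws i, rfl ws j) \<in> R) \<and>
    (\<forall>p\<in>N (\<pi> ws). \<forall>q\<in>T. q \<notin> N (\<pi> ws) \<longrightarrow> (p, q) \<in> R)" for ws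
  have P0: "P []" by (simp add: P_def reduced_def N_one)
  have bound: "length ws \<le> card T" if "P ws" for ws
  proof -
    have "\<pi> ws \<in> carrier G" "length ws = \<ell> (\<pi> ws)" using that by (simp_all add: P_def reduced_def)
    then show ?thesis using card_N(2)[of "\<pi> ws"] N_subset_T[of "\<pi> ws"] card_mono[OF finite_T[OF fin], of "N (\<pi> ws)"] by simp
  qed
  obtain ws where ws: "P ws" "\<And>vs. P vs \<Longrightarrow> length vs \<le> length ws"
  proof -
    have "\<forall>vs. P vs \<longrightarrow> length vs < Suc (card T)" using bound by (simp add: le_imp_less_Suc)
    from ex_has_greatest_nat[OF P0 this] show ?thesis using that by blast
  qed
  have red: "reduced ws" and S: "set ws \<subseteq> S" using ws by (simp_all add: P_def reduced_def)
  let ?w = "\<pi> ws"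
  have w: "?w \<in> carrier G" using S by simp
  have NT: "N ?w = T"
  proof (rule ccontr)
    assume "N ?w \<noteq> T"
    then have "T - N ?w \<noteq> {}" using N_subset_T[OF w] by blast
    then obtain t where t: "t \<in> T - N ?w" "\<forall>x\<in>T - N ?w. (t, x) \<in> R"
      using linear_order_min[of "T - N ?w" T R] finite_T[OF fin] o by auto
    have down: "\<And>p q. p \<in> N ?w \<Longrightarrow> q \<in> T \<Longrightarrow> q \<notin> N ?w \<Longrightarrow> (p, q) \<in> R" using ws(1) unfolding P_def by blast
    define s where "s = inv ?w \<otimes> t \<otimes> ?w"
    have s: "s \<in> S" unfolding s_def using next_reflection_simple[OF fin R w down] t by blast
    have t_eq: "t = ?w \<otimes> s \<otimes> inv ?w" using t w by (simp add: s_def m_assoc)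
    have ws_s: "\<pi> (ws @ [s]) = ?w \<otimes> s" using S s by (simp add: words_append)
    have "s \<notin> N (inv ?w)" using N_inv[OF w, of t] t by (simp add: s_def)
    then have "\<ell> ?w < \<ell> (?w \<otimes> s)" using right_descent(2)[OF w s] by simp
    then have red': "reduced (ws @ [s])"
      using right_descent(1)[OF w s] red S s ws_s by (simp add: reduced_def)
    have rfl_last: "rfl (ws @ [s]) (length ws) = t" by (simp add: rfl_def t_eq)
    have rfl_init: "rfl (ws @ [s]) i = rfl ws i" if "i < length ws" for i using that by (rule rfl_append)
    have "N (\<pi> (ws @ [s])) = rfl (ws @ [s]) ` {..<Suc (length ws)}" using reduced_N[OF red'] by simp
    also have "\<dots> = insert t (rfl ws ` {..<length ws})"
      unfolding lessThan_Suc using rfl_last rfl_init by auto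
    finally have N': "N (\<pi> (ws @ [s])) = insert t (N ?w)" using reduced_N[OF red] by simp
    have "P (ws @ [s])" unfolding P_def
    proof (intro conjI allI impI ballI)
      show "reduced (ws @ [s])" by (rule red')
    next
      fix i j assume ij: "i < j \<and> j < length (ws @ [s])"
      show "(rfl (ws @ [s]) i, rfl (ws @ [s]) j) \<in> R"
      proof (cases "j = length ws")
        case True
        then show ?thesis using rfl_last rfl_init[of i] ij reduced_rfl_N[OF red, of i] down t by auto
      next
        case False
        then show ?thesis using rfl_init[of i] rfl_init[of j] ij ws(1) by (auto simp: P_def)
      qed
    next
      fix p q assume "p \<in> N (\<pi> (ws @ [s]))" "q \<in> T" "q \<notin> N (\<pi> (ws @ [s]))"
      then show "(p, q) \<in> R" unfolding N' using down t by auto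
    qed
    then show False using ws(2) by force
  qed
  have T_rfl: "\<exists>i<length ws. t = rfl ws i" if "t \<in> T" for t using reduced_N[OF red] NT that by auto
  have "R = word_order ws"
  proof (intro equalityI subrelI)
    fix p q assume pq: "(p, q) \<in> R"
    then obtain i j where ij: "i < length ws" "p = rfl ws i" "j < length ws" "q = rfl ws j" using T_rfl o(1) by blast
    have "i \<le> j"
    proof (rule ccontr)
      assume "\<not> i \<le> j"
      then have "(q, p) \<in> R" using ws(1) ij by (auto simp: P_def)
      then have "p = q" using pq o(4) by (auto dest: antisymD)
      then show False using reduced_rfl_inj[OF red] ij \<open>\<not> i \<le> j\<close> by (auto dest: inj_onD)
    qed
    then show "(p, q) \<in> word_order ws" using ij by (auto simp: word_order_def)
  next
    fix p q assume "(p, q) \<in> word_order ws"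
    then obtain i j where ij: "i \<le> j" "j < length ws" "p = rfl ws i" "q = rfl ws j" by (auto simp: word_order_def)
    show "(p, q) \<in> R"
    proof (cases "i = j")
      case True
      then show ?thesis using ij o(2) rfl_T[OF S] by (auto simp: refl_on_def)
    next
      case False
      then show ?thesis using ij ws(1) by (auto simp: P_def)
    qed
  qed
  then show ?thesis using red NT by blast
qed

end

section \<open>Toggling paths along a dihedral subgroup\<close>

context reflection_subgroup_of
begin

text \<open>For a rank-two \<open>H\<close> and a level strictly between the extreme ones the choice
  is forced, by \<open>level_partner\<close>.\<close>

definition partner :: "'a \<Rightarrow> 'a" where
  "partner y = (SOME z. z \<in> carrier G \<and> z \<otimes> inv y \<in> H \<and> z \<noteq> y \<and> lev z = lev y)"

text \<open>Toggling all inner vertices of the segments of a path with labels in \<open>H\<close> turns increasing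
  paths into paths that are increasing after reversal of the interval \<open>T \<inter> H\<close>. The bound \<open>k\<close>
  exhibits the toggle as a composite of flips, so that flipclasses are preserved.\<close>

definition togglable :: "'a list \<Rightarrow> nat \<Rightarrow> bool" where
  "togglable xs i \<longleftrightarrow> 0 < i \<and> Suc i < length xs \<and>
     xs ! i \<otimes> inv (xs ! (i - 1)) \<in> H \<and> xs ! Suc i \<otimes> inv (xs ! i) \<in> H"

definition toggle :: "nat \<Rightarrow> 'a list \<Rightarrow> 'a list" where
  "toggle k xs = map (\<lambda>i. if i \<le> k \<and> togglable xs i then partner (xs ! i) else xs ! i) [0..<length xs]"

lemma length_toggle [simp]: "length (toggle k xs) = length xs"
  by (simp add: toggle_def)

lemma nth_toggle: "i < length xs \<Longrightarrow>
    toggle k xs ! i = (if i \<le> k \<and> togglable xs i then partner (xs ! i) else xs ! i)"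
  by (simp add: toggle_def)

lemma coset_label_iff:
  assumes c: "x \<in> carrier G" "x' \<in> carrier G" "y \<in> carrier G" "y' \<in> carrier G"
    and H: "x' \<otimes> inv x \<in> H" "y' \<otimes> inv y \<in> H"
  shows "y' \<otimes> inv x' \<in> H \<longleftrightarrow> y \<otimes> inv x \<in> H"
proof
  assume "y \<otimes> inv x \<in> H"
  then have "(y' \<otimes> inv y) \<otimes> (y \<otimes> inv x) \<otimes> inv (x' \<otimes> inv x) \<in> H" using H by simp
  then show "y' \<otimes> inv x' \<in> H" using c by (simp add: m_assoc inv_mult_group)
next
  assume "y' \<otimes> inv x' \<in> H"
  then have "inv (y' \<otimes> inv y) \<otimes> (y' \<otimes> inv x') \<otimes> (x' \<otimes> inv x) \<in> H" using H by simp
  then show "y \<otimes> inv x \<in> H" using c by (simp add: m_assoc inv_mult_group)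
qed

end

context maximal_dihedral
begin

text \<open>The partner depends on the coset alone and not on the end points \<open>u\<close> and
  \<open>v\<close>; therefore flips at neighbouring positions do not disturb each other.\<close>

lemma partner_flip:
  assumes u: "u \<rightarrow>\<^sub>B x" "x \<rightarrow>\<^sub>B v" "x \<otimes> inv u \<in> H" "v \<otimes> inv x \<in> H"
  shows "flip G S u v x = partner x" "partner x \<in> carrier G" "partner x \<otimes> inv x \<in> H" "partner x \<noteq> x"
    "lev (partner x) = lev x" "partner (partner x) = x" "u \<rightarrow>\<^sub>B partner x" "partner x \<rightarrow>\<^sub>B v"
proof -
  note f = flip_level[OF u]
  have "\<exists>z. z \<in> carrier G \<and> z \<otimes> inv x \<in> H \<and> z \<noteq> x \<and> lev z = lev x" using f(1-4) by blast
  from someI_ex[OF this] have p: "partner x \<in> carrier G \<and> partner x \<otimes> inv x \<in> H \<and> partner x \<noteq> x \<and> lev (partner x) = lev x"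
    unfolding partner_def .
  then show "partner x \<in> carrier G" "partner x \<otimes> inv x \<in> H" "partner x \<noteq> x" "lev (partner x) = lev x" by blast+
  show eq: "flip G S u v x = partner x" using f(8)[of "partner x"] p by simp
  show e: "u \<rightarrow>\<^sub>B partner x" "partner x \<rightarrow>\<^sub>B v" using f(5) eq middle_vertices_iff by auto
  note c = edgeD(1,2)[OF u(1)] edgeD(2)[OF u(2)]
  have h: "partner x \<otimes> inv u \<in> H" "v \<otimes> inv (partner x) \<in> H"
    using coset_trans[of u x "partner x"] coset_trans[of "partner x" x v] coset_sym[of x "partner x"] p c u by blast+
  note f' = flip_level[OF e h]
  have "\<exists>z. z \<in> carrier G \<and> z \<otimes> inv (partner x) \<in> H \<and> z \<noteq> partner x \<and> lev z = lev (partner x)" using f'(1-4) by blast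
  from someI_ex[OF this] have "partner (partner x) = flip G S u v (partner x)"
    using f'(8)[of "partner (partner x)"] unfolding partner_def[of "partner x", symmetric] by blast
  moreover have "x = flip G S u v (partner x)" using f'(8)[of x] p coset_sym[of x "partner x"] c by auto
  ultimately show "partner (partner x) = x" by simp
qed

lemma path_nthD:
  assumes "xs \<in> paths G S h u v"
  shows "length xs = Suc h" "\<And>i. i \<le> h \<Longrightarrow> xs ! i \<in> carrier G" "\<And>i. i < h \<Longrightarrow> xs ! i \<rightarrow>\<^sub>B xs ! Suc i"
  using assms by (auto simp: paths_def in_lists_conv_set)

lemma togglable_partner:
  assumes "xs \<in> paths G S h u v" "togglable xs i"
  shows "flip G S (xs ! (i - 1)) (xs ! Suc i) (xs ! i) = partner (xs ! i)" "partner (xs ! i) \<in> carrier G"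
    "partner (xs ! i) \<otimes> inv (xs ! i) \<in> H" "partner (partner (xs ! i)) = xs ! i" "lev (partner (xs ! i)) = lev (xs ! i)"
proof -
  have i: "0 < i" "i < h" "xs ! i \<otimes> inv (xs ! (i - 1)) \<in> H" "xs ! Suc i \<otimes> inv (xs ! i) \<in> H"
    using assms path_nthD(1)[OF assms(1)] by (auto simp: togglable_def)
  have e: "xs ! (i - 1) \<rightarrow>\<^sub>B xs ! i" "xs ! i \<rightarrow>\<^sub>B xs ! Suc i"
    using path_nthD(3)[OF assms(1), of "i - 1"] path_nthD(3)[OF assms(1), of i] i by auto
  show "flip G S (xs ! (i - 1)) (xs ! Suc i) (xs ! i) = partner (xs ! i)" "partner (xs ! i) \<in> carrier G"
    "partner (xs ! i) \<otimes> inv (xs ! i) \<in> H" "partner (partner (xs ! i)) = xs ! i" "lev (partner (xs ! i)) = lev (xs ! i)"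
    using partner_flip[OF e i(3,4)] by blast+
qed

lemma toggle_coset:
  assumes xs: "xs \<in> paths G S h u v" and i: "i \<le> h"
  shows "toggle k xs ! i \<in> carrier G" "toggle k xs ! i \<otimes> inv (xs ! i) \<in> H"
  using togglable_partner[OF xs, of i] path_nthD[OF xs] i by (auto simp: nth_toggle)

lemma toggle_label_iff:
  assumes xs: "xs \<in> paths G S h u v" and i: "i < h"
  shows "toggle k xs ! Suc i \<otimes> inv (toggle k xs ! i) \<in> H \<longleftrightarrow> xs ! Suc i \<otimes> inv (xs ! i) \<in> H"
  using coset_label_iff toggle_coset[OF xs, of i] toggle_coset[OF xs, of "Suc i"] path_nthD[OF xs] i by simp

lemma togglable_toggle:
  assumes xs: "xs \<in> paths G S h u v"
  shows "togglable (toggle k xs) i \<longleftrightarrow> togglable xs i"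
proof (cases "0 < i \<and> i < h")
  case True
  then have "Suc (i - 1) = i" "i - 1 < h" by auto
  then show ?thesis using toggle_label_iff[OF xs, of "i - 1" k] toggle_label_iff[OF xs, of i k] True
    path_nthD(1)[OF xs] by (simp add: togglable_def)
qed (use path_nthD(1)[OF xs] in \<open>auto simp: togglable_def\<close>)

lemma toggle_in_flipclass:
  assumes F: "F \<subseteq> paths G S h u v" "flip_closed G S h F" and xs: "xs \<in> F"
  shows "toggle k xs \<in> F"
proof (induction k)
  case 0
  have "toggle 0 xs = xs" by (rule nth_equalityI) (auto simp: nth_toggle togglable_def)
  then show ?case using xs by simp
next
  case (Suc k)
  have P: "xs \<in> paths G S h u v" "toggle k xs \<in> paths G S h u v" using F xs Suc by auto
  note len = path_nthD(1)[OF P(1)]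
  show ?case
  proof (cases "togglable xs (Suc k)")
    case False
    then have "toggle (Suc k) xs = toggle k xs"
      by (intro nth_equalityI) (auto simp: nth_toggle le_Suc_eq)
    then show ?thesis using Suc by simp
  next
    case True
    then have k: "Suc k < h" using len by (simp add: togglable_def)
    have "togglable (toggle k xs) (Suc k)" using togglable_toggle[OF P(1)] True by simp
    from togglable_partner(1)[OF P(2) this]
    \<comment> \<open>The left neighbour may already have been replaced by its partner, which stays
      in the same coset and so leaves this flip unchanged.\<close>
    have fl: "flip G S (toggle k xs ! k) (toggle k xs ! Suc (Suc k)) (toggle k xs ! Suc k) = partner (xs ! Suc k)"
      using k len by (simp add: nth_toggle)
    have "flip_path G S (Suc k) (toggle k xs) = toggle (Suc k) xs"
    proof (rule nth_equalityI)
      show "length (flip_path G S (Suc k) (toggle k xs)) = length (toggle (Suc k) xs)" by (simp add: flip_path_def)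
      fix i assume i: "i < length (flip_path G S (Suc k) (toggle k xs))"
      then have i: "i < length xs" by (simp add: flip_path_def)
      show "flip_path G S (Suc k) (toggle k xs) ! i = toggle (Suc k) xs ! i"
      proof (cases "i = Suc k")
        case True
        then show ?thesis using fl i \<open>togglable xs (Suc k)\<close> by (simp add: flip_path_def nth_toggle)
      next
        case False
        then show ?thesis using i by (auto simp: flip_path_def nth_toggle le_Suc_eq)
      qed
    qed
    moreover have "flip_path G S (Suc k) (toggle k xs) \<in> F" using F(2) Suc k unfolding flip_closed_def by auto
    ultimately show ?thesis by simp
  qed
qed

lemma toggle_toggle:
  assumes xs: "xs \<in> paths G S h u v" shows "toggle h (toggle h xs) = xs"
proof (rule nth_equalityI)
  fix i assume "i < length (toggle h (toggle h xs))"
  then have "i < length xs" by simp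
  then show "toggle h (toggle h xs) ! i = xs ! i"
    using togglable_toggle[OF xs] togglable_partner(4)[OF xs, of i] by (simp add: nth_toggle)
qed simp

text \<open>The label entering \<open>x\<close> is an inversion of \<open>x\<close>, the label
  leaving it is not. As the inversions of \<open>x\<close> form a segment at one end of the
  reflections of \<open>H\<close>, this end decides whether the labels ascend or descend at
  \<open>x\<close>; the partner of \<open>x\<close> has the other end.\<close>

lemma ascent_iff_initial:
  assumes x: "u \<rightarrow>\<^sub>B x" "x \<rightarrow>\<^sub>B v" "x \<otimes> inv u \<in> H" "v \<otimes> inv x \<in> H"
  shows "x \<otimes> inv u \<in> N x \<inter> H" "v \<otimes> inv x \<in> T \<inter> H" "v \<otimes> inv x \<notin> N x"
    "(N x \<inter> H = uu ` {..<lev x} \<and> N (partner x) \<inter> H = vv ` {..<lev x}) \<or>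
     (N x \<inter> H = vv ` {..<lev x} \<and> N (partner x) \<inter> H = uu ` {..<lev x})"
proof -
  note c = edgeD[OF x(1)] edgeD[OF x(2)]
  have "inv (x \<otimes> inv u) \<otimes> x = u" using c by (simp add: inv_mult_group m_assoc del: T_inv)
  then have "(x \<otimes> inv u) \<otimes> x = u" by (simp only: T_inv[OF c(4)])
  then have "\<ell> ((x \<otimes> inv u) \<otimes> x) < \<ell> x" using c(3) by (simp only:)
  then show "x \<otimes> inv u \<in> N x \<inter> H" using N_eq[OF c(2)] c(4) x(3) by blast
  have "(v \<otimes> inv x) \<otimes> x = v" using c by (simp add: m_assoc)
  then show "v \<otimes> inv x \<notin> N x" using N_eq[OF c(2)] c by simp
  show "v \<otimes> inv x \<in> T \<inter> H" using c x by simp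
  have "lev u < lev x" "lev x < lev v" using edge_iff_lev[of u x] edge_iff_lev[of x v] c x by blast+
  then obtain z where z: "z\<in>carrier G" "z \<otimes> inv x \<in> H" "z \<noteq> x" "lev z = lev x"
    "N x \<inter> H = ua ` {..<lev x} \<and> N z \<inter> H = ub ` {..<lev x} \<or>
     N x \<inter> H = ub ` {..<lev x} \<and> N z \<inter> H = ua ` {..<lev x}"
    using level_partner[OF c(2) c(6) x(4)] by auto
  have "z = partner x" using flip_level(8)[OF x z(1-4)] partner_flip(1)[OF x] by simp
  then show "(N x \<inter> H = uu ` {..<lev x} \<and> N (partner x) \<inter> H = vv ` {..<lev x}) \<or>
     (N x \<inter> H = vv ` {..<lev x} \<and> N (partner x) \<inter> H = uu ` {..<lev x})"
    using z(5) by (simp add: ua_uu ub_vv del: alt.simps)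
qed

text \<open>By transitivity only consecutive labels matter. If both lie in \<open>H\<close>,
  toggling the vertex between them moves its inversions to the other end, as the reversed order
  requires. If one lies outside, it is unchanged, and its position relative to the reflections of
  \<open>H\<close> is the same for all of them.\<close>

lemma toggle_increasing:
  assumes trans: "trans R'" and anti: "antisym R"
    and uu: "\<And>i j. i \<le> j \<Longrightarrow> j < m \<Longrightarrow> (uu i, uu j) \<in> R" "\<And>i j. i \<le> j \<Longrightarrow> j < m \<Longrightarrow> (vv j, vv i) \<in> R"
    and enum: "T \<inter> H \<subseteq> uu ` {..<m}" "T \<inter> H \<subseteq> vv ` {..<m}"
    and rev: "\<And>p q. p \<in> T \<inter> H \<Longrightarrow> q \<in> T \<inter> H \<Longrightarrow> (p, q) \<in> R \<Longrightarrow> (q, p) \<in> R'"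
    and out: "\<And>p q. p \<in> T - H \<Longrightarrow> q \<in> T - H \<Longrightarrow> (p, q) \<in> R \<Longrightarrow> (p, q) \<in> R'"
    and mix: "\<And>p p' q. p \<in> T \<inter> H \<Longrightarrow> p' \<in> T \<inter> H \<Longrightarrow> q \<in> T - H \<Longrightarrow> (p, q) \<in> R \<Longrightarrow> (p', q) \<in> R'"
      "\<And>p p' q. p \<in> T \<inter> H \<Longrightarrow> p' \<in> T \<inter> H \<Longrightarrow> q \<in> T - H \<Longrightarrow> (q, p) \<in> R \<Longrightarrow> (q, p') \<in> R'"
    and F: "F \<subseteq> paths G S h u v" "flip_closed G S h F" and xs: "xs \<in> increasing_paths G R F"
  shows "toggle h xs \<in> increasing_paths G R' F"
proof -
  have xsF: "xs \<in> F" and inc: "sorted_wrt (\<lambda>s t. (s, t) \<in> R) (labels G xs)"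
    using xs by (auto simp: increasing_paths_def)
  define ys where "ys = toggle h xs"
  have ysF: "ys \<in> F" unfolding ys_def by (rule toggle_in_flipclass[OF F xsF])
  have P: "xs \<in> paths G S h u v" "ys \<in> paths G S h u v" using F xsF ysF by auto
  have len: "length xs = Suc h" "length ys = Suc h" using path_nthD(1) P by auto
  have ll: "length (labels G xs) = h" "length (labels G ys) = h" by (simp_all add: labels_def len)
  have lab: "labels G xs ! i = xs ! Suc i \<otimes> inv (xs ! i)" "labels G ys ! i = ys ! Suc i \<otimes> inv (ys ! i)" if "i < h" for i
    using that len by (simp_all add: labels_def)
  have LT: "xs ! Suc i \<otimes> inv (xs ! i) \<in> T" "ys ! Suc i \<otimes> inv (ys ! i) \<in> T" if "i < h" for i
    using path_nthD(3)[OF P(1) that] path_nthD(3)[OF P(2) that] edgeD(4) by blast+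
  have LH: "ys ! Suc i \<otimes> inv (ys ! i) \<in> H \<longleftrightarrow> xs ! Suc i \<otimes> inv (xs ! i) \<in> H" if "i < h" for i
    unfolding ys_def using toggle_label_iff[OF P(1) that] .
  have y_nth: "ys ! i = (if togglable xs i then partner (xs ! i) else xs ! i)" if "i \<le> h" for i
    using that len by (simp add: ys_def nth_toggle)
  have same: "ys ! Suc i \<otimes> inv (ys ! i) = xs ! Suc i \<otimes> inv (xs ! i)"
    if i: "i < h" "xs ! Suc i \<otimes> inv (xs ! i) \<notin> H" for i
  proof -
    have "\<not> togglable xs i" "\<not> togglable xs (Suc i)" using i(2) by (auto simp: togglable_def)
    then show ?thesis using y_nth[of i] y_nth[of "Suc i"] i(1) by simp
  qed
  have step: "(ys ! Suc i \<otimes> inv (ys ! i), ys ! Suc (Suc i) \<otimes> inv (ys ! Suc i)) \<in> R'" if i: "Suc i < h" for i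
  proof -
    let ?p = "xs ! Suc i \<otimes> inv (xs ! i)" and ?q = "xs ! Suc (Suc i) \<otimes> inv (xs ! Suc i)"
    let ?p' = "ys ! Suc i \<otimes> inv (ys ! i)" and ?q' = "ys ! Suc (Suc i) \<otimes> inv (ys ! Suc i)"
    have pq: "(?p, ?q) \<in> R"
      using sorted_wrt_nth_less[OF inc, of i "Suc i"] i ll lab[of i] lab[of "Suc i"] by simp
    have T: "?p \<in> T" "?q \<in> T" "?p' \<in> T" "?q' \<in> T" using LT[of i] LT[of "Suc i"] i by simp_all
    have H: "?p' \<in> H \<longleftrightarrow> ?p \<in> H" "?q' \<in> H \<longleftrightarrow> ?q \<in> H" using LH[of i] LH[of "Suc i"] i by simp_all
    consider "?p \<in> H" "?q \<in> H" | "?p \<in> H" "?q \<notin> H" | "?p \<notin> H" "?q \<in> H" | "?p \<notin> H" "?q \<notin> H" by blast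
    then show ?thesis
    proof cases
      case 1
      have e: "xs ! i \<rightarrow>\<^sub>B xs ! Suc i" "xs ! Suc i \<rightarrow>\<^sub>B xs ! Suc (Suc i)"
        "ys ! i \<rightarrow>\<^sub>B ys ! Suc i" "ys ! Suc i \<rightarrow>\<^sub>B ys ! Suc (Suc i)"
        using path_nthD(3)[OF P(1)] path_nthD(3)[OF P(2)] i by simp_all
      have H': "?p' \<in> H" "?q' \<in> H" using 1 H by simp_all
      note A = ascent_iff_initial[OF e(1,2) 1]
      note B = ascent_iff_initial[OF e(3,4) H']
      have "togglable xs (Suc i)" using 1 i len by (simp add: togglable_def)
      then have y: "ys ! Suc i = partner (xs ! Suc i)" using y_nth[of "Suc i"] i by simp
      let ?k = "lev (xs ! Suc i)"
      \<comment> \<open>Otherwise the inversions of the vertex would be the last reflections of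
        \<open>H\<close> in \<open>R\<close>, and the outgoing label would precede the incoming
        one.\<close>
      have "N (xs ! Suc i) \<inter> H \<noteq> vv ` {..<?k}"
      proof
        assume Nv: "N (xs ! Suc i) \<inter> H = vv ` {..<?k}"
        then obtain n where n: "n < ?k" "?p = vv n" using A(1) by blast
        obtain n' where n': "n' < m" "?q = vv n'" using A(2) enum(2) by blast
        have "\<not> n' < ?k" using A(2,3) n'(2) Nv by blast
        then have "(?q, ?p) \<in> R" using uu(2)[of n n'] n n' by simp
        then have "?p = ?q" using pq anti by (auto dest: antisymD)
        then show False using A(1,3) by simp
      qed
      then have Nv: "N (ys ! Suc i) \<inter> H = vv ` {..<?k}" using A(4) y by auto
      then obtain n where n: "n < ?k" "?p' = vv n" using B(1) by blast
      obtain n' where n': "n' < m" "?q' = vv n'" using B(2) enum(2) by blast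
      have "\<not> n' < ?k" using B(2,3) n'(2) Nv by blast
      then have "(?q', ?p') \<in> R" using uu(2)[of n n'] n n' by simp
      then show ?thesis using rev[of ?q' ?p'] T H' by simp
    next
      case 2
      then have "?q' = ?q" using same[of "Suc i"] i by simp
      then show ?thesis using mix(1)[of ?p ?p' ?q] T H 2 pq by simp
    next
      case 3
      then have "?p' = ?p" using same[of i] i by simp
      then show ?thesis using mix(2)[of ?q ?q' ?p] T H 3 pq by simp
    next
      case 4
      then have "?q' = ?q" "?p' = ?p" using same[of "Suc i"] same[of i] i by simp_all
      then show ?thesis using out[of ?p ?q] T 4 pq by simp
    qed
  qed
  have "transp (\<lambda>s t. (s, t) \<in> R')" using trans by (auto simp: transp_def dest: transD)
  then have "sorted_wrt (\<lambda>s t. (s, t) \<in> R') (labels G ys)"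
    using step lab ll by (subst sorted_wrt_iff_nth_Suc_transp) auto
  then show ?thesis using ysF by (simp add: increasing_paths_def ys_def)
qed

end

section \<open>The effect of a braid move\<close>

context coxeter_system
begin

lemma word_order_nth:
  assumes red: "reduced ws" and ij: "i < length ws" "j < length ws"
  shows "(rfl ws i, rfl ws j) \<in> word_order ws \<longleftrightarrow> i \<le> j"
proof
  assume "(rfl ws i, rfl ws j) \<in> word_order ws"
  then obtain k l where kl: "k \<le> l" "l < length ws" "rfl ws i = rfl ws k" "rfl ws j = rfl ws l"
    by (auto simp: word_order_def)
  have "i = k" using inj_onD[OF reduced_rfl_inj[OF red] kl(3)] ij kl by simp
  moreover have "j = l" using inj_onD[OF reduced_rfl_inj[OF red] kl(4)] ij kl by simp
  ultimately show "i \<le> j" using kl(1) by simp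
qed (use ij in \<open>auto simp: word_order_def\<close>)

lemma word_order_trans_antisym:
  assumes red: "reduced ws" shows "trans (word_order ws)" "antisym (word_order ws)"
proof -
  have nth: "\<exists>i j. i \<le> j \<and> j < length ws \<and> p = rfl ws i \<and> q = rfl ws j" if "(p, q) \<in> word_order ws" for p q
    using that by (auto simp: word_order_def)
  have inj: "i = j" if "rfl ws i = rfl ws j" "i < length ws" "j < length ws" for i j
    using reduced_rfl_inj[OF red] that by (auto dest: inj_onD)
  show "trans (word_order ws)"
  proof (rule transI)
    fix p q r assume pqr: "(p, q) \<in> word_order ws" "(q, r) \<in> word_order ws"
    obtain i j where ij: "i \<le> j" "j < length ws" "p = rfl ws i" "q = rfl ws j" using nth[OF pqr(1)] by blast
    obtain k l where kl: "k \<le> l" "l < length ws" "q = rfl ws k" "r = rfl ws l" using nth[OF pqr(2)] by blast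
    have "rfl ws j = rfl ws k" using ij(4) kl(3) by (rule subst)
    then have "j = k" using inj[of j k] ij(2) kl(1,2) by simp
    then show "(p, r) \<in> word_order ws" unfolding ij(3) kl(4)
      using word_order_nth[OF red, of i l] ij(1,2) kl(1,2) by simp
  qed
  show "antisym (word_order ws)"
  proof (rule antisymI)
    fix p q assume pq: "(p, q) \<in> word_order ws" "(q, p) \<in> word_order ws"
    obtain i j where ij: "i \<le> j" "j < length ws" "p = rfl ws i" "q = rfl ws j" using nth[OF pq(1)] by blast
    obtain k l where kl: "k \<le> l" "l < length ws" "q = rfl ws k" "p = rfl ws l" using nth[OF pq(2)] by blast
    have "rfl ws j = rfl ws k" "rfl ws i = rfl ws l" using ij(3,4) kl(3,4) by metis+
    then have "j = k" "i = l" using inj[of j k] inj[of i l] ij(1,2) kl(1,2) by simp_all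
    then show "p = q" using ij kl by simp
  qed
qed

lemma rfl_after:
  assumes "set xs \<subseteq> S" "set xs' \<subseteq> S" "set ys \<subseteq> S" "\<pi> xs = \<pi> xs'" "i < length ys"
  shows "rfl (xs @ ys) (length xs + i) = rfl (xs' @ ys) (length xs' + i)"
  using rfl_append2[OF assms(1,3,5)] rfl_append2[OF assms(2,3,5)] assms(4) by simp

text \<open>With y the product of the prefix \<open>us\<close>, the replaced letters carry exactly
  the reflections of the maximal dihedral subgroup of y s y^-1 and y t y^-1. The move reverses this
  interval of the ordering and leaves everything else in place, so toggling along this subgroup is
  the bijection.\<close>

lemma braid_increasing:
  assumes fin: "finite (carrier G)" and red: "reduced ws" "N (\<pi> ws) = T" and br: "braid_step ws ws'"
    and F: "F \<subseteq> paths G S h u v" "flip_closed G S h F"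
  shows "card (increasing_paths G (word_order ws) F) = card (increasing_paths G (word_order ws') F)"
proof -
  obtain us vs s t where st: "s \<in> S" "t \<in> S" "s \<noteq> t"
    and ws: "ws = us @ alt s t (ord (s \<otimes> t)) @ vs" "ws' = us @ alt t s (ord (s \<otimes> t)) @ vs"
    using br unfolding braid_step_def by blast
  define m where "m = ord (s \<otimes> t)"
  note ws = ws[folded m_def]
  have m0: "m \<noteq> 0" using ord_ge_1[OF fin, of "s \<otimes> t"] st by (simp add: m_def)
  have pow: "(s \<otimes> t) [^] m = \<one>" using st by (simp add: m_def)
  have pow': "(t \<otimes> s) [^] m = \<one>" using pow_ord_eq_1[of "t \<otimes> s"] ord_swap[OF st(1,2)] st(1,2) by (simp add: m_def)
  have uv: "set us \<subseteq> S" "set vs \<subseteq> S" using red(1) ws by (auto simp: reduced_def)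
  have aS: "set (alt s t m) \<subseteq> S" "set (alt t s m) \<subseteq> S" using st by simp_all
  have braid: "\<pi> (alt s t m) = \<pi> (alt t s m)" using alt_power_one[OF st(1,2) pow] .
  have same: "\<pi> ws = \<pi> ws'" unfolding ws using uv aS braid by (simp add: words_append)
  have red': "reduced ws'" using red(1) same uv aS ws by (simp add: reduced_def)
  define y where "y = \<pi> us"
  have y: "y \<in> carrier G" using uv by (simp add: y_def)
  define a where "a = y \<otimes> s \<otimes> inv y"
  define b where "b = y \<otimes> t \<otimes> inv y"
  have sT: "s \<in> T" "t \<in> T" using st S_subset_T by auto
  have ab: "a \<in> T" "b \<in> T" using T_conj sT y by (simp_all add: a_def b_def)
  have ab_ne: "a \<noteq> b" unfolding a_def b_def using st y by simp
  let ?D = "dmax a b"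
  let ?u = "\<lambda>j. \<pi> (alt s t (Suc (2 * j)))" and ?v = "\<lambda>j. \<pi> (alt t s (Suc (2 * j)))"
  have TD: "T \<inter> ?D = fixplane a b" using dmax_T ab by blast
  obtain c d where "maximal_dihedral G S (dmax s t) c d" using dmax_maximal_dihedral[OF sT st(3)] by blast
  then interpret D0: maximal_dihedral G S "dmax s t" c d .
  have "s \<in> dmax s t" "t \<in> dmax s t" using dmax_T[OF sT] in_fixplane sT by blast+
  \<comment> \<open>A simple reflection is canonical in every reflection subgroup that contains it;
    so the two canonical generators must be \<open>s\<close> and \<open>t\<close>.\<close>
  then have "s \<in> \<chi> (dmax s t)" "t \<in> \<chi> (dmax s t)" using gen_cgen st by auto
  then have chi0: "\<chi> (dmax s t) = {s, t}" using D0.cgens st(3) by auto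
  interpret D1: rank_two_subgroup G S "dmax s t" s t using chi0 st(3) by unfold_locales auto
  have enum0: "fixplane s t \<subseteq> ?u ` {..<m}"
    using D1.TH_enum m0 dmax_T[OF sT] unfolding D1.ua_uu m_def by blast
  have Dsub: "T \<inter> ?D \<subseteq> (\<lambda>j. y \<otimes> ?u j \<otimes> inv y) ` {..<m}"
  proof
    fix q assume q: "q \<in> T \<inter> ?D"
    then have "inv y \<otimes> q \<otimes> y \<in> fixplane s t"
      using TD fixplane_conj[OF sT y, of q] by (auto simp: a_def b_def)
    then obtain j where j: "j < m" "inv y \<otimes> q \<otimes> y = ?u j" using enum0 by blast
    have "q = y \<otimes> (inv y \<otimes> q \<otimes> y) \<otimes> inv y" using q y by (simp add: m_assoc)
    then show "q \<in> (\<lambda>j. y \<otimes> ?u j \<otimes> inv y) ` {..<m}" unfolding j(2) using j(1) by blast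
  qed
  have mid: "rfl ws (length us + j) = y \<otimes> ?u j \<otimes> inv y" "rfl ws' (length us + j) = y \<otimes> ?v j \<otimes> inv y"
    if j: "j < m" for j
    using rfl_append2[OF uv(1), of "alt s t m @ vs" j] rfl_append2[OF uv(1), of "alt t s m @ vs" j] j uv aS
      rfl_append[of j "alt s t m" vs] rfl_append[of j "alt t s m" vs] rfl_alt[OF st(1,2) j] rfl_alt[OF st(2,1) j]
    by (simp_all add: ws y_def)
  have lens: "length ws = length us + m + length vs" "length ws' = length ws" using ws by simp_all
  \<comment> \<open>A reflection of \<open>?D\<close> inverted by the prefix would occur a second
    time among the replaced letters, against \<open>reduced_rfl_inj\<close>.\<close>
  have Ny: "N y \<inter> ?D = {}"
  proof (rule ccontr)
    assume "N y \<inter> ?D \<noteq> {}"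
    then obtain q where q: "q \<in> N y" "q \<in> ?D" by blast
    have "reduced us" using red(1) reduced_appendD(1) ws by metis
    then obtain i where i: "i < length us" "q = rfl us i" using q reduced_N y_def by auto
    then have 1: "q = rfl ws i" unfolding ws by (simp add: rfl_append)
    have "q \<in> T" using q y N_T by blast
    then obtain j where j: "j < m" "q = y \<otimes> ?u j \<otimes> inv y" using Dsub q by blast
    then have "rfl ws i = rfl ws (length us + j)" using mid 1 by simp
    then have "i = length us + j" using reduced_rfl_inj[OF red(1)] i j lens by (auto dest: inj_onD)
    then show False using i by simp
  qed
  obtain c' d' where "maximal_dihedral G S ?D c' d'" using dmax_maximal_dihedral[OF ab ab_ne] by blast
  then interpret M0: maximal_dihedral G S ?D c' d' .
  have abD: "a \<in> ?D" "b \<in> ?D" using TD in_fixplane ab by blast+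
  have "a \<in> \<chi> ?D" "b \<in> \<chi> ?D"
    using M0.coset_minimal_conj[OF y Ny st(1)] M0.coset_minimal_conj[OF y Ny st(2)] abD by (simp_all add: a_def b_def)
  then have chi: "\<chi> ?D = {a, b}" using M0.cgens ab_ne by auto
  interpret M: maximal_dihedral G S ?D a b using chi ab_ne M0.maximal by unfold_locales auto
  interpret M': maximal_dihedral G S ?D b a using chi ab_ne M0.maximal by unfold_locales auto
  have conj_pow: "(y \<otimes> g \<otimes> inv y) [^] n = y \<otimes> g [^] n \<otimes> inv y" if g: "g \<in> carrier G" for g and n :: nat
    by (induction n) (use g y in \<open>simp_all add: m_assoc\<close>)
  have conj_mult: "(y \<otimes> g \<otimes> inv y) \<otimes> (y \<otimes> k \<otimes> inv y) = y \<otimes> (g \<otimes> k) \<otimes> inv y"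
    if "g \<in> carrier G" "k \<in> carrier G" for g k using that y by (simp add: m_assoc)
  have uu: "M.uu j = y \<otimes> ?u j \<otimes> inv y" for j
    unfolding M.uu_def unfolding D1.ua_uu D1.uu_def a_def b_def using st(1,2) y by (simp only: conj_mult conj_pow S_in m_closed nat_pow_closed)
  have vv: "M.vv j = y \<otimes> ?v j \<otimes> inv y" for j
    unfolding M.vv_def unfolding D1.ub_vv D1.vv_def a_def b_def using st(1,2) y by (simp only: conj_mult conj_pow S_in m_closed nat_pow_closed)
  have swap_uv: "M'.uu = M.vv" "M'.vv = M.uu" by (simp_all add: fun_eq_iff M.uu_def M.vv_def M'.uu_def M'.vv_def)
  have flipv: "M.vv j = M.uu (m - Suc j)" if "j < m" for j
    unfolding uu vv using alt_flip[OF st(1,2) pow that] by simp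
  have enum: "T \<inter> ?D = M.uu ` {..<m}" "T \<inter> ?D = M.vv ` {..<m}"
  proof -
    show 1: "T \<inter> ?D = M.uu ` {..<m}" using Dsub M.uu_vv_T unfolding uu by blast
    have "M.uu j = M.vv (m - Suc j)" if "j < m" for j using flipv[of "m - Suc j"] that by (simp add: Suc_diff_Suc)
    then have "M.uu ` {..<m} \<subseteq> M.vv ` {..<m}" using m0 by (auto intro!: image_eqI)
    then show "T \<inter> ?D = M.vv ` {..<m}" using 1 M.uu_vv_T by blast
  qed
  let ?R = "word_order ws" and ?R' = "word_order ws'"
  let ?p = "length us"
  have uuR: "(M.uu i, M.uu j) \<in> ?R \<longleftrightarrow> i \<le> j" "(M.vv i, M.vv j) \<in> ?R' \<longleftrightarrow> i \<le> j" if "i < m" "j < m" for i j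
    using word_order_nth[OF red(1), of "?p + i" "?p + j"] word_order_nth[OF red', of "?p + i" "?p + j"]
      mid[OF that(1)] mid[OF that(2)] that lens unfolding uu vv by simp_all
  have vvR: "(M.vv j, M.vv i) \<in> ?R" "(M.uu j, M.uu i) \<in> ?R'" if "i \<le> j" "j < m" for i j
  proof -
    show "(M.vv j, M.vv i) \<in> ?R" using flipv[of i] flipv[of j] uuR(1)[of "m - Suc j" "m - Suc i"] that by simp
    have "M.uu i = M.vv (m - Suc i)" if "i < m" for i using flipv[of "m - Suc i"] that by (simp add: Suc_diff_Suc)
    then show "(M.uu j, M.uu i) \<in> ?R'" using uuR(2)[of "m - Suc j" "m - Suc i"] that by simp
  qed
  define inD where "inD i \<longleftrightarrow> ?p \<le> i \<and> i < ?p + m" for i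
  have rflD: "rfl ws i \<in> ?D \<longleftrightarrow> inD i" "rfl ws' i \<in> ?D \<longleftrightarrow> inD i" if i: "i < length ws" for i
  proof -
    have T: "rfl ws i \<in> T" "rfl ws' i \<in> T" using rfl_T i lens red red' by (simp_all add: reduced_def)
    have in1: "rfl ws i \<in> ?D" "rfl ws' i \<in> ?D" if "inD i"
    proof -
      obtain j where "i = ?p + j" "j < m" using \<open>inD i\<close> unfolding inD_def using le_Suc_ex by auto
      then show "rfl ws i \<in> ?D" "rfl ws' i \<in> ?D" using mid M.uu_vv_T[of j] by (simp_all add: uu vv)
    qed
    moreover have "inD i" if iD: "rfl ws i \<in> ?D"
    proof -
      have "rfl ws i \<in> M.uu ` {..<m}" using enum(1) T(1) iD by blast
      then obtain j where j: "j < m" "rfl ws i = M.uu j" by blast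
      then have "rfl ws i = rfl ws (?p + j)" using mid(1)[OF j(1)] uu[of j] by metis
      from inj_onD[OF reduced_rfl_inj[OF red(1)] this] have "i = ?p + j" using i j(1) lens by simp
      then show ?thesis using j by (simp add: inD_def)
    qed
    moreover have "inD i" if iD: "rfl ws' i \<in> ?D"
    proof -
      have "rfl ws' i \<in> M.vv ` {..<m}" using enum(2) T(2) iD by blast
      then obtain j where j: "j < m" "rfl ws' i = M.vv j" by blast
      then have "rfl ws' i = rfl ws' (?p + j)" using mid(2)[OF j(1)] vv[of j] by metis
      from inj_onD[OF reduced_rfl_inj[OF red'] this] have "i = ?p + j" using i j(1) lens by simp
      then show ?thesis using j by (simp add: inD_def)
    qed
    ultimately show "rfl ws i \<in> ?D \<longleftrightarrow> inD i" "rfl ws' i \<in> ?D \<longleftrightarrow> inD i" by blast+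
  qed
  have outD: "rfl ws i = rfl ws' i" if "i < length ws" "\<not> inD i" for i
  proof (cases "i < ?p")
    case True then show ?thesis unfolding ws by (simp add: rfl_append)
  next
    case False
    then have "?p + m \<le> i" using that by (simp add: inD_def)
    then obtain j where j: "i = ?p + m + j" using le_Suc_ex by blast
    have "\<pi> (us @ alt s t m) = \<pi> (us @ alt t s m)" using uv aS braid by (simp add: words_append)
    then show ?thesis using rfl_after[of "us @ alt s t m" "us @ alt t s m" vs j] uv aS j that(1) lens
      unfolding ws by simp
  qed
  have Tnth: "\<exists>i<length ws. q = rfl ws i" "\<exists>i<length ws. q = rfl ws' i" if "q \<in> T" for q
    using reduced_N[OF red(1)] reduced_N[OF red'] red(2) same that lens by auto
  \<comment> \<open>The comparison of the two orders is a predicate of both, so that one argument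
    serves the bijection and its inverse.\<close>
  have main: "toggle_ok R1 R2" if "(R1, R2) = (?R, ?R') \<or> (R1, R2) = (?R', ?R)"
    and "toggle_ok = (\<lambda>R1 R2. (\<forall>p\<in>T - ?D. \<forall>q\<in>T - ?D. (p, q) \<in> R1 \<longrightarrow> (p, q) \<in> R2) \<and>
      (\<forall>p\<in>T \<inter> ?D. \<forall>p'\<in>T \<inter> ?D. \<forall>q\<in>T - ?D. ((p, q) \<in> R1 \<longrightarrow> (p', q) \<in> R2) \<and> ((q, p) \<in> R1 \<longrightarrow> (q, p') \<in> R2)) \<and>
      (\<forall>p\<in>T \<inter> ?D. \<forall>q\<in>T \<inter> ?D. (p, q) \<in> R1 \<longrightarrow> (q, p) \<in> R2))" for R1 R2 toggle_ok
  proof -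
    have A: "(p, q) \<in> ?R \<longleftrightarrow> (p, q) \<in> ?R'" if pq: "p \<in> T - ?D" "q \<in> T - ?D" for p q
    proof -
      obtain i j where ij: "i < length ws" "p = rfl ws i" "j < length ws" "q = rfl ws j" using Tnth(1) pq by blast
      then have o: "\<not> inD i" "\<not> inD j" using rflD(1) pq by auto
      then have "p = rfl ws' i" "q = rfl ws' j" using outD ij by auto
      then show ?thesis using word_order_nth[OF red(1) ij(1,3)] word_order_nth[OF red', of i j] ij lens by simp
    qed
    have B: "((p, q) \<in> ?R \<longleftrightarrow> (p', q) \<in> ?R') \<and> ((q, p) \<in> ?R \<longleftrightarrow> (q, p') \<in> ?R')"
      if pq: "p \<in> T \<inter> ?D" "p' \<in> T \<inter> ?D" "q \<in> T - ?D" for p p' q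
    proof -
      obtain i j where ij: "i < length ws" "p = rfl ws i" "j < length ws" "q = rfl ws j" using Tnth(1) pq by blast
      obtain i' where i': "i' < length ws" "p' = rfl ws' i'" using Tnth(2) pq by blast
      have o: "inD i" "inD i'" "\<not> inD j" using rflD ij i' pq by auto
      then have "q = rfl ws' j" using outD ij by auto
      moreover have "i \<le> j \<longleftrightarrow> i' \<le> j" "j \<le> i \<longleftrightarrow> j \<le> i'" using o by (auto simp: inD_def)
      ultimately show ?thesis using word_order_nth[OF red(1) ij(1,3)] word_order_nth[OF red', of i' j]
        word_order_nth[OF red(1) ij(3,1)] word_order_nth[OF red', of j i'] ij i' lens by simp
    qed
    have C: "(p, q) \<in> ?R \<longleftrightarrow> (q, p) \<in> ?R'" if pq: "p \<in> T \<inter> ?D" "q \<in> T \<inter> ?D" for p q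
    proof -
      obtain i j where ij: "i < m" "p = M.uu i" "j < m" "q = M.uu j" using pq enum(1) by blast
      have e: "M.uu i = M.vv (m - Suc i)" if "i < m" for i using flipv[of "m - Suc i"] that by (simp add: Suc_diff_Suc)
      have "(q, p) \<in> ?R' \<longleftrightarrow> m - Suc j \<le> m - Suc i" using uuR(2)[of "m - Suc j" "m - Suc i"] ij e by simp
      then show ?thesis using uuR(1)[of i j] ij by auto
    qed
    show ?thesis using that(1) unfolding that(2) using A B C by blast
  qed
  note ok1 = main[of ?R ?R', OF _ refl, simplified]
  note ok2 = main[of ?R' ?R, OF _ refl, simplified]
  have t1: "M0.toggle h xs \<in> increasing_paths G ?R' F" if "xs \<in> increasing_paths G ?R F" for xs
    by (rule M.toggle_increasing[OF word_order_trans_antisym(1)[OF red'] word_order_trans_antisym(2)[OF red(1)]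
        _ _ _ _ _ _ _ _ F that, where m = m]) (use uuR vvR enum ok1 in auto)
  have t2: "M0.toggle h xs \<in> increasing_paths G ?R F" if "xs \<in> increasing_paths G ?R' F" for xs
    by (rule M'.toggle_increasing[OF word_order_trans_antisym(1)[OF red(1)] word_order_trans_antisym(2)[OF red']
        _ _ _ _ _ _ _ _ F that, where m = m, unfolded swap_uv]) (use uuR vvR enum ok2 in auto)
  have invol: "M0.toggle h (M0.toggle h xs) = xs" if "xs \<in> F" for xs using M0.toggle_toggle F that by blast
  have "bij_betw (M0.toggle h) (increasing_paths G ?R F) (increasing_paths G ?R' F)"
    by (rule bij_betw_byWitness[where f' = "M0.toggle h"])
       (use t1 t2 invol in \<open>auto simp: increasing_paths_def\<close>)
  then show ?thesis by (rule bij_betw_same_card)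
qed

theorem increasing_number_indep:
  assumes fin: "finite (carrier G)" and F: "flipclass G S h F"
    and R: "reflection_ordering G S R" "reflection_ordering G S R'"
  shows "card (increasing_paths G R F) = card (increasing_paths G R' F)"
proof -
  obtain u v where F: "F \<subseteq> paths G S h u v" "flip_closed G S h F"
    using F unfolding flipclass_def flipclass_from_to_def by blast
  obtain ws where ws: "reduced ws" "N (\<pi> ws) = T" "R = word_order ws"
    using reflection_ordering_word[OF fin R(1)] by blast
  obtain ws' where ws': "reduced ws'" "N (\<pi> ws') = T" "R' = word_order ws'"
    using reflection_ordering_word[OF fin R(2)] by blast
  have "\<pi> ws = \<pi> ws'" using N_inj[of "\<pi> ws" "\<pi> ws'"] ws ws' by (simp add: reduced_def)
  then have "braid_step\<^sup>*\<^sup>* ws ws'" using word_property ws(1) ws'(1) by blast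
  then have "reduced ws' \<and> N (\<pi> ws') = T \<and>
    card (increasing_paths G (word_order ws) F) = card (increasing_paths G (word_order ws') F)"
  proof (induction rule: rtranclp_induct)
    case base then show ?case using ws by simp
  next
    case (step vs vs')
    then have vs: "reduced vs" "N (\<pi> vs) = T" by auto
    then have S: "set vs \<subseteq> S" by (simp add: reduced_def)
    have S': "set vs' \<subseteq> S" using braid_step_S[OF step.hyps(2) S] .
    have "vs \<sim>\<^sub>w vs'" using weq_braid[OF step.hyps(2) S] .
    then have eq: "\<pi> vs = \<pi> vs'" using weq_iff[OF S S'] by simp
    have "length vs = length vs'" using step.hyps(2) by (auto simp: braid_step_def)
    then have "reduced vs'" using vs eq S' by (simp add: reduced_def)
    then show ?case using braid_increasing[OF fin vs step.hyps(2) F] step.IH eq vs by simp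
  qed
  then show ?thesis using ws(3) ws'(3) by simp
qed

end

section \<open>Rank and irreducibility\<close>

text \<open>Gaussian elimination: the unknown \<open>p\<close> is a pivot of the last equation,
  \<open>?M\<close> is the system after elimination, and \<open>z\<close> is the value of
  \<open>p\<close> that the last equation dictates.\<close>

lemma homogeneous_nontrivial:
  fixes M :: "nat \<Rightarrow> 'q \<Rightarrow> real"
  assumes "finite B" "h < card B"
  shows "\<exists>c. (\<exists>q\<in>B. c q \<noteq> 0) \<and> (\<forall>i<h. (\<Sum>q\<in>B. c q * M i q) = 0)"
  using assms
proof (induction h arbitrary: B M)
  case 0
  then have "B \<noteq> {}" by auto
  then show ?case by (intro exI[of _ "\<lambda>_. 1"]) auto
next
  case (Suc h)
  show ?case
  proof (cases "\<forall>q\<in>B. M h q = 0")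
    case True
    obtain c where c: "\<exists>q\<in>B. c q \<noteq> 0" "\<forall>i<h. (\<Sum>q\<in>B. c q * M i q) = 0"
      using Suc.IH[of B M] Suc.prems by auto
    then show ?thesis using True by (intro exI[of _ c]) (auto simp: less_Suc_eq)
  next
    case False
    then obtain p where p: "p \<in> B" "M h p \<noteq> 0" by blast
    let ?B = "B - {p}"
    let ?M = "\<lambda>i q. M i q - M i p * M h q / M h p"
    have "h < card ?B" using Suc.prems p by simp
    then obtain c where c: "\<exists>q\<in>?B. c q \<noteq> 0" "\<forall>i<h. (\<Sum>q\<in>?B. c q * ?M i q) = 0"
      using Suc.IH[of ?B ?M] Suc.prems by auto
    define z where "z = - (\<Sum>q\<in>?B. c q * M h q) / M h p"
    define d where "d q = (if q = p then z else c q)" for q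
    have sum: "(\<Sum>q\<in>B. d q * M i q) = z * M i p + (\<Sum>q\<in>?B. c q * M i q)" for i
    proof -
      have "(\<Sum>q\<in>B. d q * M i q) = d p * M i p + (\<Sum>q\<in>?B. d q * M i q)"
        using Suc.prems(1) p(1) by (rule sum.remove)
      moreover have "(\<Sum>q\<in>?B. d q * M i q) = (\<Sum>q\<in>?B. c q * M i q)" by (intro sum.cong) (auto simp: d_def)
      ultimately show ?thesis by (simp add: d_def)
    qed
    have "(\<Sum>q\<in>B. d q * M i q) = 0" if i: "i < Suc h" for i
    proof (cases "i = h")
      case True
      then show ?thesis unfolding sum using p(2) by (simp add: z_def)
    next
      case False
      then have "(\<Sum>q\<in>?B. c q * ?M i q) = 0" using c(2) i by simp
      then have "(\<Sum>q\<in>?B. c q * M i q) - (\<Sum>q\<in>?B. c q * M h q) * (M i p / M h p) = 0"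
        by (simp add: right_diff_distrib sum_subtractf sum_distrib_right mult.assoc mult.left_commute)
           (simp add: sum_divide_distrib sum_distrib_left mult.assoc mult.commute mult.left_commute)
      then show ?thesis unfolding sum z_def by simp
    qed
    moreover have "\<exists>q\<in>B. d q \<noteq> 0" using c(1) by (auto simp: d_def)
    ultimately show ?thesis by blast
  qed
qed

context coxeter_system
begin

lemma path_lenD: "xs \<in> paths G S h u v \<Longrightarrow> length xs = Suc h"
  and path_edgeD: "xs \<in> paths G S h u v \<Longrightarrow> i < h \<Longrightarrow> xs ! i \<rightarrow>\<^sub>B xs ! Suc i"
  by (auto simp: paths_def)

lemma set_labels: "xs \<in> paths G S h u v \<Longrightarrow>
    set (labels G xs) = {xs ! Suc i \<otimes> inv (xs ! i) | i. i < h}"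
  by (auto simp: labels_def path_lenD)

lemma set_labels_T:
  assumes "xs \<in> paths G S h u v" shows "set (labels G xs) \<subseteq> T"
  unfolding set_labels[OF assms] using edgeD(4)[OF path_edgeD[OF assms]] by blast

text \<open>A flip keeps the product of the two labels at \<open>i\<close>; so the new labels lie in
  the \<open>fixplane\<close> of the old ones and vanish wherever these do.\<close>

lemma flip_path_fixed:
  assumes xs: "xs \<in> paths G S h u v" and ys: "flip_path G S i xs \<in> paths G S h u v" and i: "i \<in> {1..<h}"
    and fix0: "\<forall>t\<in>set (labels G xs). rt t F = 0"
  shows "\<forall>t\<in>set (labels G (flip_path G S i xs)). rt t F = 0"
proof
  let ?ys = "flip_path G S i xs"
  fix t assume "t \<in> set (labels G ?ys)"
  then obtain j where j: "j < h" "t = ?ys ! Suc j \<otimes> inv (?ys ! j)" using set_labels[OF ys] by auto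
  have len: "length xs = Suc h" using path_lenD[OF xs] .
  have nth: "?ys ! k = xs ! k" if "k \<noteq> i" for k using that by (simp add: flip_path_def)
  have Si: "Suc (i - 1) = i" "i - 1 < h" "i < h" using i by auto
  define p where "p = xs ! i \<otimes> inv (xs ! (i - 1))"
  define q where "q = xs ! Suc i \<otimes> inv (xs ! i)"
  define p' where "p' = ?ys ! i \<otimes> inv (?ys ! (i - 1))"
  define q' where "q' = ?ys ! Suc i \<otimes> inv (?ys ! i)"
  have e: "xs ! (i - 1) \<rightarrow>\<^sub>B xs ! i" "xs ! i \<rightarrow>\<^sub>B xs ! Suc i" "?ys ! (i - 1) \<rightarrow>\<^sub>B ?ys ! i" "?ys ! i \<rightarrow>\<^sub>B ?ys ! Suc i"
    using path_edgeD[OF xs, of "i - 1"] path_edgeD[OF xs, of i] path_edgeD[OF ys, of "i - 1"] path_edgeD[OF ys, of i] Si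
    by simp_all
  note c = edgeD[OF e(1)] edgeD[OF e(2)] edgeD[OF e(3)] edgeD[OF e(4)]
  have T: "p \<in> T" "q \<in> T" "p' \<in> T" "q' \<in> T" using c by (simp_all add: p_def q_def p'_def q'_def)
  have "p \<in> set (labels G xs)" "q \<in> set (labels G xs)"
    using set_labels[OF xs] Si p_def q_def by (metis (mono_tags, lifting) mem_Collect_eq)+
  then have pq0: "rt p F = 0" "rt q F = 0" using fix0 by auto
  have "q \<otimes> p = xs ! Suc i \<otimes> inv (xs ! (i - 1))" using c by (simp add: p_def q_def m_assoc)
  moreover have "q' \<otimes> p' = ?ys ! Suc i \<otimes> inv (?ys ! (i - 1))" using c by (simp add: p'_def q'_def m_assoc)
  moreover have "i - 1 \<noteq> i" using Si by simp
  ultimately have eq: "q \<otimes> p = q' \<otimes> p'" using nth[of "i - 1"] nth[of "Suc i"] by simp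
  have "q \<noteq> p" using flip_maximal_dihedral[OF e(1,2)] p_def q_def by blast
  then have "q' \<in> fixplane q p" "p' \<in> fixplane q p" using same_product_fixplane[OF T(2,1,4,3) _ eq] by blast+
  then have pq': "rt p' F = 0" "rt q' F = 0" using pq0 by (auto simp: fixplane_def)
  consider "j = i" | "Suc j = i" | "j \<noteq> i" "Suc j \<noteq> i" by blast
  then show "rt t F = 0"
  proof cases
    case 1 then show ?thesis using pq' j by (simp add: q'_def)
  next
    case 2 then show ?thesis using pq' j by (auto simp: p'_def)
  next
    case 3
    then have "t = xs ! Suc j \<otimes> inv (xs ! j)" using nth j by simp
    then have "t \<in> set (labels G xs)" using set_labels[OF xs] j by blast
    then show ?thesis using fix0 by blast
  qed
qed

text \<open>The subspace of points fixed by all labels of a path is invariant under flips; if it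
  contained a nonzero point of the span of finitely many basis vectors, the group would fix it.\<close>

theorem rank_le:
  assumes F: "flipclass G S h F" and gen: "generate G (label_set G F) = carrier G"
  shows "finite S \<and> card S \<le> h"
proof (rule finite_if_finite_subsets_card_bdd)
  obtain u v where uvF: "flipclass_from_to G S h u v F" using F unfolding flipclass_def by blast
  then have FP: "F \<subseteq> paths G S h u v" "F \<noteq> {}" "flip_closed G S h F"
    and min: "\<And>A. A \<subseteq> F \<Longrightarrow> A \<noteq> {} \<Longrightarrow> flip_closed G S h A \<Longrightarrow> A = F"
    by (simp_all add: flipclass_from_to_def)
  fix B assume B: "B \<subseteq> S" "finite B"
  show "card B \<le> h"
  proof (rule ccontr)
    assume "\<not> card B \<le> h"
    obtain xs where xs: "xs \<in> F" using FP by blast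
    then have xsP: "xs \<in> paths G S h u v" using FP by blast
    define t where "t i = xs ! Suc i \<otimes> inv (xs ! i)" for i
    have tT: "t i \<in> T" if "i < h" for i using path_edgeD[OF xsP that] edgeD(4) by (simp add: t_def)
    obtain c where c: "\<exists>q\<in>B. c q \<noteq> 0" "\<forall>i<h. (\<Sum>q\<in>B. c q * rt (t i) (delta q)) = 0"
      using homogeneous_nontrivial[OF B(2), of h "\<lambda>i q. rt (t i) (delta q)"] \<open>\<not> card B \<le> h\<close> by auto
    \<comment> \<open>The point with value \<open>c q\<close> on the simple root of each
      \<open>q\<close> in \<open>B\<close>. Its coefficients solve h equations in more than h
      unknowns, so every label of \<open>xs\<close> fixes it.\<close>
    define C where "C p = (\<Sum>q\<in>B. c q * delta q p)" for p
    have rtC: "rt r (\<lambda>p. \<Sum>q\<in>B'. c q * delta q p) = (\<Sum>q\<in>B'. c q * rt r (delta q))" if r: "r \<in> T" and "finite B'" for r B'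
      using that(2)
    proof (induction B')
      case empty
      show ?case using rt_lin[OF r, of 0 "\<lambda>_. 0" 0 "\<lambda>_. 0"] by simp
    next
      case (insert q A)
      then show ?case using rt_lin[OF r, of "c q" "delta q" 1] by simp
    qed
    then have rtC: "rt r C = (\<Sum>q\<in>B. c q * rt r (delta q))" if "r \<in> T" for r
      using that B(2) unfolding C_def by blast
    define A where "A = {ys \<in> F. \<forall>r\<in>set (labels G ys). rt r C = 0}"
    have "xs \<in> A" using xs c(2) rtC tT set_labels[OF xsP] by (auto simp: A_def t_def)
    moreover have "flip_closed G S h A"
      unfolding flip_closed_def
    proof (intro ballI)
      fix ys i assume ys: "ys \<in> A" and i: "i \<in> {1..<h}"
      then have yF: "ys \<in> F" and fl: "flip_path G S i ys \<in> F" using FP(3) by (auto simp: A_def flip_closed_def)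
      then have "ys \<in> paths G S h u v" "flip_path G S i ys \<in> paths G S h u v" using FP(1) by auto
      then show "flip_path G S i ys \<in> A" using flip_path_fixed[OF _ _ i, of ys u v C] ys fl by (auto simp: A_def)
    qed
    ultimately have "A = F" using min[of A] by (auto simp: A_def)
    then have lab: "rt r C = 0" "r \<in> T" if r: "r \<in> label_set G F" for r
    proof -
      obtain ys where ys: "ys \<in> F" "r \<in> set (labels G ys)" using r unfolding label_set_def by blast
      then show "rt r C = 0" "r \<in> T"
        using \<open>A = F\<close> set_labels_T[of ys h u v] FP(1) unfolding A_def by blast+
    qed
    have fixC: "act g C = C" if "g \<in> generate G (label_set G F)" for g
      using that
    proof induction
      case one then show ?case by simp
    next
      case (incl h) then show ?case using lab act_fix_iff by blast
    next
      case (inv h)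
      then show ?case using lab[of h] act_fix_iff[of h] by simp
    next
      case (eng h1 h2)
      then show ?case using gen by (simp add: act_mult)
    qed
    have "c q = 0" if q: "q \<in> B" for q
    proof -
      have qS: "q \<in> S" using q B by blast
      then have "act q C = C" using fixC gen by simp
      \<comment> \<open>Reflection in \<open>q\<close> changes the coordinate (q, True) by exactly
        the value of \<open>C\<close> on the simple root of \<open>q\<close>, whether or not the
        Cartan form is degenerate.\<close>
      then have "refl q C (q, True) = C (q, True)" using act_gen[OF qS] by simp
      then have "C (q, False) = 0" by (simp add: refl_def)
      moreover have "C (q, False) = (\<Sum>p\<in>B. if p = q then c p else 0)"
        unfolding C_def by (intro sum.cong) (auto simp: delta_def)
      ultimately show ?thesis using q B(2) by simp
    qed
    then show False using c(1) by blast
  qed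
qed

text \<open>The exchange condition only deletes letters, so shortening a word never leaves
  \<open>A\<close>.\<close>

lemma parabolic_reduced_word:
  assumes A: "A \<subseteq> S" and w: "w \<in> generate G A"
  shows "\<exists>xs. reduced xs \<and> set xs \<subseteq> A \<and> \<pi> xs = w"
proof -
  obtain xs where xs: "set xs \<subseteq> A" "\<pi> xs = w" using ex_word_generate[OF A w] by blast
  have "\<exists>ys. reduced ys \<and> set ys \<subseteq> A \<and> \<pi> ys = \<pi> xs" using xs(1)
  proof (induction xs)
    case Nil show ?case by (intro exI[of _ "[]"]) (simp add: reduced_def)
  next
    case (Cons s xs)
    then obtain ys where ys: "reduced ys" "set ys \<subseteq> A" "\<pi> ys = \<pi> xs" by auto
    have s: "s \<in> A" "s \<in> S" using Cons.prems A by auto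
    have yS: "set ys \<subseteq> S" using ys A by blast
    show ?case
    proof (cases "s \<in> N (\<pi> ys)")
      case False
      then have "reduced (s # ys)" using reduced_Cons_iff s ys by blast
      then show ?thesis using ys s by (intro exI[of _ "s # ys"]) auto
    next
      case True
      obtain i where i: "i < length ys" "s = rfl ys i" using in_N_rfl[OF yS True] by blast
      define zs where "zs = take i ys @ drop (Suc i) ys"
      have zs: "s \<otimes> \<pi> ys = \<pi> zs" unfolding zs_def using rfl_mult[OF yS i(1)] i(2) by simp
      have "\<ell> (\<pi> ys) = Suc (\<ell> (\<pi> zs))" using gen_left_descent(1)[OF s(2) _ True] yS zs by simp
      moreover have sub: "set zs \<subseteq> set ys" unfolding zs_def by (auto dest: in_set_takeD in_set_dropD)
      moreover have "Suc (length zs) = length ys" using i(1) by (simp add: zs_def)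
      ultimately have "reduced zs" using ys(1) yS by (simp add: reduced_def)
      moreover have "\<pi> (s # xs) = \<pi> zs" using zs ys(3) by simp
      ultimately show ?thesis using sub ys(2) by (intro exI[of _ zs]) simp
    qed
  qed
  then show ?thesis using xs(2) by simp
qed

text \<open>If \<open>S\<close> splits into commuting parts, each element is a product of commuting
  factors from the two parabolic subgroups, and conjugating a generator only feels the factor from
  its own part. So every reflection lies in one of the subgroups, which splits \<open>A\<close>;
  both pieces are nonempty because neither subgroup is the whole group.\<close>

lemma irreducible_generators:
  assumes A: "A \<subseteq> T" "generate G A = carrier G" and irr: "commuting_irreducible G A"
  shows "commuting_irreducible G S"
  unfolding commuting_irreducible_def
proof
  assume "\<exists>S1 S2. S1 \<noteq> {} \<and> S2 \<noteq> {} \<and> S1 \<inter> S2 = {} \<and> S1 \<union> S2 = S \<and> (\<forall>a\<in>S1. \<forall>b\<in>S2. a \<otimes> b = b \<otimes> a)"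
  then obtain S1 S2 where S12: "S1 \<noteq> {}" "S2 \<noteq> {}" "S1 \<inter> S2 = {}" "S1 \<union> S2 = S"
    and comm: "\<And>a b. a \<in> S1 \<Longrightarrow> b \<in> S2 \<Longrightarrow> a \<otimes> b = b \<otimes> a" by blast
  have sub: "S1 \<subseteq> S" "S2 \<subseteq> S" using S12 by auto
  let ?G1 = "generate G S1" and ?G2 = "generate G S2"
  have car: "S1 \<subseteq> carrier G" "S2 \<subseteq> carrier G" using sub S_carrier by auto
  have G1: "subgroup ?G1 G" and G2: "subgroup ?G2 G" using generate_is_subgroup car by auto
  have c1: "x \<in> carrier G" if "x \<in> ?G1" for x using that subgroup.mem_carrier[OF G1] by blast
  have c2: "x \<in> carrier G" if "x \<in> ?G2" for x using that subgroup.mem_carrier[OF G2] by blast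
  have comm': "x \<otimes> b = b \<otimes> x" if "x \<in> ?G1" "b \<in> S2" for x b
    using that(1)
  proof induction
    case one then show ?case using that car by auto
  next
    case (incl h) then show ?case using comm that by blast
  next
    case (inv h) then show ?case using comm[of h b] that sub by auto
  next
    case (eng h1 h2)
    have c: "h1 \<in> carrier G" "h2 \<in> carrier G" "b \<in> carrier G" using eng c1 that car by auto
    have "h1 \<otimes> h2 \<otimes> b = h1 \<otimes> (b \<otimes> h2)" using c eng by (simp add: m_assoc)
    also have "\<dots> = (h1 \<otimes> b) \<otimes> h2" using c by (simp add: m_assoc)
    also have "\<dots> = b \<otimes> (h1 \<otimes> h2)" using c eng by (simp add: m_assoc)
    finally show ?case .
  qed
  have comm'': "x \<otimes> y = y \<otimes> x" if "x \<in> ?G1" "y \<in> ?G2" for x y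
    using that(2)
  proof induction
    case one then show ?case using that c1 by auto
  next
    case (incl h) then show ?case using comm' that by blast
  next
    case (inv h) then show ?case using comm'[of x h] that sub by auto
  next
    case (eng h1 h2)
    have c: "h1 \<in> carrier G" "h2 \<in> carrier G" "x \<in> carrier G" using eng c1 c2 that by auto
    have "x \<otimes> (h1 \<otimes> h2) = (x \<otimes> h1) \<otimes> h2" using c by (simp add: m_assoc)
    also have "\<dots> = h1 \<otimes> (x \<otimes> h2)" using c eng by (simp add: m_assoc)
    also have "\<dots> = (h1 \<otimes> h2) \<otimes> x" using c eng by (simp add: m_assoc)
    finally show ?case .
  qed
  have dec: "\<exists>x\<in>?G1. \<exists>y\<in>?G2. \<pi> xs = x \<otimes> y" if "set xs \<subseteq> S" for xs
    using that
  proof (induction xs)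
    case Nil
    show ?case by (intro bexI[of _ \<one>]) (auto intro: generate.one)
  next
    case (Cons s xs)
    then obtain x y where xy: "x \<in> ?G1" "y \<in> ?G2" "\<pi> xs = x \<otimes> y" by auto
    have xyc: "x \<in> carrier G" "y \<in> carrier G" "s \<in> carrier G" using xy c1 c2 Cons.prems by auto
    show ?case
    proof (cases "s \<in> S1")
      case True
      then have "s \<otimes> x \<in> ?G1" using subgroup.m_closed[OF G1 generate.incl[OF True] xy(1)] by blast
      moreover have "\<pi> (s # xs) = (s \<otimes> x) \<otimes> y" using xy(3) xyc by (simp add: m_assoc)
      ultimately show ?thesis using xy(2) by blast
    next
      case False
      then have s2: "s \<in> S2" using Cons.prems S12 by auto
      then have "s \<otimes> y \<in> ?G2" using subgroup.m_closed[OF G2 generate.incl[OF s2] xy(2)] by blast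
      moreover have "\<pi> (s # xs) = x \<otimes> (s \<otimes> y)"
      proof -
        have "\<pi> (s # xs) = (s \<otimes> x) \<otimes> y" using xy(3) xyc by (simp add: m_assoc)
        also have "\<dots> = (x \<otimes> s) \<otimes> y" using comm'[OF xy(1) s2] by simp
        finally show ?thesis using xyc by (simp add: m_assoc)
      qed
      ultimately show ?thesis using xy(1) by blast
    qed
  qed
  have T12: "t \<in> ?G1 \<or> t \<in> ?G2" if t: "t \<in> T" for t
  proof -
    obtain w s where w: "w \<in> carrier G" "s \<in> S" "t = w \<otimes> s \<otimes> inv w" using t by (rule T_E)
    obtain xs where xs: "set xs \<subseteq> S" "\<pi> xs = w" using ex_word[OF w(1)] by blast
    obtain x y where xy: "x \<in> ?G1" "y \<in> ?G2" "\<pi> xs = x \<otimes> y" using dec[OF xs(1)] by blast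
    have wxy: "w = x \<otimes> y" using xs xy by simp
    have xyc: "x \<in> carrier G" "y \<in> carrier G" "s \<in> carrier G" using xy c1 c2 w by auto
    show ?thesis
    proof (cases "s \<in> S1")
      case True
      then have s1: "s \<in> ?G1" by (rule generate.incl)
      have "t = x \<otimes> (y \<otimes> s) \<otimes> inv y \<otimes> inv x" unfolding w(3) wxy using xyc by (simp add: m_assoc inv_mult_group)
      also have "y \<otimes> s = s \<otimes> y" using comm''[OF s1 xy(2)] by simp
      also have "x \<otimes> (s \<otimes> y) \<otimes> inv y \<otimes> inv x = x \<otimes> s \<otimes> inv x" using xyc by (simp add: m_assoc)
      finally show ?thesis using s1 xy subgroup.m_closed[OF G1] subgroup.m_inv_closed[OF G1] by simp
    next
      case False
      then have "s \<in> S2" using w S12 by auto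
      then have s2: "s \<in> ?G2" by (rule generate.incl)
      let ?q = "y \<otimes> s \<otimes> inv y"
      have q: "?q \<in> ?G2" using s2 xy subgroup.m_closed[OF G2] subgroup.m_inv_closed[OF G2] by simp
      have "t = (x \<otimes> ?q) \<otimes> inv x" unfolding w(3) wxy using xyc by (simp add: m_assoc inv_mult_group)
      also have "x \<otimes> ?q = ?q \<otimes> x" using comm''[OF xy(1) q] .
      also have "?q \<otimes> x \<otimes> inv x = ?q" using xyc by (simp add: m_assoc)
      finally show ?thesis using q by simp
    qed
  qed
  \<comment> \<open>A simple reflection has length 1, so its reduced word in the letters of
    \<open>S'\<close> is a single letter, namely itself.\<close>
  have notin: "s \<in> S'" if s: "s \<in> S" "S' \<subseteq> S" "s \<in> generate G S'" for s S'
  proof -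
    obtain xs where xs: "reduced xs" "set xs \<subseteq> S'" "\<pi> xs = s" using parabolic_reduced_word[OF s(2,3)] by blast
    then have "length xs = 1" using length_gen[OF s(1)] by (simp add: reduced_def)
    then obtain c where c: "xs = [c]" by (metis One_nat_def length_0_conv length_Suc_conv)
    then have "c \<in> S'" "c = s" using xs s(2) by auto
    then show ?thesis by simp
  qed
  have whole: "A \<subseteq> K \<Longrightarrow> subgroup K G \<Longrightarrow> carrier G \<subseteq> K" for K using generate_subgroup_incl[of A K] A(2) by simp
  have "A \<inter> ?G1 \<noteq> {}"
  proof
    assume "A \<inter> ?G1 = {}"
    then have "carrier G \<subseteq> ?G2" using whole[OF _ G2] A(1) T12 by blast
    moreover obtain s where s: "s \<in> S1" using S12 by blast
    moreover have "s \<in> S" using s sub by blast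
    ultimately have "s \<in> S2" using notin[of s S2] sub S_in by blast
    then show False using s S12 by blast
  qed
  moreover have "A - ?G1 \<noteq> {}"
  proof
    assume "A - ?G1 = {}"
    then have "carrier G \<subseteq> ?G1" using whole[OF _ G1] by blast
    moreover obtain s where s: "s \<in> S2" using S12 by blast
    moreover have "s \<in> S" using s sub by blast
    ultimately have "s \<in> S1" using notin[of s S1] sub S_in by blast
    then show False using s S12 by blast
  qed
  moreover have "a \<otimes> b = b \<otimes> a" if "a \<in> A \<inter> ?G1" "b \<in> A - ?G1" for a b
  proof -
    have "b \<in> ?G2" using T12[of b] A(1) that(2) by blast
    then show ?thesis using comm''[of a b] that(1) by simp
  qed
  moreover have "(A \<inter> K) \<inter> (A - K) = {}" "(A \<inter> K) \<union> (A - K) = A" for K by blast+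
  ultimately have "\<exists>A1 A2. A1 \<noteq> {} \<and> A2 \<noteq> {} \<and> A1 \<inter> A2 = {} \<and> A1 \<union> A2 = A \<and>
      (\<forall>a\<in>A1. \<forall>b\<in>A2. a \<otimes> b = b \<otimes> a)"
    by (intro exI[of _ "A \<inter> ?G1"] exI[of _ "A - ?G1"] conjI ballI) simp_all
  then show False using irr unfolding commuting_irreducible_def by simp
qed

end

section \<open>Flipclasses in cosets of reflection subgroups\<close>

locale flipclass_embedding = reflection_embedding +
  fixes u0 :: 'a and h u v F
  assumes u0: "u0 \<in> carrier G" "inversions G S u0 \<inter> H = {}"
    and F: "flipclass_from_to G S h u v F"
    and label_H: "label_set G F \<subseteq> H"
    and u_coset: "u \<in> (\<lambda>w. \<psi> w \<otimes>\<^bsub>G\<^esub> u0) ` carrier W"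
begin

definition "E w = \<psi> w \<otimes>\<^bsub>G\<^esub> u0"

lemma E_carrier [simp]: "w \<in> carrier W \<Longrightarrow> E w \<in> carrier G"
  using u0 by (simp add: E_def)

lemma E_inj: "inj_on E (carrier W)"
  using u0 \<psi>_eq_iff by (auto intro!: inj_onI simp: E_def)

lemma E_eq_iff: "x \<in> carrier W \<Longrightarrow> y \<in> carrier W \<Longrightarrow> E x = E y \<longleftrightarrow> x = y"
  using E_inj by (auto dest: inj_onD)

lemma E_label: "x \<in> carrier W \<Longrightarrow> y \<in> carrier W \<Longrightarrow>
    E y \<otimes>\<^bsub>G\<^esub> inv\<^bsub>G\<^esub> (E x) = \<psi> (y \<otimes>\<^bsub>W\<^esub> inv\<^bsub>W\<^esub> x)"
  using u0 by (simp add: E_def G.m_assoc G.inv_mult_group)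

lemma E_edge:
  assumes "x \<in> carrier W" "y \<in> carrier W"
  shows "bruhat_edge G S (E x) (E y) \<longleftrightarrow> bruhat_edge W gens x y"
proof -
  have l: "H.lev (E w) = cox_length W gens w" if "w \<in> carrier W" for w
    using H.N_coset[OF u0, of "\<psi> w"] length_W[OF that] that by (simp add: H.lev_def E_def)
  have T: "E y \<otimes>\<^bsub>G\<^esub> inv\<^bsub>G\<^esub> (E x) \<in> reflections G S \<longleftrightarrow> y \<otimes>\<^bsub>W\<^esub> inv\<^bsub>W\<^esub> x \<in> reflections W gens"
    unfolding E_label[OF assms] reflections_W using W.m_closed[OF assms(2) W.inv_closed[OF assms(1)]] by blast
  have "E y \<otimes>\<^bsub>G\<^esub> inv\<^bsub>G\<^esub> (E x) \<in> H"
    unfolding E_label[OF assms] using W.m_closed[OF assms(2) W.inv_closed[OF assms(1)]] by blast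
  then show ?thesis
    unfolding bruhat_edge_def
    using T H.length_less_iff_lev[of "E x" "E y"] l assms by auto
qed

lemma F_props:
  "F \<subseteq> paths G S h u v" "F \<noteq> {}" "flip_closed G S h F"
  "\<And>A. A \<subseteq> F \<Longrightarrow> A \<noteq> {} \<Longrightarrow> flip_closed G S h A \<Longrightarrow> A = F"
  using F by (auto simp: flipclass_from_to_def)

lemma F_vertices: assumes "xs \<in> F" shows "set xs \<subseteq> E ` carrier W"
proof -
  have P: "xs \<in> paths G S h u v" using assms F_props by blast
  have len: "length xs = Suc h" using G.path_lenD[OF P] .
  have "i \<le> h \<Longrightarrow> xs ! i \<in> E ` carrier W" for i
  proof (induction i)
    case 0
    then show ?case using P u_coset by (simp add: paths_def E_def image_def)
  next
    case (Suc i)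
    then obtain x where x: "x \<in> carrier W" "xs ! i = E x" by auto
    note e = G.edgeD[OF G.path_edgeD[OF P, of i]]
    have "xs ! Suc i \<otimes>\<^bsub>G\<^esub> inv\<^bsub>G\<^esub> (xs ! i) \<in> set (labels G xs)"
      unfolding G.set_labels[OF P] using Suc.prems by (intro CollectI exI[of _ i]) simp
    then have "xs ! Suc i \<otimes>\<^bsub>G\<^esub> inv\<^bsub>G\<^esub> (xs ! i) \<in> label_set G F"
      unfolding label_set_def using assms by blast
    then obtain t where t: "t \<in> carrier W" "xs ! Suc i \<otimes>\<^bsub>G\<^esub> inv\<^bsub>G\<^esub> (xs ! i) = \<psi> t" using label_H by blast
    have "xs ! Suc i = (xs ! Suc i \<otimes>\<^bsub>G\<^esub> inv\<^bsub>G\<^esub> (xs ! i)) \<otimes>\<^bsub>G\<^esub> xs ! i"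
      using e Suc.prems by (simp add: G.m_assoc)
    also have "\<dots> = E (t \<otimes>\<^bsub>W\<^esub> x)" unfolding t(2) x(2) using t x u0 by (simp add: E_def G.m_assoc)
    finally show ?case using t x by blast
  qed
  then show ?thesis using len by (auto simp: in_set_conv_nth less_Suc_eq_le)
qed

definition "FW = {xs. set xs \<subseteq> carrier W \<and> map E xs \<in> F}"

lemma F_lift: assumes "xs \<in> F" shows "\<exists>ys\<in>FW. xs = map E ys"
proof -
  have "xs \<in> map E ` lists (carrier W)" using F_vertices[OF assms] by (simp add: lists_image[symmetric] in_lists_conv_set subset_iff)
  then show ?thesis using assms by (auto simp: FW_def)
qed

lemma map_E_FW: "map E ` FW = F"
  using F_lift by (auto simp: FW_def)

lemma map_E_inj: "set xs \<subseteq> carrier W \<Longrightarrow> set ys \<subseteq> carrier W \<Longrightarrow> map E xs = map E ys \<longleftrightarrow> xs = ys"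
  using E_inj by (intro inj_on_map_eq_map) (auto intro: inj_on_subset)

definition "uW = inv_into (carrier W) E u"
definition "vW = inv_into (carrier W) E v"

lemma uvW: "uW \<in> carrier W" "E uW = u" "vW \<in> carrier W" "E vW = v"
proof -
  obtain xs where xs: "xs \<in> F" using F_props by blast
  then have "xs \<in> paths G S h u v" using F_props by blast
  then have "u = xs ! 0" "v = xs ! h" "length xs = Suc h" by (auto simp: paths_def)
  then have "u \<in> set xs" "v \<in> set xs" by auto
  then have "u \<in> E ` carrier W" "v \<in> E ` carrier W" using F_vertices[OF xs] by auto
  then show "uW \<in> carrier W" "E uW = u" "vW \<in> carrier W" "E vW = v"
    unfolding uW_def vW_def by (auto intro: inv_into_into f_inv_into_f)
qed

lemma FW_paths: "FW \<subseteq> paths W gens h uW vW"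
proof
  fix xs assume "xs \<in> FW"
  then have xs: "set xs \<subseteq> carrier W" "map E xs \<in> paths G S h u v" using F_props by (auto simp: FW_def)
  then have len: "length xs = Suc h" and ends: "E (xs ! 0) = u" "E (xs ! h) = v"
    and e: "\<And>i. i < h \<Longrightarrow> bruhat_edge G S (E (xs ! i)) (E (xs ! Suc i))" by (auto simp: paths_def)
  have c: "xs ! i \<in> carrier W" if "i \<le> h" for i using xs(1) len that by auto
  have "xs ! 0 = uW" "xs ! h = vW" using ends uvW E_eq_iff c by auto
  moreover have "bruhat_edge W gens (xs ! i) (xs ! Suc i)" if "i < h" for i
    using e[OF that] E_edge c that by simp
  ultimately show "xs \<in> paths W gens h uW vW" using xs(1) len by (auto simp: paths_def)
qed

lemma labels_map_E: assumes "set xs \<subseteq> carrier W" shows "labels G (map E xs) = map \<psi> (labels W xs)"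
proof -
  have "xs ! i \<in> carrier W" if "i < length xs" for i using assms that by auto
  then show ?thesis by (auto simp: labels_def E_label)
qed

lemma labels_carrier: "set xs \<subseteq> carrier W \<Longrightarrow> set (labels W xs) \<subseteq> carrier W"
  by (auto simp: labels_def subset_iff)

lemma comparable_E: "W.comparable x y \<Longrightarrow> G.comparable (E x) (E y)"
  unfolding W.comparable_def G.comparable_def using E_edge W.edgeD(1,2) by blast

text \<open>\<open>E\<close> preserves comparability. The flip of \<open>E y\<close> is not
  comparable to \<open>E y\<close>, so its preimage is a middle vertex not comparable to
  \<open>y\<close>, and \<open>flip_char\<close> identifies it. That the flip lies in the coset is
  ensured by the closure of \<open>F\<close> under flips.\<close>

lemma flip_E:
  assumes e: "bruhat_edge W gens x y" "bruhat_edge W gens y z"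
    and fl: "flip G S (E x) (E z) (E y) \<in> E ` carrier W"
  shows "flip G S (E x) (E z) (E y) = E (flip W gens x z y)"
proof -
  have c: "x \<in> carrier W" "y \<in> carrier W" "z \<in> carrier W" using W.edgeD[OF e(1)] W.edgeD[OF e(2)] by auto
  obtain y' where y': "y' \<in> carrier W" "flip G S (E x) (E z) (E y) = E y'" using fl by blast
  have "E y \<in> middle_vertices G S (E x) (E z)" using G.middle_vertices_iff E_edge e c by simp
  note f = G.flip_char[OF this]
  have m: "y \<in> middle_vertices W gens x z" using W.middle_vertices_iff e by simp
  have "y' \<in> middle_vertices W gens x z"
    using f(1) y' G.middle_vertices_iff W.middle_vertices_iff E_edge c by simp
  moreover have "y' \<noteq> y" using f(2) y' by auto
  moreover have "\<not> W.comparable y y'" using f(3) y' comparable_E by auto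
  ultimately have "y' = flip W gens x z y" using W.flip_char(4)[OF m] by blast
  then show ?thesis using y' by simp
qed

lemma flip_path_E:
  assumes xs: "xs \<in> FW" and i: "i \<in> {1..<h}"
  shows "flip_path G S i (map E xs) = map E (flip_path W gens i xs)" "flip_path W gens i xs \<in> FW"
proof -
  have P: "xs \<in> paths W gens h uW vW" using xs FW_paths by blast
  have len: "length xs = Suc h" using W.path_lenD[OF P] .
  have Si: "Suc (i - 1) = i" "i - 1 < h" "i < h" using i by auto
  have e: "bruhat_edge W gens (xs ! (i - 1)) (xs ! i)" "bruhat_edge W gens (xs ! i) (xs ! Suc i)"
    using W.path_edgeD[OF P, of "i - 1"] W.path_edgeD[OF P, of i] Si by simp_all
  have Fi: "flip_path G S i (map E xs) \<in> F" using F_props(3) xs i by (auto simp: flip_closed_def FW_def)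
  have "flip G S (E (xs ! (i - 1))) (E (xs ! Suc i)) (E (xs ! i)) \<in> set (flip_path G S i (map E xs))"
    using len Si by (auto simp: flip_path_def set_update_memI)
  then have "flip G S (E (xs ! (i - 1))) (E (xs ! Suc i)) (E (xs ! i)) \<in> E ` carrier W"
    using F_vertices[OF Fi] by blast
  then have fl: "flip G S (E (xs ! (i - 1))) (E (xs ! Suc i)) (E (xs ! i)) =
      E (flip W gens (xs ! (i - 1)) (xs ! Suc i) (xs ! i))" by (rule flip_E[OF e])
  show eq: "flip_path G S i (map E xs) = map E (flip_path W gens i xs)"
    using fl len Si by (simp add: flip_path_def map_update)
  have "flip W gens (xs ! (i - 1)) (xs ! Suc i) (xs ! i) \<in> carrier W"
    using W.flip_char(1)[of "xs ! i"] W.middle_vertices_iff e W.edgeD by blast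
  then have "set (flip_path W gens i xs) \<subseteq> carrier W"
    using xs set_update_subset_insert[of xs i] by (auto simp: flip_path_def FW_def)
  then show "flip_path W gens i xs \<in> FW" using Fi eq by (simp add: FW_def)
qed

lemma flipclass_FW: "flipclass W gens h FW"
proof -
  have "flip_closed W gens h FW" using flip_path_E(2) by (auto simp: flip_closed_def)
  moreover have "FW \<noteq> {}" using map_E_FW F_props(2) by auto
  moreover have "A = FW" if A: "A \<subseteq> FW" "A \<noteq> {}" "flip_closed W gens h A" for A
  proof -
    have "flip_closed G S h (map E ` A)"
      unfolding flip_closed_def
    proof (intro ballI)
      fix xs i assume "xs \<in> map E ` A" and i: "i \<in> {1..<h}"
      then obtain ys where ys: "ys \<in> A" "xs = map E ys" by blast
      then have "flip_path G S i xs = map E (flip_path W gens i ys)" using flip_path_E(1)[OF _ i] A(1) by auto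
      then show "flip_path G S i xs \<in> map E ` A" using A(3) ys i by (auto simp: flip_closed_def)
    qed
    then have "map E ` A = F" using F_props(4)[of "map E ` A"] A map_E_FW by blast
    moreover have "inj_on (map E) FW" using map_E_inj by (auto simp: inj_on_def FW_def)
    ultimately show ?thesis using A(1) map_E_FW by (metis inj_on_image_eq_iff order_refl)
  qed
  ultimately show ?thesis
    unfolding flipclass_def flipclass_from_to_def using FW_paths uvW by blast
qed

lemma label_set_FW: "label_set G F = \<psi> ` label_set W FW"
proof -
  have "label_set G F = (\<Union>xs\<in>FW. set (labels G (map E xs)))"
    using arg_cong[OF map_E_FW, of "label_set G"] by (simp add: label_set_def)
  also have "\<dots> = (\<Union>xs\<in>FW. \<psi> ` set (labels W xs))"
  proof (rule SUP_cong[OF refl])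
    fix xs assume "xs \<in> FW"
    then show "set (labels G (map E xs)) = \<psi> ` set (labels W xs)"
      using labels_map_E[of xs] by (simp add: FW_def)
  qed
  finally show ?thesis by (simp add: label_set_def image_UN)
qed

lemma label_set_FW_carrier: "label_set W FW \<subseteq> carrier W"
  using labels_carrier by (auto simp: label_set_def FW_def)

lemma vertex_set_FW: "vertex_set F = E ` vertex_set FW"
  using arg_cong[OF map_E_FW, of vertex_set] by (simp add: vertex_set_def image_UN)

lemma vertex_set_FW_carrier: "vertex_set FW \<subseteq> carrier W"
  by (auto simp: vertex_set_def FW_def)

lemma flipclass_isomorphic_FW: "flipclass_isomorphic h G S F W gens FW"
proof -
  define \<epsilon> where "\<epsilon> = inv_into (carrier W) E"
  define \<tau> where "\<tau> = inv_into (carrier W) \<psi>"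
  have \<epsilon>: "\<epsilon> (E x) = x" if "x \<in> carrier W" for x using that E_inj by (simp add: \<epsilon>_def)
  have \<tau>: "\<tau> (\<psi> x) = x" if "x \<in> carrier W" for x using that \<psi>_inj by (simp add: \<tau>_def)
  have map\<epsilon>: "map \<epsilon> (map E xs) = xs" if "set xs \<subseteq> carrier W" for xs
    using that \<epsilon> by (induction xs) auto
  have map\<tau>: "map \<tau> (map \<psi> xs) = xs" if "set xs \<subseteq> carrier W" for xs
    using that \<tau> by (induction xs) auto
  have "bij_betw \<epsilon> (vertex_set F) (vertex_set FW)"
    using vertex_set_FW vertex_set_FW_carrier \<epsilon> by (intro bij_betw_byWitness[where f' = E]) auto
  moreover have "bij_betw \<tau> (label_set G F) (label_set W FW)"
    using label_set_FW label_set_FW_carrier \<tau> by (intro bij_betw_byWitness[where f' = \<psi>]) auto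
  moreover have "(xs \<in> F \<and> labels G xs = ts) \<longleftrightarrow> (map \<epsilon> xs \<in> FW \<and> labels W (map \<epsilon> xs) = map \<tau> ts)"
    if xs: "xs \<in> lists (vertex_set F)" and ts: "ts \<in> lists (label_set G F)" for xs ts
  proof -
    obtain ys where ys: "ys \<in> lists (vertex_set FW)" "xs = map E ys"
      using xs unfolding vertex_set_FW lists_image by blast
    obtain rs where rs: "rs \<in> lists (label_set W FW)" "ts = map \<psi> rs"
      using ts unfolding label_set_FW lists_image by blast
    have yc: "set ys \<subseteq> carrier W" and rc: "set rs \<subseteq> carrier W"
      using ys rs vertex_set_FW_carrier label_set_FW_carrier by auto
    have "map \<psi> (labels W ys) = map \<psi> rs \<longleftrightarrow> labels W ys = rs"
      using map\<tau>[OF rc] map\<tau>[OF labels_carrier[OF yc]] by metis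
    moreover have "map E ys \<in> F \<longleftrightarrow> ys \<in> FW" using yc by (simp add: FW_def)
    ultimately show ?thesis unfolding ys(2) rs(2) map\<epsilon>[OF yc] map\<tau>[OF rc] labels_map_E[OF yc] by blast
  qed
  moreover have "map \<epsilon> (flip_path G S i xs) = flip_path W gens i (map \<epsilon> xs)" if xs: "xs \<in> F" and i: "i \<in> {1..<h}" for xs i
  proof -
    obtain ys where ys: "ys \<in> FW" "xs = map E ys" using F_lift[OF xs] by blast
    then have c: "set ys \<subseteq> carrier W" by (simp add: FW_def)
    have "set (flip_path W gens i ys) \<subseteq> carrier W" using flip_path_E(2)[OF ys(1) i] by (simp add: FW_def)
    then show ?thesis unfolding ys(2) flip_path_E(1)[OF ys(1) i] using map\<epsilon> c by metis
  qed
  moreover obtain R where R: "reflection_ordering G S R" using G.reflection_ordering_exists by blast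
  moreover have "reflection_ordering W gens (pullback R)" using reflection_ordering_pullback[OF R] .
  moreover have "(s, t) \<in> R \<longleftrightarrow> (\<tau> s, \<tau> t) \<in> pullback R" if st: "s \<in> label_set G F" "t \<in> label_set G F" for s t
  proof -
    obtain x y where xy: "x \<in> label_set W FW" "s = \<psi> x" "y \<in> label_set W FW" "t = \<psi> y"
      using st unfolding label_set_FW by blast
    then have "x \<in> carrier W" "y \<in> carrier W" using label_set_FW_carrier by auto
    then show ?thesis unfolding xy(2,4) by (simp add: \<tau> pullback_def)
  qed
  ultimately show ?thesis unfolding flipclass_isomorphic_def by blast
qed

lemma card_increasing_FW: "card (increasing_paths G R F) = card (increasing_paths W (pullback R) FW)"
proof -
  have eq: "sorted_wrt (\<lambda>s t. (s, t) \<in> R) (labels G (map E xs)) \<longleftrightarrow>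
      sorted_wrt (\<lambda>s t. (s, t) \<in> pullback R) (labels W xs)" if "set xs \<subseteq> carrier W" for xs
  proof -
    have "(\<psi> s, \<psi> t) \<in> R \<longleftrightarrow> (s, t) \<in> pullback R" if "s \<in> set (labels W xs)" "t \<in> set (labels W xs)" for s t
      using that labels_carrier[OF \<open>set xs \<subseteq> carrier W\<close>] by (auto simp: pullback_def)
    then show ?thesis unfolding labels_map_E[OF that] sorted_wrt_map
      using sorted_wrt_mono_rel[of "labels W xs" "\<lambda>s t. (\<psi> s, \<psi> t) \<in> R" "\<lambda>s t. (s, t) \<in> pullback R"]
        sorted_wrt_mono_rel[of "labels W xs" "\<lambda>s t. (s, t) \<in> pullback R" "\<lambda>s t. (\<psi> s, \<psi> t) \<in> R"] by blast
  qed
  have "increasing_paths G R F = map E ` increasing_paths W (pullback R) FW"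
  proof -
    have "xs \<in> FW \<Longrightarrow> set xs \<subseteq> carrier W" for xs by (simp add: FW_def)
    then have "increasing_paths G R (map E ` FW) = map E ` increasing_paths W (pullback R) FW"
      using eq unfolding increasing_paths_def by blast
    then show ?thesis unfolding map_E_FW .
  qed
  moreover have "inj_on (map E) (increasing_paths W (pullback R) FW)"
    using map_E_inj by (auto simp: inj_on_def FW_def increasing_paths_def)
  ultimately show ?thesis by (simp add: card_image)
qed

text \<open>Every ordering of either group yields the same number \<open>n\<close>; the existence of
  one ordering on each side makes the definite description unique.\<close>

lemma increasing_number_FW:
  assumes "finite (carrier W)" shows "increasing_number G S F = increasing_number W gens FW"
proof -
  obtain R where R: "reflection_ordering G S R" using G.reflection_ordering_exists by blast
  define n where "n = card (increasing_paths W (pullback R) FW)"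
  have nW: "card (increasing_paths W R' FW) = n" if "reflection_ordering W gens R'" for R'
    using W.increasing_number_indep[OF assms flipclass_FW that reflection_ordering_pullback[OF R]] by (simp add: n_def)
  have nG: "card (increasing_paths G R' F) = n" if "reflection_ordering G S R'" for R'
    using nW[OF reflection_ordering_pullback[OF that]] card_increasing_FW by simp
  have "increasing_number W gens FW = n"
    unfolding increasing_number_def using nW reflection_ordering_pullback[OF R] by (intro the_equality) auto
  moreover have "increasing_number G S F = n"
    unfolding increasing_number_def using nG R by (intro the_equality) auto
  ultimately show ?thesis by simp
qed

lemma rank_and_irreducible:
  assumes gen: "generate G (label_set G F) = H"
  shows "finite gens" "card gens \<le> h" "flipclass_irreducible G F \<Longrightarrow> commuting_irreducible W gens"
proof -
  have "\<psi> ` generate W (label_set W FW) = \<psi> ` carrier W"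
    using \<psi>.generate_img[OF label_set_FW_carrier] gen label_set_FW by simp
  then have genW: "generate W (label_set W FW) = carrier W"
    using inj_on_image_eq_iff[OF \<psi>_inj W.generate_incl[OF label_set_FW_carrier] order_refl] by simp
  show "finite gens" "card gens \<le> h" using W.rank_le[OF flipclass_FW genW] by auto
  have T: "label_set W FW \<subseteq> reflections W gens"
    using W.set_labels_T[of _ h uW vW] FW_paths unfolding label_set_def by blast
  assume irr: "flipclass_irreducible G F"
  have "commuting_irreducible W (label_set W FW)"
    unfolding commuting_irreducible_def
  proof
    assume "\<exists>A1 A2. A1 \<noteq> {} \<and> A2 \<noteq> {} \<and> A1 \<inter> A2 = {} \<and> A1 \<union> A2 = label_set W FW \<and>
      (\<forall>a\<in>A1. \<forall>b\<in>A2. a \<otimes>\<^bsub>W\<^esub> b = b \<otimes>\<^bsub>W\<^esub> a)"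
    then obtain A1 A2 where AA: "A1 \<noteq> {} \<and> A2 \<noteq> {} \<and> A1 \<inter> A2 = {} \<and> A1 \<union> A2 = label_set W FW \<and>
      (\<forall>a\<in>A1. \<forall>b\<in>A2. a \<otimes>\<^bsub>W\<^esub> b = b \<otimes>\<^bsub>W\<^esub> a)" by (elim exE)
    then have A: "A1 \<noteq> {}" "A2 \<noteq> {}" "A1 \<inter> A2 = {}" "A1 \<union> A2 = label_set W FW" by simp_all
    have comm: "a \<otimes>\<^bsub>W\<^esub> b = b \<otimes>\<^bsub>W\<^esub> a" if "a \<in> A1" "b \<in> A2" for a b using AA that by blast
    have sub: "A1 \<subseteq> carrier W" "A2 \<subseteq> carrier W" using A(4) label_set_FW_carrier by auto
    have "\<psi> ` A1 \<inter> \<psi> ` A2 = \<psi> ` (A1 \<inter> A2)" using inj_on_image_Int[OF \<psi>_inj sub] by simp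
    then have "\<psi> ` A1 \<inter> \<psi> ` A2 = {}" using A(3) by simp
    moreover have "\<psi> ` A1 \<union> \<psi> ` A2 = label_set G F" unfolding label_set_FW A(4)[symmetric] by blast
    moreover have "\<psi> a \<otimes>\<^bsub>G\<^esub> \<psi> b = \<psi> b \<otimes>\<^bsub>G\<^esub> \<psi> a" if "a \<in> A1" "b \<in> A2" for a b
    proof -
      have "a \<in> carrier W" "b \<in> carrier W" using that sub by auto
      then show ?thesis using comm[OF that] by (simp flip: \<psi>.hom_mult)
    qed
    ultimately have "\<exists>B1 B2. B1 \<noteq> {} \<and> B2 \<noteq> {} \<and> B1 \<inter> B2 = {} \<and> B1 \<union> B2 = label_set G F \<and>
        (\<forall>a\<in>B1. \<forall>b\<in>B2. a \<otimes>\<^bsub>G\<^esub> b = b \<otimes>\<^bsub>G\<^esub> a)"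
      using A(1,2) by (intro exI[of _ "\<psi> ` A1"] exI[of _ "\<psi> ` A2"] conjI) auto
    then show False using irr unfolding flipclass_irreducible_def commuting_irreducible_def by simp
  qed
  then show "commuting_irreducible W gens" using W.irreducible_generators[OF T genW] by blast
qed

end

section \<open>Finite models\<close>

text \<open>Provides the fixed carrier type over which the theorem quantifies its models.\<close>

lemma finite_transport_nat:
  fixes K :: "('a, 'b) monoid_scheme"
  assumes "group K" "finite (carrier K)"
  shows "\<exists>(W :: nat monoid) \<psi>. group W \<and> \<psi> \<in> iso W K"
proof -
  interpret K: group K by fact
  obtain e :: "'a \<Rightarrow> nat" where e: "bij_betw e (carrier K) {0..<card (carrier K)}"
    using ex_bij_betw_finite_nat[OF assms(2)] by blast
  define \<psi> where "\<psi> = inv_into (carrier K) e"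
  have \<psi>: "\<psi> (e x) = x" "e x \<in> e ` carrier K" if "x \<in> carrier K" for x
    using that e by (auto simp: \<psi>_def bij_betw_def)
  define W :: "nat monoid" where
    "W = \<lparr>carrier = e ` carrier K, mult = \<lambda>i j. e (\<psi> i \<otimes>\<^bsub>K\<^esub> \<psi> j), one = e \<one>\<^bsub>K\<^esub>\<rparr>"
  have "group W"
  proof (rule groupI)
    show "\<exists>y\<in>carrier W. y \<otimes>\<^bsub>W\<^esub> x = \<one>\<^bsub>W\<^esub>" if x: "x \<in> carrier W" for x
    proof -
      obtain k where "k \<in> carrier K" "x = e k" using x by (auto simp: W_def)
      then show ?thesis by (intro bexI[of _ "e (inv\<^bsub>K\<^esub> k)"]) (auto simp: W_def \<psi>)
    qed
  qed (auto simp: W_def \<psi> K.m_assoc)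
  moreover have "\<psi> \<in> iso W K"
    using \<psi> by (auto simp: iso_def hom_def W_def intro!: bij_betw_byWitness[where f' = e])
  ultimately show ?thesis by blast
qed

section \<open>Finiteness of Weyl groups and of products of type A\<close>

lemma euclid_inner_lin:
  "euclid_inner n (\<lambda>i. x i + k * y i) z = euclid_inner n x z + k * euclid_inner n y z"
  "euclid_inner n (\<lambda>i. x i - k * y i) z = euclid_inner n x z - k * euclid_inner n y z"
  by (simp_all add: euclid_inner_def sum.distrib sum_subtractf sum_distrib_left algebra_simps)

lemma euclid_inner_commute: "euclid_inner n x y = euclid_inner n y x"
  by (simp add: euclid_inner_def mult.commute)

lemma euclid_inner_zero: "x \<in> euclid n \<Longrightarrow> euclid_inner n x x = 0 \<Longrightarrow> x = (\<lambda>i. 0)"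
  unfolding euclid_inner_def euclid_def
  by (subst (asm) sum_nonneg_eq_0_iff) (auto simp: fun_eq_iff not_less[symmetric])

lemma euclid_inner_sum:
  "finite A \<Longrightarrow> euclid_inner n (\<lambda>i. \<Sum>a\<in>A. c a * a i) z = (\<Sum>a\<in>A. c a * euclid_inner n a z)"
  unfolding euclid_inner_def sum_distrib_right sum_distrib_left
  by (subst sum.swap) (simp add: mult.assoc)

text \<open>Roots need not span the space, so a permutation of the roots alone does not determine a
  linear map. The last clause, that points move only within the span of the roots, supplies what is
  missing.\<close>

definition isometry_mod_span :: "nat \<Rightarrow> (nat \<Rightarrow> real) set \<Rightarrow> ((nat \<Rightarrow> real) \<Rightarrow> nat \<Rightarrow> real) \<Rightarrow> bool" where
  "isometry_mod_span n \<Phi> g \<longleftrightarrow> g \<in> Bij (euclid n) \<and> g ` \<Phi> \<subseteq> \<Phi> \<and>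
     (\<forall>x\<in>euclid n. \<forall>y\<in>euclid n. euclid_inner n (g x) (g y) = euclid_inner n x y) \<and>
     (\<forall>x\<in>euclid n. \<exists>c. g x = (\<lambda>i. x i + (\<Sum>a\<in>\<Phi>. c a * a i)))"

lemma root_reflection_isometry:
  assumes \<Phi>: "crystallographic_root_system n \<Phi>" and a: "a \<in> \<Phi>"
  shows "isometry_mod_span n \<Phi> (root_reflection n a)"
    "\<And>x. x \<in> euclid n \<Longrightarrow> root_reflection n a (root_reflection n a x) = x"
proof -
  let ?r = "root_reflection n a"
  have fin: "finite \<Phi>" and E: "\<Phi> \<subseteq> euclid n - {\<lambda>i. 0}" and im: "?r ` \<Phi> = \<Phi>"
    using \<Phi> a by (auto simp: crystallographic_root_system_def)
  have aE: "a \<in> euclid n" and nz: "euclid_inner n a a \<noteq> 0" using E a euclid_inner_zero by auto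
  have r: "?r x = (\<lambda>i. x i - (2 * euclid_inner n x a / euclid_inner n a a) * a i)" if "x \<in> euclid n" for x
    using that by (simp add: root_reflection_def)
  have rE: "?r x \<in> euclid n" if "x \<in> euclid n" for x
    using that aE unfolding r[OF that] by (auto simp: euclid_def)
  have ra: "euclid_inner n (?r x) a = - euclid_inner n x a" if "x \<in> euclid n" for x
    unfolding r[OF that] euclid_inner_lin using nz by simp
  show rr: "?r (?r x) = x" if x: "x \<in> euclid n" for x
    unfolding r[OF rE[OF x]] ra[OF x] unfolding r[OF x] by (simp add: fun_eq_iff)
  have "?r \<in> Bij (euclid n)"
    unfolding Bij_def using rE rr
    by (auto simp: root_reflection_def intro!: bij_betw_byWitness[where f' = "root_reflection n a"])
  moreover have "euclid_inner n (?r x) (?r y) = euclid_inner n x y" if xy: "x \<in> euclid n" "y \<in> euclid n" for x y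
  proof -
    have "euclid_inner n (?r x) (?r y) =
      euclid_inner n x (?r y) - (2 * euclid_inner n x a / euclid_inner n a a) * euclid_inner n a (?r y)"
      unfolding r[OF xy(1)] euclid_inner_lin ..
    also have "euclid_inner n a (?r y) = - euclid_inner n y a" using ra[OF xy(2)] euclid_inner_commute by metis
    also have "euclid_inner n x (?r y) = euclid_inner n (?r y) x" by (rule euclid_inner_commute)
    also have "\<dots> = euclid_inner n y x - (2 * euclid_inner n y a / euclid_inner n a a) * euclid_inner n a x"
      unfolding r[OF xy(2)] euclid_inner_lin ..
    finally show ?thesis by (simp add: euclid_inner_commute[of n a x] euclid_inner_commute[of n y x])
  qed
  moreover have "\<exists>c. ?r x = (\<lambda>i. x i + (\<Sum>b\<in>\<Phi>. c b * b i))" if x: "x \<in> euclid n" for x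
  proof -
    let ?k = "2 * euclid_inner n x a / euclid_inner n a a"
    have "(\<Sum>b\<in>\<Phi>. (if b = a then - ?k else 0) * b i) = - ?k * a i" for i
    proof -
      have "(\<Sum>b\<in>\<Phi>. (if b = a then - ?k else 0) * b i) = (\<Sum>b\<in>\<Phi>. if b = a then - ?k * a i else 0)"
        by (intro sum.cong) auto
      then show ?thesis using fin a by simp
    qed
    then show ?thesis unfolding r[OF x] by (intro exI[of _ "\<lambda>b. if b = a then - ?k else 0"]) simp
  qed
  ultimately show "isometry_mod_span n \<Phi> ?r" using im by (simp add: isometry_mod_span_def)
qed

lemma isometry_mod_span_compose:
  assumes g: "isometry_mod_span n \<Phi> g" and f: "isometry_mod_span n \<Phi> f" and E: "\<Phi> \<subseteq> euclid n"
  shows "isometry_mod_span n \<Phi> (compose (euclid n) g f)"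
proof -
  have gB: "g \<in> Bij (euclid n)" and fB: "f \<in> Bij (euclid n)" using g f by (simp_all add: isometry_mod_span_def)
  have fE: "f x \<in> euclid n" if "x \<in> euclid n" for x using Bij_imp_funcset[OF fB] that by auto
  have "\<exists>c. compose (euclid n) g f x = (\<lambda>i. x i + (\<Sum>a\<in>\<Phi>. c a * a i))" if x: "x \<in> euclid n" for x
  proof -
    obtain c where c: "f x = (\<lambda>i. x i + (\<Sum>a\<in>\<Phi>. c a * a i))" using f x unfolding isometry_mod_span_def by blast
    obtain d where d: "g (f x) = (\<lambda>i. f x i + (\<Sum>a\<in>\<Phi>. d a * a i))"
      using g fE[OF x] unfolding isometry_mod_span_def by blast
    have "compose (euclid n) g f x = (\<lambda>i. f x i + (\<Sum>a\<in>\<Phi>. d a * a i))" using x d by (simp add: compose_eq)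
    also have "\<dots> = (\<lambda>i. x i + (\<Sum>a\<in>\<Phi>. (c a + d a) * a i))"
      unfolding c by (simp add: fun_eq_iff sum.distrib distrib_right)
    finally show ?thesis by (intro exI[of _ "\<lambda>a. c a + d a"])
  qed
  moreover have "compose (euclid n) g f ` \<Phi> \<subseteq> \<Phi>"
  proof (rule image_subsetI)
    fix a assume a: "a \<in> \<Phi>"
    have "f a \<in> \<Phi>" "g (f a) \<in> \<Phi>" using f g a unfolding isometry_mod_span_def by blast+
    then show "compose (euclid n) g f a \<in> \<Phi>" using a E by (metis compose_eq subsetD)
  qed
  moreover have "euclid_inner n (compose (euclid n) g f x) (compose (euclid n) g f y) = euclid_inner n x y"
    if "x \<in> euclid n" "y \<in> euclid n" for x y
    using g f fE that by (simp add: isometry_mod_span_def compose_eq)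
  ultimately show ?thesis using compose_Bij[OF gB fB] by (simp add: isometry_mod_span_def)
qed

text \<open>The group acts faithfully on the finite set of roots. If f and g agree on the roots,
  then f(x) - g(x) lies in their span by the last clause of \<open>isometry_mod_span\<close> and is
  orthogonal to all of them, as both maps are isometries; so it vanishes.\<close>

lemma finite_root_system_group:
  assumes \<Phi>: "crystallographic_root_system n \<Phi>"
  shows "finite (carrier (root_system_group n \<Phi>))"
proof -
  let ?E = "euclid n" and ?B = "BijGroup (euclid n)"
  interpret B: group ?B by (rule group_BijGroup)
  have fin: "finite \<Phi>" and E: "\<Phi> \<subseteq> ?E" using \<Phi> by (auto simp: crystallographic_root_system_def)
  have iso: "isometry_mod_span n \<Phi> g" if "g \<in> generate ?B (root_reflection n ` \<Phi>)" for g
    using that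
  proof induction
    case one
    have "\<exists>c. (\<lambda>x\<in>?E. x) x = (\<lambda>i. x i + (\<Sum>a\<in>\<Phi>. c a * a i))" if "x \<in> ?E" for x
      using that by (intro exI[of _ "\<lambda>_. 0"]) simp
    then have "isometry_mod_span n \<Phi> (\<lambda>x\<in>?E. x)"
      using E id_Bij[of ?E] by (auto simp: isometry_mod_span_def)
    moreover have "\<one>\<^bsub>?B\<^esub> = (\<lambda>x\<in>?E. x)" by (simp add: BijGroup_def)
    ultimately show ?case by (simp only:)
  next
    case (incl h)
    then show ?case using root_reflection_isometry(1)[OF \<Phi>] by blast
  next
    case (inv h)
    then obtain a where a: "a \<in> \<Phi>" "h = root_reflection n a" by blast
    note r = root_reflection_isometry[OF \<Phi> a(1), folded a(2)]
    have hB: "h \<in> carrier ?B" using r(1) by (simp add: isometry_mod_span_def BijGroup_def)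
    have "compose ?E h h = (\<lambda>x\<in>?E. x)" using r(2) by (auto simp: compose_def)
    then have "h \<otimes>\<^bsub>?B\<^esub> h = \<one>\<^bsub>?B\<^esub>" using hB by (simp add: BijGroup_def)
    then have "inv\<^bsub>?B\<^esub> h = h" using B.inv_equality hB by blast
    then show ?case using r(1) by simp
  next
    case (eng h1 h2)
    then have "h1 \<in> Bij ?E" "h2 \<in> Bij ?E" by (simp_all add: isometry_mod_span_def)
    then show ?case using isometry_mod_span_compose[OF eng.IH E] by (simp add: BijGroup_def)
  qed
  have "inj_on (\<lambda>g. restrict g \<Phi>) (generate ?B (root_reflection n ` \<Phi>))"
  proof (rule inj_onI)
    fix f g assume fg: "f \<in> generate ?B (root_reflection n ` \<Phi>)" "g \<in> generate ?B (root_reflection n ` \<Phi>)"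
      and "restrict f \<Phi> = restrict g \<Phi>"
    then have eq: "f a = g a" if "a \<in> \<Phi>" for a using that by (metis restrict_apply)
    note f = iso[OF fg(1), unfolded isometry_mod_span_def] and g = iso[OF fg(2), unfolded isometry_mod_span_def]
    have gB: "g \<in> Bij ?E" and fB: "f \<in> Bij ?E" using f g by auto
    have "inj_on g \<Phi>" using gB E by (auto simp: Bij_def bij_betw_def intro: inj_on_subset)
    \<comment> \<open>Finiteness turns the inclusion into equality, so each root has the form
      \<open>g a\<close> and orthogonality can be tested on such roots.\<close>
    then have gim: "g ` \<Phi> = \<Phi>" using g fin by (meson endo_inj_surj)
    have "f x = g x" if x: "x \<in> ?E" for x
    proof -
      obtain c where c: "f x = (\<lambda>i. x i + (\<Sum>a\<in>\<Phi>. c a * a i))" using f x by blast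
      obtain d where d: "g x = (\<lambda>i. x i + (\<Sum>a\<in>\<Phi>. d a * a i))" using g x by blast
      define w where "w = (\<lambda>i. f x i - 1 * g x i)"
      have fx: "f x \<in> ?E" "g x \<in> ?E" using Bij_imp_funcset[OF fB] Bij_imp_funcset[OF gB] x by auto
      then have wE: "w \<in> ?E" by (auto simp: w_def euclid_def)
      have w0: "euclid_inner n w b = 0" if "b \<in> \<Phi>" for b
      proof -
        obtain a where a: "a \<in> \<Phi>" "b = g a" using gim \<open>b \<in> \<Phi>\<close> by blast
        then have aE: "a \<in> ?E" using E by blast
        have "euclid_inner n w b = euclid_inner n (f x) (f a) - 1 * euclid_inner n (g x) (g a)"
          unfolding w_def euclid_inner_lin a(2) eq[OF a(1)] ..
        also have "euclid_inner n (f x) (f a) = euclid_inner n x a" using f x aE by blast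
        also have "euclid_inner n (g x) (g a) = euclid_inner n x a" using g x aE by blast
        finally show ?thesis by simp
      qed
      have w: "w = (\<lambda>i. \<Sum>a\<in>\<Phi>. (c a - d a) * a i)"
        unfolding w_def c d by (simp add: fun_eq_iff left_diff_distrib sum_subtractf)
      have "euclid_inner n w w = (\<Sum>a\<in>\<Phi>. (c a - d a) * euclid_inner n a w)"
        using euclid_inner_sum[OF fin, of n "\<lambda>a. c a - d a" w] w by simp
      also have "\<dots> = 0" using w0 by (intro sum.neutral) (simp add: euclid_inner_commute)
      finally have "w = (\<lambda>i. 0)" using euclid_inner_zero wE by blast
      then show ?thesis by (simp add: w_def fun_eq_iff)
    qed
    then show "f = g" using extensionalityI[OF Bij_imp_extensional[OF fB] Bij_imp_extensional[OF gB]] by blast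
  qed
  moreover have "(\<lambda>g. restrict g \<Phi>) ` generate ?B (root_reflection n ` \<Phi>) \<subseteq> \<Phi> \<rightarrow>\<^sub>E \<Phi>"
  proof (rule image_subsetI)
    fix g assume "g \<in> generate ?B (root_reflection n ` \<Phi>)"
    then have "g ` \<Phi> \<subseteq> \<Phi>" using iso unfolding isometry_mod_span_def by blast
    then show "restrict g \<Phi> \<in> \<Phi> \<rightarrow>\<^sub>E \<Phi>" by auto
  qed
  ultimately have "finite (generate ?B (root_reflection n ` \<Phi>))"
    using finite_PiE[OF fin, of "\<lambda>_. \<Phi>"] fin by (meson finite_imageD finite_subset)
  then show ?thesis by (simp add: root_system_group_def)
qed

lemma is_weyl_group_finite: "is_weyl_group G S \<Longrightarrow> finite (carrier G)"
  unfolding is_weyl_group_def iso_def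
  by (metis (no_types, lifting) finite_root_system_group bij_betw_finite mem_Collect_eq)

lemma is_product_of_type_A_finite:
  assumes "is_product_of_type_A G S" shows "finite (carrier G)"
proof -
  obtain k :: nat and n \<phi> where "\<phi> \<in> iso G (product_group {..<k} (\<lambda>i. sym_group (n i + 1)))"
    using assms unfolding is_product_of_type_A_def by blast
  moreover have "finite (carrier (product_group {..<k} (\<lambda>i. sym_group (n i + 1))))"
    by (auto simp: sym_group_def intro!: finite_PiE finite_permutations)
  ultimately show ?thesis by (metis (no_types, lifting) bij_betw_finite iso_def mem_Collect_eq)
qed

lemma is_weyl_group_iso:
  assumes "is_weyl_group K C" "\<psi> \<in> iso W K" "\<psi> ` B = C" shows "is_weyl_group W B"
proof -
  obtain n \<Phi> \<Delta> \<phi> where "crystallographic_root_system n \<Phi>" "simple_system \<Phi> \<Delta>"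
    "\<phi> \<in> iso K (root_system_group n \<Phi>)" "\<phi> ` C = root_reflection n ` \<Delta>"
    using assms(1) unfolding is_weyl_group_def by blast
  moreover then have "\<phi> \<circ> \<psi> \<in> iso W (root_system_group n \<Phi>)" using iso_set_trans[OF assms(2)] by blast
  moreover have "(\<phi> \<circ> \<psi>) ` B = \<phi> ` C" using image_comp[of \<phi> \<psi> B] assms(3) by (simp only:)
  ultimately show ?thesis unfolding is_weyl_group_def by metis
qed

lemma is_product_of_type_A_iso:
  assumes "is_product_of_type_A K C" "\<psi> \<in> iso W K" "\<psi> ` B = C" shows "is_product_of_type_A W B"
proof -
  obtain k :: nat and n \<phi> where *: "\<forall>i<k. n i \<ge> 1" "\<phi> \<in> iso K (product_group {..<k} (\<lambda>i. sym_group (n i + 1)))"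
    "\<phi> ` C = {(\<lambda>j\<in>{..<k}. if j = i then transpose p (p + 1) else id) | i p. i < k \<and> 1 \<le> p \<and> p \<le> n i}"
    using assms(1) unfolding is_product_of_type_A_def by blast
  have "\<phi> \<circ> \<psi> \<in> iso W (product_group {..<k} (\<lambda>i. sym_group (n i + 1)))" using iso_set_trans[OF assms(2) *(2)] .
  moreover have "(\<phi> \<circ> \<psi>) ` B = \<phi> ` C" using image_comp[of \<phi> \<psi> B] assms(3) by (simp only:)
  ultimately show ?thesis unfolding is_product_of_type_A_def
    by (intro exI[of _ k] exI[of _ n] exI[of _ "\<phi> \<circ> \<psi>"] conjI *(1)) (simp_all only: *(3))
qed

context coxeter_system
begin

text \<open>The isomorphism with W(F) that matches the canonical generators belongs to the
  conclusion because the Weyl and the symmetric type are transported along it.\<close>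

theorem flipclass_finite_model:
  assumes "flipclass G S h F" and fin: "finite (label_subgroup G F)"
  shows "\<exists>(W :: nat monoid) S' F' \<psi>. coxeter_system W S' \<and> finite (carrier W) \<and>
    flipclass W S' h F' \<and> flipclass_isomorphic h G S F W S' F' \<and>
    increasing_number G S F = increasing_number W S' F' \<and> finite S' \<and> card S' \<le> h \<and>
    (flipclass_irreducible G F \<longrightarrow> commuting_irreducible W S') \<and>
    \<psi> \<in> iso W (G\<lparr>carrier := label_subgroup G F\<rparr>) \<and>
    \<psi> ` S' = canonical_generators G S (label_subgroup G F)"
proof -
  let ?H = "label_subgroup G F"
  obtain u v where u: "u \<in> carrier G" and F: "flipclass_from_to G S h u v F"
    using assms(1) unfolding flipclass_def by blast
  have lab: "label_set G F \<subseteq> T"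
    using F set_labels_T[of _ h u v] unfolding flipclass_from_to_def label_set_def by blast
  then have H: "reflection_subgroup G S ?H" unfolding reflection_subgroup_def label_subgroup_def by blast
  interpret H: reflection_subgroup_of G S ?H using H by unfold_locales
  obtain w u0 where w: "w \<in> ?H" "u0 \<in> carrier G" "u = w \<otimes> u0" "N u0 \<inter> ?H = {}"
    using H.coset_minimal_rep[OF u] by blast
  let ?K = "G\<lparr>carrier := ?H\<rparr>"
  have "group ?K" using subgroup.subgroup_is_group[OF H.H_subgroup is_group] .
  then obtain W :: "nat monoid" and \<psi> where W: "group W" and \<psi>: "\<psi> \<in> iso W ?K"
    using finite_transport_nat[of ?K] fin by auto
  have bij: "bij_betw \<psi> (carrier W) ?H" and hom: "\<psi> \<in> hom W ?K" using \<psi> by (auto simp: iso_def)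
  have im: "\<psi> ` carrier W = ?H" using bij by (simp add: bij_betw_def)
  have homG: "\<psi> \<in> hom W G" using hom by (auto simp: hom_def Pi_iff intro: H.H_carrier)
  have finW: "finite (carrier W)" using bij_betw_finite[OF bij] fin by simp
  interpret W: group W by (rule W)
  interpret E: reflection_embedding G S W \<psi>
    using homG bij im H by unfold_locales (auto simp: bij_betw_def)
  interpret E: flipclass_embedding G S W \<psi> u0 h u v F
  proof
    show "inversions G S u0 \<inter> \<psi> ` carrier W = {}" using w im by simp
    show "label_set G F \<subseteq> \<psi> ` carrier W" unfolding im label_subgroup_def by (auto intro: generate.incl)
    have "w \<in> \<psi> ` carrier W" using w(1) by (simp only: im)
    then show "u \<in> (\<lambda>w. \<psi> w \<otimes> u0) ` carrier W" unfolding w(3) by (elim imageE) (simp only: image_eqI)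
    show "u0 \<in> carrier G" "flipclass_from_to G S h u v F" by fact+
  qed
  have gen: "generate G (label_set G F) = \<psi> ` carrier W" using im by (simp add: label_subgroup_def)
  have "\<psi> ` E.gens = \<chi> ?H" using E.image_gens im by simp
  then show ?thesis
    using E.W.coxeter_system_axioms finW E.flipclass_FW E.flipclass_isomorphic_FW
      E.increasing_number_FW[OF finW] E.rank_and_irreducible[OF gen] \<psi>
    by (intro exI[of _ W] exI[of _ E.gens] exI[of _ E.FW] exI[of _ \<psi>]) blast
qed

end

theorem theorem6p10:
  fixes G :: "('a, 'b) monoid_scheme" and S :: "'a set" and h :: nat and F :: "'a list set"
  assumes "coxeter_system G S"
    and "flipclass G S h F"
  shows
    "(finite_type G F \<longrightarrow>
       (\<exists>(W :: nat monoid) S' F'.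
          coxeter_system W S' \<and> finite (carrier W) \<and>
          flipclass W S' h F' \<and> flipclass_isomorphic h G S F W S' F' \<and>
          increasing_number G S F = increasing_number W S' F' \<and>
          finite S' \<and> card S' \<le> h \<and>
          (flipclass_irreducible G F \<longrightarrow> commuting_irreducible W S'))) \<and>
     (weyl_type G S F \<longrightarrow>
       (\<exists>(W :: nat monoid) S' F'.
          coxeter_system W S' \<and> is_weyl_group W S' \<and>
          flipclass W S' h F' \<and> flipclass_isomorphic h G S F W S' F' \<and>
          increasing_number G S F = increasing_number W S' F' \<and>
          finite S' \<and> card S' \<le> h \<and>
          (flipclass_irreducible G F \<longrightarrow> commuting_irreducible W S'))) \<and>
     (symmetric_type G S F \<longrightarrow>
       (\<exists>(W :: nat monoid) S' F'.
          coxeter_system W S' \<and> is_product_of_type_A W S' \<and>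
          flipclass W S' h F' \<and> flipclass_isomorphic h G S F W S' F' \<and>
          increasing_number G S F = increasing_number W S' F' \<and>
          finite S' \<and> card S' \<le> h \<and>
          (flipclass_irreducible G F \<longrightarrow> commuting_irreducible W S')))"
proof (intro conjI impI)
  assume "finite_type G F"
  then show "\<exists>(W :: nat monoid) S' F'.
      coxeter_system W S' \<and> finite (carrier W) \<and>
      flipclass W S' h F' \<and> flipclass_isomorphic h G S F W S' F' \<and>
      increasing_number G S F = increasing_number W S' F' \<and>
      finite S' \<and> card S' \<le> h \<and>
      (flipclass_irreducible G F \<longrightarrow> commuting_irreducible W S')"
    using coxeter_system.flipclass_finite_model[OF assms] unfolding finite_type_def by blast
next
  assume wt: "weyl_type G S F"
  then have "finite (label_subgroup G F)" using is_weyl_group_finite unfolding weyl_type_def by fastforce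
  from coxeter_system.flipclass_finite_model[OF assms this] is_weyl_group_iso[OF wt[unfolded weyl_type_def]]
  show "\<exists>(W :: nat monoid) S' F'.
      coxeter_system W S' \<and> is_weyl_group W S' \<and>
      flipclass W S' h F' \<and> flipclass_isomorphic h G S F W S' F' \<and>
      increasing_number G S F = increasing_number W S' F' \<and>
      finite S' \<and> card S' \<le> h \<and>
      (flipclass_irreducible G F \<longrightarrow> commuting_irreducible W S')" by blast
next
  assume st: "symmetric_type G S F"
  then have "finite (label_subgroup G F)" using is_product_of_type_A_finite unfolding symmetric_type_def by fastforce
  from coxeter_system.flipclass_finite_model[OF assms this] is_product_of_type_A_iso[OF st[unfolded symmetric_type_def]]
  show "\<exists>(W :: nat monoid) S' F'.
      coxeter_system W S' \<and> is_product_of_type_A W S' \<and>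
      flipclass W S' h F' \<and> flipclass_isomorphic h G S F W S' F' \<and>
      increasing_number G S F = increasing_number W S' F' \<and>
      finite S' \<and> card S' \<le> h \<and>
      (flipclass_irreducible G F \<longrightarrow> commuting_irreducible W S')" by blast
qed

end
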